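(* Let $x \in \mathbb{Z}$ with $x \notin \{-1, 2\}$ be such that $p = x^2-x+1$ and $q = x^2+1$ are both prime. Then there exist $u \in \{2,4\}$, $v \in \{2,3\}$ and two supersingular elliptic curves $\mathcal{E}/\mathbb{F}_{p^u}$ and $\hat{\mathcal{E}}/\mathbb{F}_{q^v}$ which form a pairing-friendly $2$-cycle $\mathcal{E} \rightleftharpoons \hat{\mathcal{E}}$, such that the target group of the order-$q$ Weil pairing on $\mathcal{E}$ is $\mathbb{F}_{p^4}^\times$ and the target group of the order-$p$ Weil pairing on $\hat{\mathcal{E}}$ is $\mathbb{F}_{q^6}^\times$. Moreover, the four possibilities for $(u,v)$ correspond to the four possible classes of $x$ in $\mathbb{Z}/12\mathbb{Z}$ leading to prime numbers $p$ and $q$. That is, $x$ is congruent to one of $0, 4, 6, 10$ modulo $12$, and such curves exist with: 1. $(u,v) = (2,2)$ if $x \equiv 10 \pmod{12}$; 2. $(u,v) = (2,3)$ if $x \equiv 6 \pmod{12}$; 3. $(u,v) = (4,2)$ if $x \equiv 4 \pmod{12}$; 4. $(u,v) = (4,3)$ if $x \equiv 0 \pmod{12}$.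
   Context: Embedding degree: let $E/\mathbb{F}_{\ell^w}$ be an elliptic curve over a finite field ($\ell$ prime) and let $r$ be a prime, $r \ne \ell$, with $r \mid \#E(\mathbb{F}_{\ell^w})$. The embedding degree of $E$ with respect to $r$ is the multiplicative order $k = \operatorname{ord}_r(\ell^w)$ of $\ell^w$ modulo $r$. The curve $E$ is pairing-friendly with respect to $r$ if its embedding degree with respect to $r$ is small, meaning $k \le 50$. Target group: the order-$r$ Weil pairing on $E$ takes values in the $r$-th roots of unity. Its target group is the multiplicative group $\mathbb{F}_{\ell^{wk}}^\times$, where $k$ is the embedding degree of $E/\mathbb{F}_{\ell^w}$ with respect to $r$; that is, $\mathbb{F}_{\ell^{wk}}$ is the smallest extension of $\mathbb{F}_{\ell^w}$ containing the $r$-th roots of unity. Pairing-friendly $2$-cycle: two elliptic curves $\mathcal{E}/\mathbb{F}_{p^u}$ and $\hat{\mathcal{E}}/\mathbb{F}_{q^v}$ ($p,q$ primes) are a pairing-friendly $2$-cycle, denoted $\mathcal{E} \rightleftharpoons \hat{\mathcal{E}}$, if (i) $p \mid \#\hat{\mathcal{E}}(\mathbb{F}_{q^v})$; (ii) $q \mid \#\mathcal{E}(\mathbb{F}_{p^u})$; (iii) $\mathcal{E}$ is pairing-friendly with respect to $q$; and (iv) $\hat{\mathcal{E}}$ is pairing-friendly with respect to $p$. *)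

theory Defs
  imports
    "HOL-Number_Theory.Number_Theory"
    "HOL-Algebra.Algebraic_Closure_Type"
    "Berlekamp_Zassenhaus.Finite_Field"
begin

hide_const (open) Divisibility.prime

text \<open>
  All finite fields of characteristic \<open>p\<close> are taken inside one algebraic closure of the prime
  field: if \<open>CARD('p) = p\<close> is prime, then \<open>'p Fbar\<close> is an algebraic closure of \<open>\<int>/p\<int>\<close>, and the
  field with \<open>p ^ n\<close> elements is its unique subfield of that order, namely the set of fixed
  points of the \<open>n\<close>-th power of the Frobenius automorphism (for \<open>n > 0\<close>).
\<close>

type_synonym 'p Fbar = "'p mod_ring alg_closure"

definition GF :: "nat \<Rightarrow> 'k::field set" where
  "GF N = {z. z ^ N = z}"

definition GF_units :: "nat \<Rightarrow> 'k::field monoid" where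
  "GF_units N = \<lparr>carrier = GF N - {0}, monoid.mult = (*), one = 1\<rparr>"


record 'k weierstrass =
  a1 :: 'k
  a2 :: 'k
  a3 :: 'k
  a4 :: 'k
  a6 :: 'k

definition discriminant :: "'k::field weierstrass \<Rightarrow> 'k" where
  "discriminant E =
     (let b2 = (a1 E)^2 + 4 * a2 E;
          b4 = 2 * a4 E + a1 E * a3 E;
          b6 = (a3 E)^2 + 4 * a6 E;
          b8 = (a1 E)^2 * a6 E + 4 * a2 E * a6 E - a1 E * a3 E * a4 E + a2 E * (a3 E)^2 - (a4 E)^2
      in - (b2^2 * b8) - 8 * b4^3 - 27 * b6^2 + 9 * b2 * b4 * b6)"

text \<open>\<open>elliptic_curve N E\<close>: \<open>E\<close> is an elliptic curve over the finite field with \<open>N\<close> elements.\<close>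

definition elliptic_curve :: "nat \<Rightarrow> 'k::field weierstrass \<Rightarrow> bool" where
  "elliptic_curve N E \<longleftrightarrow>
     (\<exists>w>0. N = CHAR('k) ^ w) \<and>
     {a1 E, a2 E, a3 E, a4 E, a6 E} \<subseteq> GF N \<and> discriminant E \<noteq> 0"

datatype 'k point = Infinity | Affine 'k 'k

definition points :: "'k::field weierstrass \<Rightarrow> 'k set \<Rightarrow> 'k point set" where
  "points E K = insert Infinity
     {Affine x y | x y. x \<in> K \<and> y \<in> K \<and>
        y^2 + a1 E * x * y + a3 E * y = x^3 + a2 E * x^2 + a4 E * x + a6 E}"

text \<open>
  The chord-tangent law. In the affine case the first branch is \<open>Q = -P\<close>, and \<open>m\<close> is the slope
  of the line through \<open>P\<close> and \<open>Q\<close>, or of the tangent if \<open>P = Q\<close>.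
\<close>

fun point_add :: "'k::field weierstrass \<Rightarrow> 'k point \<Rightarrow> 'k point \<Rightarrow> 'k point" where
  "point_add E Infinity Q = Q"
| "point_add E P Infinity = P"
| "point_add E (Affine x1 y1) (Affine x2 y2) =
     (if x1 = x2 \<and> y1 + y2 + a1 E * x2 + a3 E = 0 then Infinity
      else
        let m = (if x1 = x2
                 then (3 * x1^2 + 2 * a2 E * x1 + a4 E - a1 E * y1) / (2 * y1 + a1 E * x1 + a3 E)
                 else (y2 - y1) / (x2 - x1));
            x3 = m^2 + a1 E * m - a2 E - x1 - x2;
            y3 = - (y1 + m * (x3 - x1)) - a1 E * x3 - a3 E
        in Affine x3 y3)"

primrec point_mult :: "'k::field weierstrass \<Rightarrow> nat \<Rightarrow> 'k point \<Rightarrow> 'k point" where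
  "point_mult E 0 P = Infinity"
| "point_mult E (Suc n) P = point_add E P (point_mult E n P)"

text \<open>
  A curve in characteristic \<open>l\<close> is supersingular if it has no geometric point of order \<open>l\<close>;
  the class constraint makes \<open>UNIV\<close> an algebraically closed field.
\<close>

definition supersingular :: "'k::alg_closed_field weierstrass \<Rightarrow> bool" where
  "supersingular E \<longleftrightarrow>
     (\<forall>P \<in> points E UNIV. point_mult E CHAR('k) P = Infinity \<longrightarrow> P = Infinity)"


text \<open>
  In the following, \<open>N\<close> is the cardinality of the field over which \<open>E\<close> is considered. The
  embedding degree depends on \<open>N\<close> and \<open>r\<close> only. The target group is again taken inside the
  algebraic closure in which the coefficients of \<open>E\<close> live.
\<close>

definition embedding_degree :: "nat \<Rightarrow> nat \<Rightarrow> nat" where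
  "embedding_degree N r = ord r N"

definition pairing_friendly :: "nat \<Rightarrow> 'k::field weierstrass \<Rightarrow> nat \<Rightarrow> bool" where
  "pairing_friendly N E r \<longleftrightarrow>
     elliptic_curve N E \<and> prime r \<and> r \<noteq> CHAR('k) \<and> r dvd card (points E (GF N)) \<and>
     embedding_degree N r \<le> 50"

definition target_group :: "nat \<Rightarrow> 'k::field weierstrass \<Rightarrow> nat \<Rightarrow> 'k monoid" where
  "target_group N E r = GF_units (N ^ embedding_degree N r)"

definition pairing_friendly_2_cycle ::
    "nat \<Rightarrow> 'k::field weierstrass \<Rightarrow> nat \<Rightarrow> 'l::field weierstrass \<Rightarrow> bool" where
  "pairing_friendly_2_cycle M E N E' \<longleftrightarrow>
     elliptic_curve M E \<and> elliptic_curve N E' \<and>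
     CHAR('k) dvd card (points E' (GF N)) \<and>
     CHAR('l) dvd card (points E (GF M)) \<and>
     pairing_friendly M E CHAR('l) \<and>
     pairing_friendly N E' CHAR('k)"

text \<open>
  The supersingular 2-cycles over the fields with \<open>p ^ u\<close> and \<open>q ^ v\<close> elements whose target
  groups are the multiplicative groups of the fields with \<open>p ^ 4\<close> and \<open>q ^ 6\<close> elements.
\<close>

definition supersingular_cycle_4_6 ::
    "nat \<Rightarrow> 'p::prime_card Fbar weierstrass \<Rightarrow> nat \<Rightarrow> 'q::prime_card Fbar weierstrass \<Rightarrow> bool"
  where
  "supersingular_cycle_4_6 u E v E' \<longleftrightarrow>
     (let p = CARD('p); q = CARD('q) in
       supersingular E \<and> supersingular E' \<and>
       pairing_friendly_2_cycle (p ^ u) E (q ^ v) E' \<and>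
       target_group (p ^ u) E q = GF_units (p ^ 4) \<and>
       target_group (q ^ v) E' p = GF_units (q ^ 6))"

end

theory Submission
  imports Defs "HOL-Complex_Analysis.Complex_Analysis"
begin


text \<open>Put p = x^2 - x + 1 and q = x^2 + 1. The identities p^2 + 1 = q (q - 2x + 1) and q^2 - q
  + 1 = p (p + 2x) give p order 4 modulo q and q order 6 modulo p, because p and q are odd and p is
  not 3. For u in {2, 4} and v in {2, 3} this fixes both target groups. What remains is to find
  supersingular curves over F_(p^u) and F_(q^v) with a rational point of order q and p respectively.

  Let l be the characteristic of a curve y^2 = f(x). If its Hasse invariant, the coefficient of
  x^(l-1) in f^((l-1)/2), vanishes, then over every finite field of definition the number of points
  is 1 modulo l, so there is no l-torsion (\<open>no_CHAR_torsion\<close>). Division polynomials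
  then show that [l] acts on abscissae by an injective polynomial of degree l^2, which must be
  x^(l^2) up to an affine map (\<open>torsion_free_mult\<close>). Two 2-torsion points rational over
  F_(l^2) remove the affine map, so the l^2-Frobenius is [l] or -[l]
  (\<open>torsion_free_frob\<close>). Its action on r-torsion is therefore governed by l modulo r.
  Once a nonzero r-torsion point is sent by Frobenius to its image under an automorphism of the
  curve, a twist makes that point rational (\<open>twist_torsion\<close>).

  Four curves result. For p = 3 modulo 4, y^2 = x^3 - x has a quartic twist over F_(p^2) that works.
  For q = 2 modulo 3, y^2 = x^3 + 1 has a sextic twist over F_(q^2) that works. Over F_(p^4) a
  supersingular Legendre curve suffices, because the sign of Frobenius disappears on squaring. Over
  F_(q^3) a supersingular curve defined over the prime field is used: its squared Frobenius is -[q],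
  so on p-torsion the q^3-Frobenius is an involution. The class of x modulo 12 decides which
  congruences on p and q hold: x is even, x is not 2 modulo 3, x = 2 modulo 4 gives p = 3 modulo 4,
  and x = 1 modulo 3 gives q = 2 modulo 3.

  The deep ingredient is a supersingular curve over F_q for every prime q = 1 modulo 4
  (\<open>trace_zero_parameter\<close>). It is the reduction of a complex curve with multiplication
  by \<tau> = sqrt(-q). On a Legendre coordinate, z -> \<tau> z is a rational function N/D. At a
  place of the complex numbers above q this function is integral and reduces to x^q / d0. The
  differential equation expressing that the isogeny multiplies the invariant differential by \<tau>
  then forces the Hasse invariant of the reduced curve to vanish, and the action on 2-torsion gives
  \<mu>^(q+1) = 1. Hence \<mu> + 1/\<mu> + 2 reduces into F_q, and the curve has a model y^2 = x
  (x^2 + k x + k) with k an integer.\<close>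

section \<open>The chord-tangent group law\<close>

fun point_neg :: "'k::field point \<Rightarrow> 'k point" where
  "point_neg Infinity = Infinity"
| "point_neg (Affine x y) = Affine x (- y)"

lemma infinite_alg_closed_field: "infinite (UNIV :: 'a::alg_closed_field set)"
proof
  assume fin: "finite (UNIV :: 'a set)"
  define h where "h = (\<Prod>a\<in>(UNIV :: 'a set). [:- a, 1:])"
  have deg: "degree h = card (UNIV :: 'a set)"
    unfolding h_def by (subst degree_prod_eq_sum_degree) auto
  have "degree (h + 1) = degree h" using deg fin by (intro degree_add_eq_left) (simp add: card_gt_0_iff)
  hence "degree (h + 1) > 0" using deg fin by (simp add: card_gt_0_iff)
  then obtain x where x: "poly (h + 1) x = 0" using alg_closed_imp_poly_has_root by blast
  have "poly h x = 0" unfolding h_def poly_prod by (rule prod_zero[OF fin]) auto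
  thus False using x by simp
qed

locale short_weierstrass =
  fixes E :: "'a::alg_closed_field weierstrass"
  assumes a1_zero [simp]: "a1 E = 0" and a3_zero [simp]: "a3 E = 0"
    and two_nonzero: "(2::'a) \<noteq> 0" and nonsingular: "discriminant E \<noteq> 0"
begin

definition cubic :: "'a \<Rightarrow> 'a" where
  "cubic x = x^3 + a2 E * x^2 + a4 E * x + a6 E"

definition cubic' :: "'a \<Rightarrow> 'a" where
  "cubic' x = 3 * x^2 + 2 * a2 E * x + a4 E"

abbreviation curve :: "'a point set" where
  "curve \<equiv> points E UNIV"

abbreviation add :: "'a point \<Rightarrow> 'a point \<Rightarrow> 'a point"  (infixl \<open>\<oplus>\<^sub>E\<close> 65) where
  "P \<oplus>\<^sub>E Q \<equiv> point_add E P Q"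

lemma Infinity_in_curve [simp]: "Infinity \<in> points E K"
  by (simp add: points_def)

lemma Affine_in_curve_iff: "Affine x y \<in> points E K \<longleftrightarrow> x \<in> K \<and> y \<in> K \<and> y^2 = cubic x"
  by (auto simp: points_def cubic_def)

lemma cubic_no_double_root: "cubic x = 0 \<Longrightarrow> cubic' x \<noteq> 0"
proof
  assume 1: "cubic x = 0" and 2: "cubic' x = 0"
  \<comment> \<open>By Vieta this is the third root when \<open>x\<close> is a double one. All
    coefficients become polynomials in \<open>x\<close> and \<open>r\<close>, and the discriminant
    vanishes identically.\<close>
  define r where "r = - (a2 E + 2 * x)"
  have a2: "a2 E = - (2 * x + r)" by (simp add: r_def)
  have "- (3 * x^2 + 2 * a2 E * x) = a4 E" using 2 unfolding cubic'_def by (rule minus_unique)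
  hence a4: "a4 E = x^2 + 2 * x * r" unfolding a2 by (simp add: algebra_simps power2_eq_square)
  have "- (x^3 + a2 E * x^2 + a4 E * x) = a6 E" using 1 unfolding cubic_def by (rule minus_unique)
  hence a6: "a6 E = - (x^2 * r)" unfolding a2 a4 by (simp add: algebra_simps power2_eq_square power3_eq_cube)
  have "discriminant E = 0" unfolding discriminant_def Let_def a6 a4 a2 a1_zero a3_zero
    by (simp, Groebner_Basis.algebra)
  with nonsingular show False by simp
qed

lemma point_neg_closed [simp]: "P \<in> points E UNIV \<Longrightarrow> point_neg P \<in> points E UNIV"
  by (cases P) (auto simp: Affine_in_curve_iff)

lemma point_neg_neg [simp]: "point_neg (point_neg P) = P"
  by (cases P) auto

lemma add_Infinity_right [simp]: "P \<oplus>\<^sub>E Infinity = P"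
  by (cases P) auto

lemma add_point_neg [simp]: "P \<oplus>\<^sub>E point_neg P = Infinity"
  by (cases P) auto

lemma point_neg_add [simp]: "point_neg P \<oplus>\<^sub>E P = Infinity"
  by (cases P) auto

lemma add_commute:
  assumes "P \<in> curve" "Q \<in> curve"
  shows "P \<oplus>\<^sub>E Q = Q \<oplus>\<^sub>E P"
proof (cases P; cases Q)
  fix x1 y1 x2 y2 assume P: "P = Affine x1 y1" and Q: "Q = Affine x2 y2"
  have on: "y1^2 = cubic x1" "y2^2 = cubic x2" using assms P Q by (auto simp: Affine_in_curve_iff)
  show ?thesis
  proof (cases "x1 = x2")
    case True
    hence "(y1 - y2) * (y1 + y2) = 0" using on by (simp add: algebra_simps power2_eq_square)
    hence "y1 = y2 \<or> y1 + y2 = 0" by auto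
    thus ?thesis using True by (auto simp: P Q add.commute)
  next
    case False
    have m: "(y2 - y1) / (x2 - x1) = (y1 - y2) / (x1 - x2)"
      by (metis minus_diff_eq minus_divide_divide)
    define m where "m = (y1 - y2) / (x1 - x2)"
    have y: "y1 = y2 + m * (x1 - x2)" using False unfolding m_def by simp
    show ?thesis using False unfolding P Q
      by (simp add: Let_def m m_def[symmetric]) (simp add: y algebra_simps)
  qed
qed auto

lemma point_negI:
  assumes "Affine x y \<in> curve" "Affine x y' \<in> curve"
  shows "y = y' \<or> y = - y'"
proof -
  have "(y - y') * (y + y') = 0" using assms by (simp add: Affine_in_curve_iff algebra_simps power2_eq_square)
  thus ?thesis by (auto simp: add_eq_0_iff)
qed

text \<open>In coordinates centred at \<open>B\<close>, a line of slope \<open>m\<close> through \<open>A\<close> and \<open>B\<close> meets the curve in two further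
  abscissae \<open>u\<close>, \<open>u'\<close> that are the roots of a quadratic polynomial; this covers chords and
  tangents (\<open>u = 0\<close>) alike.\<close>

lemma add_line:
  assumes "Affine xa ya \<in> curve" "Affine xb yb \<in> curve" "Affine xa ya \<noteq> Affine xb (- yb)"
  obtains m u u' where "u = xa - xb" "Affine xa ya \<oplus>\<^sub>E Affine xb yb = Affine (xb + u') (- (yb + m * u'))"
    "ya = yb + m * u" "u * u' = cubic' xb - 2 * yb * m" "u' = m^2 - (3 * xb + a2 E) - u"
proof (cases "xa = xb")
  case True
  have y: "ya = yb" using point_negI[of xb ya yb] assms True by auto
  have y0: "ya + yb \<noteq> 0"
  proof
    assume "ya + yb = 0"
    hence "ya = - yb" by (simp only: eq_neg_iff_add_eq_0)
    thus False using assms(3) True by simp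
  qed
  define m where "m = cubic' xb / (2 * yb)"
  have nz: "2 * yb \<noteq> 0" using y0 unfolding y mult_2 .
  have "2 * yb * m = cubic' xb" using nz unfolding m_def times_divide_eq_right by (rule nonzero_mult_div_cancel_left)
  moreover have "Affine xa ya \<oplus>\<^sub>E Affine xb yb = Affine (m^2 - a2 E - xb - xb) (- (yb + m * (m^2 - a2 E - xb - xb - xb)))"
    using True y y0 by (simp add: Let_def cubic'_def[symmetric] m_def[symmetric])
  hence "Affine xa ya \<oplus>\<^sub>E Affine xb yb = Affine (xb + (m^2 - (3 * xb + a2 E))) (- (yb + m * (m^2 - (3 * xb + a2 E))))"
    by (simp add: algebra_simps)
  ultimately show ?thesis by (intro that[of 0 "m^2 - (3 * xb + a2 E)" m]) (auto simp: True y)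
next
  case False
  define m where "m = (yb - ya) / (xb - xa)"
  have "m * (xb - xa) = yb - ya" using False unfolding m_def by simp
  hence m: "ya = yb + m * (xa - xb)" by (simp add: algebra_simps)
  have on: "ya^2 = cubic xa" "yb^2 = cubic xb" using assms by (auto simp: Affine_in_curve_iff)
  have "(xa - xb) * ((xa - xb) * (m^2 - (3 * xb + a2 E) - (xa - xb)) - (cubic' xb - 2 * yb * m)) = 0"
    using on m unfolding cubic_def cubic'_def by Groebner_Basis.algebra
  hence B: "(xa - xb) * (m^2 - (3 * xb + a2 E) - (xa - xb)) = cubic' xb - 2 * yb * m" using False by simp
  have X: "m^2 - a2 E - xa - xb = xb + (m^2 - (3 * xb + a2 E) - (xa - xb))" by (simp add: algebra_simps)
  have Y: "ya + m * (m^2 - a2 E - xa - xb - xa) = yb + m * (m^2 - (3 * xb + a2 E) - (xa - xb))"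
    unfolding m by (simp add: algebra_simps)
  have "Affine xa ya \<oplus>\<^sub>E Affine xb yb = Affine (m^2 - a2 E - xa - xb) (- (ya + m * (m^2 - a2 E - xa - xb - xa)))"
    using False by (simp add: Let_def m_def[symmetric])
  hence A: "Affine xa ya \<oplus>\<^sub>E Affine xb yb = Affine (xb + (m^2 - (3 * xb + a2 E) - (xa - xb)))
      (- (yb + m * (m^2 - (3 * xb + a2 E) - (xa - xb))))"
    unfolding Y unfolding X .
  show ?thesis by (rule that[OF refl A m B refl])
qed

lemma add_closed [simp]:
  assumes "P \<in> curve" "Q \<in> curve"
  shows "P \<oplus>\<^sub>E Q \<in> curve"
proof (cases P; cases Q)
  fix xa ya xb yb assume P: "P = Affine xa ya" and Q: "Q = Affine xb yb"
  show ?thesis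
  proof (cases "P = point_neg Q")
    case False
    obtain m u u' where *: "P \<oplus>\<^sub>E Q = Affine (xb + u') (- (yb + m * u'))"
     "ya = yb + m * u" "u * u' = cubic' xb - 2 * yb * m" "u' = m^2 - (3 * xb + a2 E) - u"
      using add_line[of xa ya xb yb] assms False unfolding P Q point_neg.simps by metis
    have "yb^2 = cubic xb" using assms Q by (auto simp: Affine_in_curve_iff)
    hence "(- (yb + m * u'))^2 = cubic (xb + u')" using *(3,4) unfolding cubic'_def cubic_def
      by Groebner_Basis.algebra
    thus ?thesis using * by (auto simp: Affine_in_curve_iff)
  qed auto
qed (use assms in auto)

text \<open>Of the four additions only A + B can be a tangent. Both inner lines pass through B, with
  slopes \<open>m\<close> and \<open>n\<close>; coordinates are centred there. The slopes
  \<open>k\<close> and \<open>k'\<close> of the two outer chords become polynomial after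
  multiplication by \<open>D = m - n\<close>, and they satisfy \<open>k' = k + D\<close>. Equality
  of both coordinates follows from this relation.\<close>

lemma add_assoc_generic:
  assumes P: "Affine xa ya \<in> curve" "Affine xb yb \<in> curve" "Affine xs ys \<in> curve"
    and ab: "Affine xa ya \<noteq> Affine xb (- yb)" and bs: "xb \<noteq> xs" and as: "xa \<noteq> xs"
    and AB: "Affine xa ya \<oplus>\<^sub>E Affine xb yb = Affine xab yab" "xab \<noteq> xs"
    and BS: "Affine xb yb \<oplus>\<^sub>E Affine xs ys = Affine xbs ybs" "xbs \<noteq> xa"
  shows "(Affine xa ya \<oplus>\<^sub>E Affine xb yb) \<oplus>\<^sub>E Affine xs ys = Affine xa ya \<oplus>\<^sub>E (Affine xb yb \<oplus>\<^sub>E Affine xs ys)"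
proof -
  obtain m u u' where m: "u = xa - xb" "Affine xa ya \<oplus>\<^sub>E Affine xb yb = Affine (xb + u') (- (yb + m * u'))"
    "ya = yb + m * u" "u * u' = cubic' xb - 2 * yb * m" "u' = m^2 - (3 * xb + a2 E) - u"
    by (rule add_line[OF P(1,2) ab])
  have sb: "Affine xs ys \<noteq> Affine xb (- yb)" using bs by simp
  obtain n w w' where n: "w = xs - xb" "Affine xs ys \<oplus>\<^sub>E Affine xb yb = Affine (xb + w') (- (yb + n * w'))"
    "ys = yb + n * w" "w * w' = cubic' xb - 2 * yb * n" "w' = n^2 - (3 * xb + a2 E) - w"
    by (rule add_line[OF P(3,2) sb])
  have xab: "xab = xb + u'" "yab = - (yb + m * u')" and xbs: "xbs = xb + w'" "ybs = - (yb + n * w')"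
    
    using AB(1) m(2) BS(1) n(2) add_commute[OF P(2,3)] by (simp_all del: point_add.simps)
  define s where "s = w - u'" define s' where "s' = u - w'"
  have s: "s \<noteq> 0" "s' \<noteq> 0" using AB(2) BS(2) unfolding s_def s'_def m(1) n(1) xab xbs
    by (auto simp: algebra_simps simp del: point_add.simps)
  define D where "D = m - n"
  \<comment> \<open>Equal slopes would make the two lines through B coincide, so \<open>xs\<close>
    would be the abscissa of A or of A + B, both excluded.\<close>
  have D: "D \<noteq> 0"
  proof
    assume "D = 0" hence mn: "m = n" by (simp add: D_def)
    hence uw: "u + u' = w + w'" "u * u' = w * w'" using m n by simp_all
    have "(w - u) * (w - u') = w * (w - (u + u')) + u * u'" by (simp add: algebra_simps)
    also have "\<dots> = 0" unfolding uw by (simp add: algebra_simps)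
    finally have "(w - u) * (w - u') = 0" .
    hence "w = u \<or> w = u'" by simp
    thus False using as AB(2) unfolding m(1) n(1) xab by (auto simp: algebra_simps)
  qed
  have H1: "2 * yb * D = w * w' - u * u'" using m(4) n(4) unfolding D_def by Groebner_Basis.algebra
  have H2: "w' = u + u' - w - (m^2 - n^2)" using m(5) n(5) by Groebner_Basis.algebra
  define k where "k = (ys - yab) / (xs - xab)"
  define k' where "k' = (ybs - ya) / (xbs - xa)"
  have "ys - yab = n * w + m * u' + 2 * yb" "xs - xab = s" using xab n(1,3) by (simp_all add: s_def)
  hence "k * s = n * w + m * u' + 2 * yb" using s unfolding k_def by simp
  hence "s * (k * D) = D * (n * w + m * u') + 2 * yb * D" by (simp add: algebra_simps)
  also have "\<dots> = s * (D * n + u - w - (m^2 - n^2))"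
    unfolding H1 H2 unfolding D_def s_def by (simp add: algebra_simps power2_eq_square)
  finally have "s * (k * D) = s * (D * n + u - w - (m^2 - n^2))" .
  hence kD: "k * D = D * n + u - w - (m^2 - n^2)" using s by simp
  have "k' = (ya - ybs) / (xa - xbs)" unfolding k'_def by (metis minus_diff_eq minus_divide_divide)
  moreover have "ya - ybs = m * u + n * w' + 2 * yb" "xa - xbs = s'" using xbs m(1,3) by (simp_all add: s'_def)
  ultimately have "k' * s' = m * u + n * w' + 2 * yb" using s by simp
  hence "s' * (k' * D) = D * (m * u + n * w') + 2 * yb * D" by (simp add: algebra_simps)
  also have "\<dots> = s' * (u - w - D * n)"
    unfolding H1 unfolding s'_def unfolding H2 D_def by (simp add: algebra_simps power2_eq_square)
  finally have "s' * (k' * D) = s' * (u - w - D * n)" .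
  hence kD': "k' * D = u - w - D * n" using s by simp
  have "D * (k' - (k + D)) = k' * D - k * D - D^2" by (simp add: algebra_simps power2_eq_square)
  also have "\<dots> = 0" unfolding kD kD' by (simp add: D_def algebra_simps power2_eq_square)
  finally have k': "k' = k + D" using D by simp
  have kD2: "2 * (k * D) = 2 * (D * n + u - w - (m^2 - n^2))" using kD by simp
  have "k'^2 - k^2 = 2 * (k * D) + D^2" unfolding k' by (simp add: algebra_simps power2_eq_square)
  also have "\<dots> = u + w' - u' - w"
    unfolding kD2 H2 by (simp add: D_def algebra_simps power2_eq_square)
  finally have X: "k^2 - a2 E - xab - xs = k'^2 - a2 E - xa - xbs"
    using m(1) n(1) xab(1) xbs(1) by (simp add: algebra_simps)
  have xa: "xa = xb + u" using m(1) by simp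
  define Z where "Z = k^2 - a2 E - xab - xs - xb"
  have Zeq: "Z = k^2 - (m^2 - u + w)" unfolding Z_def using xab(1) n(1) m(5) by Groebner_Basis.algebra
  have "D * ((yab + k * (Z + xb - xab)) - (ya + k' * (Z + xb - xa)))
     = - (2 * yb * D) - D * m * (u + u') + (k * D) * (u - u') + D^2 * u - D^2 * Z"
    unfolding xab m(3) k' xa by (simp add: algebra_simps power2_eq_square)
  also have "D^2 * Z = (k * D)^2 - D^2 * (m^2 - u + w)"
    unfolding Zeq by (simp add: algebra_simps power2_eq_square)
  also have "- (2 * yb * D) - D * m * (u + u') + (k * D) * (u - u') + D^2 * u - ((k * D)^2 - D^2 * (m^2 - u + w)) = 0"
    unfolding kD H1 H2 unfolding D_def by (simp add: algebra_simps power2_eq_square)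
  finally have "yab + k * (Z + xb - xab) = ya + k' * (Z + xb - xa)" using D by simp
  moreover have "Z + xb = k^2 - a2 E - xab - xs" by (simp add: Z_def)
  ultimately have Y: "yab + k * (k^2 - a2 E - xab - xs - xab) = ya + k' * (k'^2 - a2 E - xa - xbs - xa)"
    unfolding X[symmetric] by simp
  have "(Affine xa ya \<oplus>\<^sub>E Affine xb yb) \<oplus>\<^sub>E Affine xs ys
      = Affine (k^2 - a2 E - xab - xs) (- (yab + k * (k^2 - a2 E - xab - xs - xab)))"
    unfolding AB(1) using AB(2) by (simp add: Let_def k_def)
  moreover have "Affine xa ya \<oplus>\<^sub>E (Affine xb yb \<oplus>\<^sub>E Affine xs ys)
      = Affine (k'^2 - a2 E - xa - xbs) (- (ya + k' * (k'^2 - a2 E - xa - xbs - xa)))"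
    unfolding BS(1) using BS(2) by (simp add: Let_def k'_def)
  ultimately show ?thesis unfolding Y unfolding X by (simp only:)
qed


text \<open>Cofiniteness on the curve. Since the curve is infinite, finitely many such conditions
  are met by a single auxiliary point.\<close>

definition almost_all :: "('a point \<Rightarrow> bool) \<Rightarrow> bool" where
  "almost_all \<phi> \<longleftrightarrow> finite {S \<in> curve. \<not> \<phi> S}"

lemma finite_abscissae:
  assumes "finite V"
  shows "finite {S \<in> curve. \<exists>x\<in>V. \<exists>y. S = Affine x y}"
proof -
  have "finite {y. y^2 = (c::'a)}" for c
  proof -
    obtain d where "d^2 = c" using nth_root_exists[of 2 c] by auto
    have "y = d \<or> y = - d" if "y^2 = c" for y
      using that \<open>d^2 = c\<close> by (metis power2_eq_iff)
    hence "{y. y^2 = c} \<subseteq> {d, - d}" by auto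
    thus ?thesis by (rule finite_subset) simp
  qed
  hence "finite (\<Union>x\<in>V. (\<lambda>y. Affine x y) ` {y. y^2 = cubic x})" using assms by auto
  moreover have "{S \<in> curve. \<exists>x\<in>V. \<exists>y. S = Affine x y} \<subseteq> (\<Union>x\<in>V. (\<lambda>y. Affine x y) ` {y. y^2 = cubic x})"
    by (auto simp: Affine_in_curve_iff)
  ultimately show ?thesis by (rule rev_finite_subset)
qed

lemma infinite_curve: "infinite curve"
proof
  assume fin: "finite curve"
  have "\<exists>y. Affine x y \<in> curve" for x
    using nth_root_exists[of 2 "cubic x"] by (auto simp: Affine_in_curve_iff)
  hence "UNIV \<subseteq> (\<lambda>P. case P of Affine x y \<Rightarrow> x | Infinity \<Rightarrow> 0) ` curve"
    by (force simp: image_iff split: point.splits)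
  hence "finite (UNIV :: 'a set)" using fin by (meson finite_imageI finite_subset)
  thus False using infinite_alg_closed_field by blast
qed

lemma almost_all_ex: "almost_all \<phi> \<Longrightarrow> \<exists>S \<in> curve. \<phi> S"
  using infinite_curve unfolding almost_all_def by (metis (mono_tags, lifting) Collect_cong mem_Collect_eq Collect_mem_eq)

lemma almost_all_mono: "almost_all \<phi> \<Longrightarrow> (\<And>S. S \<in> curve \<Longrightarrow> \<phi> S \<Longrightarrow> \<psi> S) \<Longrightarrow> almost_all \<psi>"
  unfolding almost_all_def by (erule rev_finite_subset) auto

lemma almost_all_conj: "almost_all \<phi> \<Longrightarrow> almost_all \<psi> \<Longrightarrow> almost_all (\<lambda>S. \<phi> S \<and> \<psi> S)"
  unfolding almost_all_def by (erule (1) finite_subset[rotated, OF finite_UnI]) auto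

lemma almost_all_abscissae:
  assumes "finite V"
  shows "almost_all (\<lambda>S. \<exists>x y. S = Affine x y \<and> x \<notin> V)"
proof -
  have "{S \<in> curve. \<not> (\<exists>x y. S = Affine x y \<and> x \<notin> V)} \<subseteq> insert Infinity {S \<in> curve. \<exists>x\<in>V. \<exists>y. S = Affine x y}"
  proof
    fix S assume "S \<in> {S \<in> curve. \<not> (\<exists>x y. S = Affine x y \<and> x \<notin> V)}"
    thus "S \<in> insert Infinity {S \<in> curve. \<exists>x\<in>V. \<exists>y. S = Affine x y}" by (cases S) auto
  qed
  thus ?thesis unfolding almost_all_def using finite_abscissae[OF assms] by (meson finite_insert finite_subset)
qed

lemma almost_all_cancel:
  assumes "B \<in> curve"
  shows "almost_all (\<lambda>S. point_neg B \<oplus>\<^sub>E (B \<oplus>\<^sub>E S) = S)"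
proof (cases B)
  case (Affine xb yb)
  \<comment> \<open>For \<open>yb\<close> nonzero, \<open>xb + t\<close> is the abscissa of 2B:
    besides S = B and S = -B, the computation degenerates only if B + S = -B. For
    \<open>yb = 0\<close> the quotient has the default value 0, and the degenerate case is
    impossible because the cubic has no double root.\<close>
  define t where "t = (cubic' xb / (2 * yb))^2 - (3 * xb + a2 E)"
  have "almost_all (\<lambda>S. \<exists>x y. S = Affine x y \<and> x \<notin> {xb, xb + t})" by (rule almost_all_abscissae) simp
  thus ?thesis
  proof (rule almost_all_mono)
    fix S assume S: "S \<in> curve" "\<exists>x y. S = Affine x y \<and> x \<notin> {xb, xb + t}"
    then obtain xs ys where Sx: "S = Affine xs ys" and x: "xs \<noteq> xb" "xs \<noteq> xb + t" by auto
    have P: "Affine xb yb \<in> curve" "Affine xs ys \<in> curve" using assms S Affine Sx by auto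
    have sb: "Affine xs ys \<noteq> Affine xb (- yb)" using x by simp
    obtain n w w' where n: "w = xs - xb" "Affine xs ys \<oplus>\<^sub>E Affine xb yb = Affine (xb + w') (- (yb + n * w'))"
      "ys = yb + n * w" "w * w' = cubic' xb - 2 * yb * n" "w' = n^2 - (3 * xb + a2 E) - w"
      by (rule add_line[OF P(2,1) sb])
    have w': "w' \<noteq> 0"
    proof
      assume w': "w' = 0"
      hence c: "cubic' xb = 2 * yb * n" using n(4) by simp
      have "yb \<noteq> 0"
      proof
        assume "yb = 0"
        hence "cubic xb = 0" "cubic' xb = 0" using P(1) c by (auto simp: Affine_in_curve_iff)
        thus False using cubic_no_double_root by auto
      qed
      hence "cubic' xb / (2 * yb) = n" using c two_nonzero by (simp add: nonzero_divide_eq_eq)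
      hence "w = t" using n(5) w' unfolding t_def by simp
      thus False using x n(1) by (auto simp: algebra_simps)
    qed
    have k: "(- (yb + n * w') - (- yb)) / (xb + w' - xb) = - n" using w' by (simp add: field_simps)
    have "Affine xb (- yb) \<oplus>\<^sub>E Affine (xb + w') (- (yb + n * w'))
       = Affine ((- n)^2 - a2 E - xb - (xb + w')) (- (- yb + (- n) * ((- n)^2 - a2 E - xb - (xb + w') - xb)))"
      using w' k by (simp add: Let_def)
    also have "(- n)^2 - a2 E - xb - (xb + w') = xs" using n(1,5) by Groebner_Basis.algebra
    also have "- (- yb + (- n) * (xs - xb)) = ys" using n(1,3) by simp
    finally show "point_neg B \<oplus>\<^sub>E (B \<oplus>\<^sub>E S) = S"
      unfolding Affine Sx point_neg.simps add_commute[OF P] n(2) .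
  qed
qed (simp add: almost_all_def)

text \<open>Translations are not yet known to be injective; \<open>almost_all_cancel\<close> gives
  injectivity outside a finite set, which suffices to pull back finite exceptional sets.\<close>

lemma almost_all_translate:
  assumes "B \<in> curve" "almost_all \<phi>"
  shows "almost_all (\<lambda>S. \<phi> (B \<oplus>\<^sub>E S))"
proof -
  have "{S \<in> curve. \<not> \<phi> (B \<oplus>\<^sub>E S)} \<subseteq> {S \<in> curve. \<not> point_neg B \<oplus>\<^sub>E (B \<oplus>\<^sub>E S) = S} \<union>
     (\<lambda>T. point_neg B \<oplus>\<^sub>E T) ` {T \<in> curve. \<not> \<phi> T}"
  proof (rule subsetI, goal_cases)
    case (1 S)
    show ?case
    proof (cases "point_neg B \<oplus>\<^sub>E (B \<oplus>\<^sub>E S) = S")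
      case True
      moreover have "B \<oplus>\<^sub>E S \<in> {T \<in> curve. \<not> \<phi> T}" using 1 assms(1) by simp
      ultimately show ?thesis by (intro UnI2) (metis (no_types, lifting) imageI)
    qed (use 1 in simp)
  qed
  thus ?thesis using assms almost_all_cancel[OF assms(1)] unfolding almost_all_def
    by (meson finite_UnI finite_imageI finite_subset)
qed

lemma almost_all_neq: "almost_all (\<lambda>S. S \<noteq> T)"
  unfolding almost_all_def by (rule finite_subset[of _ "{T}"]) auto

lemma almost_all_assoc:
  assumes "A \<in> curve" "B \<in> curve"
  shows "almost_all (\<lambda>S. (A \<oplus>\<^sub>E B) \<oplus>\<^sub>E S = A \<oplus>\<^sub>E (B \<oplus>\<^sub>E S))"
proof (cases "A = Infinity \<or> B = Infinity")
  case True
  thus ?thesis by (auto simp: almost_all_def)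
next
  case False
  then obtain xa ya xb yb where A: "A = Affine xa ya" and B: "B = Affine xb yb" by (metis point.exhaust)
  have P: "Affine xa ya \<in> curve" "Affine xb yb \<in> curve" using assms A B by auto
  show ?thesis
  proof (cases "A = point_neg B")
    case True
    hence "B = point_neg A" by simp
    moreover have "A \<oplus>\<^sub>E B = Infinity" unfolding \<open>B = point_neg A\<close> by (rule add_point_neg)
    ultimately show ?thesis using almost_all_cancel[OF assms(2)] True
      by (auto elim!: almost_all_mono simp del: point_add.simps simp: point_add.simps(1))
  next
    case False
    hence ab: "Affine xa ya \<noteq> Affine xb (- yb)" using A B by simp
    obtain xab yab where AB: "Affine xa ya \<oplus>\<^sub>E Affine xb yb = Affine xab yab"
      using add_line[OF P ab] by metis
    have "almost_all (\<lambda>S. (\<exists>x y. S = Affine x y \<and> x \<notin> {xb, xa, xab}) \<and> (\<exists>x y. B \<oplus>\<^sub>E S = Affine x y \<and> x \<notin> {xa}))"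
      by (intro almost_all_conj almost_all_translate almost_all_abscissae assms) simp_all
    thus ?thesis
    proof (rule almost_all_mono)
      fix S assume S: "S \<in> curve" "(\<exists>x y. S = Affine x y \<and> x \<notin> {xb, xa, xab}) \<and> (\<exists>x y. B \<oplus>\<^sub>E S = Affine x y \<and> x \<notin> {xa})"
      from S(2) obtain xs ys where Sx: "S = Affine xs ys" "xs \<notin> {xb, xa, xab}" by blast
      from S(2) obtain xbs ybs where BS: "B \<oplus>\<^sub>E S = Affine xbs ybs" "xbs \<noteq> xa" by blast
      show "(A \<oplus>\<^sub>E B) \<oplus>\<^sub>E S = A \<oplus>\<^sub>E (B \<oplus>\<^sub>E S)"
        unfolding A B Sx(1)
        by (rule add_assoc_generic[OF P _ ab _ _ AB _ _ BS(2)])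
           (use S(1) Sx BS(1) in \<open>auto simp: A B simp del: point_add.simps\<close>)
    qed
  qed
qed

text \<open>Associativity only has to be checked after adding a generic point to both sides, where no
  degenerate case of the addition law occurs.\<close>

lemma add_assoc:
  assumes "P \<in> curve" "Q \<in> curve" "R \<in> curve"
  shows "(P \<oplus>\<^sub>E Q) \<oplus>\<^sub>E R = P \<oplus>\<^sub>E (Q \<oplus>\<^sub>E R)"
proof -
  define L where "L = (P \<oplus>\<^sub>E Q) \<oplus>\<^sub>E R" define Y where "Y = P \<oplus>\<^sub>E (Q \<oplus>\<^sub>E R)"
  define Z where "Z = point_neg L \<oplus>\<^sub>E Y"
  have C: "L \<in> curve" "Y \<in> curve" "Z \<in> curve" "point_neg L \<in> curve" unfolding L_def Y_def Z_def using assms by simp_all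
  have fin: "finite {x. cubic x = 0}"
  proof -
    have "{x. cubic x = 0} = {x. poly [:a6 E, a4 E, a2 E, 1:] x = 0}"
      by (auto simp: cubic_def algebra_simps power2_eq_square power3_eq_cube)
    thus ?thesis using poly_roots_finite[of "[:a6 E, a4 E, a2 E, 1:]"] by simp
  qed
  have "almost_all (\<lambda>S. (P \<oplus>\<^sub>E Q) \<oplus>\<^sub>E R \<oplus>\<^sub>E S = (P \<oplus>\<^sub>E Q) \<oplus>\<^sub>E (R \<oplus>\<^sub>E S) \<and>
     (P \<oplus>\<^sub>E Q) \<oplus>\<^sub>E (R \<oplus>\<^sub>E S) = P \<oplus>\<^sub>E (Q \<oplus>\<^sub>E (R \<oplus>\<^sub>E S)) \<and>
     Q \<oplus>\<^sub>E R \<oplus>\<^sub>E S = Q \<oplus>\<^sub>E (R \<oplus>\<^sub>E S) \<and>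
     P \<oplus>\<^sub>E (Q \<oplus>\<^sub>E R) \<oplus>\<^sub>E S = P \<oplus>\<^sub>E ((Q \<oplus>\<^sub>E R) \<oplus>\<^sub>E S) \<and>
     point_neg L \<oplus>\<^sub>E (L \<oplus>\<^sub>E S) = S \<and> point_neg L \<oplus>\<^sub>E Y \<oplus>\<^sub>E S = point_neg L \<oplus>\<^sub>E (Y \<oplus>\<^sub>E S) \<and>
     (\<exists>x y. S = Affine x y \<and> x \<notin> {x. cubic x = 0}))"
    by (intro almost_all_conj almost_all_assoc almost_all_translate[OF assms(3) almost_all_assoc]
         almost_all_cancel almost_all_abscissae fin add_closed assms C)
  then obtain S where S: "S \<in> curve" "(P \<oplus>\<^sub>E Q) \<oplus>\<^sub>E R \<oplus>\<^sub>E S = (P \<oplus>\<^sub>E Q) \<oplus>\<^sub>E (R \<oplus>\<^sub>E S)"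
     "(P \<oplus>\<^sub>E Q) \<oplus>\<^sub>E (R \<oplus>\<^sub>E S) = P \<oplus>\<^sub>E (Q \<oplus>\<^sub>E (R \<oplus>\<^sub>E S))"
     "Q \<oplus>\<^sub>E R \<oplus>\<^sub>E S = Q \<oplus>\<^sub>E (R \<oplus>\<^sub>E S)" "P \<oplus>\<^sub>E (Q \<oplus>\<^sub>E R) \<oplus>\<^sub>E S = P \<oplus>\<^sub>E ((Q \<oplus>\<^sub>E R) \<oplus>\<^sub>E S)"
     "point_neg L \<oplus>\<^sub>E (L \<oplus>\<^sub>E S) = S" "point_neg L \<oplus>\<^sub>E Y \<oplus>\<^sub>E S = point_neg L \<oplus>\<^sub>E (Y \<oplus>\<^sub>E S)"
     "\<exists>x y. S = Affine x y \<and> x \<notin> {x. cubic x = 0}"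
    by (drule_tac almost_all_ex) blast
  have "L \<oplus>\<^sub>E S = Y \<oplus>\<^sub>E S" unfolding L_def Y_def S(2) S(3) S(5) S(4) ..
  hence ZS: "Z \<oplus>\<^sub>E S = S" using S(6,7) unfolding Z_def by simp
  \<comment> \<open>For affine Z the identity Z + S = S puts the third point of the line at abscissa
    \<open>xs\<close>, so that point is S itself. Its negative is Z + S = S, against the nonzero
    ordinate of S.\<close>
  have "Z = Infinity"
  proof (cases Z)
    case (Affine xz yz)
    obtain xs ys where Sx: "S = Affine xs ys" "cubic xs \<noteq> 0" using S(8) by auto
    have ys: "ys \<noteq> 0" using S(1) Sx by (auto simp: Affine_in_curve_iff)
    have P: "Affine xs ys \<in> curve" "Affine xz yz \<in> curve" using S C Sx Affine by auto
    have "Affine xz yz \<noteq> Affine xs (- ys)"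
    proof
      assume "Affine xz yz = Affine xs (- ys)"
      hence "Z = point_neg S" using Affine Sx by simp
      hence "Z \<oplus>\<^sub>E S = Infinity" by (simp only: point_neg_add)
      thus False using ZS Sx by simp
    qed
    then obtain n w w' where n: "w = xz - xs" "Affine xz yz \<oplus>\<^sub>E Affine xs ys = Affine (xs + w') (- (ys + n * w'))"
      "yz = ys + n * w" "w * w' = cubic' xs - 2 * ys * n" "w' = n^2 - (3 * xs + a2 E) - w"
      by (rule add_line[OF P(2,1)])
    have "Affine (xs + w') (- (ys + n * w')) = Affine xs ys" using n(2) ZS Affine Sx by metis
    hence "w' = 0" "- (ys + n * w') = ys" by auto
    hence "ys + ys = 0" by (metis add.right_inverse add.right_neutral mult_zero_right)
    hence "2 * ys = 0" unfolding mult_2 .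
    thus ?thesis using ys two_nonzero by simp
  qed
  hence "point_neg L \<oplus>\<^sub>E Y = Infinity" by (simp add: Z_def)
  hence "L = Y"
  proof (cases L; cases Y)
    fix x1 y1 x2 y2 assume "L = Affine x1 y1" "Y = Affine x2 y2"
    thus ?thesis using \<open>point_neg L \<oplus>\<^sub>E Y = Infinity\<close> by (auto split: if_splits simp: Let_def)
  qed auto
  thus ?thesis unfolding L_def Y_def .
qed

end


section \<open>Multiples of points and the finite groups of rational points\<close>

context short_weierstrass begin

lemma point_mult_closed [simp]: "P \<in> curve \<Longrightarrow> point_mult E n P \<in> curve"
  by (induction n) simp_all

lemma point_mult_1 [simp]: "point_mult E (Suc 0) P = P"
  by simp

lemma add_left_commute:
  assumes "P \<in> curve" "Q \<in> curve" "R \<in> curve"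
  shows "P \<oplus>\<^sub>E (Q \<oplus>\<^sub>E R) = Q \<oplus>\<^sub>E (P \<oplus>\<^sub>E R)"
  using assms by (metis add_assoc add_commute)

lemma point_mult_add: "P \<in> curve \<Longrightarrow> point_mult E (m + n) P = point_mult E m P \<oplus>\<^sub>E point_mult E n P"
  by (induction m) (simp_all add: add_assoc)

lemma point_mult_Infinity [simp]: "point_mult E n Infinity = Infinity"
  by (induction n) simp_all

lemma point_mult_distrib:
  "P \<in> curve \<Longrightarrow> Q \<in> curve \<Longrightarrow> point_mult E n (P \<oplus>\<^sub>E Q) = point_mult E n P \<oplus>\<^sub>E point_mult E n Q"
proof (induction n)
  case (Suc n)
  let ?A = "point_mult E n P" and ?B = "point_mult E n Q"
  have "(P \<oplus>\<^sub>E Q) \<oplus>\<^sub>E (?A \<oplus>\<^sub>E ?B) = P \<oplus>\<^sub>E (Q \<oplus>\<^sub>E (?A \<oplus>\<^sub>E ?B))" using Suc.prems by (simp add: add_assoc)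
  also have "Q \<oplus>\<^sub>E (?A \<oplus>\<^sub>E ?B) = ?A \<oplus>\<^sub>E (Q \<oplus>\<^sub>E ?B)" using Suc.prems by (intro add_left_commute) simp_all
  also have "P \<oplus>\<^sub>E \<dots> = (P \<oplus>\<^sub>E ?A) \<oplus>\<^sub>E (Q \<oplus>\<^sub>E ?B)" using Suc.prems by (simp add: add_assoc)
  finally show ?case using Suc by simp
qed simp

lemma point_mult_mult: "P \<in> curve \<Longrightarrow> point_mult E (m * n) P = point_mult E m (point_mult E n P)"
  by (induction m) (simp_all add: point_mult_add)

lemma point_neg_eqI:
  assumes "P \<in> curve" "Q \<in> curve" "P \<oplus>\<^sub>E Q = Infinity"
  shows "Q = point_neg P"
proof -
  have "point_neg P = point_neg P \<oplus>\<^sub>E (P \<oplus>\<^sub>E Q)" using assms(3) by simp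
  also have "\<dots> = (point_neg P \<oplus>\<^sub>E P) \<oplus>\<^sub>E Q" using assms by (intro add_assoc[symmetric]) simp_all
  finally show ?thesis by simp
qed

lemma point_neg_distrib:
  assumes "P \<in> curve" "Q \<in> curve"
  shows "point_neg (P \<oplus>\<^sub>E Q) = point_neg P \<oplus>\<^sub>E point_neg Q"
proof -
  have "(P \<oplus>\<^sub>E Q) \<oplus>\<^sub>E (point_neg P \<oplus>\<^sub>E point_neg Q) = P \<oplus>\<^sub>E (Q \<oplus>\<^sub>E (point_neg P \<oplus>\<^sub>E point_neg Q))"
    using assms by (intro add_assoc) simp_all
  also have "Q \<oplus>\<^sub>E (point_neg P \<oplus>\<^sub>E point_neg Q) = point_neg P \<oplus>\<^sub>E (Q \<oplus>\<^sub>E point_neg Q)"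
    using assms by (intro add_left_commute) simp_all
  finally have "(P \<oplus>\<^sub>E Q) \<oplus>\<^sub>E (point_neg P \<oplus>\<^sub>E point_neg Q) = Infinity" by simp
  thus ?thesis using assms by (metis add_closed point_neg_closed point_neg_eqI)
qed

lemma point_mult_neg: "P \<in> curve \<Longrightarrow> point_mult E n (point_neg P) = point_neg (point_mult E n P)"
  by (induction n) (simp_all add: point_neg_distrib)

lemma add_cancel_left:
  assumes "P \<in> curve" "Q \<in> curve" "R \<in> curve" "P \<oplus>\<^sub>E Q = P \<oplus>\<^sub>E R"
  shows "Q = R"
proof -
  have "point_neg P \<oplus>\<^sub>E (P \<oplus>\<^sub>E Q) = point_neg P \<oplus>\<^sub>E (P \<oplus>\<^sub>E R)" using assms(4) by simp
  thus ?thesis using assms(1-3) by (simp flip: add_assoc)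
qed

definition curve_group :: "'a set \<Rightarrow> 'a point monoid" where
  "curve_group K = \<lparr>carrier = points E K, monoid.mult = point_add E, one = Infinity\<rparr>"

lemma points_subset: "P \<in> points E K \<Longrightarrow> P \<in> curve"
  by (cases P) (auto simp: Affine_in_curve_iff)

lemma points_closed:
  assumes K: "0 \<in> K" "\<And>x y. x \<in> K \<Longrightarrow> y \<in> K \<Longrightarrow> x + y \<in> K \<and> x - y \<in> K \<and> x * y \<in> K \<and> x / y \<in> K"
    and E: "a2 E \<in> K" "a4 E \<in> K" and P: "P \<in> points E K" "Q \<in> points E K"
  shows "P \<oplus>\<^sub>E Q \<in> points E K"
proof (cases P; cases Q)
  fix xa ya xb yb assume A: "P = Affine xa ya" and B: "Q = Affine xb yb"
  have mem: "xa \<in> K" "ya \<in> K" "xb \<in> K" "yb \<in> K" using P A B by (auto simp: Affine_in_curve_iff)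
  have two: "2 * x \<in> K" if "x \<in> K" for x using K(2)[OF that that] unfolding mult_2 by blast
  have three: "3 * x \<in> K" if "x \<in> K" for x
  proof -
    have "2 * x + x = 3 * x" by (simp add: algebra_simps)
    thus ?thesis using K(2)[OF two[OF that] that] by metis
  qed
  have Kadd: "x + y \<in> K" and Kdiff: "x - y \<in> K" and Kmult: "x * y \<in> K" and Kdiv: "x / y \<in> K" if "x \<in> K" "y \<in> K" for x y
    using K(2)[OF that] by auto
  have neg: "- x \<in> K" if "x \<in> K" for x using K(2)[OF K(1) that] by simp
  show ?thesis
  proof (cases "xa = xb \<and> ya + yb = 0")
    case False
    define m where "m = (if xa = xb then (3 * xa^2 + 2 * a2 E * xa + a4 E) / (2 * ya) else (yb - ya) / (xb - xa))"
    have m: "m \<in> K" unfolding m_def power2_eq_square mult.assoc by (auto intro!: Kadd Kdiff Kmult Kdiv two three E mem)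
    have eq: "P \<oplus>\<^sub>E Q = Affine (m^2 - a2 E - xa - xb) (- (ya + m * (m^2 - a2 E - xa - xb - xa)))"
      using False A B by (auto simp: Let_def m_def)
    have 1: "m^2 - a2 E - xa - xb \<in> K" unfolding power2_eq_square by (intro Kdiff Kmult m E mem)
    have 2: "- (ya + m * (m^2 - a2 E - xa - xb - xa)) \<in> K" by (intro neg Kadd Kdiff Kmult m 1 mem)
    have "P \<oplus>\<^sub>E Q \<in> curve" using P by (intro add_closed) (auto dest: points_subset)
    thus ?thesis unfolding eq using 1 2 by (simp only: Affine_in_curve_iff)
  qed (auto simp: A B)
qed (use P in auto)

lemma group_curve_group:
  assumes K: "0 \<in> K" "\<And>x y. x \<in> K \<Longrightarrow> y \<in> K \<Longrightarrow> x + y \<in> K \<and> x - y \<in> K \<and> x * y \<in> K \<and> x / y \<in> K"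
    and E: "a2 E \<in> K" "a4 E \<in> K"
  shows "group (curve_group K)"
proof (rule groupI)
  fix P assume "P \<in> carrier (curve_group K)"
  hence P: "P \<in> points E K" by (simp add: curve_group_def)
  have "- y \<in> K" if "y \<in> K" for y using K(2)[OF K(1) that] by simp
  hence "point_neg P \<in> points E K" using P by (cases P) (auto simp: Affine_in_curve_iff)
  thus "\<exists>Q \<in> carrier (curve_group K). Q \<otimes>\<^bsub>curve_group K\<^esub> P = \<one>\<^bsub>curve_group K\<^esub>"
    by (intro bexI[of _ "point_neg P"]) (auto simp: curve_group_def)
qed (auto simp: curve_group_def points_closed[OF assms] intro!: add_assoc dest: points_subset)

lemma curve_group_pow:
  assumes "P \<in> curve"
  shows "P [^]\<^bsub>curve_group K\<^esub> (n::nat) = point_mult E n P"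
proof (induction n)
  case (Suc n)
  have "point_mult E n P \<oplus>\<^sub>E P = P \<oplus>\<^sub>E point_mult E n P" using assms by (intro add_commute) simp_all
  thus ?case using Suc by (simp add: curve_group_def nat_pow_def)
qed (simp add: curve_group_def nat_pow_def)

text \<open>Lagrange's theorem: a nonzero point killed by the prime \<open>r\<close> has order
  exactly \<open>r\<close>.\<close>

lemma prime_dvd_card_points:
  assumes K: "0 \<in> K" "\<And>x y. x \<in> K \<Longrightarrow> y \<in> K \<Longrightarrow> x + y \<in> K \<and> x - y \<in> K \<and> x * y \<in> K \<and> x / y \<in> K"
    and E: "a2 E \<in> K" "a4 E \<in> K" and P: "P \<in> points E K" "P \<noteq> Infinity" "point_mult E r P = Infinity" and r: "prime r"
  shows "r dvd card (points E K)"
proof -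
  interpret G: group "curve_group K" by (rule group_curve_group[OF K E])
  have PG: "P \<in> carrier (curve_group K)" using P by (simp add: curve_group_def)
  have "G.ord P dvd r" using P points_subset[OF P(1)] 
    by (subst G.pow_eq_id[OF PG, symmetric]) (simp add: curve_group_pow, simp add: curve_group_def)
  moreover have "G.ord P \<noteq> 1" using G.ord_eq_1[OF PG] P(2) by (simp add: curve_group_def)
  ultimately have "G.ord P = r" using r by (metis prime_nat_iff)
  thus ?thesis using G.ord_dvd_group_order[OF PG] by (simp add: Coset.order_def curve_group_def)
qed

lemma card_point_mult:
  assumes K: "0 \<in> K" "\<And>x y. x \<in> K \<Longrightarrow> y \<in> K \<Longrightarrow> x + y \<in> K \<and> x - y \<in> K \<and> x * y \<in> K \<and> x / y \<in> K"
    and E: "a2 E \<in> K" "a4 E \<in> K" and P: "P \<in> points E K"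
  shows "point_mult E (card (points E K)) P = Infinity"
proof -
  interpret G: group "curve_group K" by (rule group_curve_group[OF K E])
  have PG: "P \<in> carrier (curve_group K)" using P by (simp add: curve_group_def)
  show ?thesis using G.pow_order_eq_1[OF PG] points_subset[OF P]
    by (simp add: curve_group_pow Coset.order_def) (simp add: curve_group_def)
qed


section \<open>Abscissae of sums and differences\<close>

text \<open>\<open>(A : B)\<close> are homogeneous coordinates of the image of the point on the
  projective x-line, the point at infinity going to (1 : 0).\<close>

definition abscissa :: "'a point \<Rightarrow> 'a \<Rightarrow> 'a \<Rightarrow> bool" where
  "abscissa P A B = (case P of Infinity \<Rightarrow> A \<noteq> 0 \<and> B = 0 | Affine x y \<Rightarrow> B \<noteq> 0 \<and> A = x * B)"

lemma abscissa_simps [simp]: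
  "abscissa Infinity A B \<longleftrightarrow> A \<noteq> 0 \<and> B = 0"
  "abscissa (Affine x y) A B \<longleftrightarrow> B \<noteq> 0 \<and> A = x * B"
  by (simp_all add: abscissa_def)

lemma abscissa_ex: "\<exists>A B. abscissa P A B"
  by (cases P) (auto intro: exI[of _ 1] simp: exI[of _ "1::'a"])

definition kummer0 :: "'a \<Rightarrow> 'a \<Rightarrow> 'a \<Rightarrow> 'a" where
  "kummer0 x A B = (A - x * B)^2"

definition kummer1 :: "'a \<Rightarrow> 'a \<Rightarrow> 'a \<Rightarrow> 'a" where
  "kummer1 x A B = 2 * ((x * A + a4 E * B) * (A + x * B) + 2 * a2 E * x * A * B + 2 * a6 E * B^2)"

definition kummer2 :: "'a \<Rightarrow> 'a \<Rightarrow> 'a \<Rightarrow> 'a" where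
  "kummer2 x A B = (x * A - a4 E * B)^2 - 4 * a6 E * B * (A + x * B + a2 E * B)"

lemma add_chord:
  assumes "x1 \<noteq> x2"
  shows "Affine x1 y1 \<oplus>\<^sub>E Affine x2 y2 = Affine (((y2 - y1) / (x2 - x1))^2 - a2 E - x1 - x2)
    (- (y1 + (y2 - y1) / (x2 - x1) * (((y2 - y1) / (x2 - x1))^2 - a2 E - x1 - x2 - x1)))"
  using assms by (simp add: Let_def)

lemma add_tangent:
  assumes "y \<noteq> 0"
  shows "\<exists>y'. Affine x y \<oplus>\<^sub>E Affine x y = Affine ((cubic' x / (2 * y))^2 - a2 E - x - x) y'"
proof -
  have "y + y \<noteq> 0" using assms two_nonzero by (simp flip: mult_2)
  thus ?thesis by (simp add: Let_def cubic'_def)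
qed

text \<open>The three forms are the elementary symmetric functions of the abscissae of
  \<open>U - P\<close> and \<open>U + P\<close>, in homogeneous form.\<close>

lemma kummer_same:
  assumes P: "Affine x y \<in> curve" and U: "abscissa (Affine x y) A B"
    and W: "abscissa (Affine x y \<oplus>\<^sub>E Affine x y) C' D'" and C: "C \<noteq> 0"
  obtains r where "r \<noteq> 0" "kummer0 x A B = 0" "kummer1 x A B = r * (C * D')" "kummer2 x A B = r * (C * C')"
proof -
  have y: "y^2 = cubic x" using P by (simp add: Affine_in_curve_iff)
  have B: "B \<noteq> 0" "A = x * B" using U by auto
  have 0: "kummer0 x A B = 0" using B by (simp add: kummer0_def)
  have 1: "kummer1 x A B = 4 * y^2 * B^2" unfolding kummer1_def B(2) y cubic_def by Groebner_Basis.algebra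
  have 2: "kummer2 x A B = (cubic' x ^ 2 - 4 * y^2 * (a2 E + 2 * x)) * B^2"
    unfolding kummer2_def B(2) y cubic_def cubic'_def by Groebner_Basis.algebra
  show ?thesis
  proof (cases "y = 0")
    case True
    have "cubic' x \<noteq> 0" using cubic_no_double_root[of x] y True by simp
    moreover have "Affine x y \<oplus>\<^sub>E Affine x y = Infinity" using True by simp
    ultimately show ?thesis using W True B(1) C
      by (intro that[of "kummer2 x A B / (C * C')"]) (simp_all add: 0 1 2)
  next
    case False
    then obtain y' where y': "Affine x y \<oplus>\<^sub>E Affine x y = Affine ((cubic' x / (2 * y))^2 - a2 E - x - x) y'"
      using add_tangent by blast
    have D: "D' \<noteq> 0" "C' = ((cubic' x / (2 * y))^2 - a2 E - x - x) * D'" using W unfolding y' by auto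
    have four: "(4::'a) \<noteq> 0" using two_nonzero by (metis mult_2_right mult_eq_0_iff numeral_Bit0)
    have nz: "4 * y^2 * B^2 / (C * D') \<noteq> 0" using False B(1) C D(1) four by simp
    define t where "t = (cubic' x / (2 * y))^2 - a2 E - x - x"
    have "(cubic' x)^2 = 4 * y^2 * (t + a2 E + x + x)"
      using False two_nonzero four unfolding t_def by (simp add: power_divide power_mult_distrib)
    hence "kummer2 x A B = 4 * y^2 * t * B^2"
      unfolding 2 by (simp add: algebra_simps)
    also have "\<dots> = 4 * y^2 * B^2 / (C * D') * (C * C')"
      unfolding D(2)[folded t_def] using C D(1) by simp
    finally have "kummer2 x A B = 4 * y^2 * B^2 / (C * D') * (C * C')" .
    thus ?thesis using nz 0 1 C D(1) by (intro that[of "4 * y^2 * B^2 / (C * D')"]) auto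
  qed
qed

text \<open>For distinct abscissae the sum and the product of the two chord abscissae depend on the
  ordinates only through their squares, which the curve equation eliminates. If U = P or U = -P, one
  of the two points is infinite and the other is a double; this is \<open>kummer_same\<close>,
  applied to P or to -P.\<close>

lemma kummer_relation:
  assumes P: "Affine x y \<in> curve" and U: "U \<in> curve" "abscissa U A B"
    and V: "abscissa (U \<oplus>\<^sub>E Affine x (- y)) C D" and W: "abscissa (U \<oplus>\<^sub>E Affine x y) C' D'"
  obtains r where "r \<noteq> 0" "kummer0 x A B = r * (D * D')" "kummer1 x A B = r * (C * D' + C' * D)"
    "kummer2 x A B = r * (C * C')"
proof (cases U)
  case Infinity
  have "D \<noteq> 0" "D' \<noteq> 0" "C = x * D" "C' = x * D'" "A \<noteq> 0" "B = 0" using U V W Infinity by auto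
  thus ?thesis by (intro that[of "A^2 / (D * D')"])
    (simp_all add: kummer0_def kummer1_def kummer2_def field_simps power2_eq_square)
next
  case (Affine x1 y1)
  have on: "y^2 = cubic x" "y1^2 = cubic x1" using P U Affine by (auto simp: Affine_in_curve_iff)
  have B: "B \<noteq> 0" "A = x1 * B" using U Affine by auto
  show ?thesis
  proof (cases "x1 = x")
    case True
    hence "y1 = y \<or> y1 = - y" using U(1) P Affine point_negI[of x y1 y] by auto
    thus ?thesis
    proof
      assume y1: "y1 = y"
      hence "U \<oplus>\<^sub>E Affine x (- y) = Infinity" using True Affine by simp
      hence "D = 0" "C \<noteq> 0" using V by auto
      thus ?thesis using kummer_same[of x y A B C' D' C] that P U W y1 Affine True
        by (metis add_0_right mult_zero_left mult_zero_right)
    next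
      assume y1: "y1 = - y"
      have P': "Affine x (- y) \<in> curve" using P by (simp add: Affine_in_curve_iff)
      have "U \<oplus>\<^sub>E Affine x y = Infinity" using True Affine y1 by simp
      hence D': "D' = 0" "C' \<noteq> 0" using W by auto
      have VV: "abscissa (Affine x (- y) \<oplus>\<^sub>E Affine x (- y)) C D" using V Affine y1 True by simp
      have UU: "abscissa (Affine x (- y)) A B" using U(2) Affine y1 True by simp
      show ?thesis
        by (rule kummer_same[OF P' UU VV D'(2)], rule that, assumption) (simp_all add: D' ac_simps)
    qed
  next
    case False
    define s where "s = (x - x1)^2"
    have s: "s \<noteq> 0" using False by (simp add: s_def)
    define xp where "xp = ((y - y1) / (x - x1))^2 - a2 E - x1 - x"
    define xm where "xm = ((- y - y1) / (x - x1))^2 - a2 E - x1 - x"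
    have C: "D \<noteq> 0" "C = xm * D" and C': "D' \<noteq> 0" "C' = xp * D'"
      using V W unfolding Affine add_chord[OF False] xm_def xp_def by auto
    have sp: "s * xp = (y - y1)^2 - s * (a2 E + x1 + x)"
      using s unfolding xp_def s_def by (simp add: power_divide algebra_simps)
    have sm: "s * xm = (- y - y1)^2 - s * (a2 E + x1 + x)"
      using s unfolding xm_def s_def by (simp add: power_divide algebra_simps)
    have "s * (xp + xm) = 2 * (y^2 + y1^2) - 2 * s * (a2 E + x1 + x)"
      unfolding distrib_left sp sm by Groebner_Basis.algebra
    hence sum: "B^2 * (s * (xp + xm)) = kummer1 x A B"
      unfolding on s_def cubic_def kummer1_def B(2) by Groebner_Basis.algebra
    have "(s * xp) * (s * xm) = (y^2 + y1^2 - s * (a2 E + x1 + x))^2 - 4 * y^2 * y1^2"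
      unfolding sp sm by Groebner_Basis.algebra
    hence "s * (B^2 * (s * (xp * xm)) - kummer2 x A B) = 0"
      unfolding on s_def cubic_def kummer2_def B(2) by Groebner_Basis.algebra
    hence prod: "B^2 * (s * (xp * xm)) = kummer2 x A B" using s by simp
    have "kummer0 x A B = B^2 * s" unfolding kummer0_def B(2) s_def by Groebner_Basis.algebra
    thus ?thesis using s B(1) C C'
      by (intro that[of "B^2 * s / (D * D')"]) (simp_all add: sum[symmetric] prod[symmetric] field_simps)
  qed
qed

end


section \<open>Division polynomials\<close>

text \<open>Over an algebraically closed field the absence of common roots is coprimality; the proof
  strips one root of \<open>A\<close> at a time from both sides.\<close>

lemma dvd_of_no_common_root:
  fixes A B H :: "'a::alg_closed_field poly"
  assumes "A \<noteq> 0" "\<And>x. poly A x = 0 \<Longrightarrow> poly B x \<noteq> 0" "A dvd B * H"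
  shows "A dvd H"
  using assms
proof (induction "degree A" arbitrary: A H)
  case 0
  hence "is_unit A" by (auto simp: is_unit_iff_degree)
  thus ?case by (rule unit_imp_dvd)
next
  case (Suc n)
  obtain a where a: "poly A a = 0" using alg_closed_imp_poly_has_root[of A] Suc.hyps(2) by auto
  then obtain A' where A': "A = [:- a, 1:] * A'" by (metis poly_eq_0_iff_dvd dvdE)
  have A'0: "A' \<noteq> 0" using Suc.prems(1) A' by auto
  have "degree A = degree [:- a, 1:] + degree A'" unfolding A' by (rule degree_mult_eq) (use A'0 in auto)
  hence deg: "n = degree A'" using Suc.hyps(2) by simp
  obtain K where K: "B * H = A * K" using Suc.prems(3) by (elim dvdE)
  have "poly B a * poly H a = 0" using a by (metis K poly_mult mult_zero_left)
  hence "poly H a = 0" using Suc.prems(2)[OF a] by simp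
  then obtain H' where H': "H = [:- a, 1:] * H'" by (metis poly_eq_0_iff_dvd dvdE)
  have "[:- a, 1:] * (B * H') = [:- a, 1:] * (A' * K)" using K unfolding A' H' by (simp only: mult_ac)
  hence "B * H' = A' * K" by (subst (asm) mult_cancel_left) auto
  moreover have "poly B x \<noteq> 0" if "poly A' x = 0" for x using Suc.prems(2) that unfolding A' by simp
  ultimately have "A' dvd H'" using Suc.hyps(1)[OF deg A'0] by simp
  thus ?case unfolding A' H' by (rule mult_dvd_mono[OF dvd_refl])
qed

lemma poly_eqI_all: 
  fixes A B :: "'a::alg_closed_field poly"
  assumes "\<And>x. poly A x = poly B x"
  shows "A = B"
proof (rule ccontr)
  assume "A \<noteq> B"
  hence "finite {x. poly (A - B) x = 0}" by (intro poly_roots_finite) simp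
  thus False using assms infinite_alg_closed_field[where 'a = 'a] by simp
qed

context short_weierstrass begin

text \<open>\<open>A / B\<close> is the effect of [n] on abscissae, in lowest terms since
  \<open>(0, 0)\<close> is no valid coordinate pair. The pair is characterised by its values and its
  leading term instead of by recursion formulas. The disjunct \<open>B = 0\<close> covers n =
  0.\<close>

definition division_polys :: "nat \<Rightarrow> 'a poly \<Rightarrow> 'a poly \<Rightarrow> bool" where
  "division_polys n A B \<longleftrightarrow> lead_coeff A = 1 \<and> degree A = n^2 \<and> (B = 0 \<or> degree B < n^2) \<and>
     (\<forall>x y. Affine x y \<in> curve \<longrightarrow> abscissa (point_mult E n (Affine x y)) (poly A x) (poly B x))"

lemma ex_point: "\<exists>y. Affine x y \<in> curve"
  using nth_root_exists[of 2 "cubic x"] by (auto simp: Affine_in_curve_iff)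

lemma abscissa_nonzero: "abscissa P A B \<Longrightarrow> A \<noteq> 0 \<or> B \<noteq> 0"
  by (cases P) auto

lemma abscissa_scale: "abscissa P A B \<Longrightarrow> r \<noteq> 0 \<Longrightarrow> abscissa P (r * A) (r * B)"
  by (cases P) auto

lemma division_polys_no_common_root:
  assumes "division_polys n A B" "poly A x = 0"
  shows "poly B x \<noteq> 0"
  using assms ex_point[of x] abscissa_nonzero unfolding division_polys_def by metis

lemma division_polys_0: "division_polys 0 1 0"
  by (auto simp: division_polys_def)

lemma division_polys_1: "division_polys (Suc 0) [:0, 1:] 1"
  by (auto simp: division_polys_def)

text \<open>The next pair is the second root of the quadratic form whose coefficients are the Kummer
  forms, so it is obtained by exact division from the pair two steps before.\<close>

lemma division_polys_step:
  assumes 1: "division_polys n A1 B1" and 2: "division_polys (Suc n) A B"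
  shows "\<exists>A' B'. division_polys (Suc (Suc n)) A' B'"
proof -
  let ?x = "[:0, 1:] :: 'a poly" and ?c = "\<lambda>a. [:a:] :: 'a poly"
  define N where "N = (Suc n)^2"
  define T0 where "T0 = (A - ?x * B)^2"
  define T1 where "T1 = 2 * ((?x * A + ?c (a4 E) * B) * (A + ?x * B) + 2 * ?c (a2 E) * ?x * A * B + 2 * ?c (a6 E) * B^2)"
  define T2 where "T2 = (?x * A - ?c (a4 E) * B)^2 - 4 * ?c (a6 E) * B * (A + ?x * B + ?c (a2 E) * B)"
  have A1: "lead_coeff A1 = 1" "degree A1 = n^2" "B1 = 0 \<or> degree B1 < n^2" "A1 \<noteq> 0" using 1 by (auto simp: division_polys_def)
  have A: "lead_coeff A = 1" "degree A = N" "B = 0 \<or> degree B < N" "A \<noteq> 0" using 2 by (auto simp: division_polys_def N_def)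
  have N: "N > 0" by (simp add: N_def)
  have pT: "poly T0 x = kummer0 x (poly A x) (poly B x)" "poly T1 x = kummer1 x (poly A x) (poly B x)"
    "poly T2 x = kummer2 x (poly A x) (poly B x)" for x
    by (simp_all add: T0_def T1_def T2_def kummer0_def kummer1_def kummer2_def algebra_simps)
  have rel: "\<exists>C D r. abscissa (point_mult E (Suc (Suc n)) (Affine x y)) C D \<and> r \<noteq> 0 \<and>
     poly T0 x = r * (poly B1 x * D) \<and> poly T1 x = r * (poly A1 x * D + C * poly B1 x) \<and> poly T2 x = r * (poly A1 x * C)"
    if P: "Affine x y \<in> curve" for x y
  proof -
    define P where "P = Affine x y"
    have Pc: "P \<in> curve" using P by (simp add: P_def)
    define U where "U = point_mult E (Suc n) P"
    have U: "U \<in> curve" "abscissa U (poly A x) (poly B x)"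
      using Pc 2 unfolding U_def P_def division_polys_def by (simp_all del: point_mult.simps)
    have "U = point_mult E n P \<oplus>\<^sub>E P" unfolding U_def using Pc by (simp add: add_commute)
    hence "U \<oplus>\<^sub>E Affine x (- y) = point_mult E n P \<oplus>\<^sub>E P \<oplus>\<^sub>E point_neg P" by (simp add: P_def)
    also have "\<dots> = point_mult E n P" using Pc by (subst add_assoc) simp_all
    finally have V: "abscissa (U \<oplus>\<^sub>E Affine x (- y)) (poly A1 x) (poly B1 x)"
      using 1 P unfolding division_polys_def P_def by simp
    have W: "U \<oplus>\<^sub>E Affine x y = point_mult E (Suc (Suc n)) P"
      using add_commute[OF U(1) Pc] unfolding U_def P_def by simp
    obtain C D where CD: "abscissa (U \<oplus>\<^sub>E Affine x y) C D" using abscissa_ex by blast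
    obtain r where "r \<noteq> 0" "kummer0 x (poly A x) (poly B x) = r * (poly B1 x * D)"
       "kummer1 x (poly A x) (poly B x) = r * (poly A1 x * D + C * poly B1 x)"
       "kummer2 x (poly A x) (poly B x) = r * (poly A1 x * C)"
      by (rule kummer_relation[OF P U V CD]) 
    thus ?thesis using CD unfolding pT W P_def by blast
  qed
  \<comment> \<open>The pair for n is one root, in homogeneous form, of the quadratic whose roots
    are the abscissae of the n-fold and the (n+2)-fold point.\<close>
  have form: "T0 * A1^2 - T1 * A1 * B1 + T2 * B1^2 = 0"
  proof (rule poly_eqI_all)
    fix x obtain y where P: "Affine x y \<in> curve" using ex_point by blast
    show "poly (T0 * A1^2 - T1 * A1 * B1 + T2 * B1^2) x = poly 0 x"
      using rel[OF P] by (auto simp: algebra_simps power2_eq_square)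
  qed
  have ncr: "poly B1 x \<noteq> 0" if "poly A1 x = 0" for x using division_polys_no_common_root[OF 1 that] .
  have "T2 * B1^2 = A1 * (T1 * B1 - T0 * A1)" using form by Groebner_Basis.algebra
  hence "A1 dvd B1 * (B1 * T2)" by (metis dvd_triv_left mult.assoc mult.commute power2_eq_square)
  hence "A1 dvd T2" using dvd_of_no_common_root[OF A1(4) ncr] by blast
  then obtain A' where A': "T2 = A1 * A'" by (elim dvdE)
  have "A1 * (B1 * (T1 - A' * B1)) = A1 * (T0 * A1)" using form unfolding A' by Groebner_Basis.algebra
  hence T0A1: "B1 * (T1 - A' * B1) = T0 * A1" using A1(4) by simp
  hence "A1 dvd B1 * (T1 - A' * B1)" by simp
  hence "A1 dvd T1 - A' * B1" using dvd_of_no_common_root[OF A1(4) ncr] by blast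
  then obtain B' where "T1 - A' * B1 = A1 * B'" by (elim dvdE)
  hence B': "T1 = A1 * B' + A' * B1" by (simp add: algebra_simps)
  have "A1 * (B1 * B') = A1 * T0" using T0A1 unfolding B' by Groebner_Basis.algebra
  hence T0: "T0 = B1 * B'" using A1(4) by simp
  have absc: "abscissa (point_mult E (Suc (Suc n)) (Affine x y)) (poly A' x) (poly B' x)"
    if P: "Affine x y \<in> curve" for x y
  proof -
    obtain C D r where *: "abscissa (point_mult E (Suc (Suc n)) (Affine x y)) C D" "r \<noteq> 0"
     "poly B1 x * poly B' x = r * (poly B1 x * D)" 
     "poly A1 x * poly B' x + poly A' x * poly B1 x = r * (poly A1 x * D + C * poly B1 x)"
     "poly A1 x * poly A' x = r * (poly A1 x * C)"
      using rel[OF P] unfolding T0 B' A' by auto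
    have "poly A' x = r * C \<and> poly B' x = r * D"
    proof (cases "poly B1 x = 0")
      case True
      hence "poly A1 x \<noteq> 0" using ncr by blast
      thus ?thesis using *(4,5) True by simp
    next
      case False
      hence D: "poly B' x = r * D" using *(3) by simp
      hence "poly A' x * poly B1 x = (r * C) * poly B1 x" using *(4) by (simp add: algebra_simps)
      thus ?thesis using False D by simp
    qed
    thus ?thesis using abscissa_scale[OF *(1,2)] by simp
  qed
  have d: "degree (p * q) \<le> k + l" if "degree p \<le> k" "degree q \<le> l" for p q :: "'a poly" and k l
    using degree_mult_le[of p q] that by linarith
  have dB: "degree B \<le> N - 1" "degree (?x * B) \<le> N" "degree (A + ?x * B) \<le> N" "degree (?c a * B) \<le> N - 1" for a
  proof -
    show *: "degree B \<le> N - 1" using A(3) by auto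
    show **: "degree (?x * B) \<le> N" using d[of ?x 1 B "N - 1"] * N by simp
    show "degree (A + ?x * B) \<le> N" using ** A(2) by (intro degree_add_le) auto
    show "degree (?c a * B) \<le> N - 1" using d[of "?c a" 0 B "N - 1"] * by simp
  qed
  \<comment> \<open>The leading term of \<open>T2\<close> is that of \<open>(?x * A)^2\<close>, of
    degree 2 (n+1)^2 + 2 = n^2 + (n+2)^2. Dividing by the monic \<open>A1\<close> of degree n^2
    leaves degree (n+2)^2.\<close>
  define F where "F = ?x * A - ?c (a4 E) * B"
  define G where "G = 4 * ?c (a6 E) * B * (A + ?x * B + ?c (a2 E) * B)"
  have dxA: "degree (?x * A) = Suc N" "lead_coeff (?x * A) = 1" using A by (auto simp: degree_mult_eq)
  have dF: "degree F = Suc N" "lead_coeff F = 1"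
  proof -
    have less: "degree (- (?c (a4 E) * B)) < degree (?x * A)" using dB(4)[of "a4 E"] dxA(1) N by (simp del: mult_pCons_left)
    show "degree F = Suc N" unfolding F_def diff_conv_add_uminus using degree_add_eq_left[OF less] dxA(1) by simp
    show "lead_coeff F = 1" unfolding F_def diff_conv_add_uminus using lead_coeff_add_le[OF less] dxA(2) by (metis add.commute)
  qed
  have dF2: "degree (F^2) = 2 * N + 2" "lead_coeff (F^2) = 1"
  proof -
    have "F \<noteq> 0" using dF by auto
    thus "degree (F^2) = 2 * N + 2" using dF by (simp add: degree_power_eq)
    show "lead_coeff (F^2) = 1" using dF(2) by (simp add: lead_coeff_power)
  qed
  have dG: "degree G \<le> 2 * N - 1"
  proof -
    have "degree (A + ?x * B + ?c (a2 E) * B) \<le> N"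
      by (rule degree_add_le[OF dB(3) order_trans[OF dB(4)]]) simp
    moreover have "degree (4 * ?c (a6 E) * B) \<le> 0 + 0 + (N - 1)" using dB(1) by (intro d) auto
    ultimately have "degree G \<le> (0 + 0 + (N - 1)) + N" unfolding G_def by (metis d)
    thus ?thesis using N by linarith
  qed
  have T2: "degree T2 = 2 * N + 2" "lead_coeff T2 = 1"
  proof -
    have eq: "T2 = F^2 + (- G)" by (simp add: T2_def F_def G_def)
    have less: "degree (- G) < degree (F^2)" using dG dF2 by simp
    show "degree T2 = 2 * N + 2" unfolding eq using degree_add_eq_left[OF less] dF2 by simp
    show "lead_coeff T2 = 1" unfolding eq using lead_coeff_add_le[OF less] dF2 by (metis add.commute)
  qed
  have "A' \<noteq> 0" using T2 A' by auto
  hence "degree T2 = n^2 + degree A'" unfolding A' using A1 by (simp add: degree_mult_eq)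
  hence dA': "degree A' = (Suc (Suc n))^2" using T2 by (simp add: N_def power2_eq_square)
  have lA': "lead_coeff A' = 1" using T2(2) unfolding A' lead_coeff_mult A1(1) by simp
  have dT1: "degree T1 \<le> 2 * N + 1"
  proof -
    have "degree (?x * A + ?c (a4 E) * B) \<le> Suc N" using dxA(1) dB(4)[of "a4 E"] by (intro degree_add_le) auto
    hence "degree ((?x * A + ?c (a4 E) * B) * (A + ?x * B)) \<le> Suc N + N" using dB(3) by (rule d)
    moreover have "degree (2 * ?c (a2 E) * ?x * A * B) \<le> (0 + 0) + 1 + N + (N - 1)"
      using A(2) dB(1) by (intro d) auto
    moreover have "degree (2 * ?c (a6 E) * B^2) \<le> (0 + 0) + ((N - 1) + (N - 1))"
      unfolding power2_eq_square using dB(1) by (intro d) auto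
    ultimately have "degree ((?x * A + ?c (a4 E) * B) * (A + ?x * B) + 2 * ?c (a2 E) * ?x * A * B + 2 * ?c (a6 E) * B^2) \<le> 2 * N + 1"
      using N by (intro degree_add_le) linarith+
    hence "degree T1 \<le> 0 + (2 * N + 1)" unfolding T1_def by (rule d[rotated]) simp
    thus ?thesis by simp
  qed
  have dB': "B' = 0 \<or> degree B' < (Suc (Suc n))^2"
  proof (cases "B' = 0")
    case False
    have N2: "(Suc (Suc n))^2 + n^2 = 2 * N + 2" by (simp add: N_def power2_eq_square)
    have "degree (A' * B1) \<le> 2 * N + 1"
    proof (cases "B1 = 0")
      case False
      hence "degree B1 < n^2" using A1(3) by simp
      thus ?thesis using d[of A' "(Suc (Suc n))^2" B1 "n^2 - 1"] dA' N2 by simp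
    qed simp
    moreover have "A1 * B' = T1 + (- (A' * B1))" using B' by simp
    ultimately have "degree (A1 * B') \<le> 2 * N + 1" using dT1 by (metis degree_add_le degree_minus)
    hence "n^2 + degree B' \<le> 2 * N + 1" using False A1 by (simp add: degree_mult_eq)
    thus ?thesis using N2 by linarith
  qed simp
  show ?thesis unfolding division_polys_def
    using absc dA' lA' dB' by blast
qed

lemma division_polys_ex: "\<exists>A B. division_polys n A B"
proof (induction n rule: induct_nat_012)
  case (ge2 n)
  thus ?case using division_polys_step by blast
qed (use division_polys_0 division_polys_1 in blast)+

end


section \<open>Existence of torsion points\<close>

lemma monic_unique_root:
  fixes A :: "'a::alg_closed_field poly"
  assumes "lead_coeff A = 1" "\<And>x. poly A x = 0 \<Longrightarrow> x = 0"
  shows "A = monom 1 (degree A)"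
  using assms
proof (induction "degree A" arbitrary: A)
  case 0
  then obtain c where "A = [:c:]" by (metis degree_eq_zeroE)
  thus ?case using 0 by (simp add: one_pCons[symmetric])
next
  case (Suc n)
  obtain a where a: "poly A a = 0" using alg_closed_imp_poly_has_root[of A] Suc.hyps(2) by auto
  hence "[:0, 1:] dvd A" using Suc.prems(2)[OF a] by (metis poly_eq_0_iff_dvd neg_0_equal_iff_equal)
  then obtain A' where A': "A = [:0, 1:] * A'" by (elim dvdE)
  have A'0: "A' \<noteq> 0" using Suc.prems(1) A' by auto
  have deg: "degree A = Suc (degree A')" unfolding A' using A'0 by (simp add: degree_mult_eq)
  have "lead_coeff A' = 1" using Suc.prems(1) unfolding A' lead_coeff_mult by simp
  moreover have "x = 0" if "poly A' x = 0" for x using Suc.prems(2)[of x] that unfolding A' by simp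
  ultimately have "A' = monom 1 (degree A')" using Suc.hyps deg by simp
  hence "A = [:0, 1:] * monom 1 (degree A')" using A' by simp
  also have "\<dots> = monom 1 (Suc (degree A'))" by (simp add: monom_Suc)
  finally show ?case using deg by simp
qed

lemma nontrivial_root_of_unity:
  assumes r: "r > 1" "of_nat r \<noteq> (0 :: 'a::alg_closed_field)"
  obtains z :: "'a::alg_closed_field" where "z \<noteq> 1" "z ^ r = 1"
proof -
  define S where "S = (\<Sum>i<r. monom (1::'a) i)"
  have "coeff S (r - 1) = 1" using r by (simp add: S_def coeff_sum)
  hence "degree S \<ge> r - 1" by (intro le_degree) simp
  hence "degree S > 0" using r by simp
  then obtain z where z: "poly S z = 0" using alg_closed_imp_poly_has_root by blast
  hence sum: "(\<Sum>i<r. z ^ i) = 0" by (simp add: S_def poly_sum poly_monom)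
  have "z \<noteq> 1" using sum r by auto
  moreover have "z ^ r = 1" using power_diff_1_eq[of z r] sum by simp
  ultimately show ?thesis using that by blast
qed

fun frob :: "nat \<Rightarrow> 'k::field point \<Rightarrow> 'k point" where
  "frob N Infinity = Infinity"
| "frob N (Affine x y) = Affine (x ^ N) (y ^ N)"

context short_weierstrass begin

lemma point_mult_injective:
  assumes "\<And>P. P \<in> curve \<Longrightarrow> point_mult E r P = Infinity \<Longrightarrow> P = Infinity"
    and P: "P \<in> curve" "Q \<in> curve" "point_mult E r P = point_mult E r Q"
  shows "P = Q"
proof -
  have "point_mult E r (P \<oplus>\<^sub>E point_neg Q) = Infinity"
    using P by (simp add: point_mult_distrib point_mult_neg)
  hence "P \<oplus>\<^sub>E point_neg Q = Infinity" using assms(1) P by simp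
  hence "point_neg Q \<oplus>\<^sub>E P = Infinity" using P by (simp add: add_commute)
  hence "P = point_neg (point_neg Q)" using P by (intro point_neg_eqI) simp_all
  thus ?thesis by simp
qed

text \<open>Without \<open>r\<close>-torsion, multiplication by \<open>r\<close> acts on abscissae as a polynomial that is
  injective on an algebraically closed field, which leaves only a pure power up to affine maps.\<close>

lemma torsion_free_mult:
  assumes r: "r > 0" and free: "\<And>P. P \<in> curve \<Longrightarrow> point_mult E r P = Infinity \<Longrightarrow> P = Infinity"
  obtains b c where "b \<noteq> 0" "inj (\<lambda>x::'a. x ^ r\<^sup>2)"
    "\<And>x y. Affine x y \<in> curve \<Longrightarrow> \<exists>y'. point_mult E r (Affine x y) = Affine ((x ^ r\<^sup>2 + c) / b) y'"
proof -
  obtain A B where AB: "division_polys r A B" using division_polys_ex by blast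
  have absc: "abscissa (point_mult E r (Affine x y)) (poly A x) (poly B x)" if "Affine x y \<in> curve" for x y
    using AB that by (auto simp: division_polys_def)
  have B0: "poly B x \<noteq> 0" for x
  proof
    assume "poly B x = 0"
    moreover obtain y where P: "Affine x y \<in> curve" using ex_point by blast
    ultimately have "point_mult E r (Affine x y) = Infinity"
      using absc[OF P] by (cases "point_mult E r (Affine x y)") auto
    thus False using free[OF P] by simp
  qed
  have "degree B = 0" using alg_closed_imp_poly_has_root[of B] B0 by auto
  then obtain b where b: "B = [:b:]" by (metis degree_eq_zeroE)
  have b0: "b \<noteq> 0" using B0[of 0] b by simp
  have eq: "\<exists>y'. point_mult E r (Affine x y) = Affine (poly A x / b) y'" if P: "Affine x y \<in> curve" for x y
    using absc[OF P] b b0 by (cases "point_mult E r (Affine x y)") auto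
  \<comment> \<open>Equal image abscissae mean rP = rQ or rP = -rQ, hence P = Q or P = -Q because
    there is no \<open>r\<close>-torsion; in both cases the abscissae agree.\<close>
  have inj: "x1 = x2" if eqA: "poly A x1 = poly A x2" for x1 x2
  proof -
    obtain y1 y2 where P: "Affine x1 y1 \<in> curve" "Affine x2 y2 \<in> curve" using ex_point by metis
    obtain y1' y2' where y: "point_mult E r (Affine x1 y1) = Affine (poly A x1 / b) y1'"
       "point_mult E r (Affine x2 y2) = Affine (poly A x1 / b) y2'"
      using eq[OF P(1)] eq[OF P(2)] unfolding eqA by blast
    have "Affine (poly A x1 / b) y1' \<in> curve" "Affine (poly A x1 / b) y2' \<in> curve"
      using P y by (metis point_mult_closed)+
    hence "y1' = y2' \<or> y1' = - y2'" by (rule point_negI)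
    hence "point_mult E r (Affine x1 y1) = point_mult E r (Affine x2 y2) \<or>
      point_mult E r (Affine x1 y1) = point_mult E r (point_neg (Affine x2 y2))"
      unfolding point_mult_neg[OF P(2)] y by auto
    hence "Affine x1 y1 = Affine x2 y2 \<or> Affine x1 y1 = point_neg (Affine x2 y2)"
      using point_mult_injective[of r, OF free] P by (metis point_neg_closed)
    thus ?thesis by auto
  qed
  define c where "c = poly A 0"
  have lA: "lead_coeff A = 1" "degree A = r^2" using AB by (auto simp: division_polys_def)
  have "r^2 > 0" using r by simp
  hence less: "degree [:- c:] < degree A" using lA by simp
  have "A - [:c:] = monom 1 (degree (A - [:c:]))"
  proof (rule monic_unique_root)
    show "lead_coeff (A - [:c:]) = 1"
      using lead_coeff_add_le[OF less] lA by (simp add: diff_conv_add_uminus add.commute del: add_uminus_conv_diff)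
    show "x = 0" if "poly (A - [:c:]) x = 0" for x using inj[of x 0] that by (simp add: c_def)
  qed
  moreover have "degree (A - [:c:]) = r^2"
    using degree_add_eq_left[OF less] lA by (simp add: diff_conv_add_uminus del: add_uminus_conv_diff)
  ultimately have "A = monom 1 (r^2) + [:c:]" by (simp add: algebra_simps)
  hence A: "poly A x = x ^ r\<^sup>2 + c" for x by (simp add: poly_monom)
  show ?thesis
  proof (rule that[OF b0])
    show "inj (\<lambda>x::'a. x ^ r\<^sup>2)" using inj by (auto simp: A inj_on_def)
  qed (use eq A in auto)
qed

text \<open>Without \<open>r\<close>-torsion the map x -> x^(r^2) would be injective, yet it sends a
  nontrivial \<open>r\<close>-th root of unity to 1. Such a root exists because \<open>r\<close> is
  nonzero in the field.\<close>

lemma prime_torsion_ex: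
  assumes "prime r" "of_nat r \<noteq> (0::'a)"
  obtains P where "P \<in> curve" "P \<noteq> Infinity" "point_mult E r P = Infinity"
proof -
  have "\<exists>P \<in> curve. P \<noteq> Infinity \<and> point_mult E r P = Infinity"
  proof (rule ccontr)
    assume "\<not> ?thesis"
    hence free: "P = Infinity" if "P \<in> curve" "point_mult E r P = Infinity" for P using that by blast
    have r: "r > 0" "r > 1" using prime_gt_0_nat[OF assms(1)] prime_gt_1_nat[OF assms(1)] by auto
    obtain b c where "inj (\<lambda>x::'a. x ^ r\<^sup>2)" using torsion_free_mult[OF r(1) free] by metis
    moreover obtain z :: 'a where z: "z \<noteq> 1" "z ^ r = 1" using nontrivial_root_of_unity[OF r(2) assms(2)] by blast
    moreover have "z ^ r\<^sup>2 = 1 ^ r\<^sup>2" using z(2) by (simp add: power2_eq_square power_mult)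
    ultimately show False by (auto simp: inj_on_def)
  qed
  thus ?thesis using that by blast
qed

end

section \<open>Frobenius on curves over the algebraic closure of a prime field\<close>

locale finite_char_curve = short_weierstrass +
  assumes prime_CHAR: "prime CHAR('a)" and algebraic: "\<And>z::'a. \<exists>k>0. z ^ (CHAR('a) ^ k) = z"
begin

lemma odd_CHAR: "odd CHAR('a)"
proof
  assume "even CHAR('a)"
  hence "CHAR('a) = 2" using prime_CHAR by (metis primes_dvd_imp_eq two_is_prime_nat)
  thus False using of_nat_CHAR[where 'a = 'a] two_nonzero by simp
qed

end

lemma frob_minus: "odd N \<Longrightarrow> (- x :: 'a::field) ^ N = - (x ^ N)"
  by simp

context finite_char_curve begin

lemma power_add: "N = CHAR('a) ^ k \<Longrightarrow> (x + y :: 'a) ^ N = x ^ N + y ^ N"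
  by (rule freshmans_dream'[OF prime_CHAR])

lemma odd_power: "N = CHAR('a) ^ k \<Longrightarrow> odd N"
  using odd_CHAR by simp

lemma power_uminus: "N = CHAR('a) ^ k \<Longrightarrow> (- x :: 'a) ^ N = - (x ^ N)"
  using odd_power by simp

lemma power_diff: "N = CHAR('a) ^ k \<Longrightarrow> (x - y :: 'a) ^ N = x ^ N - y ^ N"
  using power_add[of N k x "- y"] power_uminus[of N k y] by simp

lemma power_eq_0: "N = CHAR('a) ^ k \<Longrightarrow> (x :: 'a) ^ N = 0 \<longleftrightarrow> x = 0"
  using odd_power by (metis odd_pos power_eq_0_iff)

lemma power_inj: "N = CHAR('a) ^ k \<Longrightarrow> (x :: 'a) ^ N = y ^ N \<longleftrightarrow> x = y"
  using power_diff[of N k x y] power_eq_0[of N k "x - y"] by (metis right_minus_eq)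

lemma power_numeral_GF:
  assumes N: "N = CHAR('a) ^ k"
  shows "(2::'a) ^ N = 2" "(3::'a) ^ N = 3"
proof -
  have "(1 + 1 :: 'a) ^ N = 1 + 1" unfolding power_add[OF N] by simp
  thus 2: "(2::'a) ^ N = 2" by simp
  have "(2 + 1 :: 'a) ^ N = 2 + 1" unfolding power_add[OF N] 2 by simp
  thus "(3::'a) ^ N = 3" by simp
qed

lemma GF_closed:
  assumes N: "N = CHAR('a) ^ k" and "x \<in> GF N" "(y::'a) \<in> GF N"
  shows "x + y \<in> GF N \<and> x - y \<in> GF N \<and> x * y \<in> GF N \<and> x / y \<in> GF N"
  using assms(2,3) power_add[OF N] power_diff[OF N] by (auto simp: GF_def power_mult_distrib power_divide)

lemma zero_in_GF: "N = CHAR('a) ^ k \<Longrightarrow> (0::'a) \<in> GF N"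
  using power_eq_0[of N k 0] by (simp add: GF_def)

lemma cubic_power:
  assumes N: "N = CHAR('a) ^ k" and E: "a2 E \<in> GF N" "a4 E \<in> GF N" "a6 E \<in> GF N"
  shows "cubic x ^ N = cubic (x ^ N)"
  unfolding cubic_def
  using E by (simp add: power_add[OF N] power_mult_distrib GF_def flip: power_mult) (simp add: mult.commute)

lemma frob_closed:
  assumes N: "N = CHAR('a) ^ k" and E: "a2 E \<in> GF N" "a4 E \<in> GF N" "a6 E \<in> GF N" and P: "P \<in> curve"
  shows "frob N P \<in> curve"
proof (cases P)
  case (Affine x y)
  have "cubic x ^ N = cubic (x ^ N)" by (rule cubic_power[OF N E])
  moreover have "y^2 = cubic x" using P Affine by (simp add: Affine_in_curve_iff)
  hence "(y ^ N)^2 = cubic x ^ N" by (metis mult.commute power_mult)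
  ultimately show ?thesis using Affine by (simp add: Affine_in_curve_iff)
qed simp

lemma frob_add:
  assumes N: "N = CHAR('a) ^ k" and E: "a2 E \<in> GF N" "a4 E \<in> GF N" "a6 E \<in> GF N"
  shows "frob N (P \<oplus>\<^sub>E Q) = frob N P \<oplus>\<^sub>E frob N Q"
proof (cases P; cases Q)
  fix x1 y1 x2 y2 assume PQ: "P = Affine x1 y1" "Q = Affine x2 y2"
  have sq: "(x^2)^N = (x^N)^2" for x :: 'a by (simp flip: power_mult add: mult.commute)
  have eqs: "x1 ^ N = x2 ^ N \<longleftrightarrow> x1 = x2" "y1 ^ N + y2 ^ N = 0 \<longleftrightarrow> y1 + y2 = 0"
    using power_inj[OF N] power_eq_0[OF N, of "y1 + y2"] power_add[OF N] by auto
  show ?thesis unfolding PQ using E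
    by (simp add: Let_def eqs GF_def power_add[OF N] power_diff[OF N] power_uminus[OF N]
       power_mult_distrib power_divide sq power_numeral_GF[OF N])
qed simp_all

lemma frob_point_mult:
  assumes N: "N = CHAR('a) ^ k" and E: "a2 E \<in> GF N" "a4 E \<in> GF N" "a6 E \<in> GF N"
  shows "frob N (point_mult E n P) = point_mult E n (frob N P)"
  by (induction n) (simp_all add: frob_add[OF assms])

lemma frob_neg:
  assumes N: "N = CHAR('a) ^ k"
  shows "frob N (point_neg P) = point_neg (frob N (P :: 'a point))"
  by (cases P) (simp_all add: power_uminus[OF N])

lemma frob_frob: "frob M (frob N P) = frob (M * N) P"
  by (cases P) (simp_all add: power_mult[symmetric] mult.commute)

lemma frob_Infinity_iff [simp]: "frob N P = Infinity \<longleftrightarrow> P = Infinity"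
  by (cases P) simp_all

lemma frob_fixed_iff: "P \<in> curve \<Longrightarrow> frob N P = P \<longleftrightarrow> P \<in> points E (GF N)"
  by (cases P) (auto simp: Affine_in_curve_iff GF_def)

text \<open>A group is not the union of two proper subgroups: if P violates one alternative and Q
  the other, then P + Q violates both.\<close>

lemma two_subgroups:
  assumes "\<And>P. P \<in> curve \<Longrightarrow> g P \<in> curve" "\<And>P. P \<in> curve \<Longrightarrow> h P \<in> curve"
    and hom: "\<And>P Q. P \<in> curve \<Longrightarrow> Q \<in> curve \<Longrightarrow> g (P \<oplus>\<^sub>E Q) = g P \<oplus>\<^sub>E g Q"
     "\<And>P Q. P \<in> curve \<Longrightarrow> Q \<in> curve \<Longrightarrow> h (P \<oplus>\<^sub>E Q) = h P \<oplus>\<^sub>E h Q"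
    and pm: "\<And>P. P \<in> curve \<Longrightarrow> g P = h P \<or> g P = point_neg (h P)"
  shows "(\<forall>P \<in> curve. g P = h P) \<or> (\<forall>P \<in> curve. g P = point_neg (h P))"
proof (rule ccontr)
  assume "\<not> ?thesis"
  then obtain P Q where P: "P \<in> curve" "g P \<noteq> h P" and Q: "Q \<in> curve" "g Q \<noteq> point_neg (h Q)" by blast
  have gP: "g P = point_neg (h P)" and gQ: "g Q = h Q" using pm P Q by auto
  note cl = assms(1,2)[OF P(1)] assms(1,2)[OF Q(1)]
  have PQ: "P \<oplus>\<^sub>E Q \<in> curve" using P Q by simp
  show False
  proof (cases "g (P \<oplus>\<^sub>E Q) = h (P \<oplus>\<^sub>E Q)")
    case True
    hence "g P \<oplus>\<^sub>E h Q = h P \<oplus>\<^sub>E h Q" using hom P Q gQ by simp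
    hence "h Q \<oplus>\<^sub>E g P = h Q \<oplus>\<^sub>E h P" using add_commute cl by simp
    hence "g P = h P" by (rule add_cancel_left[OF cl(4) cl(1) cl(2)])
    thus False using P by simp
  next
    case False
    hence "g (P \<oplus>\<^sub>E Q) = point_neg (h (P \<oplus>\<^sub>E Q))" using pm[OF PQ] by blast
    hence "point_neg (h P) \<oplus>\<^sub>E g Q = point_neg (h P) \<oplus>\<^sub>E point_neg (h Q)"
      using hom P Q gP cl by (simp add: point_neg_distrib)
    hence "g Q = point_neg (h Q)" using add_cancel_left[of "point_neg (h P)" "g Q" "point_neg (h Q)"] cl by simp
    thus False using Q by simp
  qed
qed

lemma two_torsion_CHAR:
  assumes "cubic e = 0"
  shows "point_mult E CHAR('a) (Affine e 0) = Affine e 0"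
proof -
  have P: "Affine e 0 \<in> curve" using assms by (simp add: Affine_in_curve_iff)
  have 2: "point_mult E 2 (Affine e 0) = Infinity" by (simp add: numeral_2_eq_2)
  obtain t where t: "CHAR('a) = 1 + t * 2" using odd_CHAR by (metis oddE mult.commute add.commute)
  show ?thesis unfolding t point_mult_add[OF P] point_mult_mult[OF P] 2 by simp
qed

text \<open>The two rational roots pin down the affine map left open in the previous lemma.\<close>

lemma torsion_free_abscissa:
  assumes N: "N = CHAR('a)^2"
    and free: "\<And>P. P \<in> curve \<Longrightarrow> point_mult E CHAR('a) P = Infinity \<Longrightarrow> P = Infinity"
    and roots: "e \<noteq> e'" "cubic e = 0" "cubic e' = 0" "e ^ N = e" "e' ^ N = e'"
    and P: "Affine x y \<in> curve"
  shows "\<exists>y'. point_mult E CHAR('a) (Affine x y) = Affine (x ^ N) y'"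
proof -
  let ?p = "CHAR('a)"
  have p0: "?p > 0" using prime_CHAR by (rule prime_gt_0_nat)
  obtain b c where b: "b \<noteq> 0"
    and mult: "\<And>x y. Affine x y \<in> curve \<Longrightarrow> \<exists>y'. point_mult E ?p (Affine x y) = Affine ((x ^ ?p\<^sup>2 + c) / b) y'"
    using torsion_free_mult[OF p0 free] by metis
  have affine_fix: "e + c = e * b" if "cubic e = 0" "e ^ N = e" for e
    using mult[of e 0] two_torsion_CHAR[OF that(1)] that N b by (auto simp: Affine_in_curve_iff field_simps)
  have "e - e' = (e + c) - (e' + c)" by simp
  also have "\<dots> = (e - e') * b" unfolding affine_fix[OF roots(2,4)] affine_fix[OF roots(3,5)] by (simp add: algebra_simps)
  finally have "e - e' = (e - e') * b" .
  hence b1: "b = 1" using roots(1) by simp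
  hence c0: "c = 0" using affine_fix[OF roots(2,4)] by simp
  show ?thesis using mult[OF P] by (simp add: b1 c0 N)
qed

text \<open>Equality of abscissae leaves a sign that might depend on the point. Both maps are
  homomorphisms, so \<open>two_subgroups\<close> makes the sign uniform.\<close>

lemma torsion_free_frob:
  assumes E: "a2 E \<in> GF N" "a4 E \<in> GF N" "a6 E \<in> GF N" and N: "N = CHAR('a)^2"
    and free: "\<And>P. P \<in> curve \<Longrightarrow> point_mult E CHAR('a) P = Infinity \<Longrightarrow> P = Infinity"
    and roots: "e \<noteq> e'" "cubic e = 0" "cubic e' = 0" "e ^ N = e" "e' ^ N = e'"
  shows "(\<forall>P \<in> curve. point_mult E CHAR('a) P = frob N P) \<or>
         (\<forall>P \<in> curve. point_mult E CHAR('a) P = point_neg (frob N P))"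
proof -
  let ?p = "CHAR('a)"
  have Nk: "N = ?p ^ 2" using N by simp
  have pm: "point_mult E ?p P = frob N P \<or> point_mult E ?p P = point_neg (frob N P)" if P: "P \<in> curve" for P
  proof (cases P)
    case (Affine x y)
    then obtain y' where y': "point_mult E ?p P = Affine (x ^ N) y'" using torsion_free_abscissa[OF N free roots] P by blast
    have "Affine (x ^ N) y' \<in> curve" using P y' by (metis point_mult_closed)
    moreover have "Affine (x ^ N) (y ^ N) \<in> curve" using frob_closed[OF Nk E P] Affine by simp
    ultimately have "y' = y ^ N \<or> y' = - (y ^ N)" by (rule point_negI)
    thus ?thesis using y' Affine by auto
  qed simp
  show ?thesis
    by (rule two_subgroups[OF _ _ _ _ pm])
       (use frob_closed[OF Nk E] frob_add[OF Nk E] point_mult_distrib in simp_all)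
qed

end


section \<open>Finite subfields, point counts and the Hasse invariant\<close>

lemma card_roots_separable:
  fixes p :: "'a::alg_closed_field poly"
  assumes "p \<noteq> 0" "\<And>a. poly p a = 0 \<Longrightarrow> poly (pderiv p) a \<noteq> 0"
  shows "card {a. poly p a = 0} = degree p"
  using assms
proof (induction "degree p" arbitrary: p)
  case 0
  then obtain c where "p = [:c:]" by (metis degree_eq_zeroE)
  thus ?case using 0 by simp
next
  case (Suc n)
  obtain a where a: "poly p a = 0" using alg_closed_imp_poly_has_root[of p] Suc.hyps(2) by auto
  then obtain q where q: "p = [:- a, 1:] * q" by (metis poly_eq_0_iff_dvd dvdE)
  have q0: "q \<noteq> 0" using Suc.prems(1) q by auto
  have deg: "degree p = Suc (degree q)" unfolding q using q0 by (subst degree_mult_eq) auto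
  have der: "poly (pderiv p) b = (b - a) * poly (pderiv q) b + poly q b" for b
    unfolding q pderiv_mult poly_add poly_mult by (simp add: pderiv_pCons algebra_simps)
  have qa: "poly q a \<noteq> 0" using Suc.prems(2)[OF a] der[of a] by simp
  have "poly (pderiv q) b \<noteq> 0" if "poly q b = 0" for b
    using Suc.prems(2)[of b] der[of b] that by (auto simp: q)
  hence IH: "card {b. poly q b = 0} = degree q" using Suc.hyps deg q0 by auto
  have "{b. poly p b = 0} = insert a {b. poly q b = 0}" unfolding q by (auto simp: algebra_simps)
  thus ?case using qa IH deg poly_roots_finite[OF q0] by simp
qed

context
  fixes N k :: nat
  assumes prime_char: "prime CHAR('a::alg_closed_field)" and N_def: "N = CHAR('a) ^ k" and k_pos: "k > 0"
begin

lemma GF_order_gt_1: "N > 1"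
  using prime_gt_1_nat[OF prime_char] k_pos unfolding N_def by (rule one_less_power)

lemma of_nat_GF_order: "of_nat N = (0::'a)"
  using k_pos unfolding N_def by simp

lemma card_GF: "card (GF N :: 'a set) = N" and finite_GF: "finite (GF N :: 'a set)"
proof -
  define h where "h = monom (1::'a) N - monom 1 1"
  have "coeff h N = 1" using GF_order_gt_1 by (simp add: h_def)
  hence h0: "h \<noteq> 0" by auto
  have "degree h \<le> N" unfolding h_def using GF_order_gt_1 
    by (intro degree_diff_le) (auto intro: order_trans[OF degree_monom_le])
  hence deg: "degree h = N" using \<open>coeff h N = 1\<close> by (metis le_antisym le_degree zero_neq_one)
  have roots: "{a. poly h a = 0} = GF N" by (auto simp: h_def poly_monom GF_def)
  have "pderiv h = - 1" 
    by (simp add: h_def pderiv_diff pderiv_monom of_nat_GF_order)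
  hence "card {a. poly h a = 0} = degree h" using h0 by (intro card_roots_separable) auto
  thus "card (GF N :: 'a set) = N" using deg roots by simp
  show "finite (GF N :: 'a set)" using poly_roots_finite[OF h0] roots by simp
qed

lemma GF_mult: "x \<in> GF N \<Longrightarrow> y \<in> GF N \<Longrightarrow> x * (y::'a) \<in> GF N"
  by (simp add: GF_def power_mult_distrib)

lemma power_GF_order: "x ^ N = (x::'a) * x ^ (N - 1)"
proof -
  have "N = Suc (N - 1)" using GF_order_gt_1 by simp
  hence "x ^ N = x ^ Suc (N - 1)" by (rule arg_cong)
  thus ?thesis unfolding power_Suc .
qed

lemma GF_power_eq_1: "x \<in> GF N \<Longrightarrow> x \<noteq> (0::'a) \<Longrightarrow> x ^ (N - 1) = 1"
  unfolding GF_def mem_Collect_eq power_GF_order by simp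

lemma power_eq_1_imp_GF: "x ^ (N - 1) = 1 \<Longrightarrow> (x::'a) \<in> GF N"
  unfolding GF_def mem_Collect_eq power_GF_order by simp

text \<open>If some unit z has z^i different from 1, the substitution x -> z x shows that the sum
  vanishes. In the given range this leaves i = 0 and i = N - 1. For i = 0 the element 0 contributes
  0^0 = 1, so the sum is N = 0; for i = N - 1 it contributes nothing.\<close>

lemma sum_powers_GF:
  assumes "i < 2 * (N - 1)"
  shows "(\<Sum>x\<in>GF N. (x::'a) ^ i) = (if i = N - 1 then - 1 else 0)"
proof -
  have z0: "0 \<in> (GF N :: 'a set)" using GF_order_gt_1 by (simp add: GF_def)
  consider "i = 0" | "i = N - 1" | j where "0 < j" "j < N - 1" "i = j \<or> i = j + (N - 1)"
  proof -
    have "i = 0 \<or> i = N - 1 \<or> (\<exists>j. 0 < j \<and> j < N - 1 \<and> (i = j \<or> i = j + (N - 1)))"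
    proof (cases "i < N - 1")
      case False
      hence "i = (i - (N - 1)) + (N - 1)" "i - (N - 1) < N - 1" using assms by auto
      thus ?thesis by (metis add_0 gr0I)
    qed auto
    thus ?thesis using that by blast
  qed
  thus ?thesis
  proof cases
    case 1
    thus ?thesis using GF_order_gt_1 by (simp add: card_GF of_nat_GF_order)
  next
    case 2
    have "(\<Sum>x\<in>GF N. (x::'a) ^ i) = (\<Sum>x\<in>GF N - {0}. x ^ i)"
      using 2 GF_order_gt_1 finite_GF by (intro sum.mono_neutral_right) auto
    also have "\<dots> = (\<Sum>x\<in>GF N - {0::'a}. 1)" by (rule sum.cong[OF refl]) (use 2 GF_power_eq_1 in auto)
    also have "\<dots> = of_nat (N - 1)" using z0 finite_GF by (simp add: card_GF)
    also have "\<dots> = - 1" using GF_order_gt_1 of_nat_GF_order by (simp add: of_nat_diff)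
    finally show ?thesis using 2 by simp
  next
    case (3 j)
    have "\<exists>z \<in> GF N - {0::'a}. z ^ j \<noteq> 1"
    proof (rule ccontr)
      assume "\<not> ?thesis"
      hence sub: "GF N - {0::'a} \<subseteq> {z. poly (monom 1 j - 1) z = 0}" by (auto simp: poly_monom)
      have nz: "monom (1::'a) j - 1 \<noteq> 0"
      proof
        assume "monom (1::'a) j - 1 = 0"
        hence "poly (monom (1::'a) j - 1) 0 = 0" by simp
        thus False using 3(1) by (simp add: poly_monom zero_power)
      qed
      have "degree (monom (1::'a) j - 1) \<le> j" by (intro degree_diff_le) (auto simp: degree_monom_le)
      hence "card {z. poly (monom (1::'a) j - 1) z = 0} \<le> j"
        using card_poly_roots_bound[OF nz] by linarith
      moreover have "card (GF N - {0::'a}) = N - 1" using z0 finite_GF by (simp add: card_GF)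
      ultimately show False using card_mono[OF poly_roots_finite[OF nz] sub] 3(2) by simp
    qed
    then obtain z :: 'a where z: "z \<in> GF N" "z \<noteq> 0" "z ^ j \<noteq> 1" by blast
    have zi: "z ^ i = z ^ j" using 3(3) GF_power_eq_1[OF z(1,2)] by (auto simp: power_add)
    have "z ^ i * (\<Sum>x\<in>GF N. x ^ i) = (\<Sum>x\<in>GF N. (z * x) ^ i)" by (simp add: sum_distrib_left power_mult_distrib)
    also have "\<dots> = (\<Sum>x\<in>GF N. x ^ i)"
    proof (rule sum.reindex_bij_witness[of _ "\<lambda>x. x / z" "\<lambda>x. z * x"])
      show "x / z \<in> GF N" if "x \<in> GF N" for x using that z(1) by (simp add: GF_def power_divide)
    qed (use z GF_mult in auto)
    finally have "(z ^ i - 1) * (\<Sum>x\<in>GF N. x ^ i) = 0" by (simp add: algebra_simps)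
    moreover have "i \<noteq> N - 1" using 3 by auto
    ultimately show ?thesis using z(3) zi by simp
  qed
qed

lemma sum_poly_GF:
  fixes h :: "'a poly"
  assumes "degree h < 2 * (N - 1)"
  shows "(\<Sum>x\<in>GF N. poly h x) = - coeff h (N - 1)"
proof -
  have "(\<Sum>x\<in>GF N. poly h x) = (\<Sum>i\<le>degree h. coeff h i * (\<Sum>x\<in>GF N. x ^ i))"
    by (simp add: poly_altdef sum_distrib_left) (rule sum.swap)
  also have "\<dots> = (\<Sum>i\<le>degree h. if i = N - 1 then - coeff h i else 0)"
    using assms by (intro sum.cong refl) (auto simp: sum_powers_GF)
  also have "\<dots> = - coeff h (N - 1)" by (auto simp: coeff_eq_0)
  finally show ?thesis .
qed

text \<open>Euler's criterion in counting form; the formula also holds for \<open>a = 0\<close>,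
  where there is one root and the power vanishes.\<close>

lemma card_sqrt_GF:
  assumes a: "(a::'a) \<in> GF N" and two: "(2::'a) \<noteq> 0"
  shows "of_nat (card {y \<in> GF N. y^2 = a}) = (1::'a) + a ^ ((N - 1) div 2)"
proof -
  have odd: "odd N"
  proof
    assume "even N"
    hence "even CHAR('a)" unfolding N_def by simp
    hence "CHAR('a) = 2" using prime_char by (metis primes_dvd_imp_eq two_is_prime_nat)
    thus False using of_nat_CHAR[where 'a = 'a] two by simp
  qed
  hence half: "2 * ((N - 1) div 2) = N - 1" by simp
  have h0: "(N - 1) div 2 > 0" using half GF_order_gt_1 by linarith
  show ?thesis
  proof (cases "a = 0")
    case True
    have "{y \<in> GF N. y^2 = a} = {0}" using True GF_order_gt_1 by (auto simp: GF_def)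
    thus ?thesis using True h0 by simp
  next
    case False
    obtain y where y: "y^2 = a" using nth_root_exists[of 2 a] by auto
    have "y \<noteq> - y"
    proof
      assume "y = - y"
      hence "y + y = 0" by (metis add.right_inverse)
      hence "2 * y = 0" unfolding mult_2 .
      thus False using two y False by simp
    qed
    have set: "{z. z^2 = a} = {y, - y}" using y by (auto simp: power2_eq_iff)
    have ya: "y ^ (N - 1) = a ^ ((N - 1) div 2)" using half y by (metis power_mult)
    show ?thesis
    proof (cases "y \<in> GF N")
      case True
      hence "- y \<in> GF N" using odd by (simp add: GF_def)
      hence "{y \<in> GF N. y^2 = a} = {y, - y}" using set True by auto
      moreover have "y ^ (N - 1) = 1" using True y False by (intro GF_power_eq_1) auto
      ultimately show ?thesis using ya \<open>y \<noteq> - y\<close> by simp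
    next
      case False2: False
      hence "- y \<notin> GF N" using odd by (simp add: GF_def)
      hence "{y \<in> GF N. y^2 = a} = {}" using set False2 by auto
      moreover have "(a ^ ((N - 1) div 2))^2 = 1"
        using GF_power_eq_1[OF a False] half by (metis mult.commute power_mult)
      hence "a ^ ((N - 1) div 2) = 1 \<or> a ^ ((N - 1) div 2) = - 1" by (simp add: power2_eq_1_iff)
      hence "a ^ ((N - 1) div 2) = - 1" using False2 power_eq_1_imp_GF ya by auto
      ultimately show ?thesis by (simp only: card.empty of_nat_0 add.right_inverse)
    qed
  qed
qed

end

context finite_char_curve begin

definition cubic_poly :: "'a poly" where
  "cubic_poly = [:a6 E, a4 E, a2 E, 1:]"

lemma poly_cubic_poly: "poly cubic_poly x = cubic x"
  by (simp add: cubic_poly_def cubic_def algebra_simps power2_eq_square power3_eq_cube)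

lemma degree_cubic_power: "degree (cubic_poly ^ n) = 3 * n"
  by (subst degree_power_eq) (auto simp: cubic_poly_def)

lemma finite_points: "N = CHAR('a) ^ k \<Longrightarrow> k > 0 \<Longrightarrow> finite (points E (GF N))"
proof -
  assume "N = CHAR('a) ^ k" "k > 0"
  hence "finite (GF N :: 'a set)" by (rule finite_GF[OF prime_CHAR])
  hence "finite (insert Infinity ((\<lambda>(x, y). Affine x y) ` (GF N \<times> GF N :: ('a \<times> 'a) set)))" by simp
  moreover have "points E (GF N) \<subseteq> insert Infinity ((\<lambda>(x, y). Affine x y) ` (GF N \<times> GF N))"
    by (auto simp: points_def)
  ultimately show ?thesis by (rule rev_finite_subset)
qed

lemma cubic_in_GF:
  assumes N: "N = CHAR('a) ^ k" and E: "a2 E \<in> GF N" "a4 E \<in> GF N" "a6 E \<in> GF N" and x: "x \<in> GF N"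
  shows "cubic x \<in> GF N"
  using cubic_power[OF N E, of x] x by (simp add: GF_def)

text \<open>Summing Euler's criterion over all abscissae gives a power sum of a polynomial of degree
  3 (N-1) / 2 < 2 (N-1), of which only the coefficient at N - 1 survives.\<close>

lemma card_points_poly:
  assumes N: "N = CHAR('a) ^ k" and k: "k > 0" and E: "a2 E \<in> GF N" "a4 E \<in> GF N" "a6 E \<in> GF N"
  shows "of_nat (card (points E (GF N))) = 1 - coeff (cubic_poly ^ ((N - 1) div 2)) (N - 1)"
proof -
  note c = prime_CHAR N k
  have fin: "finite (GF N :: 'a set)" by (rule finite_GF[OF c])
  let ?S = "\<lambda>x. {y \<in> GF N. y^2 = cubic x}"
  have fS: "finite (?S x)" for x using fin by simp
  define A where "A = (\<Union>x\<in>GF N. Affine x ` ?S x)"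
  have pts: "points E (GF N) = insert Infinity A"
    unfolding A_def by (auto simp: points_def cubic_def)
  have "card A = (\<Sum>x\<in>GF N. card (Affine x ` ?S x))"
    unfolding A_def using fin fS by (intro card_UN_disjoint) auto
  also have "\<dots> = (\<Sum>x\<in>GF N. card (?S x))" by (intro sum.cong card_image) (auto simp: inj_on_def)
  finally have cA: "card A = (\<Sum>x\<in>GF N. card (?S x))" .
  have "finite A" unfolding A_def using fin fS by auto
  moreover have "Infinity \<notin> A" unfolding A_def by auto
  ultimately have "card (points E (GF N)) = 1 + (\<Sum>x\<in>GF N. card (?S x))" unfolding pts using cA by simp
  hence "(of_nat (card (points E (GF N))) :: 'a) = 1 + (\<Sum>x\<in>GF N. of_nat (card (?S x)))" by simp
  also have "(\<Sum>x\<in>GF N. (of_nat (card (?S x)) :: 'a)) = (\<Sum>x\<in>GF N. 1 + poly (cubic_poly ^ ((N - 1) div 2)) x)"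
    by (intro sum.cong refl, subst card_sqrt_GF[OF c]) (auto simp: cubic_in_GF[OF N E] two_nonzero poly_cubic_poly)
  also have "\<dots> = of_nat N + (\<Sum>x\<in>GF N. poly (cubic_poly ^ ((N - 1) div 2)) x)"
    by (simp add: sum.distrib card_GF[OF c])
  also have "(\<Sum>x\<in>GF N. poly (cubic_poly ^ ((N - 1) div 2)) x) = - coeff (cubic_poly ^ ((N - 1) div 2)) (N - 1)"
  proof (rule sum_poly_GF[OF c])
    show "degree (cubic_poly ^ ((N - 1) div 2)) < 2 * (N - 1)"
      unfolding degree_cubic_power using GF_order_gt_1[OF c] by linarith
  qed
  finally show ?thesis using of_nat_GF_order[OF c] by simp
qed

definition hasse_invariant :: 'a where
  "hasse_invariant = coeff (cubic_poly ^ ((CHAR('a) - 1) div 2)) (CHAR('a) - 1)"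

lemma coeff_power_CHAR:
  fixes G :: "'a poly"
  shows "\<not> CHAR('a) dvd j \<Longrightarrow> coeff (G ^ CHAR('a)) j = 0"
proof -
  assume j: "\<not> CHAR('a) dvd j"
  have "G ^ CHAR('a) = (\<Sum>i\<le>degree G. monom (coeff G i) i) ^ CHAR('a)" by (simp add: poly_as_sum_of_monoms)
  also have "\<dots> = (\<Sum>i\<le>degree G. monom (coeff G i) i ^ CHAR('a))"
    by (rule freshmans_dream_sum) (simp_all add: prime_CHAR)
  also have "\<dots> = (\<Sum>i\<le>degree G. monom (coeff G i ^ CHAR('a)) (i * CHAR('a)))"
    by (simp add: monom_power)
  also have "coeff \<dots> j = 0" unfolding coeff_sum using j by (intro sum.neutral) auto
  finally show ?thesis .
qed

text \<open>Only the factor \<open>f ^ ((p - 1) / 2)\<close> of \<open>f ^ ((N - 1) / 2)\<close> can contribute to the coefficient of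
  \<open>x ^ (N - 1)\<close>, since the cofactor is a \<open>p\<close>-th power.\<close>

lemma hasse_invariant_zero:
  assumes H: "hasse_invariant = 0" and N: "N = CHAR('a) ^ k" and k: "k > 0"
  shows "coeff (cubic_poly ^ ((N - 1) div 2)) (N - 1) = 0"
proof -
  let ?p = "CHAR('a)"
  define M where "M = ?p ^ (k - 1)"
  have NM: "N = ?p * M" using k unfolding N M_def by (cases k) auto
  have oddM: "odd M" using odd_CHAR by (simp add: M_def)
  obtain s where s: "?p = 2 * s + 1" using odd_CHAR by (elim oddE)
  obtain t where t: "M = 2 * t + 1" using oddM by (elim oddE)
  have "(N - 1) div 2 = s + ?p * t" unfolding NM t by (subst (1 2) s) (simp add: algebra_simps)
  hence eq: "cubic_poly ^ ((N - 1) div 2) = cubic_poly ^ s * (cubic_poly ^ t) ^ ?p"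
    by (simp add: Power.power_add power_mult[symmetric] mult.commute)
  have "coeff (cubic_poly ^ s) i * coeff ((cubic_poly ^ t) ^ ?p) (N - 1 - i) = 0" if i: "i \<le> N - 1" for i
  proof (cases "?p dvd N - 1 - i")
    case False
    thus ?thesis by (simp add: coeff_power_CHAR)
  next
    case True
    have N1: "N \<ge> 1" using GF_order_gt_1[OF prime_CHAR N k] by simp
    hence "N - (N - 1 - i) = i + 1" using i by linarith
    hence "?p dvd i + 1" using True NM by (metis dvd_diff_nat dvd_triv_left)
    \<comment> \<open>For \<open>l = 1\<close> the factor is the Hasse invariant. For
      \<open>l\<close> at least 2 the index \<open>i\<close> exceeds the degree \<open>3 * s\<close>
      of \<open>cubic_poly ^ s\<close>.\<close>
    then obtain l where l: "i + 1 = ?p * l" by (elim dvdE)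
    show ?thesis
    proof (cases "l = 1")
      case True
      hence "i = ?p - 1" using l by simp
      moreover have "s = (?p - 1) div 2" using s by simp
      ultimately show ?thesis using H by (simp add: hasse_invariant_def)
    next
      case False
      hence "l \<ge> 2" using l by (cases l) auto
      hence "?p * 2 \<le> ?p * l" by (intro mult_le_mono2)
      hence "i > 3 * s" using l s by linarith
      thus ?thesis by (simp add: coeff_eq_0 degree_cubic_power)
    qed
  qed
  thus ?thesis unfolding eq coeff_mult by (intro sum.neutral ballI) simp
qed

lemma card_points_mod_CHAR:
  assumes H: "hasse_invariant = 0" and N: "N = CHAR('a) ^ k" and k: "k > 0"
    and E: "a2 E \<in> GF N" "a4 E \<in> GF N" "a6 E \<in> GF N"
  shows "of_nat (card (points E (GF N))) = (1::'a)"
  using card_points_poly[OF N k E] hasse_invariant_zero[OF H N k] by simp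

lemma GF_mono:
  assumes "k dvd n" and x: "x ^ (CHAR('a) ^ k) = (x::'a)"
  shows "x \<in> GF (CHAR('a) ^ n)"
proof -
  have "x ^ (CHAR('a) ^ (k * l)) = x" for l
  proof (induction l)
    case (Suc l)
    have "x ^ (CHAR('a) ^ (k * Suc l)) = (x ^ (CHAR('a) ^ k)) ^ (CHAR('a) ^ (k * l))"
      by (simp add: Power.power_add power_mult)
    thus ?case using Suc x by simp
  qed simp
  thus ?thesis using assms(1) by (auto simp: GF_def)
qed

text \<open>A point and the coefficients of the curve lie in a common finite subfield. A nonzero
  torsion point of order the characteristic would make the characteristic divide a number of points
  that is congruent to 1.\<close>

lemma no_CHAR_torsion:
  assumes H: "hasse_invariant = 0" and P: "P \<in> curve" "point_mult E CHAR('a) P = Infinity"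
  shows "P = Infinity"
proof (rule ccontr)
  assume P0: "P \<noteq> Infinity"
  then obtain x y where xy: "P = Affine x y" by (cases P) auto
  obtain k where k: "\<And>z. k z > 0" "\<And>z::'a. z ^ (CHAR('a) ^ k z) = z" using algebraic by metis
  define K where "K = k x * k y * k (a2 E) * k (a4 E) * k (a6 E)"
  define N where "N = CHAR('a) ^ K"
  have K: "K > 0" unfolding K_def using k(1) by simp
  have mem: "x \<in> GF N" "y \<in> GF N" "a2 E \<in> GF N" "a4 E \<in> GF N" "a6 E \<in> GF N"
    unfolding N_def by (rule GF_mono[OF _ k(2)], simp add: K_def)+
  have PK: "P \<in> points E (GF N)" using P(1) mem by (simp add: xy Affine_in_curve_iff)
  have "CHAR('a) dvd card (points E (GF N))"
    by (rule prime_dvd_card_points[OF zero_in_GF[OF N_def] GF_closed[OF N_def] mem(3,4) PK P0 P(2) prime_CHAR])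
  hence "(of_nat (card (points E (GF N))) :: 'a) = 0" by (simp add: of_nat_eq_0_iff_char_dvd)
  thus False using card_points_mod_CHAR[OF H N_def K mem(3-5)] by simp
qed

end


section \<open>Twists\<close>

text \<open>The image of the curve under \<open>scale_point c\<close>. Over the algebraic closure it
  is an isomorphic copy; over a finite field it is a twist in the usual sense when \<open>c\<close>
  lies outside that field.\<close>

definition twist :: "'k::field \<Rightarrow> 'k weierstrass \<Rightarrow> 'k weierstrass" where
  "twist c E = \<lparr>a1 = 0, a2 = c^2 * a2 E, a3 = 0, a4 = c^4 * a4 E, a6 = c^6 * a6 E\<rparr>"

lemma twist_simps [simp]:
  "a1 (twist c E) = 0" "a2 (twist c E) = c^2 * a2 E" "a3 (twist c E) = 0"
  "a4 (twist c E) = c^4 * a4 E" "a6 (twist c E) = c^6 * a6 E"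
  by (simp_all add: twist_def)

fun scale_point :: "'k::field \<Rightarrow> 'k point \<Rightarrow> 'k point" where
  "scale_point c Infinity = Infinity"
| "scale_point c (Affine x y) = Affine (c^2 * x) (c^3 * y)"

context short_weierstrass begin

lemma add_affine:
  assumes "\<not> (x1 = x2 \<and> y1 + y2 = 0)"
    and "(if x1 = x2 then (3 * x1^2 + 2 * a2 E * x1 + a4 E) / (2 * y1) else (y2 - y1) / (x2 - x1)) = m"
  shows "Affine x1 y1 \<oplus>\<^sub>E Affine x2 y2 = Affine (m^2 - a2 E - x1 - x2) (- (y1 + m * (m^2 - a2 E - x1 - x2 - x1)))"
  using assms(1) unfolding assms(2)[symmetric] by (auto simp: Let_def)

lemma discriminant_twist: "discriminant (twist c E) = c^12 * discriminant E"
  unfolding discriminant_def Let_def twist_simps a1_zero a3_zero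
  by (simp, Groebner_Basis.algebra)

lemma short_weierstrass_twist: "c \<noteq> 0 \<Longrightarrow> short_weierstrass (twist c E)"
  by unfold_locales (simp_all add: two_nonzero discriminant_twist nonsingular)

lemma scale_point_add:
  assumes c: "c \<noteq> 0"
  shows "scale_point c (P \<oplus>\<^sub>E Q) = point_add (twist c E) (scale_point c P) (scale_point c Q)"
proof (cases P; cases Q)
  fix x1 y1 x2 y2 assume PQ: "P = Affine x1 y1" "Q = Affine x2 y2"
  interpret T: short_weierstrass "twist c E" by (rule short_weierstrass_twist[OF c])
  have eq: "c^2 * x1 = c^2 * x2 \<longleftrightarrow> x1 = x2" "c^3 * y1 + c^3 * y2 = 0 \<longleftrightarrow> y1 + y2 = 0"
    using c by (simp_all flip: distrib_left)
  have slope: "(c^3 * y2 - c^3 * y1) / (c^2 * x2 - c^2 * x1) = c * ((y2 - y1) / (x2 - x1))"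
    using c by (simp flip: right_diff_distrib add: power3_eq_cube power2_eq_square)
  have num: "3 * (c^2 * x)^2 + 2 * (c^2 * a2 E) * (c^2 * x) + c^4 * a4 E = c^4 * (3 * x^2 + 2 * a2 E * x + a4 E)" for x
    by Groebner_Basis.algebra
  have tangent: "(c^4 * z) / (2 * (c^3 * y)) = c * (z / (2 * y))" for y z
    using c by (simp add: field_simps eval_nat_numeral)
  have X: "(c * m)^2 - c^2 * a2 E - c^2 * x1 - c^2 * x2 = c^2 * (m^2 - a2 E - x1 - x2)" for m
    by (simp add: algebra_simps power_mult_distrib)
  have Y: "- (c^3 * y1 + c * m * (c^2 * t - c^2 * x1)) = c^3 * (- (y1 + m * (t - x1)))" for m t
    by (simp add: algebra_simps power3_eq_cube power2_eq_square)
  show ?thesis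
  proof (cases "x1 = x2 \<and> y1 + y2 = 0")
    case True
    thus ?thesis by (simp add: PQ eq)
  next
    case False
    define m where "m = (if x1 = x2 then (3 * x1^2 + 2 * a2 E * x1 + a4 E) / (2 * y1) else (y2 - y1) / (x2 - x1))"
    have m': "(if c^2 * x1 = c^2 * x2 then (3 * (c^2 * x1)^2 + 2 * (c^2 * a2 E) * (c^2 * x1) + c^4 * a4 E) / (2 * (c^3 * y1))
       else (c^3 * y2 - c^3 * y1) / (c^2 * x2 - c^2 * x1)) = c * m"
      unfolding eq slope num tangent m_def by simp
    have "P \<oplus>\<^sub>E Q = Affine (m^2 - a2 E - x1 - x2) (- (y1 + m * (m^2 - a2 E - x1 - x2 - x1)))"
      unfolding PQ by (rule add_affine[OF False m_def[symmetric]])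
    moreover have "point_add (twist c E) (scale_point c P) (scale_point c Q)
       = Affine ((c * m)^2 - c^2 * a2 E - c^2 * x1 - c^2 * x2)
         (- (c^3 * y1 + c * m * ((c * m)^2 - c^2 * a2 E - c^2 * x1 - c^2 * x2 - c^2 * x1)))"
      unfolding PQ scale_point.simps
      by (rule T.add_affine[unfolded twist_simps, OF _ m']) (use False eq in simp)
    ultimately show ?thesis unfolding X Y by simp
  qed
qed simp_all

lemma scale_point_mult: "c \<noteq> 0 \<Longrightarrow> scale_point c (point_mult E n P) = point_mult (twist c E) n (scale_point c P)"
  by (induction n) (simp_all add: scale_point_add)

lemma scale_point_Infinity_iff [simp]: "scale_point c P = Infinity \<longleftrightarrow> P = Infinity"
  by (cases P) simp_all

lemma scale_point_in_twist:
  assumes "c \<noteq> 0"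
  shows "scale_point c P \<in> points (twist c E) UNIV \<longleftrightarrow> P \<in> curve"
proof (cases P)
  case (Affine x y)
  interpret T: short_weierstrass "twist c E" by (rule short_weierstrass_twist[OF assms])
  have "T.cubic (c^2 * x) = c^6 * cubic x"
    unfolding T.cubic_def cubic_def twist_simps by Groebner_Basis.algebra
  moreover have "(c^3 * y)^2 = c^6 * y^2" by Groebner_Basis.algebra
  ultimately show ?thesis using assms by (simp add: Affine Affine_in_curve_iff T.Affine_in_curve_iff)
qed (simp add: points_def)

lemma scale_point_surj:
  assumes "c \<noteq> 0"
  obtains P where "Q = scale_point c P"
proof (cases Q)
  case Infinity
  thus ?thesis using that[of Infinity] by simp
next
  case (Affine x y)
  thus ?thesis using that[of "Affine (x / c^2) (y / c^3)"] assms by simp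
qed

end

context finite_char_curve begin

lemma finite_char_curve_twist:
  assumes "c \<noteq> 0"
  shows "finite_char_curve (twist c E)"
proof -
  interpret T: short_weierstrass "twist c E" by (rule short_weierstrass_twist[OF assms])
  show ?thesis by unfold_locales (fact prime_CHAR algebraic)+
qed

text \<open>If the \<open>N\<close>-Frobenius acts on an \<open>r\<close>-torsion point as the automorphism \<open>scale_point z\<close>, then the
  twist by \<open>c\<close> with \<open>c ^ (N - 1) = 1 / z\<close> makes this point rational.\<close>

lemma twist_torsion:
  assumes N: "N = CHAR('a) ^ k" and k: "k > 0" and E: "a2 E \<in> GF N" "a4 E \<in> GF N" "a6 E \<in> GF N"
    and free: "\<And>P. P \<in> curve \<Longrightarrow> point_mult E CHAR('a) P = Infinity \<Longrightarrow> P = Infinity"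
    and P: "P \<in> curve" "P \<noteq> Infinity" "point_mult E r P = Infinity" and r: "prime r"
    and z: "z \<noteq> 0" "a2 E = 0 \<or> z^2 = 1" "a4 E = 0 \<or> z^4 = 1" "a6 E = 0 \<or> z^6 = 1"
    and frob: "frob N P = scale_point z P"
  shows "\<exists>E' :: 'a weierstrass. supersingular E' \<and> elliptic_curve N E' \<and> r dvd card (points E' (GF N))"
proof -
  have N1: "N > 1" by (rule GF_order_gt_1[OF prime_CHAR N k])
  obtain c where "c ^ (N - 1) = inverse z" using nth_root_exists[of "N - 1" "inverse z"] N1 by auto
  moreover have "c ^ N = c * c ^ (N - 1)" by (rule power_GF_order[OF prime_CHAR N k])
  ultimately have cN: "c ^ N = c / z" by (simp add: field_simps)
  have c0: "c \<noteq> 0"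
  proof
    assume "c = 0"
    hence "inverse z = 0" using \<open>c ^ (N - 1) = inverse z\<close> N1 by (simp add: zero_power)
    thus False using z(1) by simp
  qed
  interpret T: finite_char_curve "twist c E" by (rule finite_char_curve_twist[OF c0])
  have cNi: "(c ^ i) ^ N = c ^ i / z ^ i" for i
    using cN by (metis mult.commute power_divide power_mult)
  \<comment> \<open>Frobenius divides c^i by z^i, so the coefficient is fixed as soon as z^i = 1 or
    the coefficient is zero: exactly the condition that z scales the curve to itself.\<close>
  have coef: "c ^ i * a \<in> GF N" if "a \<in> GF N" "a = 0 \<or> z ^ i = 1" for a i
    using that cNi[of i] by (auto simp: GF_def power_mult_distrib)
  have E': "a2 (twist c E) \<in> GF N" "a4 (twist c E) \<in> GF N" "a6 (twist c E) \<in> GF N"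
    using coef E z by simp_all
  have zero: "(0::'a) \<in> GF N" by (rule zero_in_GF[OF N])
  have ell: "elliptic_curve N (twist c E)"
    unfolding elliptic_curve_def using N k E' zero T.nonsingular by auto
  have ss: "supersingular (twist c E)"
    unfolding supersingular_def
  proof (intro ballI impI)
    fix Q assume Q: "Q \<in> points (twist c E) UNIV" "point_mult (twist c E) CHAR('a) Q = Infinity"
    obtain P where P: "Q = scale_point c P" by (rule scale_point_surj[OF c0])
    have "P \<in> curve" using Q(1) unfolding P scale_point_in_twist[OF c0] .
    moreover have "point_mult E CHAR('a) P = Infinity"
      using Q(2) unfolding P scale_point_mult[OF c0, symmetric] by simp
    ultimately show "Q = Infinity" using free P by simp
  qed
  have "frob N (scale_point c P) = scale_point c P"
  proof (cases P)
    case (Affine x y)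
    have "x ^ N = z^2 * x" "y ^ N = z^3 * y" using frob Affine by auto
    thus ?thesis using z(1) by (simp add: Affine power_mult_distrib cNi)
  qed simp
  hence "scale_point c P \<in> points (twist c E) (GF N)"
    using T.frob_fixed_iff scale_point_in_twist[OF c0] P(1) by blast
  moreover have "point_mult (twist c E) r (scale_point c P) = Infinity"
    using P(3) scale_point_mult[OF c0, of r P] by simp
  ultimately have "r dvd card (points (twist c E) (GF N))"
    using P(2) by (intro T.prime_dvd_card_points[OF zero T.GF_closed[OF N] E'(1,2) _ _ _ r]) simp_all
  thus ?thesis using ell ss by blast
qed

end


section \<open>Curves over F_(p^2) with extra automorphisms\<close>

lemma scale_point_scale: "scale_point c (scale_point d P) = scale_point (c * d) P"
  by (cases P) (simp_all add: power_mult_distrib mult.assoc)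

lemma scale_point_1 [simp]: "scale_point 1 P = P"
  by (cases P) simp_all

lemma scale_point_minus: "scale_point (- c) P = point_neg (scale_point c P)"
  by (cases P) simp_all

lemma scale_point_neg: "scale_point c (point_neg P) = point_neg (scale_point c P)"
  by (cases P) simp_all

definition short_curve :: "'k::field \<Rightarrow> 'k \<Rightarrow> 'k \<Rightarrow> 'k weierstrass" where
  "short_curve a b c = \<lparr>a1 = 0, a2 = a, a3 = 0, a4 = b, a6 = c\<rparr>"

lemma short_curve_simps [simp]:
  "a1 (short_curve a b c) = 0" "a2 (short_curve a b c) = a" "a3 (short_curve a b c) = 0"
  "a4 (short_curve a b c) = b" "a6 (short_curve a b c) = c"
  by (simp_all add: short_curve_def)

context finite_char_curve begin

lemma torsion_free_frob_scale:
  assumes E: "a2 E \<in> GF N" "a4 E \<in> GF N" "a6 E \<in> GF N" and N: "N = CHAR('a)^2"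
    and free: "\<And>P. P \<in> curve \<Longrightarrow> point_mult E CHAR('a) P = Infinity \<Longrightarrow> P = Infinity"
    and roots: "e \<noteq> e'" "cubic e = 0" "cubic e' = 0" "e ^ N = e" "e' ^ N = e'"
  obtains s :: 'a where "s = 1 \<or> s = - 1" "\<And>P. P \<in> curve \<Longrightarrow> frob N P = scale_point s (point_mult E CHAR('a) P)"
proof -
  have "(\<forall>P \<in> curve. frob N P = scale_point 1 (point_mult E CHAR('a) P)) \<or>
        (\<forall>P \<in> curve. frob N P = scale_point (- 1) (point_mult E CHAR('a) P))"
    using torsion_free_frob[OF E N free roots] by (auto simp: scale_point_minus)
  thus ?thesis using that by blast
qed

lemma point_mult_torsion_cong:
  assumes "P \<in> curve" "point_mult E r P = Infinity" "[m = n] (mod r)"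
  shows "point_mult E m P = point_mult E n P"
proof -
  have reduce: "point_mult E k P = point_mult E (k mod r) P" for k
  proof -
    have "point_mult E k P = point_mult E (k mod r + k div r * r) P" by simp
    also have "\<dots> = point_mult E (k mod r) P"
      unfolding point_mult_add[OF assms(1)] point_mult_mult[OF assms(1)] assms(2) by simp
    finally show ?thesis .
  qed
  show ?thesis using reduce[of m] reduce[of n] assms(3) unfolding Cong.cong_def by (simp only:)
qed

lemma torsion_point_mult:
  assumes "P \<in> curve" "point_mult E r P = Infinity"
  shows "point_mult E r (point_mult E n P) = Infinity"
  by (metis assms mult.commute point_mult_mult point_mult_Infinity)

lemma point_mult_torsion_neg:
  assumes "P \<in> curve" "point_mult E r P = Infinity" "r dvd n + 1"
  shows "point_mult E n P = point_neg P"
proof -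
  have "point_mult E (n + 1) P = point_mult E 0 P"
    using assms by (intro point_mult_torsion_cong[OF assms(1,2)]) (simp add: cong_0_iff)
  hence "P \<oplus>\<^sub>E point_mult E n P = Infinity" by simp
  thus ?thesis using assms(1) by (intro point_neg_eqI) simp_all
qed

lemma hasse_no_torsion:
  "hasse_invariant = 0 \<Longrightarrow> P \<in> curve \<Longrightarrow> point_mult E CHAR('a) P = Infinity \<Longrightarrow> P = Infinity"
  by (rule no_CHAR_torsion)

text \<open>The hypotheses on z say that \<open>twist z E = E\<close>, so scaling by z is an
  automorphism of the curve.\<close>

lemma scale_automorphism_add:
  assumes "z \<noteq> 0" "a2 E = 0 \<or> z^2 = 1" "a4 E = 0 \<or> z^4 = 1" "a6 E = 0 \<or> z^6 = 1"
  shows "scale_point z (P \<oplus>\<^sub>E Q) = scale_point z P \<oplus>\<^sub>E scale_point z Q"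
    and "scale_point z (point_mult E n P) = point_mult E n (scale_point z P)"
    and "scale_point z P \<in> curve \<longleftrightarrow> P \<in> curve"
proof -
  have "twist z E = E" using assms by (cases E) (auto simp: twist_def, (metis a1_zero a3_zero weierstrass.simps)+)
  thus "scale_point z (P \<oplus>\<^sub>E Q) = scale_point z P \<oplus>\<^sub>E scale_point z Q"
    "scale_point z (point_mult E n P) = point_mult E n (scale_point z P)"
    "scale_point z P \<in> curve \<longleftrightarrow> P \<in> curve"
    using scale_point_add[OF assms(1)] scale_point_mult[OF assms(1)] scale_point_in_twist[OF assms(1)] by auto
qed

end

lemma coeff_power_multiples:
  fixes p :: "'a::comm_semiring_1 poly"
  assumes "\<And>i. \<not> d dvd i \<Longrightarrow> coeff p i = 0" "\<not> d dvd j"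
  shows "coeff (p ^ n) j = 0"
  using assms(2)
proof (induction n arbitrary: j)
  case (Suc n)
  have "coeff p i * coeff (p ^ n) (j - i) = 0" if "i \<le> j" for i
  proof (cases "d dvd i")
    case True
    hence "\<not> d dvd j - i" using Suc.prems that by (metis dvd_diffD)
    thus ?thesis using Suc.IH by simp
  qed (simp add: assms(1))
  thus ?case unfolding power_Suc coeff_mult by (intro sum.neutral ballI) simp
next
  case 0
  hence "j \<noteq> 0" by (metis dvd_0_right)
  thus ?case by simp
qed

lemma coeff_pCons_0_power:
  fixes p :: "'a::comm_semiring_1 poly"
  shows "coeff ((pCons 0 p) ^ m) (2 * m) = coeff (p ^ m) m"
proof -
  have "pCons 0 p = monom 1 1 * p" by (simp add: monom_Suc)
  hence "(pCons 0 p) ^ m = monom 1 m * p ^ m" by (simp add: power_mult_distrib monom_power)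
  thus ?thesis by (simp add: coeff_monom_mult)
qed

text \<open>The curve y^2 = x^3 - x has an automorphism i with i^2 = -1, and r | p^2 + 1 gives [p]^2
  = -1 on \<open>r\<close>-torsion. Thus ([p] - i)([p] + i) = 0 there, and either P itself or W = (i
  + [p]) P is a nonzero point on which [p] acts as -i or i. Frobenius then acts through an
  automorphism of order 4, which a quartic twist undoes. The Hasse invariant vanishes because f / x
  is a polynomial in x^2 while (p-1)/2 is odd.\<close>

lemma supersingular_curve_embedding_2:
  assumes p: "prime CHAR('a::alg_closed_field)" and alg: "\<And>z::'a. \<exists>k>0. z ^ (CHAR('a) ^ k) = z"
    and p3: "CHAR('a) mod 4 = 3" and r: "prime r" "of_nat r \<noteq> (0::'a)" "r dvd CHAR('a)^2 + 1"
  shows "\<exists>E :: 'a weierstrass. supersingular E \<and> elliptic_curve (CHAR('a)^2) E \<and> r dvd card (points E (GF (CHAR('a)^2)))"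
proof -
  let ?p = "CHAR('a)"
  have two: "(2::'a) \<noteq> 0"
  proof
    assume "(2::'a) = 0"
    hence "?p dvd 2" using of_nat_eq_0_iff_char_dvd[where 'a = 'a, of 2] by simp
    hence "?p \<le> 2" by (rule dvd_imp_le) simp
    thus False using p3 by simp
  qed
  define E where "E = short_curve 0 (- 1) (0::'a)"
  have "discriminant E = 2^6" by (simp add: E_def discriminant_def)
  hence disc: "discriminant E \<noteq> 0" using power_not_zero[OF two, of 6] by metis
  interpret finite_char_curve E
    by unfold_locales (fact p alg two disc | simp add: E_def)+
  obtain m where m: "?p = 2 * m + 1" "odd m"
  proof -
    have "?p = 4 * (?p div 4) + 3" using p3 by (metis mult_div_mod_eq)
    hence "?p = 2 * (2 * (?p div 4) + 1) + 1" by simp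
    thus ?thesis by (rule that) simp
  qed
  have "coeff ([:- 1, 0, 1:] ^ m) m = (0::'a)"
  proof (rule coeff_power_multiples[of 2])
    show "coeff [:- 1, 0, 1::'a:] i = 0" if "\<not> 2 dvd i" for i
      using that by (auto elim!: oddE simp: coeff_pCons split: nat.splits)
  qed (use m in simp)
  moreover have "cubic_poly = [:0, - 1, 0, 1:]" unfolding cubic_poly_def by (simp add: E_def)
  ultimately have H: "hasse_invariant = 0"
    unfolding hasse_invariant_def using m by (simp add: coeff_pCons_0_power)
  note free = no_CHAR_torsion[OF H]
  have cubic_E: "cubic x = x^3 - x" for x unfolding cubic_def by (simp add: E_def)
  define N where "N = ?p^2"
  have oddN: "odd N" using odd_CHAR by (simp add: N_def)
  have coef: "a2 E \<in> GF N" "a4 E \<in> GF N" "a6 E \<in> GF N"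
    using oddN by (auto simp: E_def GF_def odd_pos)
  have N0: "N > 0" using oddN by (rule odd_pos)
  obtain s where s: "s = 1 \<or> s = - 1" "\<And>P. P \<in> curve \<Longrightarrow> frob N P = scale_point s (point_mult E ?p P)"
    by (rule torsion_free_frob_scale[OF coef N_def free, of 0 1])
       (use N0 in \<open>auto simp: cubic_E\<close>)
  obtain i :: 'a where i: "i^2 = - 1" using nth_root_exists[of 2 "- 1"] by auto
  have i0: "i \<noteq> 0" using i by auto
  have i4: "i^4 = 1" using i by (metis (no_types) mult_2 numeral_Bit0 Power.power_add mult_minus1 minus_minus)
  have aut: "a2 E = 0 \<or> i^2 = 1" "a4 E = 0 \<or> i^4 = 1" "a6 E = 0 \<or> i^6 = 1" using i4 by (simp_all add: E_def)
  note hom = scale_automorphism_add[OF i0 aut]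
  have ii: "scale_point i (scale_point i P) = point_neg P" for P
    using i by (simp add: scale_point_scale scale_point_minus power2_eq_square[symmetric])
  have finish: ?thesis if P: "P \<in> curve" "P \<noteq> Infinity" "point_mult E r P = Infinity"
    and t: "point_mult E ?p P = scale_point t P" "t = i \<or> t = - i" for P t
  proof -
    have st: "(s * t)^4 = 1" using s(1) t(2) i4 by auto
    hence "s * t \<noteq> 0" by auto
    moreover have "frob N P = scale_point (s * t) P" using s(2)[OF P(1)] t(1) by (simp add: scale_point_scale)
    ultimately show ?thesis unfolding N_def[symmetric] using st
      by (intro twist_torsion[OF N_def _ coef free P r(1), of "s * t"]) (auto simp: E_def)
  qed
  obtain P where P: "P \<in> curve" "P \<noteq> Infinity" "point_mult E r P = Infinity"
    by (rule prime_torsion_ex[OF r(1,2)])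
  have p2: "point_mult E ?p (point_mult E ?p P) = point_neg P"
    using point_mult_torsion_neg[OF P(1,3) r(3)] by (simp add: power2_eq_square point_mult_mult P(1))
  define W where "W = point_add E (scale_point i P) (point_mult E ?p P)"
  have c: "scale_point i P \<in> curve" "point_mult E ?p P \<in> curve" "W \<in> curve"
    unfolding W_def using P(1) hom(3) by simp_all
  show ?thesis
  proof (cases "W = Infinity")
    case True
    hence "point_mult E ?p P = point_neg (scale_point i P)" using c by (intro point_neg_eqI) (simp_all add: W_def)
    thus ?thesis using finish[OF P, of "- i"] by (simp add: scale_point_minus)
  next
    case False
    have "scale_point i W = point_add E (point_neg P) (scale_point i (point_mult E ?p P))" by (simp add: W_def hom(1) ii)
    also have "\<dots> = point_add E (scale_point i (point_mult E ?p P)) (point_neg P)"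
      using P(1) c hom(3) by (intro add_commute) simp_all
    also have "\<dots> = point_mult E ?p W" unfolding W_def point_mult_distrib[OF c(1,2)] p2 by (simp add: hom(2))
    finally have "point_mult E ?p W = scale_point i W" ..
    moreover have "point_mult E r W = Infinity"
      unfolding W_def point_mult_distrib[OF c(1,2)]
      using torsion_point_mult[OF P(1,3)] P(3) by (simp flip: hom(2))
    ultimately show ?thesis using finish[OF c(3) False] by blast
  qed
qed


lemma two_nonzero_of_odd_CHAR:
  assumes "odd CHAR('a::field)"
  shows "(2::'a) \<noteq> 0"
proof
  assume "(2::'a) = 0"
  hence "CHAR('a) dvd 2" using of_nat_eq_0_iff_char_dvd[where 'a = 'a, of 2] by simp
  hence "CHAR('a) \<le> 2" by (rule dvd_imp_le) simp
  moreover have "CHAR('a) > 0" "CHAR('a) \<noteq> 2" using odd_pos[OF assms] assms by (auto intro: notI)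
  ultimately have "CHAR('a) = 1" by linarith
  thus False using CHAR_not_1[where 'a = 'a] by simp
qed

text \<open>On y^2 = x^3 + 1 an automorphism \<omega> of order 3 satisfies \<omega>^2 + \<omega> + 1
  = 0, so -\<omega> and -\<omega>^2 are roots of T^2 - T + 1. On \<open>r\<close>-torsion [p]
  satisfies the same equation, hence ([p] + \<omega>)([p] + \<omega>^2) = 0 and some nonzero point
  is an eigenvector of [p]. A sextic twist makes it rational. The Hasse invariant vanishes because 3
  does not divide p - 1.\<close>

lemma supersingular_curve_embedding_3:
  assumes p: "prime CHAR('a::alg_closed_field)" "odd CHAR('a)"
    and alg: "\<And>z::'a. \<exists>k>0. z ^ (CHAR('a) ^ k) = z"
    and p3: "CHAR('a) mod 3 = 2" and r: "prime r" "of_nat r \<noteq> (0::'a)" "[CHAR('a)^2 + 1 = CHAR('a)] (mod r)"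
  shows "\<exists>E :: 'a weierstrass. supersingular E \<and> elliptic_curve (CHAR('a)^2) E \<and> r dvd card (points E (GF (CHAR('a)^2)))"
proof -
  let ?p = "CHAR('a)"
  have two: "(2::'a) \<noteq> 0" by (rule two_nonzero_of_odd_CHAR[OF p(2)])
  have three: "(3::'a) \<noteq> 0"
  proof
    assume "(3::'a) = 0"
    hence "?p dvd 3" using of_nat_eq_0_iff_char_dvd[where 'a = 'a, of 3] by simp
    hence "?p \<le> 3" by (rule dvd_imp_le) simp
    thus False using p3 p(2) by presburger
  qed
  define E where "E = short_curve 0 0 (1::'a)"
  have "discriminant E = - (2^4 * 3^3)" by (simp add: E_def discriminant_def)
  hence disc: "discriminant E \<noteq> 0" using power_not_zero[OF two, of 4] power_not_zero[OF three, of 3]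
    by (metis mult_eq_0_iff neg_equal_0_iff_equal)
  interpret finite_char_curve E
    by unfold_locales (fact p alg two disc | simp add: E_def)+
  have "coeff ([:1, 0, 0, 1:] ^ ((?p - 1) div 2)) (?p - 1) = (0::'a)"
  proof (rule coeff_power_multiples[of 3])
    show "coeff [:1, 0, 0, 1::'a:] i = 0" if "\<not> 3 dvd i" for i
    proof -
      have "i \<noteq> 0" "i \<noteq> 3" using that by (metis dvd_0_right, metis dvd_refl)
      thus ?thesis by (auto simp: coeff_pCons eval_nat_numeral split: nat.splits)
    qed
    show "\<not> 3 dvd ?p - 1" using p3 by presburger
  qed
  moreover have "cubic_poly = [:1, 0, 0, 1:]" unfolding cubic_poly_def by (simp add: E_def)
  ultimately have H: "hasse_invariant = 0" unfolding hasse_invariant_def by simp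
  note free = no_CHAR_torsion[OF H]
  have cubic_E: "cubic x = x^3 + 1" for x unfolding cubic_def by (simp add: E_def)
  define N where "N = ?p^2"
  have oddN: "odd N" using p(2) by (simp add: N_def)
  have N0: "N > 0" using oddN by (rule odd_pos)
  have coef: "a2 E \<in> GF N" "a4 E \<in> GF N" "a6 E \<in> GF N" using N0 by (auto simp: E_def GF_def)
  obtain w :: 'a where w: "w \<noteq> 1" "w^3 = 1"
    by (rule nontrivial_root_of_unity[of 3]) (use three in auto)
  have wN: "w ^ N = w"
  proof -
    have "?p = 3 * (?p div 3) + 2" using p3 by (metis mult_div_mod_eq)
    then obtain t where "?p = 3 * t + 2" by blast
    hence "N = 3 * (3 * t^2 + 4 * t + 1) + 1" by (simp add: N_def power2_eq_square algebra_simps)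
    hence "w ^ N = (w ^ 3) ^ (3 * t^2 + 4 * t + 1) * w" by (simp only: Power.power_add power_mult power_one_right)
    thus ?thesis using w(2) by simp
  qed
  have w0: "w \<noteq> 0" using w by auto
  have w6: "w^6 = 1" using w(2) power_mult[of w 3 2] by simp
  have w2: "w^2 + w + 1 = 0"
  proof -
    have "(w - 1) * (w^2 + w + 1) = 0" using w(2) by (simp add: algebra_simps power2_eq_square power3_eq_cube)
    thus ?thesis using w(1) by simp
  qed
  obtain s where s: "s = 1 \<or> s = - 1" "\<And>P. P \<in> curve \<Longrightarrow> frob N P = scale_point s (point_mult E ?p P)"
  proof (rule torsion_free_frob_scale[OF coef N_def free, of "- 1" "- w"])
    show "cubic (- w) = 0" using w(2) by (simp add: cubic_E power3_eq_cube)
  qed (use w wN oddN in \<open>auto simp: cubic_E\<close>)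
  have aut: "a2 E = 0 \<or> w^2 = 1" "a4 E = 0 \<or> w^4 = 1" "a6 E = 0 \<or> w^6 = 1" using w6 by (simp_all add: E_def)
  note hom = scale_automorphism_add[OF w0 aut]
  let ?u = "scale_point w"
  \<comment> \<open>The three points P, \<omega> P and \<omega>^2 P have the same ordinate: they lie
    on a horizontal line, so their sum is zero.\<close>
  have sum: "point_add E P (point_add E (?u P) (?u (?u P))) = Infinity" if P: "P \<in> curve" for P
  proof (cases P)
    case (Affine x y)
    have y2: "y^2 = x^3 + 1" using P Affine by (simp add: Affine_in_curve_iff cubic_E)
    have u: "?u P = Affine (w^2 * x) y" "?u (?u P) = Affine (w * x) y"
    proof -
      show "?u P = Affine (w^2 * x) y" using w(2) Affine by simp
      have "w^2 * w^2 = w" using w(2) by (metis mult.assoc mult.right_neutral power2_eq_square power3_eq_cube mult.commute)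
      thus "?u (?u P) = Affine (w * x) y" using w(2) Affine by (simp flip: mult.assoc)
    qed
    have "point_add E (?u P) (?u (?u P)) = Affine x (- y)"
    proof (cases "x = 0")
      case True
      have "y \<noteq> 0" using y2 True by auto
      hence "y + y \<noteq> 0" using two by (simp flip: mult_2)
      thus ?thesis unfolding u(2) unfolding u(1) using True by (simp add: Let_def E_def)
    next
      case False
      have "w * (w - 1) \<noteq> 0" using w(1) w0 by simp
      hence "w^2 * x \<noteq> w * x" using False by (simp add: algebra_simps power2_eq_square)
      hence "point_add E (?u P) (?u (?u P)) = Affine (- (w^2 * x) - w * x) (- y)"
        unfolding u(2) unfolding u(1) by (simp add: Let_def E_def)
      also have "- (w^2 * x) - w * x = x" using w2 by Groebner_Basis.algebra
      finally show ?thesis .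
    qed
    thus ?thesis by (simp add: Affine)
  qed simp
  have finish: ?thesis if P: "P \<in> curve" "P \<noteq> Infinity" "point_mult E r P = Infinity"
    and t: "point_mult E ?p P = scale_point t P" "t^6 = 1" for P t
  proof -
    have st: "(s * t)^6 = 1" using s(1) t(2) by auto
    hence "s * t \<noteq> 0" by auto
    moreover have "frob N P = scale_point (s * t) P" using s(2)[OF P(1)] t(1) by (simp add: scale_point_scale)
    ultimately show ?thesis unfolding N_def[symmetric] using st
      by (intro twist_torsion[OF N_def _ coef free P r(1), of "s * t"]) (auto simp: E_def)
  qed
  obtain P where P: "P \<in> curve" "P \<noteq> Infinity" "point_mult E r P = Infinity"
    by (rule prime_torsion_ex[OF r(1,2)])
  define P1 where "P1 = ?u P" define P2 where "P2 = ?u P1"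
  have c: "P1 \<in> curve" "P2 \<in> curve" unfolding P1_def P2_def using P(1) hom(3) by simp_all
  have u2: "?u P2 = P" unfolding P1_def P2_def scale_point_scale using w(2) by (simp add: power3_eq_cube mult.assoc)
  have tor: "point_mult E r P1 = Infinity" "point_mult E r P2 = Infinity"
    unfolding P2_def P1_def using P(3) by (simp_all flip: hom(2))
  have trace: "point_add E Q (point_mult E (?p^2) Q) = point_mult E ?p Q"
    if "Q \<in> curve" "point_mult E r Q = Infinity" for Q
    using point_mult_torsion_cong[OF that r(3)] by simp
  have P2: "point_neg P2 = point_add E P P1"
    using sum[OF P(1)] P(1) c by (simp add: P1_def[symmetric] P2_def[symmetric] add_assoc[symmetric] )
      (metis add_closed point_neg_eqI point_neg_neg)
  \<comment> \<open>On \<open>r\<close>-torsion p^2 = p - 1, so W = (\<omega> + 1 - p) P = -([p] +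
    \<omega>^2) P, which is annihilated by [p] + \<omega>. If W is zero, then [p] P = -\<omega>^2 P
    already.\<close>
  define W where "W = point_add E P1 (point_neg (point_mult E (?p^2) P))"
  have Wc: "W \<in> curve" unfolding W_def using c P(1) by simp
  show ?thesis
  proof (cases "W = Infinity")
    case True
    have "point_neg (point_mult E (?p^2) P) = point_neg P1"
      using True c P(1) by (intro point_neg_eqI) (simp_all add: W_def)
    hence "point_mult E (?p^2) P = P1" by (metis point_neg_neg)
    hence "point_mult E ?p P = point_neg P2" using trace[OF P(1,3)] P2 by simp
    also have "\<dots> = scale_point (- (w * w)) P" by (simp add: P2_def P1_def scale_point_scale scale_point_minus)
    finally show ?thesis using finish[OF P] w6
      by (metis (no_types) power_even_eq even_numeral power_minus_even power_mult_distrib mult_1 power2_eq_square)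
  next
    case False
    have p3P: "point_mult E ?p (point_mult E (?p^2) P) = point_neg P"
    proof -
      have Q: "point_mult E ?p P \<in> curve" "point_mult E r (point_mult E ?p P) = Infinity"
        using P torsion_point_mult by simp_all
      have "point_add E (point_mult E ?p P) (point_mult E ?p (point_mult E (?p^2) P)) = point_mult E ?p (point_mult E ?p P)"
        using trace[OF Q] P(1) by (metis mult.commute point_mult_mult)
      also have "\<dots> = point_mult E (?p^2) P" using P(1) by (simp add: power2_eq_square point_mult_mult)
      finally have 1: "point_add E (point_mult E ?p P) (point_mult E ?p (point_mult E (?p^2) P)) = point_mult E (?p^2) P" .
      have "point_add E (point_mult E (?p^2) P) (point_add E P (point_mult E ?p (point_mult E (?p^2) P)))
         = point_add E (point_add E P (point_mult E (?p^2) P)) (point_mult E ?p (point_mult E (?p^2) P))"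
        using P(1) by (simp add: add_assoc add_left_commute)
      also have "\<dots> = point_add E (point_mult E (?p^2) P) Infinity" unfolding trace[OF P(1,3)] 1 by simp
      finally have "point_add E P (point_mult E ?p (point_mult E (?p^2) P)) = Infinity"
        by (rule add_cancel_left[rotated 3]) (use P(1) in simp_all)
      thus ?thesis using P(1) by (intro point_neg_eqI) simp_all
    qed
    have "?u W = point_add E P2 (point_neg (point_mult E (?p^2) P1))"
      unfolding W_def hom(1) scale_point_neg hom(2) P2_def P1_def ..
    hence "point_neg (?u W) = point_add E (point_add E P P1) (point_mult E (?p^2) P1)"
      using c by (simp add: point_neg_distrib P2)
    also have "\<dots> = point_add E P (point_mult E ?p P1)" using c P(1) trace[OF c(1) tor(1)] by (simp add: add_assoc)
    also have "\<dots> = point_add E (point_mult E ?p P1) P" using c P(1) by (intro add_commute) simp_all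
    also have "\<dots> = point_mult E ?p W" unfolding W_def using c P(1) p3P by (simp add: point_mult_distrib point_mult_neg)
    finally have "point_mult E ?p W = scale_point (- w) W" by (simp add: scale_point_minus)
    moreover have "point_mult E r W = Infinity"
      unfolding W_def using c P tor torsion_point_mult[OF P(1,3)] by (simp add: point_mult_distrib point_mult_neg)
    ultimately show ?thesis using finish[OF Wc False] w6 by simp
  qed
qed


section \<open>Supersingular Legendre curves and the field with p^4 elements\<close>

lemma coeff_linear_factor_power:
  "coeff ([:c, 1:] ^ m) j = of_nat (m choose j) * (c::'a::comm_ring_1) ^ (m - j)" if "j \<le> m"
  using coeff_linear_poly_power[of j m c 1] that by simp

text \<open>The cubic is x (x - 1)(x - l), and multiplying the binomial expansions of the last two
  factors gives, up to sign, Deuring's polynomial in l.\<close>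

lemma legendre_coeff:
  fixes l :: "'a::comm_ring_1"
  shows "coeff ([:0, l, - (1 + l), 1:] ^ m) (2 * m) = (-1) ^ m * (\<Sum>i\<le>m. of_nat ((m choose i)^2) * l ^ i)"
proof -
  have "coeff ([:0, l, - (1 + l), 1:] ^ m) (2 * m) = coeff ([:l, - (1 + l), 1:] ^ m) m"
    by (rule coeff_pCons_0_power)
  also have "\<dots> = coeff (([:- 1, 1:] * [:- l, 1:]) ^ m) m" by (simp add: algebra_simps)
  also have "\<dots> = (\<Sum>i\<le>m. coeff ([:- 1, 1:] ^ m) i * coeff ([:- l, 1:] ^ m) (m - i))"
    by (simp only: power_mult_distrib coeff_mult)
  also have "\<dots> = (\<Sum>i\<le>m. (-1) ^ m * (of_nat ((m choose i)^2) * l ^ i))"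
  proof (intro sum.cong refl)
    fix i assume "i \<in> {..m}"
    hence i: "i \<le> m" by simp
    have "(- 1) ^ (m - i) * (- l) ^ i = (- 1) ^ (m - i) * (- 1) ^ i * l ^ i" by (simp add: power_minus[of l])
    also have "(- 1 :: 'a) ^ (m - i) * (- 1) ^ i = (- 1) ^ m" using i by (simp flip: Power.power_add)
    finally have sgn: "(- 1) ^ (m - i) * (- l) ^ i = (- 1) ^ m * l ^ i" .
    have "coeff ([:- 1, 1:] ^ m) i * coeff ([:- l, 1:] ^ m) (m - i)
        = of_nat ((m choose i)^2) * ((- 1) ^ (m - i) * (- l) ^ i)"
      using i by (simp add: coeff_linear_factor_power binomial_symmetric[of i m] power2_eq_square mult_ac)
    thus "coeff ([:- 1, 1:] ^ m) i * coeff ([:- l, 1:] ^ m) (m - i) = (-1) ^ m * (of_nat ((m choose i)^2) * l ^ i)"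
      unfolding sgn by (simp add: mult_ac)
  qed
  finally show ?thesis unfolding sum_distrib_left .
qed

lemma central_binomial_nonzero:
  assumes "prime p" "p = 2 * m + 1"
  shows "\<not> p dvd (2 * m choose m)"
proof
  assume "p dvd (2 * m choose m)"
  hence "p dvd (fact (2 * m) :: nat)"
    by (metis binomial_fact_lemma dvd_mult le_add1 mult_2)
  thus False using assms by (simp add: prime_dvd_fact_iff)
qed

text \<open>Deuring's polynomial is monic of positive degree m, so it has a root. Its value at 0 is
  1, and at 1 it is the central binomial coefficient of 2m, prime to p = 2m + 1; so the root defines
  a nonsingular curve.\<close>

lemma supersingular_legendre:
  assumes p: "prime CHAR('a::alg_closed_field)" "odd CHAR('a)"
  obtains l :: "'a::alg_closed_field" where "l \<noteq> 0" "l \<noteq> 1"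
    "coeff ([:0, l, - (1 + l), 1:] ^ ((CHAR('a) - 1) div 2)) (CHAR('a) - 1) = 0"
proof -
  obtain m where m: "CHAR('a) = 2 * m + 1" using p(2) by (elim oddE)
  have m0: "m > 0" using m prime_gt_1_nat[OF p(1)] by simp
  define h :: "'a poly" where "h = (\<Sum>i\<le>m. monom (of_nat ((m choose i)^2)) i)"
  have ph: "poly h x = (\<Sum>i\<le>m. of_nat ((m choose i)^2) * x ^ i)" for x
    by (simp add: h_def poly_sum poly_monom)
  have "coeff h m = 1" by (simp add: h_def coeff_sum)
  hence "degree h \<ge> m" by (intro le_degree) simp
  then obtain l where l: "poly h l = 0" using alg_closed_imp_poly_has_root[of h] m0 by auto
  have "l \<noteq> 0"
  proof
    assume "l = 0"
    hence "(\<Sum>i\<le>m. if i = 0 then 1 else 0 :: 'a) = 0"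
      using l unfolding ph by (simp add: power_0_left if_distrib cong: if_cong sum.cong)
    thus False by simp
  qed
  moreover have "l \<noteq> 1"
  proof
    assume "l = 1"
    hence "of_nat (\<Sum>i\<le>m. (m choose i)^2) = (0::'a)" using l unfolding ph by simp
    hence "CHAR('a) dvd (2 * m choose m)" unfolding choose_square_sum by (simp add: of_nat_eq_0_iff_char_dvd)
    thus False using central_binomial_nonzero[OF p(1) m] by simp
  qed
  moreover have "coeff ([:0, l, - (1 + l), 1:] ^ m) (2 * m) = 0"
    using l unfolding legendre_coeff ph by simp
  ultimately show ?thesis using that m by simp
qed

text \<open>The p^4-Frobenius is the square of [p] or -[p], so on \<open>r\<close>-torsion it equals
  [p^2] = -1 whatever the sign. A quadratic twist makes every such point rational.\<close>

lemma supersingular_curve_embedding_1: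
  assumes p: "prime CHAR('a::alg_closed_field)" "odd CHAR('a)"
    and alg: "\<And>z::'a. \<exists>k>0. z ^ (CHAR('a) ^ k) = z"
    and r: "prime r" "of_nat r \<noteq> (0::'a)" "r dvd CHAR('a)^2 + 1"
  shows "\<exists>E :: 'a weierstrass. supersingular E \<and> elliptic_curve (CHAR('a)^4) E \<and> r dvd card (points E (GF (CHAR('a)^4)))"
proof -
  let ?p = "CHAR('a)"
  have two: "(2::'a) \<noteq> 0" by (rule two_nonzero_of_odd_CHAR[OF p(2)])
  obtain l :: 'a where l: "l \<noteq> 0" "l \<noteq> 1" and H0: "coeff ([:0, l, - (1 + l), 1:] ^ ((?p - 1) div 2)) (?p - 1) = 0"
    by (rule supersingular_legendre[OF p])
  define E where "E = short_curve (- (1 + l)) l (0::'a)"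
  have "discriminant E = 2^4 * (l^2 * (l - 1)^2)"
    unfolding discriminant_def E_def Let_def short_curve_simps by (simp, Groebner_Basis.algebra)
  hence disc: "discriminant E \<noteq> 0" using power_not_zero[OF two, of 4] l by simp
  interpret finite_char_curve E
    by unfold_locales (fact p alg two disc | simp add: E_def)+
  have "cubic_poly = [:0, l, - (1 + l), 1:]" unfolding cubic_poly_def by (simp add: E_def)
  hence H: "hasse_invariant = 0" unfolding hasse_invariant_def using H0 by simp
  note free = no_CHAR_torsion[OF H]
  have cubic_E: "cubic x = x * (x - 1) * (x - l)" for x
    unfolding cubic_def by (simp add: E_def algebra_simps power2_eq_square power3_eq_cube)
  define N where "N = ?p^2"
  have N0: "N > 0" using p(2) by (simp add: N_def odd_pos)
  have roots: "(0::'a) \<noteq> 1" "cubic 0 = 0" "cubic 1 = 0" "(0::'a) ^ N = 0" "(1::'a) ^ N = 1"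
    using N0 by (simp_all add: cubic_E)
  \<comment> \<open>The odd multiple [p] fixes the 2-torsion point \<open>(l, 0)\<close> and raises
    abscissae to the power p^2. So the parameter of a supersingular Legendre curve lies in
    F_(p^2).\<close>
  have "Affine l 0 \<in> curve" by (simp add: Affine_in_curve_iff cubic_E)
  hence "\<exists>y'. Affine l 0 = Affine (l ^ N) y'"
    using torsion_free_abscissa[OF N_def free roots, of l 0] two_torsion_CHAR[of l] by (simp add: cubic_E)
  hence lN: "l ^ N = l" by simp
  have N2: "N = ?p ^ 2" by (simp add: N_def)
  have memb: "l \<in> GF N" "1 + l \<in> GF N" "- (1 + l) \<in> GF N" "0 \<in> (GF N :: 'a set)"
  proof -
    show 1: "l \<in> GF N" using lN by (simp add: GF_def)
    have "1 \<in> (GF N :: 'a set)" by (simp add: GF_def)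
    thus 2: "1 + l \<in> GF N" using 1 GF_closed[OF N2] by blast
    show 3: "0 \<in> (GF N :: 'a set)" by (rule zero_in_GF[OF N2])
    have "0 - (1 + l) \<in> GF N" using GF_closed[OF N2 3 2] by blast
    thus "- (1 + l) \<in> GF N" by simp
  qed
  have coef: "a2 E \<in> GF N" "a4 E \<in> GF N" "a6 E \<in> GF N" using memb by (simp_all add: E_def)
  obtain s where s: "s = 1 \<or> s = - 1" "\<And>P. P \<in> curve \<Longrightarrow> frob N P = scale_point s (point_mult E ?p P)"
    by (rule torsion_free_frob_scale[OF coef N_def free roots]) (assumption, assumption, rule that)
  have NN: "?p^4 = N * N" by (simp add: N_def eval_nat_numeral)
  have coef4: "a2 E \<in> GF (?p^4)" "a4 E \<in> GF (?p^4)" "a6 E \<in> GF (?p^4)"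
    using coef unfolding NN GF_def by (simp_all add: power_mult)
  have ss: "s * s = 1" "s \<noteq> 0" "s^2 = 1" using s(1) by auto
  have "s^4 = (s^2)^2" by (simp flip: power_mult)
  hence aut: "a2 E = 0 \<or> s^2 = 1" "a4 E = 0 \<or> s^4 = 1" "a6 E = 0 \<or> s^6 = 1" using ss by (simp_all add: E_def)
  obtain P where P: "P \<in> curve" "P \<noteq> Infinity" "point_mult E r P = Infinity"
    by (rule prime_torsion_ex[OF r(1,2)])
  have "frob (?p^4) P = frob N (frob N P)" by (simp add: frob_frob NN)
  also have "\<dots> = scale_point s (point_mult E ?p (scale_point s (point_mult E ?p P)))"
    using s(2) P(1) scale_automorphism_add(3)[OF ss(2) aut] by simp
  also have "\<dots> = point_mult E ?p (point_mult E ?p P)"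
    by (simp add: scale_automorphism_add(2)[OF ss(2) aut] scale_point_scale ss(1))
  also have "\<dots> = point_neg P"
    using point_mult_torsion_neg[OF P(1,3) r(3)] by (simp add: power2_eq_square point_mult_mult P(1))
  finally have "frob (?p^4) P = scale_point (- 1) P" by (simp add: scale_point_minus)
  thus ?thesis by (intro twist_torsion[OF refl _ coef4 free P r(1), of "- 1"]) simp_all
qed

section \<open>Supersingular curves over the prime field and the extension of degree 3\<close>

context finite_char_curve begin

text \<open>Each abscissa carries at most two points. This crude bound, with the congruence modulo
  the characteristic and a parity condition, determines the number of points below.\<close>

lemma card_points_le:
  assumes N: "N = CHAR('a) ^ k" and k: "k > 0"
  shows "card (points E (GF N)) \<le> 2 * N + 1"
proof -
  note c = prime_CHAR N k
  have fin: "finite (GF N :: 'a set)" by (rule finite_GF[OF c])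
  have "\<exists>y. y^2 = cubic x" for x by (rule nth_root_exists) simp
  then obtain d where d: "\<And>x. (d x)^2 = cubic x" by metis
  define A where "A = insert Infinity ((\<lambda>x. Affine x (d x)) ` GF N \<union> (\<lambda>x. Affine x (- d x)) ` GF N)"
  have "points E (GF N) \<subseteq> A"
  proof
    fix P assume P: "P \<in> points E (GF N)"
    show "P \<in> A"
    proof (cases P)
      case (Affine x y)
      hence "x \<in> GF N" "y^2 = (d x)^2" using P d by (auto simp: Affine_in_curve_iff)
      thus ?thesis unfolding A_def Affine by (auto simp: power2_eq_iff)
    qed (simp add: A_def)
  qed
  moreover have "finite A" unfolding A_def using fin by simp
  ultimately have "card (points E (GF N)) \<le> card A" by (intro card_mono)
  also have "\<dots> \<le> Suc (card ((\<lambda>x. Affine x (d x)) ` GF N \<union> (\<lambda>x. Affine x (- d x)) ` GF N))"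
    unfolding A_def by (rule card_insert_le_m1) simp_all
  also have "\<dots> \<le> Suc (N + N)"
  proof -
    have "card ((\<lambda>x. Affine x (d x)) ` GF N) \<le> N" "card ((\<lambda>x. Affine x (- d x)) ` GF N) \<le> N"
      using card_image_le[OF fin] card_GF[OF c] by metis+
    thus ?thesis using card_Un_le[of "(\<lambda>x. Affine x (d x)) ` GF N" "(\<lambda>x. Affine x (- d x)) ` GF N"] by linarith
  qed
  finally show ?thesis by simp
qed

end


lemma of_int_coeff_power:
  "(of_int (coeff (p ^ m) j) :: 'a::comm_ring_1) = coeff (map_poly of_int p ^ m) j"
proof -
  have "map_poly of_int (p ^ m) = (map_poly of_int p ^ m :: 'a poly)"
    by (induction m) (simp_all add: of_int_poly_hom.hom_mult)
  thus ?thesis by (metis coeff_map_poly of_int_0)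
qed

text \<open>The curve y^2 = x (x^2 + k x + k) is defined over F_p and has p + 1 points there, which
  forces the p^2-Frobenius to be -[p]. On \<open>r\<close>-torsion with r | p^3 + 1 the
  p^6-Frobenius is then -[p^3] = 1, so the p^3-Frobenius F is an involution. Either P + F P is a
  nonzero fixed point, or F P = -P and a quadratic twist makes P rational.\<close>

lemma supersingular_curve_embedding_trace_zero:
  fixes k :: int
  assumes p: "prime CHAR('a::alg_closed_field)" "odd CHAR('a)" "CHAR('a) > 3"
    and alg: "\<And>z::'a. \<exists>k>0. z ^ (CHAR('a) ^ k) = z"
    and k: "\<not> int CHAR('a) dvd k" "\<not> int CHAR('a) dvd k - 4"
      "int CHAR('a) dvd coeff ([:k, k, 1:] ^ ((CHAR('a) - 1) div 2)) ((CHAR('a) - 1) div 2)"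
    and r: "prime r" "of_nat r \<noteq> (0::'a)" "r dvd CHAR('a)^3 + 1"
  shows "\<exists>E :: 'a weierstrass. supersingular E \<and> elliptic_curve (CHAR('a)^3) E \<and> r dvd card (points E (GF (CHAR('a)^3)))"
proof -
  let ?p = "CHAR('a)"
  have two: "(2::'a) \<noteq> 0" by (rule two_nonzero_of_odd_CHAR[OF p(2)])
  define c :: 'a where "c = of_int k"
  have c0: "c \<noteq> 0" using k(1) unfolding c_def by (simp add: of_int_eq_0_iff_char_dvd)
  have "of_int (k - 4) \<noteq> (0::'a)" using k(2) by (subst of_int_eq_0_iff_char_dvd)
  hence c4: "c - 4 \<noteq> 0" by (simp add: c_def)
  define E where "E = short_curve c c (0::'a)"
  have "discriminant E = 2^4 * (c^3 * (c - 4))"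
    unfolding discriminant_def E_def Let_def short_curve_simps by (simp, Groebner_Basis.algebra)
  hence disc: "discriminant E \<noteq> 0" using power_not_zero[OF two, of 4] c0 c4 by simp
  interpret finite_char_curve E
    by unfold_locales (fact p alg two disc | simp add: E_def)+
  obtain m where m: "?p = 2 * m + 1" using p(2) by (elim oddE)
  have "of_int (coeff ([:k, k, 1:] ^ m) m) = (0::'a)" using k(3) m by (subst of_int_eq_0_iff_char_dvd) simp
  hence "coeff ([:c, c, 1:] ^ m) m = 0" unfolding of_int_coeff_power by (simp add: c_def map_poly_pCons)
  moreover have "cubic_poly = [:0, c, c, 1:]" unfolding cubic_poly_def by (simp add: E_def)
  ultimately have H: "hasse_invariant = 0" unfolding hasse_invariant_def using m by (simp add: coeff_pCons_0_power)
  note free = no_CHAR_torsion[OF H]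
  have cubic_E: "cubic x = x * (x^2 + c * x + c)" for x
    unfolding cubic_def by (simp add: E_def algebra_simps power2_eq_square power3_eq_cube)
  have p1: "?p = ?p ^ 1" by simp
  have cp: "c ^ ?p = c"
  proof -
    have nat: "(of_nat n :: 'a) ^ ?p = of_nat n" for n
      by (induction n) (use p(3) in \<open>simp_all add: power_add[OF p1]\<close>)
    show ?thesis unfolding c_def
      by (cases k) (simp_all add: nat power_uminus[OF p1] del: of_nat_Suc)
  qed
  have coef1: "a2 E \<in> GF ?p" "a4 E \<in> GF ?p" "a6 E \<in> GF ?p"
    using cp p(3) by (auto simp: E_def GF_def)
  have mono: "x \<in> GF (?p ^ n)" if "x \<in> GF ?p" for x :: 'a and n
    using GF_mono[of 1 n x] that by (simp add: GF_def)
  define N where "N = ?p^2"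
  have coef2: "a2 E \<in> GF N" "a4 E \<in> GF N" "a6 E \<in> GF N" using coef1 mono unfolding N_def by blast+
  have coef3: "a2 E \<in> GF (?p^3)" "a4 E \<in> GF (?p^3)" "a6 E \<in> GF (?p^3)" using coef1 mono by blast+
  obtain e where e: "poly [:c, c, 1:] e = 0" using alg_closed_imp_poly_has_root[of "[:c, c, 1:]"] by auto
  hence e': "e^2 + c * e + c = 0" by (simp add: algebra_simps power2_eq_square)
  have e0: "e \<noteq> 0" using e' c0 by auto
  \<comment> \<open>The conjugate e^p is a root of the same quadratic over F_p, hence e or -c - e;
    in both cases applying Frobenius twice returns e.\<close>
  have eN: "e ^ N = e"
  proof -
    define t where "t = e ^ ?p"
    have "(e^2 + c * e + c) ^ ?p = 0" using e' p(3) by simp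
    hence t: "t^2 + c * t + c = 0"
      unfolding power_add[OF p1] power_mult_distrib cp t_def by (simp flip: power_mult add: mult.commute)
    have tt: "e ^ N = t ^ ?p" by (simp add: t_def N_def power2_eq_square power_mult)
    have "(t - e) * (t + e + c) = (t^2 + c * t + c) - (e^2 + c * e + c)" by (simp add: algebra_simps power2_eq_square)
    hence "(t - e) * (t + e + c) = 0" unfolding t e' by simp
    hence "t - e = 0 \<or> t + e + c = 0" by (rule mult_eq_0_iff[THEN iffD1])
    moreover have "t + e + c = t - (- c - e)" by simp
    ultimately have "t - e = 0 \<or> t - (- c - e) = 0" by (simp only:)
    hence "t = e \<or> t = - c - e" by (simp only: right_minus_eq)
    thus ?thesis
    proof
      assume "t = e"
      thus ?thesis using tt t_def by simp
    next
      assume te: "t = - c - e"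
      have "t ^ ?p = - c - t" unfolding te power_diff[OF p1] power_uminus[OF p1] cp t_def[symmetric] te ..
      thus ?thesis unfolding tt te by simp
    qed
  qed
  obtain s where s: "s = 1 \<or> s = - 1" "\<And>P. P \<in> curve \<Longrightarrow> frob N P = scale_point s (point_mult E ?p P)"
    by (rule torsion_free_frob_scale[OF coef2 N_def free, of 0 e])
       (use e0 e' eN p(3) in \<open>auto simp: cubic_E N_def\<close>)
  let ?G = "points E (GF ?p)"
  have zero: "(0::'a) \<in> GF ?p" using zero_in_GF[OF p1] .
  note closed = GF_closed[OF p1]
  have card_G: "card ?G = ?p + 1"
  proof -
    have le: "card ?G \<le> 2 * ?p + 1" by (rule card_points_le[OF p1]) simp
    have "(of_nat (card ?G) :: 'a) = of_nat 1" using card_points_mod_CHAR[OF H p1 _ coef1] by simp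
    hence "[card ?G = 1] (mod ?p)" by (simp only: of_nat_eq_iff_cong_CHAR)
    moreover have "2 dvd card ?G"
    proof (rule prime_dvd_card_points[OF zero closed coef1(1,2), of "Affine 0 0"])
      show "Affine 0 0 \<in> points E (GF ?p)" using zero by (simp add: Affine_in_curve_iff cubic_E)
    qed (use two_is_prime_nat in \<open>simp_all add: numeral_2_eq_2\<close>)
    moreover have "card ?G > 0" using finite_points[OF p1] Infinity_in_curve by (metis card_gt_0_iff empty_iff less_one)
    ultimately have *: "[card ?G = 1] (mod ?p)" "even (card ?G)" "card ?G > 0" by simp_all
    \<comment> \<open>The 2-torsion point (0, 0) makes the count even, so \<open>j\<close> is odd;
      the bound 2p + 1 then leaves only \<open>j = 1\<close>.\<close>
    obtain j where j: "card ?G = 1 + j * ?p"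
      using *(1,3) p(3) by (metis Cong.cong_def One_nat_def add.commute mod_div_mult_eq mod_less less_trans one_less_numeral_iff semiring_norm(77))
    have "j \<noteq> 0" using j *(2) by (intro notI) simp
    moreover have "j \<noteq> 2" using j *(2) by (intro notI) simp
    moreover have "j < 3"
    proof (rule ccontr)
      assume "\<not> j < 3"
      hence "3 * ?p \<le> j * ?p" by simp
      thus False using j le p(3) by linarith
    qed
    ultimately have "j = 1" by linarith
    thus ?thesis using j by simp
  qed
  \<comment> \<open>If the p^2-Frobenius were [p], every F_p-rational point would satisfy pP = P and
    (p+1)P = 0, so 2P = 0. There are at most four such points, fewer than p + 1.\<close>
  have s1: "s = - 1"
  proof (rule ccontr)
    assume "s \<noteq> - 1"
    hence s1: "s = 1" using s(1) by simp
    have sub: "?G \<subseteq> insert Infinity ((\<lambda>x. Affine x 0) ` {x. poly [:0, c, c, 1:] x = 0})"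
    proof
      fix P assume P: "P \<in> ?G"
      hence Pc: "P \<in> curve" by (rule points_subset)
      have "frob ?p P = P" using P frob_fixed_iff[OF Pc] by blast
      hence "frob N P = P" by (metis N_def frob_frob power2_eq_square)
      hence pP: "point_mult E ?p P = P" using s(2)[OF Pc] s1 \<open>frob N P = P\<close> by simp
      have "point_mult E (?p + 1) P = Infinity"
        using card_point_mult[OF zero closed coef1(1,2) P] unfolding card_G .
      hence PP: "point_add E P P = Infinity" using pP by simp
      show "P \<in> insert Infinity ((\<lambda>x. Affine x 0) ` {x. poly [:0, c, c, 1:] x = 0})"
      proof (cases P)
        case (Affine x y)
        have "P = point_neg P" using PP Pc by (intro point_neg_eqI) 
        hence "y = - y" using Affine by simp
        hence "y + y = 0" by (metis add.right_inverse)
        hence "2 * y = 0" unfolding mult_2 .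
        hence y: "y = 0" using two by simp
        hence "cubic x = 0" using Pc Affine by (simp add: Affine_in_curve_iff)
        thus ?thesis using Affine y by (auto simp: cubic_E algebra_simps power2_eq_square)
      qed simp
    qed
    have nz: "[:0, c, c, 1:] \<noteq> 0" by simp
    have "card ?G \<le> card (insert Infinity ((\<lambda>x. Affine x 0) ` {x. poly [:0, c, c, 1:] x = 0}))"
      using poly_roots_finite[OF nz] by (intro card_mono sub) simp
    also have "\<dots> \<le> Suc (card ((\<lambda>x. Affine x 0) ` {x. poly [:0, c, c, 1:] x = 0}))"
      by (rule card_insert_le_m1) simp_all
    also have "\<dots> \<le> Suc (card {x. poly [:0, c, c, 1:] x = 0})"
      using card_image_le[OF poly_roots_finite[OF nz]] by (rule Suc_le_mono[THEN iffD2])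
    also have "\<dots> \<le> 4" using card_poly_roots_bound[OF nz] by simp
    finally show False using card_G p(3) by simp
  qed
  have frobN: "frob N P = point_neg (point_mult E ?p P)" if "P \<in> curve" for P
    using s(2)[OF that] s1 by (simp add: scale_point_minus)
  have p3: "?p^3 = ?p^3" ..
  have frob6: "frob (?p^3) (frob (?p^3) P) = P" if P: "P \<in> curve" "point_mult E r P = Infinity" for P
  proof -
    have "?p^3 * ?p^3 = N * (N * N)" by (simp add: N_def eval_nat_numeral)
    hence "frob (?p^3) (frob (?p^3) P) = frob N (frob N (frob N P))" by (simp add: frob_frob)
    also have "\<dots> = point_neg (point_mult E (?p * (?p * ?p)) P)"
      using P(1) by (simp add: frobN point_mult_neg point_mult_mult)
    also have "?p * (?p * ?p) = ?p^3" by (simp add: power3_eq_cube)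
    finally show ?thesis using point_mult_torsion_neg[OF P r(3)] by simp
  qed
  obtain P where P: "P \<in> curve" "P \<noteq> Infinity" "point_mult E r P = Infinity"
    by (rule prime_torsion_ex[OF r(1,2)])
  define W where "W = point_add E P (frob (?p^3) P)"
  have Fc: "frob (?p^3) P \<in> curve" by (rule frob_closed[OF refl coef3 P(1)])
  have Wc: "W \<in> curve" unfolding W_def using Fc P(1) by simp
  show ?thesis
  proof (cases "W = Infinity")
    case True
    hence "frob (?p^3) P = point_neg P" using Fc P(1) by (intro point_neg_eqI) (simp_all add: W_def)
    hence "frob (?p^3) P = scale_point (- 1) P" by (simp add: scale_point_minus)
    thus ?thesis by (intro twist_torsion[OF refl _ coef3 free P r(1), of "- 1"]) simp_all
  next
    case False
    have "frob (?p^3) W = point_add E (frob (?p^3) P) P"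
      unfolding W_def frob_add[OF refl coef3] frob6[OF P(1,3)] ..
    also have "\<dots> = scale_point 1 W" unfolding W_def using Fc P(1) by (simp add: add_commute)
    finally have FW: "frob (?p^3) W = scale_point 1 W" .
    have rW: "point_mult E r W = Infinity"
      unfolding W_def point_mult_distrib[OF P(1) Fc] using P(3) by (simp flip: frob_point_mult[OF refl coef3])
    show ?thesis by (intro twist_torsion[OF refl _ coef3 free Wc False rW r(1) _ _ _ _ FW]) simp_all
  qed
qed


section \<open>Places of the complex numbers above a prime\<close>

locale complex_subring =
  fixes A :: "complex set"
  assumes one_mem [simp]: "1 \<in> A" and diff_mem: "x \<in> A \<Longrightarrow> y \<in> A \<Longrightarrow> x - y \<in> A"
    and mult_mem: "x \<in> A \<Longrightarrow> y \<in> A \<Longrightarrow> x * y \<in> A"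
begin

lemma zero_mem [simp]: "0 \<in> A"
  using diff_mem[OF one_mem one_mem] by simp

lemma minus_mem: "x \<in> A \<Longrightarrow> - x \<in> A"
  using diff_mem[of 0 x] by simp

lemma add_mem: "x \<in> A \<Longrightarrow> y \<in> A \<Longrightarrow> x + y \<in> A"
  using diff_mem[of x "- y"] minus_mem by simp

lemma power_mem: "x \<in> A \<Longrightarrow> x ^ n \<in> A"
  by (induction n) (auto intro: mult_mem)

lemma of_nat_mem [simp]: "of_nat n \<in> A"
  by (induction n) (auto intro: add_mem)

lemma of_int_mem [simp]: "of_int n \<in> A"
  by (cases n) (auto intro: minus_mem simp del: of_nat_Suc)

lemma numeral_mem [simp]: "numeral n \<in> A"
  using of_nat_mem[of "numeral n"] by simp

lemma sum_mem: "(\<And>i. i \<in> I \<Longrightarrow> f i \<in> A) \<Longrightarrow> sum f I \<in> A"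
  by (induction I rule: infinite_finite_induct) (auto intro: add_mem)

definition PA :: "complex poly set" where "PA = {p. \<forall>i. coeff p i \<in> A}"

lemma PA_coeff: "p \<in> PA \<Longrightarrow> coeff p i \<in> A" by (simp add: PA_def)

lemma PA_add: "p \<in> PA \<Longrightarrow> r \<in> PA \<Longrightarrow> p + r \<in> PA" by (auto simp: PA_def intro: add_mem)

lemma PA_diff: "p \<in> PA \<Longrightarrow> r \<in> PA \<Longrightarrow> p - r \<in> PA" by (auto simp: PA_def intro: diff_mem)

lemma PA_smult: "c \<in> A \<Longrightarrow> p \<in> PA \<Longrightarrow> smult c p \<in> PA" by (auto simp: PA_def intro: mult_mem)

lemma PA_mult: "p \<in> PA \<Longrightarrow> r \<in> PA \<Longrightarrow> p * r \<in> PA"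
  by (auto simp: PA_def coeff_mult intro!: sum_mem mult_mem)

lemma PA_1 [simp]: "1 \<in> PA" by (auto simp: PA_def coeff_1)

lemma PA_power: "p \<in> PA \<Longrightarrow> p ^ n \<in> PA" by (induction n) (auto intro: PA_mult)

lemma PA_pCons: "pCons a p \<in> PA \<longleftrightarrow> a \<in> A \<and> p \<in> PA"
  by (auto simp: PA_def coeff_pCons split: nat.splits)

lemma PA_0 [simp]: "0 \<in> PA" by (auto simp: PA_def)

lemma PA_monom: "c \<in> A \<Longrightarrow> monom c n \<in> PA" by (auto simp: PA_def)

lemma PA_pderiv: "p \<in> PA \<Longrightarrow> pderiv p \<in> PA"
  by (auto simp: PA_def coeff_pderiv intro!: mult_mem simp del: of_nat_Suc)

lemma poly_mem: "p \<in> PA \<Longrightarrow> x \<in> A \<Longrightarrow> poly p x \<in> A"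
  by (auto simp: PA_def poly_altdef intro!: sum_mem mult_mem power_mem)

end

text \<open>A valuation ring of the complex numbers in which \<open>q\<close> is not invertible,
  with maximal ideal \<open>M\<close>. The residue field is never formed: congruences modulo
  \<open>M\<close>, and modulo \<open>PM\<close> for polynomials, take its place.\<close>

locale place = complex_subring +
  fixes q :: nat
  assumes valuation: "x \<in> A \<or> inverse x \<in> A"
    and prime_q: "prime q" and inverse_q: "inverse (of_nat q) \<notin> A"
begin

definition M :: "complex set" where
  "M = {x. x = 0 \<or> inverse x \<notin> A}"

lemma M_subset: "x \<in> M \<Longrightarrow> x \<in> A"
  using valuation unfolding M_def by auto

lemma zero_M [simp]: "0 \<in> M"
  by (simp add: M_def)

lemma one_not_M [simp]: "1 \<notin> M"
  by (simp add: M_def)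

lemma unit_iff: "x \<in> A \<Longrightarrow> x \<notin> M \<longleftrightarrow> x \<noteq> 0 \<and> inverse x \<in> A"
  by (auto simp: M_def)

lemma mult_M: "x \<in> M \<Longrightarrow> a \<in> A \<Longrightarrow> a * x \<in> M"
proof -
  assume x: "x \<in> M" and a: "a \<in> A"
  show ?thesis
  proof (cases "a * x = 0")
    case False
    have "inverse (a * x) \<notin> A"
    proof
      assume "inverse (a * x) \<in> A"
      hence "a * inverse (a * x) \<in> A" using a by (rule mult_mem[rotated])
      hence "inverse x \<in> A" using False by (simp add: field_simps)
      thus False using x False by (simp add: M_def)
    qed
    thus ?thesis by (simp add: M_def)
  qed (simp only: zero_M)
qed

lemma mult_M': "x \<in> M \<Longrightarrow> a \<in> A \<Longrightarrow> x * a \<in> M"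
  using mult_M[of x a] by (simp add: mult.commute)

lemma minus_M: "x \<in> M \<Longrightarrow> - x \<in> M"
  using mult_M[of x "- 1"] minus_mem by simp

lemma add_M:
  assumes "x \<in> M" "y \<in> M"
  shows "x + y \<in> M"
proof (cases "x = 0 \<or> y = 0")
  case False
  have *: "x + y \<in> M" if "y \<in> M" "x \<noteq> 0" "y \<noteq> 0" "x / y \<in> A" for x y
  proof -
    have "(1 + x / y) * y \<in> M" using that by (intro mult_M add_mem) simp_all
    thus ?thesis using that by (simp add: field_simps)
  qed
  have "x / y \<in> A \<or> y / x \<in> A" using valuation[of "x / y"] by (simp add: field_simps)
  thus ?thesis using *[of y x] *[of x y] assms False by (auto simp: add.commute)
qed (use assms in auto)

lemma diff_M: "x \<in> M \<Longrightarrow> y \<in> M \<Longrightarrow> x - y \<in> M"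
  using add_M[of x "- y"] minus_M by simp

lemma sum_M: "(\<And>i. i \<in> I \<Longrightarrow> f i \<in> M) \<Longrightarrow> sum f I \<in> M"
  by (induction I rule: infinite_finite_induct) (auto intro: add_M)

lemma prime_M: "x * y \<in> M \<Longrightarrow> x \<in> A \<Longrightarrow> y \<in> A \<Longrightarrow> x \<in> M \<or> y \<in> M"
  unfolding M_def by (auto intro: mult_mem)

lemma power_M: "x ^ n \<in> M \<Longrightarrow> x \<in> A \<Longrightarrow> x \<in> M"
proof (induction n)
  case (Suc n)
  thus ?case using prime_M[of x "x ^ n"] power_mem by auto
qed simp

lemma not_in_A: "x \<notin> A \<Longrightarrow> inverse x \<in> M"
  unfolding M_def by auto

lemma of_nat_q_M: "of_nat q \<in> M"
  using inverse_q by (simp add: M_def)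

lemma of_int_M_iff: "of_int n \<in> M \<longleftrightarrow> int q dvd n"
proof
  assume "int q dvd n"
  then obtain j where "n = int q * j" by (elim dvdE)
  thus "of_int n \<in> M" using mult_M[OF of_nat_q_M, of "of_int j"] by (simp add: mult.commute)
next
  assume n: "of_int n \<in> M"
  show "int q dvd n"
  proof (rule ccontr)
    assume "\<not> int q dvd n"
    hence "coprime (int q) n" using prime_q by (simp add: prime_imp_coprime)
    then obtain a b where ab: "a * int q + b * n = 1" by (metis bezout_int coprime_iff_gcd_eq_1)
    have "of_int a * of_nat q + of_int b * of_int n \<in> M"
      using n of_nat_q_M by (intro add_M mult_M) simp_all
    also have "of_int a * of_nat q + of_int b * of_int n = (of_int (a * int q + b * n) :: complex)" by simp
    finally show False by (simp only: ab of_int_1 one_not_M)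
  qed
qed

lemma of_nat_M_iff: "of_nat n \<in> M \<longleftrightarrow> q dvd n"
  using of_int_M_iff[of "int n"] by simp

lemma sqrt_mem: "x * x \<in> A \<Longrightarrow> x \<in> A"
proof (rule ccontr)
  assume x: "x * x \<in> A" "x \<notin> A"
  hence "inverse x \<in> A" using valuation by blast
  hence "x * x * inverse x \<in> A" by (rule mult_mem[OF x(1)])
  moreover have "x * x * inverse x = x" by (cases "x = 0") (simp_all add: mult.assoc)
  ultimately show False using x by simp
qed

definition PM :: "complex poly set" where "PM = {p. \<forall>i. coeff p i \<in> M}"

lemma PM_coeff: "p \<in> PM \<Longrightarrow> coeff p i \<in> M" by (simp add: PM_def)
lemma PM_PA: "p \<in> PM \<Longrightarrow> p \<in> PA" by (auto simp: PA_def PM_def intro: M_subset)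
lemma PM_add: "p \<in> PM \<Longrightarrow> r \<in> PM \<Longrightarrow> p + r \<in> PM" by (auto simp: PM_def intro: add_M)
lemma PM_diff: "p \<in> PM \<Longrightarrow> r \<in> PM \<Longrightarrow> p - r \<in> PM" by (auto simp: PM_def intro: diff_M)
lemma PM_smult: "c \<in> A \<Longrightarrow> p \<in> PM \<Longrightarrow> smult c p \<in> PM" by (auto simp: PM_def intro: mult_M)
lemma PM_smult': "c \<in> M \<Longrightarrow> p \<in> PA \<Longrightarrow> smult c p \<in> PM" by (auto simp: PM_def PA_def intro: mult_M')
lemma PM_mult: "p \<in> PM \<Longrightarrow> r \<in> PA \<Longrightarrow> p * r \<in> PM"
  by (auto simp: PA_def PM_def coeff_mult intro!: sum_M mult_M')
lemma PM_mult': "r \<in> PM \<Longrightarrow> p \<in> PA \<Longrightarrow> p * r \<in> PM"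
  using PM_mult[of r p] by (simp add: mult.commute)
lemma PM_0 [simp]: "0 \<in> PM" by (auto simp: PM_def)
lemma PM_pCons: "pCons a p \<in> PM \<longleftrightarrow> a \<in> M \<and> p \<in> PM"
  by (auto simp: PM_def coeff_pCons split: nat.splits)
lemma PM_pderiv: "p \<in> PM \<Longrightarrow> pderiv p \<in> PM"
  by (auto simp: PM_def coeff_pderiv intro!: mult_M simp del: of_nat_Suc)

lemma poly_M: "p \<in> PM \<Longrightarrow> x \<in> A \<Longrightarrow> poly p x \<in> M"
  by (auto simp: PM_def poly_altdef intro!: sum_M mult_M' power_mem)

lemma monic_not_PM: "lead_coeff p = 1 \<Longrightarrow> p \<notin> PM"
  using PM_coeff[of p "degree p"] by auto

text \<open>Gauss's lemma for the residue field.\<close>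

lemma prime_PM:
  assumes "p * r \<in> PM" "p \<in> PA" "r \<in> PA"
  shows "p \<in> PM \<or> r \<in> PM"
proof (rule ccontr)
  assume "\<not> ?thesis"
  hence ex: "\<exists>i. coeff p i \<notin> M" "\<exists>j. coeff r j \<notin> M" by (auto simp: PM_def)
  define i where "i = (LEAST i. coeff p i \<notin> M)"
  define j where "j = (LEAST j. coeff r j \<notin> M)"
  have i: "coeff p i \<notin> M" "\<And>k. k < i \<Longrightarrow> coeff p k \<in> M"
    unfolding i_def using LeastI_ex[OF ex(1)] not_less_Least by blast+
  have j: "coeff r j \<notin> M" "\<And>k. k < j \<Longrightarrow> coeff r k \<in> M"
    unfolding j_def using LeastI_ex[OF ex(2)] not_less_Least by blast+
  have "(\<Sum>k\<in>{..i+j} - {i}. coeff p k * coeff r (i + j - k)) \<in> M"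
  proof (rule sum_M)
    fix k assume "k \<in> {..i+j} - {i}"
    hence "k < i \<or> i + j - k < j" by auto
    thus "coeff p k * coeff r (i + j - k) \<in> M"
      using i(2) j(2) assms(2,3) by (auto intro: mult_M mult_M' PA_coeff)
  qed
  moreover have "coeff (p * r) (i + j) = coeff p i * coeff r j + (\<Sum>k\<in>{..i+j} - {i}. coeff p k * coeff r (i + j - k))"
    unfolding coeff_mult by (subst sum.remove[of _ i]) auto
  ultimately have "coeff p i * coeff r j \<in> M"
    using PM_coeff[OF assms(1), of "i + j"] diff_M by (metis add_diff_cancel_right')
  thus False using prime_M i(1) j(1) assms(2,3) PA_coeff by blast
qed

text \<open>In a valuation ring an element of minimal valuation divides all the others.\<close>

lemma divisor_of_finite_set:
  assumes "finite S" "S \<noteq> {}"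
  shows "\<exists>c\<in>S. \<forall>s\<in>S. \<exists>a\<in>A. s = c * a"
  using assms
proof (induction S rule: finite_ne_induct)
  case (singleton x)
  thus ?case by (auto intro: bexI[of _ 1])
next
  case (insert x S)
  then obtain c where c: "c \<in> S" "\<forall>s\<in>S. \<exists>a\<in>A. s = c * a" by blast
  show ?case
  proof (cases "\<exists>a\<in>A. x = c * a")
    case True
    thus ?thesis using c by (intro bexI[of _ c]) auto
  next
    case False
    have x0: "x \<noteq> 0" using False by (metis mult_zero_right zero_mem)
    have cx: "c / x \<in> A"
    proof (rule ccontr)
      assume "c / x \<notin> A"
      hence "x / c \<in> A" "c \<noteq> 0" using valuation[of "c / x"] by auto
      thus False using False x0 by (metis nonzero_mult_div_cancel_left times_divide_eq_right)
    qed
    have "\<exists>a\<in>A. s = x * a" if s: "s \<in> S" for s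
    proof -
      obtain a where "a \<in> A" "s = c * a" using c(2) s by blast
      hence "s = x * (c / x * a)" using x0 by simp
      thus ?thesis using \<open>a \<in> A\<close> cx mult_mem by blast
    qed
    moreover have "\<exists>a\<in>A. x = x * a" by (auto intro: bexI[of _ 1])
    ultimately show ?thesis by (intro bexI[of _ x]) auto
  qed
qed

text \<open>Write B = c B1 with B1 primitive. If c were not integral, f B1^2 = G / c^2 would vanish
  modulo \<open>M\<close>, contradicting Gauss's lemma for the monic f and the primitive B1.\<close>

lemma PA_divide_sqrt:
  assumes f: "lead_coeff f = 1" "f \<in> PA" and G: "f * (B * B) = G" "G \<in> PA"
  shows "B \<in> PA"
proof (cases "B = 0")
  case False
  define S where "S = coeff B ` {..degree B}"
  have "finite S" "S \<noteq> {}" by (auto simp: S_def)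
  then obtain c where c: "c \<in> S" "\<forall>s\<in>S. \<exists>a\<in>A. s = c * a" using divisor_of_finite_set by blast
  have "lead_coeff B \<in> S" by (simp add: S_def)
  hence "\<exists>a\<in>A. lead_coeff B = c * a" using c(2) by blast
  hence c0: "c \<noteq> 0" using False by auto
  have coef: "coeff B i / c \<in> A" for i
  proof (cases "i \<le> degree B")
    case True
    then obtain a where "a \<in> A" "coeff B i = c * a" using c(2) by (auto simp: S_def)
    thus ?thesis using c0 by simp
  qed (simp add: coeff_eq_0)
  define B1 where "B1 = smult (inverse c) B"
  have B1: "B1 \<in> PA" using coef by (simp add: PA_def B1_def field_simps)
  have B1M: "B1 \<notin> PM"
  proof
    assume "B1 \<in> PM"
    moreover obtain i where "coeff B i = c" using c(1) by (auto simp: S_def)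
    ultimately show False using PM_coeff[of B1 i] c0 by (simp add: B1_def)
  qed
  have "c \<in> A"
  proof (rule ccontr)
    assume "c \<notin> A"
    hence "inverse c \<in> M" by (rule not_in_A)
    hence "smult (inverse c) (smult (inverse c) G) \<in> PM" using G(2) by (metis M_subset PM_smult' PA_smult)
    moreover have "smult (inverse c) (smult (inverse c) G) = f * (B1 * B1)"
      unfolding G(1)[symmetric] B1_def by (simp add: mult_ac)
    ultimately have "f * (B1 * B1) \<in> PM" by simp
    hence "f \<in> PM \<or> B1 \<in> PM" using prime_PM f B1 PA_mult by metis
    thus False using monic_not_PM[OF f(1)] B1M by blast
  qed
  hence "smult c B1 \<in> PA" using B1 by (rule PA_smult)
  thus ?thesis using c0 by (simp add: B1_def)
qed simp

lemma cong_mult_PM: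
  assumes "p - p' \<in> PM" "r - r' \<in> PM" "r \<in> PA" "p' \<in> PA"
  shows "p * r - p' * r' \<in> PM"
proof -
  have "p * r - p' * r' = (p - p') * r + p' * (r - r')" by (simp add: algebra_simps)
  thus ?thesis using assms by (metis PM_add PM_mult PM_mult')
qed

lemma cong_power_PM:
  assumes "p - p' \<in> PM" "p \<in> PA" "p' \<in> PA"
  shows "p ^ n - p' ^ n \<in> PM"
  using assms by (induction n) (auto intro!: cong_mult_PM PA_power)

lemma linear_power_cong:
  assumes a: "a \<in> A" and q: "odd q"
  shows "[:- a, 1:] ^ q - (monom 1 q - [:a ^ q:]) \<in> PM"
  unfolding PM_def
proof (intro CollectI allI)
  fix i
  have q1: "q > 0" using q by (rule odd_pos)
  consider "i = 0" | "i = q" | "0 < i" "i < q" | "i > q" by linarith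
  thus "coeff ([:- a, 1:] ^ q - (monom 1 q - [:a ^ q:])) i \<in> M"
  proof cases
    case 1
    thus ?thesis using q q1 by (simp add: coeff_linear_factor_power)
  next
    case 2
    thus ?thesis using q1 by (auto simp: coeff_linear_factor_power coeff_pCons split: nat.splits)
  next
    case 3
    have "q dvd q choose i" using 3 prime_q by (intro dvd_choose_prime) auto
    hence "(of_nat (q choose i) :: complex) \<in> M" by (simp add: of_nat_M_iff)
    hence "of_nat (q choose i) * (- a) ^ (q - i) \<in> M" using a by (intro mult_M' power_mem minus_mem)
    thus ?thesis using 3 by (auto simp: coeff_linear_factor_power coeff_pCons split: nat.splits)
  next
    case 4
    hence "coeff ([:- a, 1:] ^ q) i = 0"
      by (intro coeff_eq_0) (simp add: degree_power_eq)
    thus ?thesis using 4 by (auto simp: coeff_pCons split: nat.splits)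
  qed
qed

end


section \<open>Reduction of an isogeny with multiplier sqrt(-q)\<close>

text \<open>\<open>N / D\<close> models the action of such an isogeny on the abscissa of y^2 = x (x
  - 1)(x - \<mu>). The equation \<open>ode\<close> says that the invariant differential is
  multiplied by a square root of -q, and \<open>special\<close> that on 2-torsion 0 is fixed while 1
  and \<mu> are exchanged.\<close>

locale place_isogeny = place +
  fixes \<mu> :: complex and N D :: "complex poly" and n :: nat
  assumes q_mod_4: "q mod 4 = 1" and mu: "\<mu> \<in> A"
    and N: "N \<in> PA" "lead_coeff N = 1" "degree N = n" "0 < n" "n \<le> q"
    and D: "D \<in> PA" "degree D < n" "D \<notin> PM"
    and special: "poly N 0 = 0" "poly N 1 = \<mu> * poly D 1" "poly N \<mu> = poly D \<mu>"
    and ode: "[:0, \<mu>, - (1 + \<mu>), 1:] * (pderiv N * D - N * pderiv D)^2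
       = smult (- of_nat q) (D * N * (N - D) * (N - smult \<mu> D))"
begin

definition f :: "complex poly" where "f = [:0, \<mu>, - (1 + \<mu>), 1:]"
definition W :: "complex poly" where "W = pderiv N * D - N * pderiv D"
definition G :: "complex poly" where "G = D * N * (N - D) * (N - smult \<mu> D)"
definition d0 :: complex where "d0 = coeff D 0"

lemma odd_q: "odd q" using q_mod_4 by presburger

lemma q_pos: "q > 0" using prime_q by (rule prime_gt_0_nat)

lemma f_mem: "f \<in> PA" and monic_f: "lead_coeff f = 1"
  using mu minus_mem[OF one_mem] by (auto simp: f_def PA_pCons intro!: diff_mem)

lemma f_W: "f * W^2 = smult (- of_nat q) G"
  using ode unfolding f_def W_def G_def .

lemma W_mem: "W \<in> PA" and G_mem: "G \<in> PA"
  unfolding W_def G_def using N(1) D(1) mu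
  by (auto intro!: PA_diff PA_mult PA_pderiv PA_smult)

lemma W_PM: "W \<in> PM"
proof -
  have "- of_nat q \<in> M" using of_nat_q_M by (rule minus_M)
  hence "f * (W * W) \<in> PM" unfolding power2_eq_square[symmetric] f_W using G_mem by (rule PM_smult')
  hence "f \<in> PM \<or> W * W \<in> PM" using f_mem PA_mult[OF W_mem W_mem] by (rule prime_PM)
  hence "W * W \<in> PM" using monic_not_PM[OF monic_f] by blast
  thus ?thesis using prime_PM[OF _ W_mem W_mem] by blast
qed

text \<open>By \<open>ode\<close> the Wronskian \<open>W\<close> vanishes modulo \<open>M\<close>.
  If \<open>r\<close> is the degree of \<open>D\<close> modulo \<open>M\<close>, the coefficient of
  \<open>W\<close> at n + r - 1 is (n - r) times a unit, so q | n - r. Since 0 < n - r and n is at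
  most q, it follows that n = q and r = 0: the reduced map has constant denominator.\<close>

lemma degree_N: "n = q" and D_PM: "i > 0 \<Longrightarrow> coeff D i \<in> M" and d0: "d0 \<in> A" "d0 \<notin> M"
proof -
  define r where "r = Max {i. i \<le> degree D \<and> coeff D i \<notin> M}"
  let ?S = "{i. i \<le> degree D \<and> coeff D i \<notin> M}"
  have fin: "finite ?S" by simp
  have "\<exists>i. coeff D i \<notin> M" using D(3) by (auto simp: PM_def)
  hence ne: "?S \<noteq> {}" using coeff_eq_0[of D] by (metis (mono_tags, lifting) empty_Collect_eq not_le_imp_less zero_M)
  have "r \<in> ?S" unfolding r_def by (rule Max_in[OF fin ne])
  hence r: "r \<le> degree D" "coeff D r \<notin> M" by auto
  have big: "coeff D i \<in> M" if "i > r" for i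
  proof (cases "i \<le> degree D")
    case True
    show ?thesis
    proof (rule ccontr)
      assume "coeff D i \<notin> M"
      hence "i \<le> r" unfolding r_def using True by (intro Max_ge[OF fin]) simp
      thus False using that by simp
    qed
  qed (simp add: coeff_eq_0)
  have rn: "r < n" using r(1) D(2) by simp
  have cN: "coeff N n = 1" using N(2,3) by simp
  have 1: "coeff (pderiv N * D) (n + r - 1) - of_nat n * coeff D r \<in> M"
  proof -
    have "coeff (pderiv N * D) (n + r - 1) = (\<Sum>i\<le>n + r - 1. coeff (pderiv N) i * coeff D (n + r - 1 - i))"
      by (rule coeff_mult)
    also have "\<dots> = coeff (pderiv N) (n - 1) * coeff D (n + r - 1 - (n - 1))
        + (\<Sum>i\<in>{..n + r - 1} - {n - 1}. coeff (pderiv N) i * coeff D (n + r - 1 - i))"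
      by (subst sum.remove[of _ "n - 1"]) auto
    also have "coeff (pderiv N) (n - 1) = of_nat n" using N(4) cN by (simp add: coeff_pderiv)
    also have "n + r - 1 - (n - 1) = r" using N(4) by simp
    finally have "coeff (pderiv N * D) (n + r - 1) - of_nat n * coeff D r
       = (\<Sum>i\<in>{..n + r - 1} - {n - 1}. coeff (pderiv N) i * coeff D (n + r - 1 - i))" by simp
    also have "\<dots> \<in> M"
    proof (rule sum_M)
      fix i assume i: "i \<in> {..n + r - 1} - {n - 1}"
      show "coeff (pderiv N) i * coeff D (n + r - 1 - i) \<in> M"
      proof (cases "i < n - 1")
        case True
        hence "n + r - 1 - i > r" by linarith
        thus ?thesis using big N(1) by (intro mult_M PA_coeff PA_pderiv) auto
      next
        case False
        hence "Suc i > degree N" using i N(3) by auto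
        thus ?thesis by (simp add: coeff_pderiv coeff_eq_0)
      qed
    qed
    finally show ?thesis .
  qed
  have 2: "coeff (N * pderiv D) (n + r - 1) - of_nat r * coeff D r \<in> M"
  proof (cases "r = 0")
    case True
    have "pderiv D \<in> PM" using big True
      by (auto simp: PM_def coeff_pderiv intro!: mult_M simp del: of_nat_Suc)
    thus ?thesis using True N(1) by (auto intro!: PM_coeff PM_mult')
  next
    case False
    have "coeff (N * pderiv D) (n + r - 1) = (\<Sum>i\<le>n + r - 1. coeff N i * coeff (pderiv D) (n + r - 1 - i))"
      by (rule coeff_mult)
    also have "\<dots> = coeff N n * coeff (pderiv D) (n + r - 1 - n)
        + (\<Sum>i\<in>{..n + r - 1} - {n}. coeff N i * coeff (pderiv D) (n + r - 1 - i))"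
      using False by (subst sum.remove[of _ n]) auto
    also have "n + r - 1 - n = r - 1" by simp
    also have "coeff (pderiv D) (r - 1) = of_nat r * coeff D r" using False by (simp add: coeff_pderiv)
    finally have "coeff (N * pderiv D) (n + r - 1) - of_nat r * coeff D r
       = (\<Sum>i\<in>{..n + r - 1} - {n}. coeff N i * coeff (pderiv D) (n + r - 1 - i))" using cN by simp
    also have "\<dots> \<in> M"
    proof (rule sum_M)
      fix i assume i: "i \<in> {..n + r - 1} - {n}"
      show "coeff N i * coeff (pderiv D) (n + r - 1 - i) \<in> M"
      proof (cases "i < n")
        case True
        hence "Suc (n + r - 1 - i) > r" by linarith
        thus ?thesis using big N(1) unfolding coeff_pderiv
          by (intro mult_M PA_coeff) (auto simp del: of_nat_Suc)
      next
        case False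
        hence "i > degree N" using i N(3) by auto
        thus ?thesis by (simp add: coeff_eq_0)
      qed
    qed
    finally show ?thesis .
  qed
  have "(coeff (pderiv N * D) (n + r - 1) - coeff (N * pderiv D) (n + r - 1)) \<in> M"
    using PM_coeff[OF W_PM, of "n + r - 1"] by (simp add: W_def)
  hence "(coeff (pderiv N * D) (n + r - 1) - coeff (N * pderiv D) (n + r - 1))
     - ((coeff (pderiv N * D) (n + r - 1) - of_nat n * coeff D r) - (coeff (N * pderiv D) (n + r - 1) - of_nat r * coeff D r)) \<in> M"
    by (rule diff_M[OF _ diff_M[OF 1 2]])
  hence "of_nat n * coeff D r - of_nat r * coeff D r \<in> M" by simp
  hence "of_nat (n - r) * coeff D r \<in> M" using rn by (simp add: of_nat_diff algebra_simps)
  hence "of_nat (n - r) \<in> M" using prime_M r(2) D(1) PA_coeff by (metis of_nat_mem)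
  hence "q dvd n - r" by (simp only: of_nat_M_iff)
  hence "q \<le> n - r" using rn by (intro dvd_imp_le) auto
  hence nr: "n = q" "r = 0" using N(5) rn by linarith+
  thus "n = q" by simp
  show "coeff D i \<in> M" if "i > 0" using big[of i] that nr by simp
  show "d0 \<in> A" "d0 \<notin> M" using D(1) r(2) nr PA_coeff by (auto simp: d0_def)
qed

lemma D_cong: "D - [:d0:] \<in> PM"
  using D_PM by (auto simp: PM_def d0_def coeff_pCons split: nat.splits)

lemma coeff_N_q: "coeff N q = 1" and coeff_N_0: "coeff N 0 = 0" and coeff_N_big: "i > q \<Longrightarrow> coeff N i = 0"
  and coeff_D_big: "i \<ge> q \<Longrightarrow> coeff D i = 0"
  using N(2,3) D(2) special(1) degree_N by (auto simp: coeff_eq_0 poly_0_coeff_0)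

text \<open>Integrating is harmless below degree q, because the exponents 1, ..., q - 1 are units
  modulo \<open>M\<close>.\<close>

lemma PM_of_pderiv:
  assumes p: "p \<in> PA" "pderiv p \<in> PM" "coeff p 0 = 0" "\<And>i. i \<ge> q \<Longrightarrow> coeff p i = 0"
  shows "p \<in> PM"
  unfolding PM_def
proof (intro CollectI allI)
  fix i
  show "coeff p i \<in> M"
  proof (cases "i = 0 \<or> i \<ge> q")
    case False
    then obtain j where j: "i = Suc j" by (cases i) auto
    have "of_nat i * coeff p i \<in> M" using PM_coeff[OF p(2), of j] unfolding coeff_pderiv j .
    moreover have "\<not> q dvd i" using False by (auto dest: dvd_imp_le)
    ultimately show ?thesis using prime_M[of "of_nat i" "coeff p i"] PA_coeff[OF p(1)] by (simp add: of_nat_M_iff)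
  qed (use p in auto)
qed

lemma pderiv_N_PM: "pderiv N \<in> PM"
proof -
  have "pderiv D \<in> PM"
  proof -
    have "pderiv (D - [:d0:]) \<in> PM" using D_cong by (rule PM_pderiv)
    thus ?thesis by (simp add: pderiv_diff pderiv_pCons)
  qed
  hence "W + N * pderiv D \<in> PM" using W_PM N(1) by (intro PM_add PM_mult')
  hence "pderiv N * D \<in> PM" by (simp add: W_def)
  thus ?thesis using prime_PM[OF _ PA_pderiv[OF N(1)] D(1)] D(3) by blast
qed

text \<open>Not derivatives: \<open>N'\<close> and \<open>D'\<close> are the deviations of
  \<open>N\<close> and \<open>D\<close> from their reductions x^q and \<open>d0\<close>.\<close>

definition N' :: "complex poly" where "N' = N - monom 1 q"
definition D' :: "complex poly" where "D' = D - [:d0:]"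

lemma coeff_N': "coeff N' i = (if i = q then 0 else coeff N i)"
  using coeff_N_q by (simp add: N'_def)

lemma coeff_D': "coeff D' i = (if i = 0 then 0 else coeff D i)"
  by (auto simp: D'_def d0_def coeff_pCons split: nat.splits)

lemma N'_mem: "N' \<in> PA" and D'_mem: "D' \<in> PA"
  using N(1) D(1) d0(1) by (auto simp: N'_def D'_def PA_pCons intro!: PA_diff PA_monom)

lemma N'_PM: "N' \<in> PM"
proof (rule PM_of_pderiv[OF N'_mem])
  have "(of_nat q :: complex) \<in> M" by (rule of_nat_q_M)
  hence "pderiv N - monom (of_nat q) (q - 1) \<in> PM"
    using pderiv_N_PM by (intro PM_diff) (auto simp: PM_def)
  thus "pderiv N' \<in> PM" by (simp add: N'_def pderiv_diff pderiv_monom)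
qed (use q_pos coeff_N_0 coeff_N_big in \<open>auto simp: coeff_N'\<close>)

text \<open>Insert 1 and \<mu> into N = x^q and D = \<open>d0\<close> modulo \<open>M\<close>.
  Together the two congruences give \<mu>^(q+1) = 1, so the q-power Frobenius of the residue field
  inverts \<mu>.\<close>

lemma mu_d0: "\<mu> * d0 - 1 \<in> M" and mu_q: "\<mu> ^ q - d0 \<in> M"
proof -
  have D1: "poly D x - d0 \<in> M" if "x \<in> A" for x using poly_M[OF D_cong that] by simp
  have N1: "poly N x - x ^ q \<in> M" if "x \<in> A" for x using poly_M[OF N'_PM that] by (simp add: N'_def poly_monom)
  have "\<mu> * (poly D 1 - d0) \<in> M" using D1[OF one_mem] mu by (rule mult_M)
  hence "(poly N 1 - 1 ^ q) - \<mu> * (poly D 1 - d0) \<in> M" using N1[OF one_mem] by (rule diff_M[rotated])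
  thus "\<mu> * d0 - 1 \<in> M" by (simp add: special algebra_simps)
  have "(poly D \<mu> - d0) - (poly N \<mu> - \<mu> ^ q) \<in> M" by (rule diff_M[OF D1[OF mu] N1[OF mu]])
  thus "\<mu> ^ q - d0 \<in> M" by (simp add: special)
qed

lemma mu_unit: "\<mu> \<notin> M"
proof
  assume "\<mu> \<in> M"
  hence "\<mu> * d0 \<in> M" using d0 by (intro mult_M')
  hence "\<mu> * d0 - (\<mu> * d0 - 1) \<in> M" using mu_d0 by (rule diff_M)
  thus False by simp
qed

lemma mu_norm: "\<mu> * \<mu> ^ q - 1 \<in> M"
proof -
  have "\<mu> * (\<mu> ^ q - d0) + (\<mu> * d0 - 1) \<in> M" using mu_q mu_d0 mu by (intro add_M[OF mult_M])
  thus ?thesis by (simp add: algebra_simps)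
qed

lemma W_eq: "W = smult (of_nat q) (monom 1 (q - 1) * D) + pderiv N' * D - N * pderiv D'"
proof -
  have "pderiv N = pderiv N' + monom (of_nat q) (q - 1)" by (simp add: N'_def pderiv_diff pderiv_monom)
  moreover have "pderiv D = pderiv D'" by (simp add: D'_def pderiv_diff pderiv_pCons)
  moreover have "monom (of_nat q) (q - 1) = smult (of_nat q :: complex) (monom 1 (q - 1))" by (simp add: smult_monom)
  ultimately show ?thesis unfolding W_def by (simp add: algebra_simps)
qed


text \<open>Dividing \<open>ode\<close> by \<theta>^2 = -q yields f W1^2 = G, an equation whose
  reduction no longer vanishes.\<close>

definition \<theta> :: complex where "\<theta> = csqrt (- of_nat q)"

lemma theta_sq: "\<theta> * \<theta> = - of_nat q"
  unfolding \<theta>_def power2_eq_square[symmetric] by (rule power2_csqrt)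

lemma theta_mem: "\<theta> \<in> A" and theta_M: "\<theta> \<in> M" and theta_nz: "\<theta> \<noteq> 0"
proof -
  show 1: "\<theta> \<in> A" by (rule sqrt_mem) (simp add: theta_sq minus_mem)
  have "\<theta> * \<theta> \<in> M" unfolding theta_sq using of_nat_q_M by (rule minus_M)
  thus "\<theta> \<in> M" using prime_M[OF _ 1 1] by blast
  show "\<theta> \<noteq> 0" using theta_sq q_pos by auto
qed

definition W1 :: "complex poly" where "W1 = smult (inverse \<theta>) W"

lemma W_W1: "W = smult \<theta> W1"
  using theta_nz by (simp add: W1_def)

lemma f_W1: "f * (W1 * W1) = G"
proof -
  have "smult (\<theta> * \<theta>) (f * (W1 * W1)) = smult (\<theta> * \<theta>) G"
    using f_W unfolding theta_sq[symmetric] W_W1 by (simp add: power2_eq_square)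
  moreover have "\<theta> * \<theta> \<noteq> 0" using theta_nz by simp
  ultimately show ?thesis by (metis left_inverse smult_1_left smult_smult)
qed

lemma W1_mem: "W1 \<in> PA"
  by (rule PA_divide_sqrt[OF monic_f f_mem f_W1 G_mem])

text \<open>A coefficient of minimal valuation among those of \<open>N - x ^ q\<close> and \<open>D - d0\<close> is divisible by
  \<open>\<theta>\<close>: dividing the equation for \<open>W\<close> by it would otherwise force all quotients into \<open>M\<close>.\<close>

lemma divisible_by_theta:
  shows "smult (inverse \<theta>) N' \<in> PA" "smult (inverse \<theta>) D' \<in> PA"
proof -
  define S where "S = coeff N' ` {..q} \<union> coeff D' ` {..q}"
  have "finite S" "S \<noteq> {}" by (auto simp: S_def)
  then obtain c where c: "c \<in> S" "\<forall>s\<in>S. \<exists>a\<in>A. s = c * a" using divisor_of_finite_set by blast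
  have mem: "coeff N' i \<in> S" "coeff D' i \<in> S" for i
  proof -
    have "0 \<in> S" using coeff_N'[of q] by (force simp: S_def image_iff)
    thus "coeff N' i \<in> S" "coeff D' i \<in> S"
      using coeff_N'[of i] coeff_D'[of i] coeff_N_big[of i] coeff_D_big[of i]
      by (cases "i \<le> q"; force simp: S_def)+
  qed
  have "inverse \<theta> * c \<in> A"
  proof (rule ccontr)
    assume nA: "inverse \<theta> * c \<notin> A"
    hence c0: "c \<noteq> 0" by auto
    have tc: "\<theta> * inverse c \<in> M" using not_in_A[OF nA] theta_nz by (simp add: mult.commute)
    define N1 where "N1 = smult (inverse c) N'"
    define D1 where "D1 = smult (inverse c) D'"
    have quot: "inverse c * s \<in> A" if s: "s \<in> S" for s
    proof -
      obtain a where "a \<in> A" "s = c * a" using c(2) s by blast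
      thus ?thesis using c0 by (simp flip: mult.assoc)
    qed
    have N1: "N1 \<in> PA" and D1: "D1 \<in> PA" using quot mem by (auto simp: PA_def N1_def D1_def)
    have "smult (inverse c) W = smult (inverse c * of_nat q) (monom 1 (q - 1) * D) + pderiv N1 * D - N * pderiv D1"
      unfolding W_eq N1_def D1_def pderiv_smult by (simp add: smult_add_right smult_diff_right)
    moreover have "smult (inverse c) W \<in> PM"
      unfolding W_W1 smult_smult using tc W1_mem by (simp add: PM_smult' mult.commute)
    moreover have "smult (inverse c * of_nat q) (monom 1 (q - 1) * D) \<in> PM"
    proof -
      have "(of_nat q :: complex) = - \<theta> * \<theta>" using theta_sq by simp
      hence "inverse c * of_nat q = - \<theta> * (\<theta> * inverse c)" by simp
      also have "\<dots> \<in> M" by (rule mult_M[OF tc minus_mem[OF theta_mem]])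
      finally show ?thesis using D(1) by (intro PM_smult' PA_mult PA_monom) simp_all
    qed
    ultimately have "pderiv N1 * D - N * pderiv D1 \<in> PM"
      using PM_diff[of "smult (inverse c) W" "smult (inverse c * of_nat q) (monom 1 (q - 1) * D)"] by simp
    moreover have "pderiv N1 * D - pderiv N1 * [:d0:] \<in> PM"
      unfolding right_diff_distrib[symmetric] using D_cong N1 by (intro PM_mult' PA_pderiv)
    moreover have "N * pderiv D1 - monom 1 q * pderiv D1 \<in> PM"
      unfolding left_diff_distrib[symmetric] N'_def[symmetric] using N'_PM D1 by (intro PM_mult PA_pderiv)
    ultimately have "(pderiv N1 * D - N * pderiv D1) - (pderiv N1 * D - pderiv N1 * [:d0:]) + (N * pderiv D1 - monom 1 q * pderiv D1) \<in> PM"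
      by (rule PM_add[OF PM_diff])
    \<comment> \<open>\<open>N1\<close> and \<open>D1\<close> have degree below q. So the first term
      has no coefficient from x^q on and the second none below x^q: both vanish modulo
      \<open>M\<close>.\<close>
    hence key: "smult d0 (pderiv N1) - monom 1 q * pderiv D1 \<in> PM" by simp
    have N1big: "coeff N1 i = 0" if "i \<ge> q" for i using that coeff_N_big[of i] by (simp add: N1_def coeff_N')
    have D1big: "coeff D1 i = 0" if "i \<ge> q" for i using that coeff_D_big[of i] by (simp add: D1_def coeff_D')
    have "pderiv D1 \<in> PM"
      unfolding PM_def
    proof (intro CollectI allI)
      fix i
      have "- coeff (pderiv D1) i = coeff (smult d0 (pderiv N1) - monom 1 q * pderiv D1) (q + i)"
        by (simp add: coeff_monom_mult coeff_pderiv N1big)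
      hence "- coeff (pderiv D1) i \<in> M" using PM_coeff[OF key] by simp
      thus "coeff (pderiv D1) i \<in> M" using minus_M by force
    qed
    hence D1M: "D1 \<in> PM" by (rule PM_of_pderiv[OF D1]) (auto simp: D1big, simp add: D1_def coeff_D')
    have "smult d0 (pderiv N1) \<in> PM"
      using PM_add[OF key PM_mult'[OF \<open>pderiv D1 \<in> PM\<close>, of "monom 1 q"]] by (simp add: PA_monom)
    hence "[:d0:] * pderiv N1 \<in> PM" by simp
    hence "pderiv N1 \<in> PM" using prime_PM[of "[:d0:]" "pderiv N1"] d0 N1 PM_coeff[of "[:d0:]" 0]
      by (auto simp: PA_pCons PA_pderiv)
    hence N1M: "N1 \<in> PM" by (rule PM_of_pderiv[OF N1]) (auto simp: N1big, simp add: N1_def coeff_N' coeff_N_0 q_pos)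
    have "\<exists>i. c = coeff N' i \<or> c = coeff D' i" using c(1) by (auto simp: S_def)
    hence "\<exists>i. 1 = coeff N1 i \<or> 1 = coeff D1 i"
      unfolding N1_def D1_def coeff_smult using left_inverse[OF c0] by metis
    thus False using PM_coeff[OF N1M] PM_coeff[OF D1M] one_not_M by metis
  qed
  hence "inverse \<theta> * s \<in> A" if "s \<in> S" for s
    using c(2) that mult_mem by (metis mult.assoc)
  thus "smult (inverse \<theta>) N' \<in> PA" "smult (inverse \<theta>) D' \<in> PA" using mem by (auto simp: PA_def)
qed

text \<open>Both deviations are divisible by \<theta>. In the coefficient of \<open>W\<close> at q -
  1, the terms linear in them vanish: \<open>N'\<close> has no x^q term, and x^q times a polynomial
  starts too late. What remains, q d0 and a term quadratic in the deviations, is divisible by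
  \<theta>^2, so \<theta> divides the coefficient of \<open>W1\<close>.\<close>

lemma coeff_W1_M: "coeff W1 (q - 1) \<in> M"
proof -
  define N2 where "N2 = smult (inverse \<theta>) N'" define D2 where "D2 = smult (inverse \<theta>) D'"
  have N2: "N' = smult \<theta> N2" "N2 \<in> PA" and D2: "D' = smult \<theta> D2" "D2 \<in> PA"
    using divisible_by_theta theta_nz by (simp_all add: N2_def D2_def)
  have Nn: "N = monom 1 q + N'" and Dd: "D = [:d0:] + D'" by (simp_all add: N'_def D'_def)
  have "W = smult (of_nat q) (monom 1 (q - 1) * D) + smult d0 (pderiv N') - monom 1 q * pderiv D'
     + (pderiv N' * D' - N' * pderiv D')"
    unfolding W_eq by (subst (2) Dd, subst Nn) (simp add: algebra_simps)
  also have "pderiv N' * D' - N' * pderiv D' = smult (\<theta> * \<theta>) (pderiv N2 * D2 - N2 * pderiv D2)"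
    unfolding N2 D2 by (simp add: pderiv_smult smult_diff_right)
  finally have "coeff W (q - 1) = of_nat q * d0 + d0 * coeff (pderiv N') (q - 1)
     - coeff (monom 1 q * pderiv D') (q - 1) + \<theta> * \<theta> * coeff (pderiv N2 * D2 - N2 * pderiv D2) (q - 1)"
    by (simp add: coeff_monom_mult d0_def)
  also have "coeff (pderiv N') (q - 1) = 0" using q_pos by (simp add: coeff_pderiv coeff_N')
  also have "coeff (monom 1 q * pderiv D') (q - 1) = 0" using q_pos by (simp add: coeff_monom_mult)
  also have "(of_nat q :: complex) = - (\<theta> * \<theta>)" using theta_sq by simp
  finally have "\<theta> * coeff W1 (q - 1) = \<theta> * (\<theta> * (coeff (pderiv N2 * D2 - N2 * pderiv D2) (q - 1) - d0))"
    unfolding W_W1 by (simp add: algebra_simps)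
  hence "coeff W1 (q - 1) = (coeff (pderiv N2 * D2 - N2 * pderiv D2) (q - 1) - d0) * \<theta>"
    using theta_nz by simp
  also have "\<dots> \<in> M"
    using N2(2) D2(2) d0(1) by (intro mult_M theta_M diff_mem PA_coeff PA_diff PA_mult PA_pderiv)
  finally show ?thesis .
qed

lemma f_power_cong: "f ^ q - monom 1 q * ((monom 1 q - [:1:]) * (monom 1 q - [:\<mu> ^ q:])) \<in> PM"
proof -
  have f: "f ^ q = monom 1 q * ([:- 1, 1:] ^ q * [:- \<mu>, 1:] ^ q)"
  proof -
    have "f = monom 1 1 * ([:- 1, 1:] * [:- \<mu>, 1:])" by (simp add: f_def monom_Suc algebra_simps)
    thus ?thesis by (simp only: power_mult_distrib monom_power) simp
  qed
  have mem: "[:- 1, 1:] \<in> PA" "[:- \<mu>, 1:] \<in> PA" using mu minus_mem by (auto simp: PA_pCons)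
  have 1: "[:- 1, 1:] ^ q - (monom 1 q - [:1:]) \<in> PM" using linear_power_cong[OF one_mem odd_q] by simp
  have "[:- 1, 1:] ^ q * [:- \<mu>, 1:] ^ q - (monom 1 q - [:1:]) * (monom 1 q - [:\<mu> ^ q:]) \<in> PM"
    by (rule cong_mult_PM[OF 1 linear_power_cong[OF mu odd_q]])
       (use mem in \<open>auto intro!: PA_power PA_diff PA_monom simp: PA_pCons\<close>)
  thus ?thesis unfolding f right_diff_distrib[symmetric] by (intro PM_mult' PA_monom) simp_all
qed

text \<open>By \<open>mu_d0\<close> the four factors of \<open>G\<close> reduce to d0, x^q, x^q -
  \<mu>^q and x^q - 1, and the last three multiply to f^q modulo \<open>M\<close>.\<close>

lemma G_cong: "G - smult d0 (f ^ q) \<in> PM"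
proof -
  let ?x = "monom 1 q :: complex poly"
  have x: "?x \<in> PA" by (simp add: PA_monom)
  have c: "[:a:] - [:b:] \<in> PM" if "a - b \<in> M" for a b using that by (simp add: PM_pCons)
  have Nx: "N - ?x \<in> PM" using N'_PM by (simp add: N'_def)
  have ND: "N - D - (?x - [:\<mu> ^ q:]) \<in> PM"
  proof -
    have "[:\<mu> ^ q:] - [:d0:] \<in> PM" using mu_q by (rule c)
    hence "(N - ?x) - (D - [:d0:]) + ([:\<mu> ^ q:] - [:d0:]) \<in> PM" using Nx D_cong by (intro PM_add[OF PM_diff])
    moreover have "(N - ?x) - (D - [:d0:]) + ([:\<mu> ^ q:] - [:d0:]) = N - D - (?x - [:\<mu> ^ q:])" by (simp add: algebra_simps)
    ultimately show ?thesis by (simp only:)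
  qed
  have NmD: "N - smult \<mu> D - (?x - [:1:]) \<in> PM"
  proof -
    have "1 - \<mu> * d0 \<in> M" using minus_M[OF mu_d0] by simp
    hence "[:1:] - [:\<mu> * d0:] \<in> PM" by (rule c)
    hence "(N - ?x) - smult \<mu> (D - [:d0:]) + ([:1:] - [:\<mu> * d0:]) \<in> PM"
      using Nx D_cong mu by (intro PM_add[OF PM_diff] PM_smult)
    moreover have "(N - ?x) - smult \<mu> (D - [:d0:]) + ([:1:] - [:\<mu> * d0:]) = N - smult \<mu> D - (?x - [:1:])"
      by (simp add: algebra_simps smult_diff_right)
    ultimately show ?thesis by (simp only:)
  qed
  have mem: "?x - [:\<mu> ^ q:] \<in> PA" "?x - [:1:] \<in> PA" "N - D \<in> PA" "N - smult \<mu> D \<in> PA" "[:d0:] \<in> PA"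
    using x mu N(1) D(1) d0(1) by (auto intro!: PA_diff PA_smult power_mem simp: PA_pCons)
  have "D * N * (N - D) * (N - smult \<mu> D) - [:d0:] * ?x * (?x - [:\<mu> ^ q:]) * (?x - [:1:]) \<in> PM"
    by (intro cong_mult_PM Nx ND NmD D_cong PA_mult mem x N(1))
  moreover have "smult d0 (f ^ q - ?x * ((?x - [:1:]) * (?x - [:\<mu> ^ q:]))) \<in> PM"
    using f_power_cong d0(1) by (intro PM_smult)
  ultimately have "(D * N * (N - D) * (N - smult \<mu> D) - [:d0:] * ?x * (?x - [:\<mu> ^ q:]) * (?x - [:1:]))
     - smult d0 (f ^ q - ?x * ((?x - [:1:]) * (?x - [:\<mu> ^ q:]))) \<in> PM" by (rule PM_diff)
  moreover have "(D * N * (N - D) * (N - smult \<mu> D) - [:d0:] * ?x * (?x - [:\<mu> ^ q:]) * (?x - [:1:]))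
     - smult d0 (f ^ q - ?x * ((?x - [:1:]) * (?x - [:\<mu> ^ q:]))) = G - smult d0 (f ^ q)"
    unfolding G_def by (simp add: smult_diff_right mult_ac)
  ultimately show ?thesis by (simp only:)
qed

text \<open>Cancelling f in f W1^2 = d0 f^q leaves W1^2 = d0 f^(q-1) modulo \<open>M\<close>, so W1
  reduces to a square root of d0 times f^((q-1)/2), up to sign. Comparing coefficients at q - 1
  shows that the Hasse invariant of the reduced Legendre curve vanishes.\<close>

lemma coeff_f_power: "coeff (f ^ ((q - 1) div 2)) (q - 1) \<in> M"
proof -
  define m where "m = (q - 1) div 2"
  have q: "q = Suc (m + m)" using odd_q by (simp add: m_def) presburger
  define k where "k = csqrt d0"
  have kk: "k * k = d0" unfolding k_def power2_eq_square[symmetric] by (rule power2_csqrt)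
  have k: "k \<in> A" by (rule sqrt_mem) (simp add: kk d0)
  have kM: "k \<notin> M" using d0(2) mult_M[of k k] k by (auto simp: kk)
  have "f * (W1 * W1) - f * smult d0 (f ^ m * f ^ m) \<in> PM"
    using G_cong unfolding f_W1 by (subst (asm) q) (simp add: Power.power_add)
  hence "f * (W1 * W1 - smult d0 (f ^ m * f ^ m)) \<in> PM" by (simp add: algebra_simps)
  moreover have mem: "f ^ m \<in> PA" using f_mem by (rule PA_power)
  ultimately have "W1 * W1 - smult d0 (f ^ m * f ^ m) \<in> PM"
    using prime_PM[of f "W1 * W1 - smult d0 (f ^ m * f ^ m)"] monic_not_PM[OF monic_f] f_mem W1_mem d0(1)
    by (auto intro!: PA_diff PA_mult PA_smult)
  moreover have "W1 * W1 - smult d0 (f ^ m * f ^ m) = (W1 - smult k (f ^ m)) * (W1 + smult k (f ^ m))"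
    unfolding kk[symmetric] by (simp add: algebra_simps)
  ultimately have "(W1 - smult k (f ^ m)) * (W1 + smult k (f ^ m)) \<in> PM" by simp
  hence "W1 - smult k (f ^ m) \<in> PM \<or> W1 + smult k (f ^ m) \<in> PM"
    using mem k W1_mem by (intro prime_PM) (auto intro!: PA_diff PA_add PA_smult)
  hence "k * coeff (f ^ m) (q - 1) \<in> M"
  proof
    assume "W1 - smult k (f ^ m) \<in> PM"
    hence "coeff W1 (q - 1) - coeff (W1 - smult k (f ^ m)) (q - 1) \<in> M"
      using coeff_W1_M by (intro diff_M[OF _ PM_coeff])
    thus ?thesis by simp
  next
    assume "W1 + smult k (f ^ m) \<in> PM"
    hence "coeff (W1 + smult k (f ^ m)) (q - 1) - coeff W1 (q - 1) \<in> M"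
      using coeff_W1_M by (intro diff_M[OF PM_coeff])
    thus ?thesis by simp
  qed
  thus ?thesis using prime_M kM k PA_coeff[OF mem] m_def by blast
qed

end


section \<open>Descent of the Legendre parameter to an integer parameter\<close>

context place begin

lemma synthetic_div_PA: "p \<in> PA \<Longrightarrow> r \<in> A \<Longrightarrow> synthetic_div p r \<in> PA \<and> poly p r \<in> A"
  by (induction p) (auto simp: PA_pCons synthetic_div_pCons intro: add_mem mult_mem)

lemma PM_of_many_roots:
  assumes "p \<in> PA" "finite S" "S \<subseteq> A" "\<And>s t. s \<in> S \<Longrightarrow> t \<in> S \<Longrightarrow> s \<noteq> t \<Longrightarrow> s - t \<notin> M"
    "\<And>s. s \<in> S \<Longrightarrow> poly p s \<in> M" "card S > degree p"
  shows "p \<in> PM"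
  using assms
proof (induction "card S" arbitrary: S p)
  case (Suc k)
  then obtain r where r: "r \<in> S" by (metis card_gt_0_iff all_not_in_conv zero_less_Suc)
  hence rA: "r \<in> A" and pr: "poly p r \<in> M" using Suc.prems by auto
  define s where "s = synthetic_div p r"
  have s: "s \<in> PA" using synthetic_div_PA[OF Suc.prems(1) rA] by (simp add: s_def)
  have p: "p = [:- r, 1:] * s + [:poly p r:]" unfolding s_def using synthetic_div_correct'[of r p] by simp
  have "s \<in> PM"
  proof (cases "degree p = 0")
    case True
    thus ?thesis by (simp add: s_def synthetic_div_eq_0_iff[THEN iffD2])
  next
    case False
    have "k = card (S - {r})" using Suc.hyps(2) r Suc.prems(2) by simp
    moreover have "card (S - {r}) > degree s"
      using False Suc.prems(6) r Suc.prems(2) by (simp add: s_def degree_synthetic_div)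
    moreover have "poly s t \<in> M" if "t \<in> S - {r}" for t
    proof -
      have t: "t \<in> S" "t \<noteq> r" using that by auto
      have "poly p t - poly p r \<in> M" using Suc.prems(5) t r by (intro diff_M) auto
      moreover have "poly p t = (t - r) * poly s t + poly p r" by (subst p) (simp add: algebra_simps)
      ultimately have "(t - r) * poly s t \<in> M" by simp
      thus ?thesis using prime_M[of "t - r" "poly s t"] Suc.prems(3,4) t r poly_mem[OF s] diff_mem by blast
    qed
    ultimately show ?thesis using s Suc.prems by (intro Suc.hyps(1)[of "S - {r}"]) auto
  qed
  hence "[:- r, 1:] * s \<in> PM" using rA minus_mem by (intro PM_mult') (auto simp: PA_pCons)
  thus ?case by (subst p) (intro PM_add, auto simp: PM_pCons pr)
qed simp

text \<open>The residues of 0, ..., q - 1 are already q roots of X^q - X, and a nonzero polynomial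
  over a field has no more roots than its degree (\<open>PM_of_many_roots\<close>).\<close>

lemma residue_of_frobenius_fixed:
  assumes c: "c \<in> A" "c ^ q - c \<in> M"
  shows "\<exists>k::int. c - of_int k \<in> M"
proof (rule ccontr)
  assume no: "\<nexists>k::int. c - of_int k \<in> M"
  let ?p = "monom 1 q - monom 1 1 :: complex poly"
  have q1: "q > 1" using prime_q by (rule prime_gt_1_nat)
  define S where "S = insert c (of_nat ` {..<q})"
  have "c \<notin> of_nat ` {..<q}"
  proof
    assume "c \<in> of_nat ` {..<q}"
    then obtain j where "c = of_int (int j)" by auto
    thus False using no by (metis diff_self zero_M)
  qed
  moreover have "card (of_nat ` {..<q} :: complex set) = q" by (subst card_image) (auto simp: inj_on_def)
  ultimately have card: "card S = Suc q" by (simp add: S_def)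
  have nat: "of_nat j ^ q - of_nat j \<in> M" for j
  proof -
    have "[int j ^ q = int j] (mod int q)"
    proof (cases "q dvd j")
      case True
      hence "int q dvd int j" by simp
      moreover have "int q dvd int j ^ q" using True q1 by (intro dvd_power_le[of _ _ 1 q, simplified]) auto
      ultimately show ?thesis by (simp add: cong_iff_dvd_diff)
    next
      case False
      have "[j ^ (q - 1) = 1] (mod q)" using prime_q False by (rule fermat_theorem)
      hence "[j ^ (q - 1) * j = 1 * j] (mod q)" by (rule cong_scalar_right)
      moreover have "j ^ (q - 1) * j = j ^ q" using q1 by (metis gr_implies_not0 mult.commute power_eq_if)
      ultimately have "[j ^ q = j] (mod q)" by simp
      thus ?thesis by (metis cong_int_iff of_nat_power)
    qed
    hence "int q dvd int j ^ q - int j" by (simp add: cong_iff_dvd_diff)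
    hence "of_int (int j ^ q - int j) \<in> M" by (simp only: of_int_M_iff)
    thus ?thesis by simp
  qed
  have "?p \<in> PM"
  proof (rule PM_of_many_roots[of ?p S])
    show "?p \<in> PA" by (intro PA_diff PA_monom) simp_all
    show "S \<subseteq> A" using c by (auto simp: S_def)
    show "s - t \<notin> M" if "s \<in> S" "t \<in> S" "s \<noteq> t" for s t
    proof
      assume st: "s - t \<in> M"
      have cj: "c - of_nat j \<notin> M" for j using no by (metis of_int_of_nat_eq)
      consider i j where "s = of_nat i" "t = of_nat j" "i < q" "j < q" | j where "s = c" "t = of_nat j" | i where "s = of_nat i" "t = c"
        using \<open>s \<in> S\<close> \<open>t \<in> S\<close> \<open>s \<noteq> t\<close> by (auto simp: S_def)
      thus False
      proof cases
        case 1
        have "of_int (int i - int j) \<in> M" using st 1 by simp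
        hence "int q dvd int i - int j" by (simp only: of_int_M_iff)
        hence "int i mod int q = int j mod int q" by (rule mod_eq_dvd_iff[THEN iffD2])
        hence "i = j" using 1 by simp
        thus False using \<open>s \<noteq> t\<close> 1 by simp
      next
        case 2
        thus False using st cj by simp
      next
        case 3
        thus False using minus_M[OF st] cj by simp
      qed
    qed
    show "poly ?p s \<in> M" if "s \<in> S" for s using that c(2) nat by (auto simp: S_def poly_monom)
    have "degree ?p \<le> q" using q1 by (intro degree_diff_le) (auto intro: order_trans[OF degree_monom_le])
    thus "card S > degree ?p" using card by simp
  qed (simp add: S_def)
  moreover have "coeff ?p q = 1" using q1 by simp
  ultimately show False using PM_coeff[of ?p q] by simp
qed

lemma freshman_M:
  assumes "x \<in> A" "y \<in> A" "odd q"
  shows "(x + y) ^ q - (x ^ q + y ^ q) \<in> M"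
proof -
  have "poly ([:- (- y), 1:] ^ q - (monom 1 q - [:(- y) ^ q:])) x \<in> M"
    using assms by (intro poly_M linear_power_cong minus_mem)
  thus ?thesis using assms(3) by (simp add: poly_monom algebra_simps)
qed

end

lemma coeff_even_power:
  "coeff ([:b, 0, 1:] ^ (2 * l)) (2 * l) = of_nat (2 * l choose l) * (b::'a::comm_ring_1) ^ l"
proof -
  have "[:b, 0, 1:] = monom 1 2 + [:b:]" by (simp add: monom_altdef numeral_2_eq_2)
  hence "[:b, 0, 1:] ^ (2 * l) = (\<Sum>k\<le>2 * l. of_nat (2 * l choose k) * monom 1 2 ^ k * [:b:] ^ (2 * l - k))"
    by (simp only: binomial_ring)
  also have "\<dots> = (\<Sum>k\<le>2 * l. monom (of_nat (2 * l choose k) * b ^ (2 * l - k)) (2 * k))"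
    by (intro sum.cong refl) (simp add: monom_power of_nat_poly poly_const_pow smult_monom mult.commute)
  finally have "coeff ([:b, 0, 1:] ^ (2 * l)) (2 * l)
      = (\<Sum>k\<le>2 * l. if k = l then of_nat (2 * l choose k) * b ^ (2 * l - k) else 0)"
    by (auto simp: coeff_sum intro!: sum.cong)
  thus ?thesis by (simp add: mult_2)
qed

context place_isogeny begin

text \<open>Since \<mu>^q reduces to 1/\<mu>, the quantity c = \<mu> + 1/\<mu> + 2 = (1 + \<mu>)^2 /
  \<mu> is fixed by the residual Frobenius and congruent to an integer k. Scaling x by u = -k / (1 +
  \<mu>) turns x^2 - (1 + \<mu>) x + \<mu> into x^2 + k x + k^2/c, congruent to x^2 + k x + k, and
  multiplies the middle coefficient of the m-th power by u^m.\<close>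

lemma integer_parameter:
  "\<exists>k::int. \<not> int q dvd k \<and> \<not> int q dvd k - 4 \<and> int q dvd coeff ([:k, k, 1:] ^ ((q - 1) div 2)) ((q - 1) div 2)"
proof -
  define l where "l = (q - 1) div 4"
  define m where "m = 2 * l"
  have q: "q = 2 * m + 1" using q_mod_4 unfolding m_def l_def by presburger
  have m: "(q - 1) div 2 = m" using q by simp
  have b: "\<not> q dvd (2 * m choose m)" using prime_q q by (rule central_binomial_nonzero)
  have "coeff (f ^ m) (2 * m) \<in> M" using coeff_f_power m q by simp
  hence T: "coeff ([:\<mu>, - (1 + \<mu>), 1:] ^ m) m \<in> M" unfolding f_def coeff_pCons_0_power .
  have mem: "[:\<mu>, - (1 + \<mu>), 1:] \<in> PA" using f_mem by (simp add: f_def PA_pCons)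
  have cong: "coeff (P ^ m) m \<in> M \<longleftrightarrow> coeff (R ^ m) m \<in> M" if "P - R \<in> PM" "P \<in> PA" "R \<in> PA" for P R
  proof -
    have "coeff (P ^ m - R ^ m) m \<in> M" by (intro PM_coeff cong_power_PM that)
    hence *: "coeff (P ^ m) m - coeff (R ^ m) m \<in> M" by simp
    show ?thesis using add_M[OF *, of "coeff (R ^ m) m"] diff_M[OF _ *, of "coeff (P ^ m) m"] by auto
  qed
  \<comment> \<open>At \<mu> = 1 the vanishing coefficient would be, up to sign, the central
    binomial coefficient of 2m, a unit. This will exclude k = 4.\<close>
  have mu1: "\<mu> - 1 \<notin> M"
  proof
    assume 1: "\<mu> - 1 \<in> M"
    have "[:\<mu>, - (1 + \<mu>), 1:] - [:1, - (1 + 1), 1:] \<in> PM" using 1 minus_M[OF 1] by (simp add: PM_pCons)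
    hence "coeff ([:1, - (1 + 1), 1:] ^ m) m \<in> M" using T mem by (subst (asm) cong) (auto simp: PA_pCons minus_mem)
    hence "coeff ([:0, 1, - (1 + 1), 1:] ^ m) (2 * m) \<in> M" unfolding coeff_pCons_0_power .
    hence "(-1) ^ m * of_nat (\<Sum>i\<le>m. (m choose i)^2) \<in> M" unfolding legendre_coeff by simp
    hence "of_nat (2 * m choose m) \<in> M" unfolding choose_square_sum by (simp add: m_def)
    thus False using b by (simp add: of_nat_M_iff)
  qed
  \<comment> \<open>At \<mu> = -1 the polynomial is even, and because q = 1 modulo 4 the exponent m
    = 2l is even too, so the middle coefficient is a binomial coefficient times a power of \<mu>, a
    unit. This will exclude k = 0.\<close>
  have mu_m1: "\<mu> + 1 \<notin> M"
  proof
    assume 1: "\<mu> + 1 \<in> M"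
    have "[:\<mu>, - (1 + \<mu>), 1:] - [:\<mu>, 0, 1:] \<in> PM" using minus_M[OF 1] by (simp add: PM_pCons algebra_simps)
    hence "coeff ([:\<mu>, 0, 1:] ^ m) m \<in> M" using T mem mu by (subst (asm) cong) (auto simp: PA_pCons)
    hence "of_nat (m choose l) * \<mu> ^ l \<in> M" unfolding m_def coeff_even_power .
    hence "of_nat (m choose l) \<in> M" using prime_M[of "of_nat (m choose l)" "\<mu> ^ l"] power_M[of \<mu> l] mu mu_unit power_mem[OF mu] by auto
    hence "q dvd (m choose l)" by (simp only: of_nat_M_iff)
    hence "q dvd (fact m :: nat)" using binomial_fact_lemma[of l m] by (metis dvd_mult le_add1 m_def mult_2)
    thus False using prime_q q by (simp add: prime_dvd_fact_iff)
  qed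
  have mu0: "\<mu> \<noteq> 0" and imu: "inverse \<mu> \<in> A" using mu_unit unit_iff[OF mu] by auto
  define c where "c = \<mu> + inverse \<mu> + 2"
  have cA: "c \<in> A" unfolding c_def using mu imu by (intro add_mem) simp_all
  have mu_inv: "\<mu> * inverse \<mu> = 1" using mu0 by simp
  have "\<mu> + v + 2 = (1 + \<mu>)^2 * v \<and> \<mu> + v + 2 - 4 = (\<mu> - 1)^2 * v" if "\<mu> * v = 1" for v
    using that by Groebner_Basis.algebra
  from this[OF mu_inv] have c1: "c = (1 + \<mu>)^2 * inverse \<mu>" and c4: "c - 4 = (\<mu> - 1)^2 * inverse \<mu>"
    unfolding c_def by blast+
  have imuM: "inverse \<mu> \<notin> M" using mu0 mu unit_iff[OF imu] by simp
  have muq: "\<mu> ^ q - inverse \<mu> \<in> M"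
  proof -
    have "inverse \<mu> * (\<mu> * \<mu> ^ q - 1) \<in> M" using mu_norm imu by (rule mult_M)
    moreover have "v * (\<mu> * w - 1) = w - v" if "\<mu> * v = 1" for v w using that by Groebner_Basis.algebra
    ultimately show ?thesis using mu_inv by metis
  qed
  have imuq: "inverse \<mu> ^ q - \<mu> \<in> M"
  proof -
    have "- (inverse \<mu> ^ q) * (\<mu> * \<mu> ^ q - 1) \<in> M" using mu_norm imu by (intro mult_M minus_mem power_mem)
    moreover have "inverse \<mu> ^ q * \<mu> ^ q = 1" using mu0 by (simp flip: power_mult_distrib)
    hence "inverse \<mu> ^ q * (\<mu> * \<mu> ^ q) = \<mu>" by (simp add: mult.left_commute)
    hence "- (inverse \<mu> ^ q) * (\<mu> * \<mu> ^ q - 1) = inverse \<mu> ^ q - \<mu>" by (simp add: algebra_simps)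
    ultimately show ?thesis by simp
  qed
  have two: "2 ^ q - 2 \<in> M"
    using freshman_M[OF one_mem one_mem odd_q] by simp
  have "c ^ q - c \<in> M"
  proof -
    have 1: "c ^ q - ((\<mu> + inverse \<mu>) ^ q + 2 ^ q) \<in> M"
      unfolding c_def by (intro freshman_M add_mem mu imu odd_q) simp
    have 2: "(\<mu> + inverse \<mu>) ^ q - (\<mu> ^ q + inverse \<mu> ^ q) \<in> M"
      by (intro freshman_M mu imu odd_q)
    have "c ^ q - c = (c ^ q - ((\<mu> + inverse \<mu>) ^ q + 2 ^ q)) + ((\<mu> + inverse \<mu>) ^ q - (\<mu> ^ q + inverse \<mu> ^ q))
       + (\<mu> ^ q - inverse \<mu>) + (inverse \<mu> ^ q - \<mu>) + (2 ^ q - 2)" by (simp add: c_def)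
    thus ?thesis using 1 2 muq imuq two by (simp only: add_M)
  qed
  then obtain k :: int where k: "c - of_int k \<in> M" using residue_of_frobenius_fixed[OF cA] by blast
  have cM: "c \<notin> M"
  proof
    assume "c \<in> M"
    hence "(1 + \<mu>)^2 * inverse \<mu> \<in> M" unfolding c1 .
    moreover have "(1 + \<mu>)^2 \<in> A" using mu by (intro power_mem add_mem) simp_all
    ultimately have "(1 + \<mu>)^2 \<in> M" using prime_M imuM imu by blast
    hence "1 + \<mu> \<in> M" using add_mem[OF one_mem mu] by (rule power_M)
    thus False using mu_m1 by (simp add: add.commute)
  qed
  have c4M: "c - 4 \<notin> M"
  proof
    assume "c - 4 \<in> M"
    hence "(\<mu> - 1)^2 * inverse \<mu> \<in> M" unfolding c4 .
    moreover have "(\<mu> - 1)^2 \<in> A" using mu by (intro power_mem diff_mem) simp_all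
    ultimately have "(\<mu> - 1)^2 \<in> M" using prime_M imuM imu by blast
    hence "\<mu> - 1 \<in> M" using diff_mem[OF mu one_mem] by (rule power_M)
    thus False using mu1 by simp
  qed
  have k0: "\<not> int q dvd k"
  proof
    assume "int q dvd k"
    hence "of_int k \<in> M" by (simp only: of_int_M_iff)
    thus False using add_M[OF k, of "of_int k"] cM by simp
  qed
  have k4: "\<not> int q dvd k - 4"
  proof
    assume "int q dvd k - 4"
    hence "of_int (k - 4) \<in> M" by (simp only: of_int_M_iff)
    thus False using add_M[OF k, of "of_int (k - 4)"] c4M by simp
  qed
  define a where "a = - (1 + \<mu>)"
  have aA: "a \<in> A" unfolding a_def using mu by (intro minus_mem add_mem) simp_all
  have aM: "a \<notin> M" using mu_m1 minus_M[of a] by (auto simp: a_def add.commute)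
  hence a0: "a \<noteq> 0" and ia: "inverse a \<in> A" using unit_iff[OF aA] by auto
  define u where "u = of_int k * inverse a"
  have uA: "u \<in> A" unfolding u_def using ia by (intro mult_mem) simp_all
  have c0: "c \<noteq> 0" and ic: "inverse c \<in> A" using unit_iff[OF cA] cM by auto
  have scaled: "coeff ([:u^2 * \<mu>, u * a, 1:] ^ m) m = u ^ m * coeff ([:\<mu>, a, 1:] ^ m) m"
  proof (cases "u = 0")
    case False
    have "smult (u^2) [:\<mu>, a, 1:] = [:u^2 * \<mu>, u * a, 1:] \<circ>\<^sub>p [:0, u:]"
      by (simp add: pcompose_pCons power2_eq_square mult_ac)
    hence "smult (u^2) [:\<mu>, a, 1:] ^ m = ([:u^2 * \<mu>, u * a, 1:] ^ m) \<circ>\<^sub>p [:0, u:]"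
      by (simp only: pcompose_hom.hom_power)
    hence "smult ((u^2) ^ m) ([:\<mu>, a, 1:] ^ m) = ([:u^2 * \<mu>, u * a, 1:] ^ m) \<circ>\<^sub>p [:0, u:]" by (simp only: smult_power)
    hence "(u^2) ^ m * coeff ([:\<mu>, a, 1:] ^ m) m = coeff (([:u^2 * \<mu>, u * a, 1:] ^ m) \<circ>\<^sub>p [:0, u:]) m"
      by (metis coeff_smult)
    also have "\<dots> = u ^ m * coeff ([:u^2 * \<mu>, u * a, 1:] ^ m) m" by (simp add: coeff_pcompose_linear)
    finally show ?thesis using False by (simp add: power2_eq_square power_mult_distrib)
  next
    case True
    hence "of_int k = (0::complex)" using a0 by (simp add: u_def)
    thus ?thesis using k0 by simp
  qed
  have "[:u^2 * \<mu>, u * a, 1:] - [:of_int k, of_int k, 1:] \<in> PM"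
  proof -
    have ka: "u * a = of_int k" using a0 by (simp add: u_def)
    have "(K * v)^2 * \<mu> - K = (K * (K * \<mu> - a^2)) * v^2" if "a * v = 1" for v K :: complex
      using that by Groebner_Basis.algebra
    from this[of "inverse a" "of_int k"] a0
    have "u^2 * \<mu> - of_int k = (of_int k * (of_int k * \<mu> - a^2)) * (inverse a)^2" by (simp add: u_def)
    also have "of_int k * \<mu> - a^2 = - ((c - of_int k) * \<mu>)"
    proof -
      have "c * \<mu> = a^2" unfolding c1 a_def using mu0 by (simp add: field_simps power2_eq_square)
      thus ?thesis by (simp add: algebra_simps)
    qed
    also have "(of_int k * - ((c - of_int k) * \<mu>)) * (inverse a)^2 \<in> M"
      using k mu ia by (intro mult_M' mult_M minus_M power_mem) simp_all
    finally show ?thesis using ka by (simp add: PM_pCons)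
  qed
  moreover have "coeff ([:u^2 * \<mu>, u * a, 1:] ^ m) m \<in> M"
    unfolding scaled using T uA by (intro mult_M power_mem) (simp_all add: a_def)
  ultimately have "coeff ([:of_int k, of_int k, 1:] ^ m) m \<in> M"
    using uA aA mu by (subst (asm) cong) (auto simp: PA_pCons intro!: mult_mem power_mem)
  moreover have "map_poly of_int [:k, k, 1:] = ([:of_int k, of_int k, 1:] :: complex poly)"
    by (simp add: map_poly_pCons)
  ultimately have "of_int (coeff ([:k, k, 1:] ^ m) m) \<in> M" by (simp add: of_int_coeff_power)
  hence "int q dvd coeff ([:k, k, 1:] ^ m) m" by (simp only: of_int_M_iff)
  thus ?thesis using k0 k4 m by auto
qed

end


section \<open>Existence of places by maximal subrings\<close>

context complex_subring
begin

definition poly_hits :: "complex \<Rightarrow> complex \<Rightarrow> nat \<Rightarrow> bool" where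
  "poly_hits b x n \<longleftrightarrow> (\<exists>P\<in>PA. degree P \<le> n \<and> poly P x = b)"

lemma PA_sum: "(\<And>i. i \<in> I \<Longrightarrow> p i \<in> PA) \<Longrightarrow> sum p I \<in> PA"
  by (induction I rule: infinite_finite_induct) (auto intro: PA_add)

text \<open>Multiplied by x^n, the relation for 1/x has leading coefficient (1 - c b) / c, where 1 -
  c b is a unit. So x^n is a polynomial in x of smaller degree with coefficients in the ring, and
  substituting it removes the top term of the relation for x.\<close>

lemma poly_hits_reduce:
  assumes c: "c \<in> A" "inverse c \<notin> A" and unit: "\<And>a. a \<in> A \<Longrightarrow> inverse (1 + c * a) \<in> A"
    and x: "x \<noteq> 0" and P: "poly_hits (inverse c) x n" and Q: "poly_hits (inverse c) (inverse x) m"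
    and m: "0 < m" "m \<le> n"
  shows "poly_hits (inverse c) x (n - 1)"
proof -
  have c0: "c \<noteq> 0" using c(2) by auto
  obtain p where p: "p \<in> PA" "degree p \<le> n" "poly p x = inverse c" using P by (auto simp: poly_hits_def)
  obtain r where r: "r \<in> PA" "degree r \<le> m" "poly r (inverse x) = inverse c" using Q by (auto simp: poly_hits_def)
  define b where "b = coeff r 0"
  have b: "b \<in> A" unfolding b_def using r(1) by (rule PA_coeff)
  define d where "d = 1 - c * b"
  have d: "inverse d \<in> A" using unit[OF minus_mem[OF b]] by (simp add: d_def)
  have d0: "d \<noteq> 0"
  proof
    assume "d = 0"
    hence "c * b = 1" by (simp add: d_def)
    hence "inverse c = b" by (rule inverse_unique)
    thus False using c b by simp
  qed
  define s where "s = (\<Sum>i\<in>{1..m}. monom (coeff r i) (n - i))"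
  have s: "s \<in> PA" unfolding s_def using r(1) by (intro PA_sum PA_monom PA_coeff)
  have ds: "degree s \<le> n - 1" unfolding s_def
    by (intro degree_sum_le) (auto intro: order_trans[OF degree_monom_le])
  have "poly r (inverse x) = (\<Sum>i\<le>m. coeff r i * inverse x ^ i)"
    unfolding poly_altdef using r(2) by (intro sum.mono_neutral_left) (auto simp: coeff_eq_0)
  also have "\<dots> = b + (\<Sum>i\<in>{1..m}. coeff r i * inverse x ^ i)"
    unfolding b_def using m by (subst sum.atMost_shift) (simp add: sum.atLeast1_atMost_eq)
  finally have "(\<Sum>i\<in>{1..m}. coeff r i * inverse x ^ i) = inverse c - b" using r(3) by simp
  moreover have "poly s x = x ^ n * (\<Sum>i\<in>{1..m}. coeff r i * inverse x ^ i)"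
    unfolding s_def poly_sum sum_distrib_left
  proof (intro sum.cong refl)
    fix i assume i: "i \<in> {1..m}"
    hence "x ^ n = x ^ (n - i) * x ^ i" using m by (simp flip: Power.power_add)
    moreover have "x ^ i * inverse x ^ i = 1" using x by (simp flip: power_mult_distrib)
    ultimately show "poly (monom (coeff r i) (n - i)) x = x ^ n * (coeff r i * inverse x ^ i)"
      by (simp add: poly_monom mult_ac)
  qed
  ultimately have sx: "poly s x = x ^ n * (inverse c - b)" by simp
  define a where "a = coeff p n"
  define t where "t = p - monom a n + smult (a * c * inverse d) s"
  have "t \<in> PA" unfolding t_def a_def using p(1) d c s by (intro PA_add PA_diff PA_smult PA_monom mult_mem PA_coeff)
  moreover have "degree t \<le> n - 1"
  proof (rule degree_le, intro allI impI)
    fix i assume i: "n - 1 < i"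
    hence "coeff s i = 0" using ds by (intro coeff_eq_0) simp
    moreover have "coeff (p - monom a n) i = 0"
      using i p(2) coeff_eq_0[of p i] by (cases "i = n") (auto simp: a_def)
    ultimately show "coeff t i = 0" by (simp add: t_def)
  qed
  moreover have "poly t x = inverse c"
  proof -
    have "c * inverse d * (inverse c - b) = 1" using c0 d0 by (simp add: d_def field_simps)
    moreover have "poly t x = inverse c - a * x ^ n + a * x ^ n * (c * inverse d * (inverse c - b))"
      by (simp add: t_def p(3) sx poly_monom mult_ac)
    ultimately show ?thesis by simp
  qed
  ultimately show ?thesis by (auto simp: poly_hits_def)
qed

lemma adjoin_subring: "complex_subring {poly P x | P. P \<in> PA}"
proof
  show "1 \<in> {poly P x | P. P \<in> PA}" using PA_1 by (auto intro!: exI[of _ 1])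
  fix y z assume "y \<in> {poly P x | P. P \<in> PA}" "z \<in> {poly P x | P. P \<in> PA}"
  then obtain P Q where PQ: "P \<in> PA" "Q \<in> PA" "y = poly P x" "z = poly Q x" by auto
  have "y - z = poly (P - Q) x" "y * z = poly (P * Q) x" by (simp_all add: PQ)
  thus "y - z \<in> {poly P x | P. P \<in> PA}" "y * z \<in> {poly P x | P. P \<in> PA}"
    using PQ PA_diff PA_mult by blast+
qed

lemma localisation_subring: 
  assumes b: "b \<in> A"
  shows "complex_subring {x. \<exists>n. x * b ^ n \<in> A}"
proof
  show "1 \<in> {x. \<exists>n. x * b ^ n \<in> A}" by (auto intro: exI[of _ 0])
  fix y z assume "y \<in> {x. \<exists>n. x * b ^ n \<in> A}" "z \<in> {x. \<exists>n. x * b ^ n \<in> A}"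
  then obtain m n where mn: "y * b ^ m \<in> A" "z * b ^ n \<in> A" by auto
  have "(y - z) * b ^ (m + n) = y * b ^ m * b ^ n - z * b ^ n * b ^ m" "(y * z) * b ^ (m + n) = (y * b ^ m) * (z * b ^ n)"
    by (simp_all add: Power.power_add algebra_simps)
  moreover have "y * b ^ m * b ^ n - z * b ^ n * b ^ m \<in> A" "(y * b ^ m) * (z * b ^ n) \<in> A"
    by (rule diff_mem[OF mult_mem[OF mn(1) power_mem[OF b]] mult_mem[OF mn(2) power_mem[OF b]]] mult_mem[OF mn])+
  ultimately show "y - z \<in> {x. \<exists>n. x * b ^ n \<in> A}" "y * z \<in> {x. \<exists>n. x * b ^ n \<in> A}"
    by (metis (mono_tags, lifting) mem_Collect_eq)+
qed

end

lemma maximal_subring_ex: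
  fixes c :: complex
  assumes "c \<notin> \<int>"
  obtains A where "complex_subring A" "c \<notin> A"
    "\<And>B. complex_subring B \<Longrightarrow> c \<notin> B \<Longrightarrow> A \<subseteq> B \<Longrightarrow> B = A"
proof -
  let ?S = "{A. complex_subring A \<and> c \<notin> A}"
  have "\<exists>A\<in>?S. \<forall>B\<in>?S. A \<subseteq> B \<longrightarrow> B = A"
  proof (rule subset_Zorn_nonempty)
    have "complex_subring \<int>" by unfold_locales auto
    thus "?S \<noteq> {}" using assms by auto
  next
    fix \<C> assume ne: "\<C> \<noteq> {}" and chain: "subset.chain ?S \<C>"
    have sub: "complex_subring B" "c \<notin> B" if "B \<in> \<C>" for B
      using chain that by (auto simp: subset.chain_def)
    have tot: "B \<subseteq> B' \<or> B' \<subseteq> B" if "B \<in> \<C>" "B' \<in> \<C>" for B B'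
      using chain that by (auto simp: subset_chain_def)
    have two: "\<exists>B\<in>\<C>. y \<in> B \<and> z \<in> B" if yz: "y \<in> \<Union>\<C>" "z \<in> \<Union>\<C>" for y z
    proof -
      obtain B B' where "B \<in> \<C>" "y \<in> B" "B' \<in> \<C>" "z \<in> B'" using yz by auto
      thus ?thesis using tot[of B B'] by blast
    qed
    have "complex_subring (\<Union>\<C>)"
    proof
      obtain B where B: "B \<in> \<C>" using ne by auto
      interpret complex_subring B using B by (rule sub)
      show "1 \<in> \<Union>\<C>" using B one_mem by (rule UnionI)
    next
      fix y z assume "y \<in> \<Union>\<C>" "z \<in> \<Union>\<C>"
      then obtain B where B: "B \<in> \<C>" "y \<in> B" "z \<in> B" using two by blast
      interpret complex_subring B using B(1) by (rule sub)
      show "y - z \<in> \<Union>\<C>" "y * z \<in> \<Union>\<C>" using UnionI[OF B(1) diff_mem[OF B(2,3)]] UnionI[OF B(1) mult_mem[OF B(2,3)]] by simp_all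
    qed
    thus "\<Union>\<C> \<in> ?S" using sub(2) by auto
  qed
  thus ?thesis using that by blast
qed

text \<open>Take a subring maximal among those without 1/q. If neither x nor 1/x belonged to it,
  adjoining either would produce 1/q, by polynomials of minimal degrees n and m.
  \<open>poly_hits_reduce\<close> lowers the larger degree, a contradiction.\<close>

theorem place_ex:
  assumes "prime q"
  shows "\<exists>A. place A q"
proof -
  define c :: complex where "c = of_nat q"
  have q1: "q > 1" using assms by (rule prime_gt_1_nat)
  have "inverse c \<notin> \<int>"
  proof
    assume "inverse c \<in> \<int>"
    then obtain k :: int where "inverse c = of_int k" by (auto elim: Ints_cases)
    hence "of_int (int q * k) = (of_int 1 :: complex)" using q1 by (simp add: c_def field_simps)
    hence "int q * k = 1" by (simp only: of_int_eq_iff)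
    thus False using q1 by (metis nat_int zmult_eq_1_iff of_nat_eq_1_iff less_irrefl int_one_le_iff_zero_less neg_0_le_iff_le not_one_le_zero of_nat_0_le_iff)
  qed
  then obtain A where A: "complex_subring A" "inverse c \<notin> A"
    and max: "\<And>B. complex_subring B \<Longrightarrow> inverse c \<notin> B \<Longrightarrow> A \<subseteq> B \<Longrightarrow> B = A"
    by (rule maximal_subring_ex) blast
  interpret complex_subring A by fact
  have cA: "c \<in> A" by (simp add: c_def)
  have c0: "c \<noteq> 0" using q1 by (simp add: c_def)
  \<comment> \<open>Powers of 1 + c a are 1 modulo c, so inverting 1 + c a does not produce 1/c; by
    maximality the localisation is the ring itself.\<close>
  have unit: "inverse (1 + c * a) \<in> A" if a: "a \<in> A" for a
  proof -
    let ?b = "1 + c * a" and ?B = "{x. \<exists>n. x * (1 + c * a) ^ n \<in> A}"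
    have bA: "?b \<in> A" using cA a by (intro add_mem mult_mem) simp_all
    have b0: "?b \<noteq> 0"
    proof
      assume "?b = 0"
      hence "c * (- a) = 1" by (simp add: add_eq_0_iff2)
      hence "inverse c = - a" by (rule inverse_unique)
      thus False using A(2) minus_mem[OF a] by simp
    qed
    have pow: "\<exists>d\<in>A. ?b ^ n = 1 + c * d" for n
    proof (induction n)
      case (Suc n)
      then obtain d where d: "d \<in> A" "?b ^ n = 1 + c * d" by blast
      have "?b ^ Suc n = 1 + c * (d + a + a * c * d)" unfolding power_Suc d(2) by (simp add: algebra_simps)
      moreover have "d + a + a * c * d \<in> A" using d a cA by (intro add_mem mult_mem)
      ultimately show ?case by blast
    qed (auto intro: bexI[of _ 0])
    have "inverse c \<notin> ?B"
    proof
      assume "inverse c \<in> ?B"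
      then obtain n where n: "inverse c * ?b ^ n \<in> A" by auto
      obtain d where d: "d \<in> A" "?b ^ n = 1 + c * d" using pow by blast
      have "inverse c * ?b ^ n - d = inverse c" unfolding d(2) using c0 by (simp add: algebra_simps)
      thus False using diff_mem[OF n d(1)] A(2) by simp
    qed
    hence "?B = A" using localisation_subring[OF bA] by (intro max) (auto intro: exI[of _ 0])
    moreover have "inverse ?b \<in> ?B" using b0 by (auto intro!: exI[of _ 1])
    ultimately show ?thesis by simp
  qed
  have adj: "\<exists>n. poly_hits (inverse c) x n" if x: "x \<notin> A" for x
  proof (rule ccontr)
    assume no: "\<not> ?thesis"
    let ?B = "{poly P x | P. P \<in> PA}"
    have "inverse c \<notin> ?B"
    proof
      assume "inverse c \<in> ?B"
      then obtain P where "P \<in> PA" "poly P x = inverse c" by auto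
      thus False using no by (auto simp: poly_hits_def)
    qed
    moreover have "A \<subseteq> ?B"
    proof
      fix a assume "a \<in> A"
      thus "a \<in> ?B" by (auto intro!: exI[of _ "[:a:]"] simp: PA_pCons)
    qed
    ultimately have "?B = A" using adjoin_subring by (intro max)
    moreover have "x \<in> ?B" by (auto intro!: exI[of _ "[:0, 1:]"] simp: PA_pCons)
    ultimately show False using x by simp
  qed
  have pos: "0 < n" if hit: "poly_hits (inverse c) x n" for x n
  proof (rule ccontr)
    assume "\<not> 0 < n"
    then obtain P where P: "P \<in> PA" "degree P = 0" "poly P x = inverse c" using hit by (auto simp: poly_hits_def)
    then obtain a where "P = [:a:]" by (metis degree_eq_zeroE)
    thus False using P A(2) by (simp add: PA_pCons)
  qed
  have val: "x \<in> A \<or> inverse x \<in> A" for x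
  proof (rule ccontr)
    assume "\<not> ?thesis"
    hence x: "x \<notin> A" "inverse x \<notin> A" by auto
    hence x0: "x \<noteq> 0" by auto
    define m n where "m = (LEAST m. poly_hits (inverse c) (inverse x) m)" and "n = (LEAST n. poly_hits (inverse c) x n)"
    have mn: "poly_hits (inverse c) (inverse x) m" "poly_hits (inverse c) x n"
      unfolding m_def n_def using adj x by (metis LeastI)+
    note p = mn[THEN pos]
    show False
    proof (cases "m \<le> n")
      case True
      have "poly_hits (inverse c) x (n - 1)"
        by (rule poly_hits_reduce[OF cA A(2) unit x0 mn(2,1) p(1) True])
      hence "n \<le> n - 1" unfolding n_def by (rule Least_le)
      thus False using p by simp
    next
      case False
      have "poly_hits (inverse c) (inverse x) (m - 1)"
        using mn p False x0 by (intro poly_hits_reduce[OF cA A(2) unit, where n = m and m = n]) auto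
      hence "m \<le> m - 1" unfolding m_def by (rule Least_le)
      thus False using p by simp
    qed
  qed
  show ?thesis
    using A(2) assms val by (intro exI[of _ A]) (unfold_locales, auto simp: c_def)
qed


section \<open>Even elliptic functions with a double pole\<close>

lemma removable_holomorphic:
  assumes hol: "f holomorphic_on ball a r - {a}" and lim: "f \<midarrow>a\<rightarrow> l" 
  shows "(\<lambda>z. if z = a then l else f z) holomorphic_on ball a r"
proof (rule no_isolated_singularity'[where K = "{a}"])
  show "(\<lambda>z. if z = a then l else f z) holomorphic_on ball a r - {a}"
    using hol by (rule holomorphic_transform) auto
  fix z assume "z \<in> {a}"
  moreover have "(\<lambda>z. if z = a then l else f z) \<midarrow>a\<rightarrow> l"
    using lim by (rule Lim_transform_eventually) (auto simp: eventually_at_filter)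
  ultimately show "((\<lambda>z. if z = a then l else f z) \<longlongrightarrow> (if z = a then l else f z)) (at z within ball a r)"
    by (auto intro: tendsto_within_subset)
qed auto

lemma holomorphic_quotient_limit:
  assumes hol: "f holomorphic_on ball 0 r" and r: "0 < r" and f0: "f 0 = 0"
  obtains g where "g holomorphic_on ball 0 r" "\<And>z. f z = z * g z" 
proof -
  let ?g = "\<lambda>z. if z = 0 then deriv f 0 else (f z - f 0) / (z - 0)"
  have "?g holomorphic_on ball 0 r" using hol by (rule pole_lemma) (use r in auto)
  moreover have "f z = z * ?g z" for z using f0 by simp
  ultimately show ?thesis using that by blast
qed

text \<open>An even function vanishing at 0 vanishes doubly: its quotient by z is odd and
  continuous, hence zero at 0.\<close>

lemma even_holomorphic_quotient_limit:
  fixes f :: "complex \<Rightarrow> complex"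
  assumes hol: "f holomorphic_on ball 0 r" and r: "0 < r" and f0: "f 0 = 0"
    and even: "\<And>z. z \<in> ball 0 r \<Longrightarrow> f (- z) = f z"
  shows "\<exists>l. (\<lambda>z. f z / z^2) \<midarrow>0\<rightarrow> l"
proof -
  obtain g where g: "g holomorphic_on ball 0 r" "\<And>z. f z = z * g z"
    using holomorphic_quotient_limit[OF hol r f0] by blast
  have cont: "g \<midarrow>0\<rightarrow> g 0" if "g holomorphic_on ball 0 r" for g
    using holomorphic_on_imp_continuous_on[OF that] r continuous_on_eq_continuous_at[of "ball 0 r" g]
    by (auto simp: isCont_def)
  have "(\<lambda>z. g (- z)) \<midarrow>0\<rightarrow> g 0"
    using isCont_o2[of "0::complex" uminus g] cont[OF g(1)] tendsto_minus[OF tendsto_ident_at, of "0::complex" UNIV]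
    by (simp add: isCont_def)
  moreover have "eventually (\<lambda>z. g (- z) = - g z) (at 0)"
  proof -
    have "eventually (\<lambda>z. z \<in> ball 0 r) (at (0::complex))" using r by (intro eventually_at_in_open') auto
    moreover have "eventually (\<lambda>z. z \<noteq> 0) (at (0::complex))" by (simp add: eventually_at_filter)
    ultimately show ?thesis
    proof eventually_elim
      case (elim z)
      have "- z * g (- z) = z * g z" using even[OF elim(1)] by (simp only: g(2))
      hence "z * (g (- z) + g z) = 0" by Groebner_Basis.algebra
      thus ?case using elim(2) by (simp add: eq_neg_iff_add_eq_0)
    qed
  qed
  ultimately have "(\<lambda>z. - g z) \<midarrow>0\<rightarrow> g 0" by (rule Lim_transform_eventually)
  hence "- g 0 = g 0" using tendsto_minus[OF cont[OF g(1)]] LIM_unique by blast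
  hence "g 0 = 0" by simp
  then obtain k where k: "k holomorphic_on ball 0 r" "\<And>z. g z = z * k z"
    using holomorphic_quotient_limit[OF g(1) r] by blast
  have "(\<lambda>z. f z / z^2) \<midarrow>0\<rightarrow> k 0"
    using cont[OF k(1)] by (rule Lim_transform_eventually) (auto simp: eventually_at_filter g(2) k(2) power2_eq_square)
  thus ?thesis ..
qed

text \<open>\<open>x\<close> is the Weierstrass function of the lattice up to an affine change of
  values: even, periodic, with only a double pole of leading coefficient \<open>c\<close> modulo the
  lattice.\<close>

locale even_elliptic =
  fixes \<tau> c :: complex and x :: "complex \<Rightarrow> complex"
  assumes Im_pos: "Im \<tau> > 0"
  fixes L :: "complex set"
  defines "L \<equiv> {of_int a + of_int b * \<tau> | a b. True}"
  assumes hol: "x holomorphic_on - L"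
    and period_1: "x (z + 1) = x z" and period_tau: "x (z + \<tau>) = x z" and even: "x (- z) = x z"
    and pole: "(\<lambda>z. z^2 * x z) \<midarrow>0\<rightarrow> c" and c: "c \<noteq> 0"
begin

text \<open>The points above the n-torsion of the complex torus. Functions built from
  \<open>x (n * z)\<close> have their possible singularities there.\<close>

definition Z :: "nat \<Rightarrow> complex set" where "Z n = {z. of_nat n * z \<in> L}"

lemma L_I: "z = of_int a + of_int b * \<tau> \<Longrightarrow> z \<in> L" by (auto simp: L_def)

lemma L_0 [simp]: "0 \<in> L" and L_1 [simp]: "1 \<in> L" and L_tau [simp]: "\<tau> \<in> L"
  by (rule L_I[of _ 0 0] L_I[of _ 1 0] L_I[of _ 0 1], simp)+

lemma L_add: "u \<in> L \<Longrightarrow> v \<in> L \<Longrightarrow> u + v \<in> L"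
  unfolding L_def by clarify (metis (no_types, lifting) add.assoc add.left_commute distrib_right of_int_add)

lemma L_minus: "u \<in> L \<Longrightarrow> - u \<in> L"
proof -
  assume "u \<in> L"
  then obtain a b where "u = of_int a + of_int b * \<tau>" by (auto simp: L_def)
  hence "- u = of_int (- a) + of_int (- b) * \<tau>" by simp
  thus ?thesis by (rule L_I)
qed

lemma L_diff: "u \<in> L \<Longrightarrow> v \<in> L \<Longrightarrow> u - v \<in> L"
  using L_add[of u "- v"] L_minus by simp

lemma L_minus_iff [simp]: "- u \<in> L \<longleftrightarrow> u \<in> L"
  using L_minus[of u] L_minus[of "- u"] by auto

lemma L_add_iff: "v \<in> L \<Longrightarrow> u + v \<in> L \<longleftrightarrow> u \<in> L"
  using L_add[of u v] L_diff[of "u + v" v] by auto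

lemma L_of_int_mult: "u \<in> L \<Longrightarrow> of_int n * u \<in> L"
proof -
  assume "u \<in> L"
  then obtain a b where "u = of_int a + of_int b * \<tau>" by (auto simp: L_def)
  hence "of_int n * u = of_int (n * a) + of_int (n * b) * \<tau>" by (simp add: algebra_simps)
  thus ?thesis by (rule L_I)
qed

lemma L_of_nat_mult: "u \<in> L \<Longrightarrow> of_nat n * u \<in> L"
  using L_of_int_mult[of u "int n"] by simp

lemma norm_L:
  assumes "u \<in> L" "u \<noteq> 0"
  shows "norm u \<ge> min 1 (Im \<tau>)"
proof -
  obtain a b where ab: "u = of_int a + of_int b * \<tau>" using assms(1) by (auto simp: L_def)
  show ?thesis
  proof (cases "b = 0")
    case True
    hence "a \<noteq> 0" "norm u = \<bar>of_int a\<bar>" using assms ab by auto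
    thus ?thesis by linarith
  next
    case False
    have "Im \<tau> \<le> \<bar>of_int b\<bar> * Im \<tau>" using False Im_pos by simp
    also have "\<dots> = \<bar>Im u\<bar>" using Im_pos by (simp add: ab abs_mult)
    also have "\<dots> \<le> norm u" by (rule abs_Im_le_cmod)
    finally show ?thesis by simp
  qed
qed

lemma Z_1: "Z 1 = L" by (simp add: Z_def)
lemma L_Z: "L \<subseteq> Z n" using L_of_nat_mult by (auto simp: Z_def)
lemma Z_add_iff: "v \<in> L \<Longrightarrow> u + v \<in> Z n \<longleftrightarrow> u \<in> Z n"
  by (simp add: Z_def distrib_left L_add_iff L_of_nat_mult)
lemma Z_minus_iff [simp]: "- u \<in> Z n \<longleftrightarrow> u \<in> Z n"
  by (simp add: Z_def)

lemma Z_discrete: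
  assumes "n > 0"
  obtains \<delta> where "\<delta> > 0" "\<And>u v. u \<in> Z n \<Longrightarrow> v \<in> Z n \<Longrightarrow> dist u v < \<delta> \<Longrightarrow> u = v"
proof -
  define \<delta> where "\<delta> = min 1 (Im \<tau>) / real n"
  have d: "\<delta> > 0" using assms Im_pos by (simp add: \<delta>_def)
  have eq: "u = v" if uv: "u \<in> Z n" "v \<in> Z n" "dist u v < \<delta>" for u v
  proof (rule ccontr)
    assume ne: "u \<noteq> v"
    have "of_nat n * (u - v) \<in> L" using uv L_diff by (simp add: Z_def right_diff_distrib)
    hence "min 1 (Im \<tau>) \<le> norm (of_nat n * (u - v))" using ne assms by (intro norm_L) auto
    also have "\<dots> = real n * dist u v" by (simp add: norm_mult dist_norm)
    also have "\<dots> < real n * \<delta>" using uv(3) assms by simp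
    finally show False using assms by (simp add: \<delta>_def)
  qed
  show ?thesis using that d eq by blast
qed

lemma closed_Z: "n > 0 \<Longrightarrow> closed (Z n)"
  using Z_discrete[of n] discrete_imp_closed[of _ "Z n"] by (metis dist_commute)

lemma open_Z: "n > 0 \<Longrightarrow> open (- Z n)"
  using closed_Z by (simp add: open_Compl)

lemma open_L: "open (- L)"
  using open_Z[of 1] Z_1 by simp

lemma eventually_not_Z: "n > 0 \<Longrightarrow> eventually (\<lambda>u. u \<notin> Z n) (at z)"
proof -
  assume n: "n > 0"
  obtain \<delta> where d: "\<delta> > 0" "\<And>u v. u \<in> Z n \<Longrightarrow> v \<in> Z n \<Longrightarrow> dist u v < \<delta> \<Longrightarrow> u = v"
    using Z_discrete[OF n] by blast
  show ?thesis
  proof (cases "z \<in> Z n")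
    case True
    have "eventually (\<lambda>u. u \<in> ball z \<delta>) (at z)" using d(1) by (intro eventually_at_in_open') auto
    moreover have "eventually (\<lambda>u. u \<noteq> z) (at z)" by (simp add: eventually_at_filter)
    ultimately show ?thesis by eventually_elim (use d(2) True in \<open>auto simp: dist_commute\<close>)
  next
    case False
    thus ?thesis using eventually_at_in_open'[OF open_Z[OF n], of z] by simp
  qed
qed

lemma eventually_not_L: "eventually (\<lambda>u. u \<notin> L) (at z)"
  using eventually_not_Z[of 1] Z_1 by simp

lemma isolated_Z:
  assumes "n > 0"
  obtains r where "r > 0" "ball z r - {z} \<subseteq> - Z n"
proof -
  have "eventually (\<lambda>u. u \<notin> Z n) (at z)" using assms by (rule eventually_not_Z)
  then obtain r where "r > 0" "\<And>u. u \<noteq> z \<Longrightarrow> dist u z < r \<Longrightarrow> u \<notin> Z n" by (auto simp: eventually_at)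
  hence "ball z r - {z} \<subseteq> - Z n" by (auto simp: dist_commute)
  thus ?thesis using that \<open>r > 0\<close> by blast
qed

lemma period:
  assumes p1: "\<And>z. f (z + 1) = f z" and pt: "\<And>z. f (z + \<tau>) = f z" and v: "v \<in> L"
  shows "f (z + v) = f z"
proof -
  obtain a b where ab: "v = of_int a + of_int b * \<tau>" using v by (auto simp: L_def)
  have int: "f (z + of_int a * w) = f z" if w: "\<And>z. f (z + w) = f z" for w z and a :: int
  proof (induction a arbitrary: z rule: int_induct[of _ 0])
    case (step1 i)
    have "f (z + of_int (i + 1) * w) = f ((z + w) + of_int i * w)" by (simp add: algebra_simps)
    thus ?case using step1 w by simp
  next
    case (step2 i)
    have "f (z + of_int (i - 1) * w) = f ((z - w) + of_int i * w)" by (simp add: algebra_simps)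
    also have "\<dots> = f z" using step2 w[of "z - w"] by simp
    finally show ?case .
  qed simp
  have "f (z + v) = f ((z + of_int a * 1) + of_int b * \<tau>)" by (simp add: ab add.assoc)
  also have "\<dots> = f z" using int[OF p1] int[OF pt] by simp
  finally show ?thesis .
qed

lemma period_x: "v \<in> L \<Longrightarrow> x (z + v) = x z"
  by (rule period) (rule period_1 period_tau)+

lemma period_x': "u - v \<in> L \<Longrightarrow> x u = x v"
  using period_x[of "u - v" v] by simp

lemma fundamental_domain:
  obtains w where "z - w \<in> L" "w \<in> (\<lambda>s. of_real (fst s) + of_real (snd s) * \<tau>) ` ({0..1} \<times> {0..1})"
proof -
  define t where "t = Im z / Im \<tau>"
  define s where "s = Re z - t * Re \<tau>"
  have z: "z = of_real s + of_real t * \<tau>"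
    using Im_pos by (intro complex_eqI) (simp_all add: s_def t_def)
  define w where "w = of_real (frac s) + of_real (frac t) * \<tau>"
  have "z - w = of_int \<lfloor>s\<rfloor> + of_int \<lfloor>t\<rfloor> * \<tau>"
    by (simp add: z w_def frac_def algebra_simps)
  hence "z - w \<in> L" by (rule L_I)
  moreover have "w \<in> (\<lambda>s. of_real (fst s) + of_real (snd s) * \<tau>) ` ({0..1} \<times> {0..1})"
    unfolding w_def by (rule image_eqI[of _ _ "(frac s, frac t)"]) (auto simp: frac_lt_1 less_imp_le)
  ultimately show ?thesis using that by blast
qed

lemma liouville:
  assumes n: "n > 0" and hol: "f holomorphic_on - Z n" and lim: "\<And>z. z \<in> Z n \<Longrightarrow> \<exists>l. f \<midarrow>z\<rightarrow> l"
    and p1: "\<And>z. f (z + 1) = f z" and pt: "\<And>z. f (z + \<tau>) = f z"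
  shows "\<exists>C. \<forall>z. z \<notin> Z n \<longrightarrow> f z = C"
proof -
  define g where "g z = (if z \<in> Z n then Lim (at z) f else f z)" for z
  have limg: "f \<midarrow>z\<rightarrow> g z" for z
  proof (cases "z \<in> Z n")
    case True
    thus ?thesis using lim[OF True] tendsto_Lim[of "at z" f] by (auto simp: g_def)
  next
    case False
    hence "isCont f z" using hol open_Z[OF n] 
      by (metis ComplI continuous_on_eq_continuous_at holomorphic_on_imp_continuous_on)
    thus ?thesis using False by (simp add: g_def isCont_def)
  qed
  have "g field_differentiable at z" for z
  proof -
    obtain r where r: "r > 0" "ball z r - {z} \<subseteq> - Z n" using isolated_Z[OF n] by blast
    have "(\<lambda>w. if w = z then g z else f w) holomorphic_on ball z r"
      using holomorphic_on_subset[OF hol r(2)] limg by (rule removable_holomorphic)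
    hence "g holomorphic_on ball z r"
      by (rule holomorphic_transform) (use r(2) in \<open>auto simp: g_def\<close>)
    thus ?thesis using r(1) holomorphic_on_imp_differentiable_at[of g "ball z r" z] by simp
  qed
  hence hg: "g holomorphic_on UNIV" by (simp add: holomorphic_on_def)
  let ?P = "(\<lambda>s. of_real (fst s) + of_real (snd s) * \<tau>) ` ({0..1} \<times> {0..1})"
  have "compact ?P"
  proof (rule compact_continuous_image)
    show "continuous_on ({0..1} \<times> {0..1}) (\<lambda>s. of_real (fst s) + of_real (snd s) * \<tau>)"
      by (intro continuous_on_add continuous_on_mult continuous_on_of_real continuous_on_fst continuous_on_snd continuous_on_id continuous_on_const)
    show "compact ({0..1} \<times> {0..1} :: (real \<times> real) set)" by (rule compact_Times[OF compact_Icc compact_Icc])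
  qed
  hence "bounded (g ` ?P)"
    by (rule compact_imp_bounded[OF compact_continuous_image[OF continuous_on_subset[OF holomorphic_on_imp_continuous_on[OF hg] subset_UNIV]]])
  then obtain B where B: "\<And>z. z \<in> ?P \<Longrightarrow> norm (g z) \<le> B" unfolding bounded_iff by blast
  have Bf: "norm (f z) \<le> B" if z: "z \<notin> Z n" for z
  proof -
    obtain w where w: "z - w \<in> L" "w \<in> ?P" using fundamental_domain by blast
    have "w \<notin> Z n" using Z_add_iff[OF w(1), of w n] z by simp
    moreover have "f z = f w" using period[of f, OF p1 pt w(1), of w] by simp
    ultimately show ?thesis using B[OF w(2)] by (simp add: g_def)
  qed
  have "norm (g z) \<le> B" for z
  proof (rule Lim_norm_ubound[OF _ limg])
    show "eventually (\<lambda>w. norm (f w) \<le> B) (at z)"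
      by (rule eventually_mono[OF eventually_not_Z[OF n] Bf])
  qed simp
  hence "bounded (range g)" by (auto simp: bounded_iff)
  with hg have "g constant_on UNIV" by (rule Liouville_theorem)
  then obtain C where C: "g z = C" for z by (auto simp: constant_on_def)
  have "f z = C" if "z \<notin> Z n" for z using C[of z] that by (simp add: g_def)
  thus ?thesis by blast
qed

lemma limit_period:
  fixes f :: "complex \<Rightarrow> complex"
  assumes p: "\<And>z. f (z + v) = f z" and lim: "f \<midarrow>a\<rightarrow> l"
  shows "f \<midarrow>(a + v)\<rightarrow> l"
  using LIM_offset[OF lim, of "- v"] p[of "_ - v"] by simp

text \<open>Subtracting a multiple of x^k removes the leading pole term at 0, and by evenness the
  pole order drops by two. At order zero Liouville's theorem leaves a constant.\<close>

lemma even_elliptic_poly: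
  assumes n: "n > 0" and hol_f: "f holomorphic_on - Z n" and lim: "\<And>z. z \<in> Z n - L \<Longrightarrow> \<exists>l. f \<midarrow>z\<rightarrow> l"
    and p1: "\<And>z. f (z + 1) = f z" and pt: "\<And>z. f (z + \<tau>) = f z"
    and even_f: "\<And>z. z \<notin> Z n \<Longrightarrow> f (- z) = f z" and pole_f: "(\<lambda>z. z ^ (2 * k) * f z) \<midarrow>0\<rightarrow> l"
  shows "\<exists>p. degree p \<le> k \<and> coeff p k = l / c ^ k \<and> (\<forall>z. z \<notin> Z n \<longrightarrow> f z = poly p (x z))"
  using hol_f lim p1 pt even_f pole_f
proof (induction k arbitrary: f l)
  case 0
  have "\<exists>l. f \<midarrow>z\<rightarrow> l" if "z \<in> Z n" for z
  proof (cases "z \<in> L")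
    case True
    thus ?thesis using 0(6) limit_period[of f z l 0] period[of f, OF 0(3,4) True] by auto
  qed (use 0(2) that in auto)
  with n 0(1) obtain C where C: "\<And>z. z \<notin> Z n \<Longrightarrow> f z = C" using liouville 0(3,4) by metis
  have "f \<midarrow>0\<rightarrow> C"
    by (rule tendsto_eventually[OF eventually_mono[OF eventually_not_Z[OF n] C]])
  hence "C = l" using 0(6) LIM_unique by auto
  thus ?case using C by (intro exI[of _ "[:l:]"]) auto
next
  case (Suc k)
  define a where "a = l / c ^ Suc k"
  define g where "g z = f z - a * x z ^ Suc k" for z
  have hx: "x holomorphic_on - Z n" using hol by (rule holomorphic_on_subset) (use L_Z in auto)
  have hg: "g holomorphic_on - Z n" unfolding g_def by (intro holomorphic_intros Suc.prems hx)
  have ge: "g (- z) = g z" if "z \<notin> Z n" for z using Suc.prems(5)[OF that] by (simp add: g_def even)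
  have "(\<lambda>z. z ^ (2 * Suc k) * f z - a * (z^2 * x z) ^ Suc k) \<midarrow>0\<rightarrow> l - a * c ^ Suc k"
    by (intro tendsto_intros Suc.prems pole)
  moreover have "z ^ (2 * Suc k) * f z - a * (z^2 * x z) ^ Suc k = z ^ (2 * Suc k) * g z" for z
    by (simp only: g_def power_mult_distrib power_mult[symmetric]) (simp only: right_diff_distrib mult.left_commute)
  moreover have "l - a * c ^ Suc k = 0" using c by (simp add: a_def)
  ultimately have g0: "(\<lambda>z. z ^ (2 * Suc k) * g z) \<midarrow>0\<rightarrow> 0" by simp
  obtain r where r: "r > 0" "ball 0 r - {0} \<subseteq> - Z n" using isolated_Z[OF n] by blast
  define \<phi> where "\<phi> z = (if z = 0 then 0 else z ^ (2 * Suc k) * g z)" for z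
  have "\<phi> holomorphic_on ball 0 r" unfolding \<phi>_def
    by (intro removable_holomorphic g0 holomorphic_intros holomorphic_on_subset[OF hg r(2)])
  moreover have "\<phi> (- z) = \<phi> z" if "z \<in> ball 0 r" for z
    using ge[of z] r(2) that by (auto simp: \<phi>_def)
  ultimately obtain l' where l': "(\<lambda>z. \<phi> z / z^2) \<midarrow>0\<rightarrow> l'"
    using even_holomorphic_quotient_limit[of \<phi> r] r(1) by (auto simp: \<phi>_def)
  have pg: "(\<lambda>z. z ^ (2 * k) * g z) \<midarrow>0\<rightarrow> l'"
    using l' by (rule Lim_transform_eventually)
      (auto simp: eventually_at_filter \<phi>_def power2_eq_square)
  have lg: "\<exists>l. g \<midarrow>z\<rightarrow> l" if z: "z \<in> Z n - L" for z
  proof -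
    obtain l where "f \<midarrow>z\<rightarrow> l" using Suc.prems(2)[OF z] ..
    moreover have "isCont x z" using z hol open_L
      by (metis ComplI DiffD2 continuous_on_eq_continuous_at holomorphic_on_imp_continuous_on)
    ultimately have "g \<midarrow>z\<rightarrow> l - a * x z ^ Suc k" unfolding g_def isCont_def by (intro tendsto_intros)
    thus ?thesis ..
  qed
  have "g (z + 1) = g z" "g (z + \<tau>) = g z" for z by (simp_all add: g_def Suc.prems(3,4) period_1 period_tau)
  from Suc.IH[OF hg lg this ge pg] obtain p where p: "degree p \<le> k" "\<And>z. z \<notin> Z n \<Longrightarrow> g z = poly p (x z)" by blast
  have "degree (p + monom a (Suc k)) \<le> Suc k"
    using p(1) by (intro degree_add_le order_trans[OF degree_monom_le]) auto
  moreover have "coeff (p + monom a (Suc k)) (Suc k) = l / c ^ Suc k"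
    using p(1) by (simp add: a_def coeff_eq_0)
  moreover have "f z = poly (p + monom a (Suc k)) (x z)" if "z \<notin> Z n" for z
    using p(2)[OF that] by (simp add: g_def poly_monom algebra_simps)
  ultimately show ?case by blast
qed

end


context even_elliptic
begin

lemma isCont_x: "z \<notin> L \<Longrightarrow> isCont x z"
  using hol open_L by (metis ComplI continuous_on_eq_continuous_at holomorphic_on_imp_continuous_on)

lemma x_infinity: "filterlim x at_infinity (at 0)"
proof -
  have "filterlim (\<lambda>z. z^2 * x z * inverse (z^2)) at_infinity (at 0)"
  proof (rule tendsto_mult_filterlim_at_infinity[OF pole c])
    have "filterlim (\<lambda>z. z^2 :: complex) (at 0) (at 0)"
      by (intro filterlim_atI) (auto intro!: tendsto_eq_intros simp: eventually_at_filter)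
    thus "filterlim (\<lambda>z. inverse (z^2 :: complex)) at_infinity (at 0)"
      using filterlim_compose[OF filterlim_inverse_at_infinity] by blast
  qed
  thus ?thesis by (rule filterlim_mono_eventually) (auto simp: eventually_at_filter)
qed

lemma not_constant: "\<exists>z. z \<notin> L \<and> x z \<noteq> w"
proof -
  have "eventually (\<lambda>z. x z \<noteq> w) (at 0)" using x_infinity by (rule filterlim_at_infinity_imp_eventually_ne)
  hence "eventually (\<lambda>z. z \<notin> L \<and> x z \<noteq> w) (at 0)" using eventually_not_L eventually_conj by blast
  thus ?thesis using eventually_happens' at_neq_bot by blast
qed

lemma eventually_ne: "eventually (\<lambda>z. x z \<noteq> w) (at z0)"
proof (cases "z0 \<in> L")
  case True
  have "eventually (\<lambda>z. x z \<noteq> w) (at 0)" using x_infinity by (rule filterlim_at_infinity_imp_eventually_ne)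
  hence "eventually (\<lambda>z. x (z - z0) \<noteq> w) (at z0)"
    by (simp add: at_to_0[of z0] eventually_filtermap)
  thus ?thesis using period_x[OF True, of "_ - z0"] by simp
next
  case False
  show ?thesis
  proof (rule ccontr)
    assume "\<not> ?thesis"
    moreover have "eventually (\<lambda>z. x z \<noteq> w) (at z0)" if "eventually (\<lambda>z. \<not> (x z = w \<and> z \<notin> L)) (at z0)"
      using that eventually_not_L[of z0] by eventually_elim blast
    ultimately have "frequently (\<lambda>z. x z = w \<and> z \<notin> L) (at z0)" unfolding frequently_def by blast
    hence "z0 islimpt {z. x z = w \<and> z \<notin> L}" by (simp add: islimpt_conv_frequently_at)
    moreover have "connected (- L)"
    proof -
      have "L = (\<lambda>(a, b). of_int a + of_int b * \<tau>) ` (UNIV :: (int \<times> int) set)" by (auto simp: L_def)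
      hence "countable L" by (metis countable_image countableI_type)
      thus ?thesis using connected_open_diff_countable[of "UNIV :: complex set" L]
        by (simp add: Compl_eq_Diff_UNIV connected_UNIV)
    qed
    ultimately have "x z - w = 0" if "z \<notin> L" for z
      using that False
      by (intro analytic_continuation[of "\<lambda>z. x z - w" "- L" "{z. x z = w \<and> z \<notin> L}" z0 z])
        (auto intro!: holomorphic_intros hol open_L)
    thus False using not_constant[of w] by auto
  qed
qed

lemma eventually_poly_ne: "p \<noteq> 0 \<Longrightarrow> eventually (\<lambda>z. poly p (x z) \<noteq> 0) (at z0)"
proof -
  assume p: "p \<noteq> 0"
  have "eventually (\<lambda>z. \<forall>w\<in>{w. poly p w = 0}. x z \<noteq> w) (at z0)"
    by (rule eventually_ball_finite[OF poly_roots_finite[OF p]]) (use eventually_ne in blast)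
  thus ?thesis by eventually_elim auto
qed

lemma poly_eqI:
  assumes n: "n > 0" and eq: "\<And>z. z \<notin> Z n \<Longrightarrow> poly p (x z) = poly r (x z)"
  shows "p = r"
proof (rule ccontr)
  assume "p \<noteq> r"
  hence "eventually (\<lambda>z. poly (p - r) (x z) \<noteq> 0 \<and> z \<notin> Z n) (at 0)"
    using eventually_poly_ne[of "p - r" 0] eventually_not_Z[OF n] by (auto intro: eventually_conj)
  hence "\<exists>z. poly (p - r) (x z) \<noteq> 0 \<and> z \<notin> Z n" using eventually_happens' at_neq_bot by blast
  thus False using eq by auto
qed

text \<open>If the value w were omitted, 1 / (x - w) would be elliptic without poles and tend to 0
  at the lattice, hence be identically zero.\<close>

lemma surj: "\<exists>z. z \<notin> L \<and> x z = w"
proof (rule ccontr)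
  assume "\<not> ?thesis"
  hence ne: "x z \<noteq> w" if "z \<notin> L" for z using that by auto
  define f where "f z = inverse (x z - w)" for z
  have f0: "f \<midarrow>0\<rightarrow> 0"
  proof -
    have "filterlim (\<lambda>z. x z - w) at_infinity (at 0)"
      using tendsto_add_filterlim_at_infinity'[OF x_infinity tendsto_const[of "- w"]] by simp
    thus ?thesis unfolding f_def using filterlim_compose[OF tendsto_inverse_0] by blast
  qed
  have p: "f (z + 1) = f z" "f (z + \<tau>) = f z" for z by (simp_all add: f_def period_1 period_tau)
  have "f holomorphic_on - Z 1" unfolding f_def Z_1 using ne by (auto intro!: holomorphic_intros hol)
  moreover have "\<exists>l. f \<midarrow>z\<rightarrow> l" if "z \<in> Z 1" for z
    using limit_period[OF period[of f, OF p that[unfolded Z_1]] f0] by auto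
  ultimately obtain C where C: "\<And>z. z \<notin> Z 1 \<Longrightarrow> f z = C"
    using liouville[of 1 f] p by auto
  have "f \<midarrow>0\<rightarrow> C"
    by (rule tendsto_eventually[OF eventually_mono[OF eventually_not_Z[of 1] C]]) simp
  hence "C = 0" using f0 LIM_unique by blast
  moreover obtain z where "z \<notin> L" using not_constant by blast
  ultimately have "f z = 0" using C[of z] Z_1 by auto
  thus False using ne[OF \<open>z \<notin> L\<close>] by (simp add: f_def)
qed

lemma tendsto_poly: "(f \<longlongrightarrow> l) F \<Longrightarrow> ((\<lambda>z. poly p (f z :: complex)) \<longlongrightarrow> poly p l) F"
  by (induction p) (auto intro!: tendsto_intros)

lemma poly_pole: "(\<lambda>z. z ^ (2 * degree p) * poly p (x z)) \<midarrow>0\<rightarrow> lead_coeff p * c ^ degree p"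
proof -
  have gen: "(\<lambda>z. z ^ (2 * n) * poly p (x z)) \<midarrow>0\<rightarrow> coeff p n * c ^ n" if "degree p \<le> n" for n
    using that
  proof (induction p arbitrary: n)
    case (pCons a p)
    show ?case
    proof (cases n)
      case 0
      hence "p = 0" using pCons.prems by (cases "p = 0") auto
      thus ?thesis using 0 by simp
    next
      case (Suc m)
      have "degree p \<le> m" using pCons.prems Suc by (cases "p = 0") auto
      hence "(\<lambda>z. z ^ (2 * Suc m) * a + z^2 * x z * (z ^ (2 * m) * poly p (x z))) \<midarrow>0\<rightarrow>
          0 ^ (2 * Suc m) * a + c * (coeff p m * c ^ m)"
        by (intro tendsto_intros pole pCons.IH)
      moreover have "z ^ (2 * Suc m) * a + z^2 * x z * (z ^ (2 * m) * poly p (x z)) = z ^ (2 * n) * poly (pCons a p) (x z)" for z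
        by (simp add: Suc algebra_simps power2_eq_square)
      ultimately show ?thesis by (simp add: Suc mult_ac)
    qed
  qed simp
  show ?thesis by (rule gen) simp
qed

lemma deriv_period: "v \<in> L \<Longrightarrow> deriv x (z + v) = deriv x z"
  unfolding deriv_def DERIV_shift by (simp add: period_x)

lemma deriv_x: "z \<notin> L \<Longrightarrow> (x has_field_derivative deriv x z) (at z)"
  using holomorphic_derivI[OF hol open_L] by simp

lemma deriv_even: "z \<notin> L \<Longrightarrow> deriv x (- z) = - deriv x z"
proof -
  assume z: "z \<notin> L"
  have "((\<lambda>z. x (- z)) has_field_derivative deriv x (- z) * (- 1)) (at z)"
    using z by (intro DERIV_chain2[of x] deriv_x derivative_eq_intros) auto
  hence "(x has_field_derivative - deriv x (- z)) (at z)" by (simp add: even)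
  thus ?thesis using deriv_x[OF z] DERIV_unique by fastforce
qed

lemma half_period:
  assumes w: "2 * w \<in> L" "w \<notin> L"
  shows "\<exists>l. (\<lambda>z. (x (z + w) - x w) / z^2) \<midarrow>0\<rightarrow> l" and "deriv x w = 0" and "x (w - z) = x (w + z)"
proof -
  have sym: "x (w - z) = x (w + z)" for z
  proof -
    have "x (w - z) = x (- (w - z))" by (rule even[symmetric])
    also have "\<dots> = x (- (w - z) + 2 * w)" by (rule period_x[OF w(1), symmetric])
    finally show ?thesis by (simp add: algebra_simps)
  qed
  thus "x (w - z) = x (w + z)" .
  have "w \<in> - L" using w by simp
  then obtain r where r: "r > 0" "ball w r \<subseteq> - L" using open_L openE by metis
  have "(\<lambda>z. x (z + w)) holomorphic_on ball 0 r"
  proof -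
    have "(x \<circ> (\<lambda>z. z + w)) holomorphic_on ball 0 r"
      by (rule holomorphic_on_compose_gen[OF _ hol]) (use r(2) in \<open>auto intro!: holomorphic_intros simp: subset_eq dist_norm\<close>)
    thus ?thesis by (simp add: o_def)
  qed
  hence "(\<lambda>z. x (z + w) - x w) holomorphic_on ball 0 r" by (intro holomorphic_intros)
  thus "\<exists>l. (\<lambda>z. (x (z + w) - x w) / z^2) \<midarrow>0\<rightarrow> l"
    by (rule even_holomorphic_quotient_limit) (use r sym in \<open>auto simp: add.commute\<close>)
  have "deriv x w = deriv x (- w)" using deriv_period[OF w(1), of "- w"] by simp
  thus "deriv x w = 0" using deriv_even[OF w(2)] by simp
qed

text \<open>At a half period w the function x - x(w) has a double zero because it is even around w.
  Translation by w moves this zero onto the double pole at 0 and the pole onto the zero, so the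
  product has only removable singularities.\<close>

lemma half_period_product:
  assumes w: "2 * w \<in> L" "w \<notin> L"
  shows "\<exists>C. C \<noteq> 0 \<and> (\<forall>z. z \<notin> L \<longrightarrow> z + w \<notin> L \<longrightarrow> (x z - x w) * (x (z + w) - x w) = C)"
proof -
  define f where "f z = (x z - x w) * (x (z + w) - x w)" for z
  have p: "f (z + 1) = f z" "f (z + \<tau>) = f z" for z
    using period_1[of z] period_1[of "z + w"] period_tau[of z] period_tau[of "z + w"] by (simp_all add: f_def add_ac)
  have pw: "f (z + w) = f z" for z
  proof -
    have "x (z + w + w) = x z" using period_x[OF w(1), of z] by (simp add: algebra_simps)
    thus ?thesis by (simp add: f_def)
  qed
  have wZ: "z + w \<in> Z 2 \<longleftrightarrow> z \<in> Z 2" for z using w(1) by (simp add: Z_def distrib_left L_add_iff)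
  have sub: "- Z 2 \<subseteq> - L" using L_Z by blast
  have hf: "f holomorphic_on - Z 2"
  proof -
    have "(x \<circ> (\<lambda>z. z + w)) holomorphic_on - Z 2"
      by (rule holomorphic_on_compose_gen[OF _ hol]) (use sub wZ in \<open>auto intro!: holomorphic_intros\<close>)
    thus ?thesis unfolding f_def o_def by (intro holomorphic_intros holomorphic_on_subset[OF hol sub])
  qed
  obtain l where l: "(\<lambda>z. (x (z + w) - x w) / z^2) \<midarrow>0\<rightarrow> l" using half_period(1)[OF w] by blast
  have "(\<lambda>z. (z^2 * x z - z^2 * x w) * ((x (z + w) - x w) / z^2)) \<midarrow>0\<rightarrow> (c - 0^2 * x w) * l"
    by (intro tendsto_intros pole l)
  hence "f \<midarrow>0\<rightarrow> (c - 0^2 * x w) * l"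
    by (rule Lim_transform_eventually) (auto simp: eventually_at_filter f_def algebra_simps)
  then obtain l0 where l0: "f \<midarrow>0\<rightarrow> l0" by blast
  have lim: "\<exists>l. f \<midarrow>z\<rightarrow> l" for z
  proof (cases "z \<in> L \<or> z + w \<in> L")
    case True
    thus ?thesis
    proof
      assume "z \<in> L"
      thus ?thesis using limit_period[OF period[of f, OF p] l0] by fastforce
    next
      assume "z + w \<in> L"
      hence "z - w \<in> L" using L_add_iff[OF w(1), of "z - w"] by (simp add: algebra_simps)
      hence "f \<midarrow>(0 + (z - w))\<rightarrow> l0" by (rule limit_period[OF period[of f, OF p] l0])
      from limit_period[OF pw this] show ?thesis by auto
    qed
  next
    case False
    hence "isCont f z" unfolding f_def
      by (intro continuous_intros isCont_o2[where g = x and f = "\<lambda>z. z + w"] isCont_x) auto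
    thus ?thesis by (auto simp: isCont_def)
  qed
  obtain C where C: "\<And>z. z \<notin> Z 2 \<Longrightarrow> f z = C" using liouville[of 2 f] hf lim p by auto
  have C': "f z = C" if z: "z \<notin> L" "z + w \<notin> L" for z
  proof -
    have "isCont f z" unfolding f_def using z
      by (intro continuous_intros isCont_o2[where g = x and f = "\<lambda>z. z + w"] isCont_x) auto
    hence "f \<midarrow>z\<rightarrow> f z" by (simp add: isCont_def)
    moreover have "f \<midarrow>z\<rightarrow> C"
      by (rule tendsto_eventually[OF eventually_mono[OF eventually_not_Z[of 2] C]]) simp
    ultimately show ?thesis by (rule LIM_unique)
  qed
  have "eventually (\<lambda>z. x (z + w) \<noteq> x w) (at 0)"
    using eventually_ne[of "x w" w] by (subst (asm) at_to_0) (simp add: eventually_filtermap)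
  hence "eventually (\<lambda>z. x z \<noteq> x w \<and> x (z + w) \<noteq> x w \<and> z \<notin> Z 2) (at 0)"
    using eventually_ne[of "x w" 0] eventually_not_Z[of 2 0] by (intro eventually_conj) auto
  hence "\<exists>z. x z \<noteq> x w \<and> x (z + w) \<noteq> x w \<and> z \<notin> Z 2" using eventually_happens' at_neq_bot by blast
  then obtain z where "x z \<noteq> x w" "x (z + w) \<noteq> x w" "z \<notin> Z 2" by blast
  hence "C \<noteq> 0" using C[of z] by (auto simp: f_def)
  thus ?thesis using C' by (auto simp: f_def)
qed

lemma half_period_value:
  assumes w: "2 * w \<in> L" "w \<notin> L" and z: "z \<notin> L" "x z = x w"
  shows "z - w \<in> L"
proof (rule ccontr)
  assume "z - w \<notin> L"
  hence "z + w \<notin> L" using L_add_iff[OF w(1), of "z - w"] by (simp add: algebra_simps)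
  thus False using half_period_product[OF w] z by auto
qed

text \<open>The squared derivative is even, and from x ~ c / z^2 it has leading term 4 c^2 / z^6; so
  it is a cubic in x with leading coefficient 4 c^2 / c^3.\<close>

lemma deriv_squared: "\<exists>p. degree p \<le> 3 \<and> coeff p 3 = 4 / c \<and> (\<forall>z. z \<notin> L \<longrightarrow> (deriv x z)^2 = poly p (x z))"
proof -
  obtain r where r: "r > 0" "ball 0 r - {0} \<subseteq> - L" using isolated_Z[of 1 0] Z_1 by auto
  define \<phi> where "\<phi> z = (if z = 0 then c else z^2 * x z)" for z
  have h: "\<phi> holomorphic_on ball 0 r" unfolding \<phi>_def
    by (intro removable_holomorphic pole holomorphic_intros holomorphic_on_subset[OF hol r(2)])
  have "isCont (deriv \<phi>) 0"
    using holomorphic_on_imp_continuous_on[OF holomorphic_deriv[OF h open_ball]] r(1)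
    by (simp add: continuous_on_eq_continuous_at)
  moreover have "isCont \<phi> 0"
    using holomorphic_on_imp_continuous_on[OF h] r(1) by (simp add: continuous_on_eq_continuous_at)
  ultimately have "(\<lambda>z. z * deriv \<phi> z - 2 * \<phi> z) \<midarrow>0\<rightarrow> 0 * deriv \<phi> 0 - 2 * \<phi> 0"
    unfolding isCont_def by (intro tendsto_intros)
  moreover have "eventually (\<lambda>z. z * deriv \<phi> z - 2 * \<phi> z = z^3 * deriv x z) (at 0)"
  proof -
    have "eventually (\<lambda>z. z \<in> ball 0 r) (at (0::complex))" using r by (intro eventually_at_in_open') auto
    moreover have "eventually (\<lambda>z. z \<noteq> 0) (at (0::complex))" by (simp add: eventually_at_filter)
    ultimately show ?thesis
    proof eventually_elim
      case (elim z)
      hence z: "z \<notin> L" using r(2) by auto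
      have "((\<lambda>z. z^2 * x z) has_field_derivative 2 * z * x z + z^2 * deriv x z) (at z)"
        using deriv_x[OF z] by (auto intro!: derivative_eq_intros)
      hence "(\<phi> has_field_derivative 2 * z * x z + z^2 * deriv x z) (at z)"
        by (rule has_field_derivative_transform_within_open[where S = "- {0}"]) (use elim in \<open>auto simp: \<phi>_def\<close>)
      hence "deriv \<phi> z = 2 * z * x z + z^2 * deriv x z" by (rule DERIV_imp_deriv)
      thus ?case using elim by (simp add: \<phi>_def algebra_simps power2_eq_square power3_eq_cube)
    qed
  qed
  ultimately have "(\<lambda>z. z^3 * deriv x z) \<midarrow>0\<rightarrow> 0 * deriv \<phi> 0 - 2 * \<phi> 0" by (rule Lim_transform_eventually)
  hence "(\<lambda>z. (z^3 * deriv x z)^2) \<midarrow>0\<rightarrow> (0 * deriv \<phi> 0 - 2 * \<phi> 0)^2" by (intro tendsto_intros)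
  hence "(\<lambda>z. z ^ (2 * 3) * (deriv x z)^2) \<midarrow>0\<rightarrow> 4 * c^2" by (simp add: power_mult_distrib \<phi>_def flip: power_mult)
  moreover have "(\<lambda>z. (deriv x z)^2) holomorphic_on - Z 1"
    unfolding Z_1 by (intro holomorphic_intros holomorphic_deriv hol open_L)
  moreover have "(deriv x (z + 1))^2 = (deriv x z)^2" "(deriv x (z + \<tau>))^2 = (deriv x z)^2" for z
    by (simp_all add: deriv_period)
  moreover have "(deriv x (- z))^2 = (deriv x z)^2" if "z \<notin> Z 1" for z
    using deriv_even[of z] that unfolding Z_1 by simp
  ultimately obtain p where p: "degree p \<le> 3" "coeff p 3 = 4 * c^2 / c ^ 3" "\<And>z. z \<notin> Z 1 \<Longrightarrow> (deriv x z)^2 = poly p (x z)"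
    using even_elliptic_poly[of 1 "\<lambda>z. (deriv x z)^2" 3 "4 * c^2"] unfolding Z_1 by auto
  have "4 * c^2 / c^3 = 4 / c" using c by (simp add: power2_eq_square power3_eq_cube)
  thus ?thesis using p Z_1 by auto
qed

end


section \<open>A Legendre coordinate for the lattice Z + Z sqrt(-q)\<close>

context even_elliptic
begin

lemma half_in_L: "(of_int a + of_int b * \<tau>) / 2 \<in> L \<longleftrightarrow> even a \<and> even b"
proof
  assume "(of_int a + of_int b * \<tau>) / 2 \<in> L"
  then obtain m n where mn: "(of_int a + of_int b * \<tau>) / 2 = of_int m + of_int n * \<tau>" by (auto simp: L_def)
  have "of_int b * Im \<tau> = of_int (2 * n) * Im \<tau>" using arg_cong[OF mn, of Im] by (simp add: mult.commute)
  hence b: "b = 2 * n" using Im_pos by (metis less_irrefl mult_cancel_right of_int_eq_iff)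
  have "of_int a = (of_int (2 * m) :: complex)" using mn by (simp add: b)
  hence "a = 2 * m" by (simp only: of_int_eq_iff)
  thus "even a \<and> even b" using b by simp
next
  assume "even a \<and> even b"
  then obtain m n where "a = 2 * m" "b = 2 * n" by (auto elim!: evenE)
  thus "(of_int a + of_int b * \<tau>) / 2 \<in> L" by (intro L_I[of _ m n]) simp
qed

end

locale cm_elliptic = even_elliptic +
  fixes q :: nat and \<mu> w1 w2 :: complex
  assumes tau_squared: "\<tau>^2 = - of_nat q" and odd_q: "odd q"
    and half_periods: "w1 = 1 / 2 \<and> w2 = \<tau> / 2 \<or> w1 = \<tau> / 2 \<and> w2 = 1 / 2"
    and x_w0: "x (w1 + w2) = 0" and x_w1: "x w1 = 1" and x_w2: "x w2 = \<mu>"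
begin

definition f :: "complex poly" where "f = [:0, \<mu>, - (1 + \<mu>), 1:]"

lemma f_factor: "poly f e = e * (e - 1) * (e - \<mu>)"
  by (simp add: f_def algebra_simps)

lemma half_1: "2 * w1 \<in> L" "w1 \<notin> L" and half_2: "2 * w2 \<in> L" "w2 \<notin> L"
  and half_0: "2 * (w1 + w2) \<in> L" "w1 + w2 \<notin> L"
proof -
  have *: "2 * (1 / 2) \<in> L" "1 / 2 \<notin> L" "2 * (\<tau> / 2) \<in> L" "\<tau> / 2 \<notin> L"
    "2 * (1 / 2 + \<tau> / 2) \<in> L" "1 / 2 + \<tau> / 2 \<notin> L"
    using half_in_L[of 1 0] half_in_L[of 0 1] half_in_L[of 1 1] L_add[OF L_1 L_tau]
    by (simp_all add: add_divide_distrib)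
  show "2 * w1 \<in> L" "w1 \<notin> L" "2 * w2 \<in> L" "w2 \<notin> L" "2 * (w1 + w2) \<in> L" "w1 + w2 \<notin> L"
    using half_periods * by (metis add.commute)+
qed

lemma half_cases:
  assumes "2 * t \<in> L" "t \<notin> L"
  shows "t - w1 \<in> L \<or> t - w2 \<in> L \<or> t - (w1 + w2) \<in> L"
proof -
  obtain a b where ab: "2 * t = of_int a + of_int b * \<tau>" using assms(1) by (auto simp: L_def)
  hence t: "t = (of_int a + of_int b * \<tau>) / 2" by (metis nonzero_mult_div_cancel_left zero_neq_numeral)
  have *: "t - 1 / 2 = (of_int (a - 1) + of_int b * \<tau>) / 2" "t - \<tau> / 2 = (of_int a + of_int (b - 1) * \<tau>) / 2"
    "t - (1 / 2 + \<tau> / 2) = (of_int (a - 1) + of_int (b - 1) * \<tau>) / 2"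
    by (simp_all add: t field_simps)
  have "odd a \<or> odd b" using assms(2) half_in_L[of a b] t by auto
  hence "t - 1 / 2 \<in> L \<or> t - \<tau> / 2 \<in> L \<or> t - (1 / 2 + \<tau> / 2) \<in> L"
    unfolding * half_in_L by auto
  thus ?thesis using half_periods by (metis add.commute)
qed

lemma tau_L: "v \<in> L \<Longrightarrow> \<tau> * v \<in> L"
proof -
  assume "v \<in> L"
  then obtain a b where "v = of_int a + of_int b * \<tau>" by (auto simp: L_def)
  hence "\<tau> * v = of_int b * \<tau>^2 + of_int a * \<tau>" by (simp add: algebra_simps power2_eq_square)
  hence "\<tau> * v = of_int (- (int q * b)) + of_int a * \<tau>" by (simp add: tau_squared)
  thus ?thesis by (rule L_I)
qed

text \<open>As q is odd, \<tau> times \<tau>/2 equals -q/2, congruent to 1/2: multiplication by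
  \<tau> exchanges \<open>w1\<close> and \<open>w2\<close> modulo the lattice and fixes their
  sum.\<close>

lemma tau_w: "\<tau> * w1 - w2 \<in> L" "\<tau> * w2 - w1 \<in> L" "\<tau> * (w1 + w2) - (w1 + w2) \<in> L"
proof -
  have "\<tau> * (\<tau> / 2) - 1 / 2 = (of_int (- int q - 1) + of_int 0 * \<tau>) / 2"
    using tau_squared by (simp add: power2_eq_square)
  moreover have "(of_int (- int q - 1) + of_int 0 * \<tau>) / 2 \<in> L" unfolding half_in_L using odd_q by simp
  ultimately have 1: "\<tau> * (\<tau> / 2) - 1 / 2 \<in> L" by (simp only:)
  have "\<tau> * (1 / 2) - \<tau> / 2 \<in> L" by simp
  with 1 have 2: "\<tau> * w1 - w2 \<in> L \<and> \<tau> * w2 - w1 \<in> L" using half_periods by metis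
  have "\<tau> * (w1 + w2) - (w1 + w2) = (\<tau> * w1 - w2) + (\<tau> * w2 - w1)" by (simp add: algebra_simps)
  with 2 show "\<tau> * w1 - w2 \<in> L" "\<tau> * w2 - w1 \<in> L" "\<tau> * (w1 + w2) - (w1 + w2) \<in> L"
    using L_add[of "\<tau> * w1 - w2" "\<tau> * w2 - w1"] by (simp_all only:)
qed

lemma mu: "\<mu> \<noteq> 0" "\<mu> \<noteq> 1"
proof -
  show "\<mu> \<noteq> 0"
  proof
    assume "\<mu> = 0"
    hence "w2 - (w1 + w2) \<in> L" using x_w0 x_w2 by (intro half_period_value half_0 half_2) simp
    thus False using half_1 by simp
  qed
  show "\<mu> \<noteq> 1"
  proof
    assume "\<mu> = 1"
    hence "w2 - w1 \<in> L" using x_w1 x_w2 by (intro half_period_value half_1 half_2) simp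
    hence "w2 - w1 + 2 * w1 \<in> L" using half_1(1) by (rule L_add)
    thus False using half_0 by (simp add: add.commute)
  qed
qed

lemma root_f: "z \<notin> L \<Longrightarrow> poly f (x z) = 0 \<Longrightarrow> 2 * z \<in> L"
proof -
  assume z: "z \<notin> L" "poly f (x z) = 0"
  have "2 * z \<in> L" if w: "2 * w \<in> L" "w \<notin> L" "x z = x w" for w
  proof -
    have "z - w \<in> L" using w z by (intro half_period_value)
    hence "of_nat 2 * (z - w) + 2 * w \<in> L" using w(1) by (intro L_add L_of_nat_mult)
    thus ?thesis by (simp add: algebra_simps)
  qed
  from this[OF half_0] this[OF half_1] this[OF half_2] show ?thesis
    using z(2) x_w0 x_w1 x_w2 by (auto simp: f_factor)
qed

text \<open>The constants of \<open>half_period_product\<close> are found by inserting another half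
  period.\<close>

lemma product_0: "z \<notin> L \<Longrightarrow> z + (w1 + w2) \<notin> L \<Longrightarrow> x z * x (z + (w1 + w2)) = \<mu>"
  and product_1: "z \<notin> L \<Longrightarrow> z + w1 \<notin> L \<Longrightarrow> (x z - 1) * (x (z + w1) - 1) = 1 - \<mu>"
  and product_2: "z \<notin> L \<Longrightarrow> z + w2 \<notin> L \<Longrightarrow> (x z - \<mu>) * (x (z + w2) - \<mu>) = \<mu> * (\<mu> - 1)"
proof -
  have s: "w1 + (w1 + w2) = w2 + 2 * w1" "w2 + w1 = w1 + w2" by (simp_all add: algebra_simps)
  have x01: "x (w1 + (w1 + w2)) = \<mu>" unfolding s(1) using period_x[OF half_1(1)] x_w2 by simp
  have n: "w1 + (w1 + w2) \<notin> L" unfolding s(1) using L_add_iff[OF half_1(1)] half_2 by simp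
  show "x z * x (z + (w1 + w2)) = \<mu>" if "z \<notin> L" "z + (w1 + w2) \<notin> L"
    using half_period_product[OF half_0] that half_1(2) n x01 x_w0 x_w1 by fastforce
  show "(x z - 1) * (x (z + w1) - 1) = 1 - \<mu>" if "z \<notin> L" "z + w1 \<notin> L"
  proof -
    obtain C where C: "\<And>z. z \<notin> L \<Longrightarrow> z + w1 \<notin> L \<Longrightarrow> (x z - 1) * (x (z + w1) - 1) = C"
      using half_period_product[OF half_1] x_w1 by auto
    have "(x w2 - 1) * (x (w2 + w1) - 1) = C" using half_2 half_0 by (intro C) (simp_all add: s)
    thus ?thesis using C[OF that] x_w2 x_w0 by (simp add: s)
  qed
  show "(x z - \<mu>) * (x (z + w2) - \<mu>) = \<mu> * (\<mu> - 1)" if "z \<notin> L" "z + w2 \<notin> L"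
  proof -
    obtain C where C: "\<And>z. z \<notin> L \<Longrightarrow> z + w2 \<notin> L \<Longrightarrow> (x z - \<mu>) * (x (z + w2) - \<mu>) = C"
      using half_period_product[OF half_2] x_w2 by auto
    have "(x w1 - \<mu>) * (x (w1 + w2) - \<mu>) = C" using half_1 half_0 by (intro C)
    thus ?thesis using C[OF that] x_w1 x_w0 by (simp add: algebra_simps)
  qed
qed

lemma f_roots_period:
  assumes "2 * t \<in> L" "t \<notin> L"
  shows "poly f (x t) = 0"
  using half_cases[OF assms] period_x'[of t] x_w0 x_w1 x_w2 by (auto simp: f_factor)

text \<open>The derivative vanishes at the half periods, so the cubic of
  \<open>deriv_squared\<close> has the three distinct roots 0, 1 and \<mu>.\<close>

lemma deriv_f: "z \<notin> L \<Longrightarrow> (deriv x z)^2 = 4 / c * poly f (x z)"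
proof -
  assume z: "z \<notin> L"
  obtain p where p: "degree p \<le> 3" "coeff p 3 = 4 / c" "\<And>z. z \<notin> L \<Longrightarrow> (deriv x z)^2 = poly p (x z)"
    using deriv_squared by blast
  have root: "poly p (x w) = 0" if "2 * w \<in> L" "w \<notin> L" for w
    using p(3)[OF that(2)] half_period(2)[OF that] by simp
  define r where "r = p - smult (4 / c) f"
  have "r = 0"
  proof (rule ccontr)
    assume r: "r \<noteq> 0"
    have "degree r \<le> 2"
    proof (rule degree_le, intro allI impI)
      fix i :: nat assume i: "2 < i"
      show "coeff r i = 0"
      proof (cases "i = 3")
        case True
        thus ?thesis using p(2) by (simp add: r_def f_def numeral_3_eq_3)
      next
        case False
        hence "coeff p i = 0" "coeff f i = 0"
          using i p(1) by (auto intro!: coeff_eq_0 simp: f_def)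
        thus ?thesis by (simp add: r_def)
      qed
    qed
    moreover have "card {0, 1, \<mu>} \<le> card {z. poly r z = 0}"
      using root[OF half_0] root[OF half_1] root[OF half_2] x_w0 x_w1 x_w2
      by (intro card_mono poly_roots_finite[OF r]) (auto simp: r_def f_factor)
    moreover have "card {z. poly r z = 0} \<le> degree r" using r by (rule poly_roots_degree)
    ultimately show False using mu by simp
  qed
  hence "p = smult (4 / c) f" by (simp add: r_def)
  thus ?thesis using p(3)[OF z] by simp
qed

lemma scaled_pole:
  assumes m: "m \<noteq> 0"
  shows "(\<lambda>s. s^2 * x (m * s)) \<midarrow>0\<rightarrow> c / m^2"
proof -
  have "filterlim (\<lambda>s. m * s) (at 0) (at 0)"
    using m by (intro filterlim_atI) (auto intro!: tendsto_eq_intros simp: eventually_at_filter)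
  hence "(\<lambda>s. (m * s)^2 * x (m * s)) \<midarrow>0\<rightarrow> c" using filterlim_compose[OF pole] by blast
  hence "(\<lambda>s. (m * s)^2 * x (m * s) / m^2) \<midarrow>0\<rightarrow> c / m^2" using m by (intro tendsto_intros) auto
  thus ?thesis using m by (simp add: power_mult_distrib)
qed

lemma degree_f: "degree f = 3" "lead_coeff f = 1"
  by (simp_all add: f_def)

lemma scaled_holomorphic: "(\<And>z. z \<in> S \<Longrightarrow> m * z \<notin> L) \<Longrightarrow> (\<lambda>z. x (m * z)) holomorphic_on S"
proof -
  assume *: "\<And>z. z \<in> S \<Longrightarrow> m * z \<notin> L"
  have "(x \<circ> (\<lambda>z. m * z)) holomorphic_on S"
    by (rule holomorphic_on_compose_gen[OF _ hol]) (use * in \<open>auto intro!: holomorphic_intros\<close>)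
  thus ?thesis by (simp add: o_def)
qed

lemma holomorphic_poly: "g holomorphic_on S \<Longrightarrow> (\<lambda>z. poly p (g z)) holomorphic_on S"
  by (induction p) (auto intro!: holomorphic_intros)

lemma scaled_deriv: "m * z \<notin> L \<Longrightarrow> ((\<lambda>z. x (m * z)) has_field_derivative deriv x (m * z) * m) (at z)"
  by (rule DERIV_chain2[OF deriv_x]) (auto intro!: derivative_eq_intros)

lemma poly_deriv: "(g has_field_derivative d) (at z) \<Longrightarrow>
    ((\<lambda>z. poly p (g z)) has_field_derivative poly (pderiv p) (g z) * d) (at z)"
  using DERIV_chain2[OF poly_DERIV] .

text \<open>As a function of z, f(x(z)) has zeros of order two at the half periods, cancelling the
  double poles of x(2z) there. The pole at 0 has order 2 + 6 = 8, so the product is a quartic in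
  x(z).\<close>

lemma duplication_poly:
  obtains p where "degree p \<le> 4" "coeff p 4 = 1" "\<And>z. z \<notin> Z 2 \<Longrightarrow> 4 * x (2 * z) * poly f (x z) = poly p (x z)"
proof -
  define h where "h z = 4 * x (2 * z) * poly f (x z)" for z
  have sub: "- Z 2 \<subseteq> - L" using L_Z by blast
  have hh: "h holomorphic_on - Z 2" unfolding h_def
    by (intro holomorphic_intros scaled_holomorphic holomorphic_poly holomorphic_on_subset[OF hol sub])
      (auto simp: Z_def)
  have p: "h (z + 1) = h z" "h (z + \<tau>) = h z" for z
  proof -
    have "of_nat 2 * 1 \<in> L" "of_nat 2 * \<tau> \<in> L" by (intro L_of_nat_mult; simp)+
    hence "x (2 * z + 2) = x (2 * z)" "x (2 * z + 2 * \<tau>) = x (2 * z)" by (simp_all add: period_x)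
    thus "h (z + 1) = h z" "h (z + \<tau>) = h z" by (simp_all add: h_def period_1 period_tau distrib_left)
  qed
  have even_h: "h (- z) = h z" for z by (simp add: h_def even)
  have lim_w: "\<exists>l. h \<midarrow>w\<rightarrow> l" if w: "2 * w \<in> L" "w \<notin> L" for w
  proof -
    obtain l where l: "(\<lambda>z. (x (z + w) - x w) / z^2) \<midarrow>0\<rightarrow> l" using half_period(1)[OF w] by blast
    have "[:- x w, 1:] dvd f" using f_roots_period[OF w] by (simp add: poly_eq_0_iff_dvd)
    then obtain k where k: "f = [:- x w, 1:] * k" by (elim dvdE)
    have "isCont (\<lambda>z. x (z + w)) 0" using w(2) by (intro isCont_o2[where g = x and f = "\<lambda>z. z + w"] isCont_x) auto
    hence cont: "(\<lambda>z. x (z + w)) \<midarrow>0\<rightarrow> x w" by (simp add: isCont_def)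
    have "(\<lambda>z. 4 * (z^2 * x (2 * z)) * ((x (z + w) - x w) / z^2) * poly k (x (z + w))) \<midarrow>0\<rightarrow> 4 * (c / 2^2) * l * poly k (x w)"
      by (intro tendsto_mult scaled_pole l tendsto_poly cont tendsto_const) simp
    hence "(\<lambda>z. h (w + z)) \<midarrow>0\<rightarrow> 4 * (c / 2^2) * l * poly k (x w)"
    proof (rule Lim_transform_eventually)
      have "4 * (z^2 * x (2 * z)) * ((x (z + w) - x w) / z^2) * poly k (x (z + w)) = h (w + z)" if "z \<noteq> 0" for z
        using that period_x[OF w(1), of "2 * z"] unfolding h_def by (subst k) (simp add: algebra_simps)
      thus "\<forall>\<^sub>F z in at 0. 4 * (z^2 * x (2 * z)) * ((x (z + w) - x w) / z^2) * poly k (x (z + w)) = h (w + z)"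
        by (auto simp: eventually_at_filter)
    qed
    from LIM_offset_zero_cancel[OF this] show ?thesis ..
  qed
  have lim: "\<exists>l. h \<midarrow>z\<rightarrow> l" if "z \<in> Z 2 - L" for z using lim_w that by (auto simp: Z_def)
  have "(\<lambda>z. 4 * (z^2 * x (2 * z)) * (z ^ (2 * degree f) * poly f (x z))) \<midarrow>0\<rightarrow> 4 * (c / 2^2) * (lead_coeff f * c ^ degree f)"
    by (intro tendsto_mult scaled_pole poly_pole tendsto_const) simp
  moreover have "4 * (z^2 * x (2 * z)) * (z ^ (2 * degree f) * poly f (x z)) = z ^ (2 * 4) * h z" for z
    unfolding degree_f(1) h_def by (simp add: numeral_eq_Suc)
  moreover have "4 * (c / 2^2) * (lead_coeff f * c ^ degree f) = c ^ 4"
    unfolding degree_f(2) unfolding degree_f(1) by (simp add: numeral_eq_Suc)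
  ultimately have "(\<lambda>z. z ^ (2 * 4) * h z) \<midarrow>0\<rightarrow> c ^ 4" by simp
  from even_elliptic_poly[of 2 h, OF _ hh lim p even_h this]
  obtain p where "degree p \<le> 4" "coeff p 4 = c ^ 4 / c ^ 4" "\<And>z. z \<notin> Z 2 \<Longrightarrow> h z = poly p (x z)" by auto
  thus ?thesis using that[of p] c by (simp add: h_def)
qed

lemma double_roots_poly:
  fixes v :: complex
  assumes p: "degree p \<le> 4" "coeff p 4 = 1" and v: "v \<noteq> 0"
    and roots: "poly p v = 0" "poly p (- v) = 0" "poly (pderiv p) v = 0" "poly (pderiv p) (- v) = 0"
  shows "poly p y = (y^2 - v^2)^2"
proof -
  obtain a b d e where pe: "p = [:a, b, d, e, 1:]"
  proof -
    have "p = [:coeff p 0, coeff p 1, coeff p 2, coeff p 3, 1:]"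
    proof (rule Polynomial.poly_eqI)
      fix n :: nat
      consider "n = 0" | "n = 1" | "n = 2" | "n = 3" | "n = 4" | "n > 4" by linarith
      thus "coeff p n = coeff [:coeff p 0, coeff p 1, coeff p 2, coeff p 3, 1:] n"
        using p by cases (auto simp: numeral_eq_Suc coeff_eq_0 coeff_pCons split: nat.splits)
    qed
    thus ?thesis using that by blast
  qed
  have "a + b * v + d * v^2 + e * v^3 + v^4 = 0" "a - b * v + d * v^2 - e * v^3 + v^4 = 0"
    "b + 2 * d * v + 3 * e * v^2 + 4 * v^3 = 0" "b - 2 * d * v + 3 * e * v^2 - 4 * v^3 = 0"
    using roots by (simp_all add: pe pderiv_pCons algebra_simps power2_eq_square power3_eq_cube numeral_eq_Suc)
  hence "v * (d + 2 * v^2) = 0" and b: "b = - 3 * e * v^2" and "2 * v * (b + e * v^2) = 0" and a: "a = - d * v^2 - v^4"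
    by Groebner_Basis.algebra+
  hence "d + 2 * v^2 = 0" "b + e * v^2 = 0" using v by simp_all
  hence d: "d = - 2 * v^2" and "2 * (v^2 * e) = 0" using b by Groebner_Basis.algebra+
  hence e: "e = 0" using v by simp
  have a': "a = v^4" unfolding a d by (simp add: numeral_eq_Suc)
  show ?thesis unfolding pe e b d a' by (simp add: algebra_simps numeral_eq_Suc)
qed

text \<open>The zeros of x(2z) are double and lie where 2z = w1 + w2 modulo the lattice. The points
  a and b = a + w1 satisfy this, and the product formulas give x(a)^2 = \<mu> and x(b) = -x(a). So
  the quartic has double roots at both square roots of \<mu>.\<close>

lemma duplication:
  assumes z: "2 * z \<notin> L"
  shows "4 * x (2 * z) * poly f (x z) = ((x z)^2 - \<mu>)^2"
proof -
  obtain p where p: "degree p \<le> 4" "coeff p 4 = 1" "\<And>z. z \<notin> Z 2 \<Longrightarrow> 4 * x (2 * z) * poly f (x z) = poly p (x z)"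
    using duplication_poly by blast
  have nL: "t \<notin> L" if "2 * t \<notin> L" for t using that L_of_nat_mult[of t 2] by auto
  have n2: "2 * t \<notin> L" if "2 * t - (w1 + w2) \<in> L" for t using L_diff[OF _ that, of "2 * t"] half_0 by auto
  have dbl: "poly p (x t) = 0 \<and> poly (pderiv p) (x t) = 0" if t: "2 * t - (w1 + w2) \<in> L" for t
  proof
    note t2 = n2[OF t]
    note t1 = nL[OF t2]
    have x2: "x (2 * t) = 0" using period_x'[OF t] x_w0 by simp
    have d2: "deriv x (2 * t) = 0" using deriv_period[OF t, of "w1 + w2"] half_period(2)[OF half_0] by simp
    show "poly p (x t) = 0" using p(3)[of t] t2 x2 by (simp add: Z_def)
    have "((\<lambda>z. 4 * x (2 * z) * poly f (x z)) has_field_derivative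
       4 * (deriv x (2 * t) * 2) * poly f (x t) + poly (pderiv f) (x t) * deriv x t * (4 * x (2 * t))) (at t)"
      by (rule DERIV_mult[OF DERIV_cmult[OF scaled_deriv[OF t2]] poly_deriv[OF deriv_x[OF t1]]])
    hence "((\<lambda>z. poly p (x z)) has_field_derivative 0) (at t)"
      unfolding x2 d2 by (simp, elim has_field_derivative_transform_within_open[where S = "- Z 2"])
        (use p(3) t2 open_Z[of 2] in \<open>auto simp: Z_def\<close>)
    moreover have "((\<lambda>z. poly p (x z)) has_field_derivative poly (pderiv p) (x t) * deriv x t) (at t)"
      by (intro poly_deriv deriv_x t1)
    ultimately have "poly (pderiv p) (x t) * deriv x t = 0" using DERIV_unique by blast
    moreover have "deriv x t \<noteq> 0" using deriv_f[OF t1] root_f[OF t1] t2 c by auto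
    ultimately show "poly (pderiv p) (x t) = 0" by simp
  qed
  define a b where "a = (w1 + w2) / 2" and "b = a + w1"
  have a2: "2 * a - (w1 + w2) \<in> L" by (simp add: a_def)
  have b2: "2 * b - (w1 + w2) \<in> L" using half_1 by (simp add: b_def a_def algebra_simps)
  have n: "a \<notin> L" "b \<notin> L" by (rule nL[OF n2[OF a2]] nL[OF n2[OF b2]])+
  have va: "(x a)^2 = \<mu>"
    using product_0[of "- a"] n even by (simp add: a_def power2_eq_square field_simps)
  have eq: "- b + (w1 + w2) = b - 2 * w1" by (simp add: b_def a_def field_simps)
  have "b - 2 * w1 \<notin> L" "x (b - 2 * w1) = x b"
    using n(2) L_add_iff[OF half_1(1), of "b - 2 * w1"] period_x[OF half_1(1), of "b - 2 * w1"] by simp_all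
  hence "- b + (w1 + w2) \<notin> L" "x (- b + (w1 + w2)) = x b" unfolding eq .
  hence vb: "(x b)^2 = \<mu>" using product_0[of "- b"] n even by (simp add: power2_eq_square)
  have "x a \<noteq> x b"
  proof
    assume "x a = x b"
    moreover have "(x a - 1) * (x b - 1) = 1 - \<mu>" using product_1[of a] n by (simp add: b_def)
    ultimately have "(x a - 1)^2 = 1 - (x a)^2" using va by (simp add: power2_eq_square)
    hence "x a * (x a - 1) = 0" by Groebner_Basis.algebra
    thus False using va mu by auto
  qed
  hence xb: "x b = - x a" using va vb by (metis power2_eq_iff)
  have "poly p (x z) = ((x z)^2 - (x a)^2)^2"
    using va mu dbl[OF a2] dbl[OF b2] p(1,2) unfolding xb by (intro double_roots_poly) auto
  thus ?thesis using p(3)[of z] z va by (simp add: Z_def)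
qed

end


section \<open>Multiplication by sqrt(-q) as a rational function\<close>

lemma degree_prod_linear: "finite S \<Longrightarrow> degree (\<Prod>j\<in>S. [:- e j, 1:] :: 'a::idom poly) = card S \<and> lead_coeff (\<Prod>j\<in>S. [:- e j, 1:]) = 1"
proof (induction S rule: finite_induct)
  case (insert i S)
  let ?P = "\<Prod>j\<in>S. [:- e j, 1:]"
  have "?P \<noteq> 0" using insert.IH by auto
  hence "degree ([:- e i, 1:] * ?P) = 1 + degree ?P" by (subst degree_mult_eq) auto
  moreover have "lead_coeff ([:- e i, 1:] * ?P) = 1" using insert.IH unfolding lead_coeff_mult by auto
  ultimately show ?case using insert.IH unfolding prod.insert[OF insert.hyps] card_insert_disjoint[OF insert.hyps] by auto
qed auto

lemma coprime_no_common_root: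
  fixes p r :: "'a::field_gcd poly"
  assumes "coprime p r" "poly p w = 0"
  shows "poly r w \<noteq> 0"
proof
  assume "poly r w = 0"
  hence "[:- w, 1:] dvd p" "[:- w, 1:] dvd r" using assms(2) by (simp_all add: poly_eq_0_iff_dvd)
  hence "is_unit [:- w, 1:]" by (rule coprime_common_divisor[OF assms(1)])
  thus False by (simp add: is_unit_iff_degree)
qed

context cm_elliptic
begin

lemma q_pos: "q > 0" using odd_q by (rule odd_pos)

lemma tau_nonzero: "\<tau> \<noteq> 0" using Im_pos by auto

lemma tau_mult_L_Z: "\<tau> * z \<in> L \<Longrightarrow> z \<in> Z q"
proof -
  assume "\<tau> * z \<in> L"
  hence "\<tau> * (\<tau> * z) \<in> L" by (rule tau_L)
  also have "\<tau> * (\<tau> * z) = - (of_nat q * z)"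
    using tau_squared by (simp add: power2_eq_square flip: mult.assoc)
  finally show ?thesis by (simp add: Z_def)
qed

text \<open>The kernel is cyclic of order q, generated by \<tau>/q: solve q z = -\<tau> (\<tau> z)
  with \<tau> z in the lattice.\<close>

lemma isogeny_kernel:
  assumes z: "\<tau> * z \<in> L" "z \<notin> L"
  obtains j where "j \<in> {1..<q}" "z - of_nat j * \<tau> / of_nat q \<in> L"
proof -
  obtain a b where ab: "\<tau> * z = of_int a + of_int b * \<tau>" using z(1) by (auto simp: L_def)
  have "of_nat q * z = - (\<tau> * (\<tau> * z))"
    using tau_squared by (simp add: power2_eq_square flip: mult.assoc)
  also have "\<dots> = of_nat q * of_int b - of_int a * \<tau>" 
    using tau_squared unfolding ab by Groebner_Basis.algebra
  finally have qz: "of_nat q * z = of_nat q * of_int b - of_int a * \<tau>" .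
  define j m where "j = nat ((- a) mod int q)" and "m = (- a) div int q"
  have "int j = (- a) mod int q" using q_pos by (simp add: j_def)
  hence a: "- a = int q * m + int j" by (simp add: m_def)
  have jq: "j < q" using \<open>int j = _\<close> q_pos by (metis of_nat_0_less_iff of_nat_less_iff pos_mod_bound)
  have "of_int (- a) = (of_nat q * of_int m + of_nat j :: complex)" unfolding a by simp
  hence "of_nat q * z = of_nat q * (of_int b + of_int m * \<tau> + of_nat j * \<tau> / of_nat q)"
  proof -
    assume a: "of_int (- a) = (of_nat q * of_int m + of_nat j :: complex)"
    have "of_nat q * of_int b - of_int a * \<tau> = of_nat q * of_int b + of_int (- a) * \<tau>" by simp
    also have "\<dots> = of_nat q * (of_int b + of_int m * \<tau> + of_nat j * \<tau> / of_nat q)"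
      unfolding a using q_pos by (simp add: field_simps)
    finally show ?thesis unfolding qz .
  qed
  hence zj: "z = of_int b + of_int m * \<tau> + of_nat j * \<tau> / of_nat q" using q_pos by simp
  have "z - of_nat j * \<tau> / of_nat q \<in> L" by (rule L_I[of _ b m]) (simp add: zj)
  moreover have "j \<noteq> 0"
  proof
    assume "j = 0"
    hence "z = of_int b + of_int m * \<tau>" using zj by simp
    thus False using z(2) L_I by blast
  qed
  ultimately show ?thesis using that[of j] jq by auto
qed

text \<open>Multiplying x(\<tau> z) by the linear factors of all nonzero kernel points cancels its
  poles away from the lattice; the pole left at 0 has order 2 + 2 (q - 1), so the product is a
  polynomial of degree q in x. Its leading coefficient is 1 / \<tau>^2 = -1/q, whence the factor -q
  in the final choice.\<close>

lemma isogeny_polys: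
  obtains N D where "lead_coeff N = 1" "degree N = q" "degree D = q - 1" "D \<noteq> 0"
    "\<And>z. z \<notin> Z q \<Longrightarrow> poly N (x z) = x (\<tau> * z) * poly D (x z)"
proof -
  define D0 where "D0 = (\<Prod>j\<in>{1..<q}. [:- x (of_nat j * \<tau> / of_nat q), 1:])"
  have D0: "degree D0 = q - 1" "lead_coeff D0 = 1"
    using degree_prod_linear[of "{1..<q}" "\<lambda>j. x (of_nat j * \<tau> / of_nat q)"] by (auto simp: D0_def)
  define h where "h z = x (\<tau> * z) * poly D0 (x z)" for z
  have sub: "- Z q \<subseteq> - L" using L_Z by blast
  have hh: "h holomorphic_on - Z q" unfolding h_def
    by (intro holomorphic_intros scaled_holomorphic holomorphic_poly holomorphic_on_subset[OF hol sub])
      (use tau_mult_L_Z in auto)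
  have p: "h (z + 1) = h z" "h (z + \<tau>) = h z" for z
    using period_x[OF tau_L[OF L_1], of "\<tau> * z"] period_x[OF tau_L[OF L_tau], of "\<tau> * z"]
    by (simp_all add: h_def period_1 period_tau distrib_left)
  have even_h: "h (- z) = h z" for z by (simp add: h_def even)
  have lim: "\<exists>l. h \<midarrow>z0\<rightarrow> l" if z0: "z0 \<in> Z q - L" for z0
  proof (cases "\<tau> * z0 \<in> L")
    case False
    hence "isCont x (\<tau> * z0)" by (rule isCont_x)
    hence "isCont (\<lambda>z. x (\<tau> * z)) z0" by (intro isCont_o2[where g = x and f = "\<lambda>z. \<tau> * z"] continuous_intros)
    moreover have "isCont x z0" using z0 by (intro isCont_x) auto
    ultimately have "h \<midarrow>z0\<rightarrow> h z0" unfolding h_def isCont_def by (intro tendsto_mult tendsto_poly)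
    thus ?thesis ..
  next
    case True
    have nL: "z0 \<notin> L" using z0 by simp
    obtain j where j: "j \<in> {1..<q}" "z0 - of_nat j * \<tau> / of_nat q \<in> L" using isogeny_kernel[OF True nL] by blast
    define e where "e = x z0"
    have e1: "x (of_nat j * \<tau> / of_nat q) = e" using period_x'[OF j(2)] by (simp add: e_def)
    \<comment> \<open>As q is odd, j and q - j are distinct indices; their kernel points are
      opposite and share an abscissa, so the denominator has the double factor needed against the
      double pole.\<close>
    have j': "q - j \<in> {1..<q} - {j}" using j(1) odd_q by auto presburger
    have "of_nat (q - j) * \<tau> / of_nat q = - (of_nat j * \<tau> / of_nat q) + \<tau>"
      using j(1) q_pos by (simp add: of_nat_diff field_simps)
    hence e2: "x (of_nat (q - j) * \<tau> / of_nat q) = e" by (simp only: period_tau even e1)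
    define k where "k = (\<Prod>j\<in>{1..<q} - {j} - {q - j}. [:- x (of_nat j * \<tau> / of_nat q), 1:])"
    have k: "D0 = [:- e, 1:] * ([:- e, 1:] * k)"
      unfolding D0_def k_def prod.remove[OF finite_atLeastLessThan j(1)]
        prod.remove[OF finite_Diff[OF finite_atLeastLessThan] j'] e1 e2 ..
    have "isCont (\<lambda>s. x (z0 + s)) 0" using nL by (intro isCont_o2[where g = x and f = "\<lambda>z. z0 + z"] isCont_x continuous_intros) auto
    hence cont: "(\<lambda>s. x (z0 + s)) \<midarrow>0\<rightarrow> e" by (simp add: isCont_def e_def)
    have "(\<lambda>s. (x (z0 + s) - e) / s) \<midarrow>0\<rightarrow> deriv x z0" using deriv_x[OF nL] by (simp add: DERIV_def e_def)
    hence "(\<lambda>s. s^2 * x (\<tau> * s) * ((x (z0 + s) - e) / s)^2 * poly k (x (z0 + s))) \<midarrow>0\<rightarrow> c / \<tau>^2 * (deriv x z0)^2 * poly k e"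
      by (intro tendsto_mult tendsto_power scaled_pole tau_nonzero tendsto_poly cont)
    hence "(\<lambda>s. h (z0 + s)) \<midarrow>0\<rightarrow> c / \<tau>^2 * (deriv x z0)^2 * poly k e"
    proof (rule Lim_transform_eventually)
      have "s^2 * x (\<tau> * s) * ((x (z0 + s) - e) / s)^2 * poly k (x (z0 + s)) = h (z0 + s)" if "s \<noteq> 0" for s
      proof -
        have "x (\<tau> * (z0 + s)) = x (\<tau> * s)" using period_x[OF True, of "\<tau> * s"] by (simp add: distrib_left add.commute)
        moreover have "poly D0 (x (z0 + s)) = (x (z0 + s) - e)^2 * poly k (x (z0 + s))"
          unfolding k by (simp add: power2_eq_square algebra_simps)
        ultimately show ?thesis using that by (simp add: h_def power_divide)
      qed
      thus "\<forall>\<^sub>F s in at 0. s^2 * x (\<tau> * s) * ((x (z0 + s) - e) / s)^2 * poly k (x (z0 + s)) = h (z0 + s)"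
        by (auto simp: eventually_at_filter)
    qed
    from LIM_offset_zero_cancel[OF this] show ?thesis ..
  qed
  have "(\<lambda>z. z^2 * x (\<tau> * z) * (z ^ (2 * degree D0) * poly D0 (x z))) \<midarrow>0\<rightarrow> c / \<tau>^2 * (lead_coeff D0 * c ^ degree D0)"
    by (intro tendsto_mult scaled_pole poly_pole tau_nonzero)
  moreover have "z^2 * x (\<tau> * z) * (z ^ (2 * degree D0) * poly D0 (x z)) = z ^ (2 * q) * h z" for z
  proof -
    have "2 * q = 2 + 2 * (q - 1)" using q_pos by simp
    hence "z ^ (2 * q) = z^2 * z ^ (2 * (q - 1))" by (metis Power.power_add)
    thus ?thesis unfolding D0(1) h_def by simp
  qed
  moreover have "c / \<tau>^2 * (lead_coeff D0 * c ^ degree D0) = - (c ^ q) / of_nat q"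
    unfolding D0(2) unfolding D0(1) tau_squared using power_minus_mult[OF q_pos, of c] by (simp add: mult.commute)
  ultimately have "(\<lambda>z. z ^ (2 * q) * h z) \<midarrow>0\<rightarrow> - (c ^ q) / of_nat q" by simp
  from even_elliptic_poly[of q h, OF q_pos hh lim p even_h this]
  obtain P where P: "degree P \<le> q" "coeff P q = - (c ^ q) / of_nat q / c ^ q" "\<And>z. z \<notin> Z q \<Longrightarrow> h z = poly P (x z)" by auto
  have Pq: "coeff P q = - 1 / of_nat q" using P(2) c by simp
  have degP: "degree P = q" using P(1) Pq q_pos le_degree[of P q] by simp
  define N D where "N = smult (- of_nat q) P" and "D = smult (- of_nat q) D0"
  show ?thesis
  proof (rule that)
    show "degree N = q" using degP q_pos by (simp add: N_def)
    thus "lead_coeff N = 1" using Pq q_pos by (simp add: N_def)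
    show "degree D = q - 1" using D0(1) q_pos by (simp add: D_def)
    show "D \<noteq> 0" using D0(2) q_pos by (auto simp: D_def)
    show "poly N (x z) = x (\<tau> * z) * poly D (x z)" if "z \<notin> Z q" for z
      using P(3)[OF that] by (simp add: N_def D_def h_def)
  qed
qed

text \<open>The fraction is reduced by the gcd; where the gcd vanishes, the identity extends by
  continuity. Only the bound q is kept for the degree of \<open>N\<close>; equality returns modulo
  the place in \<open>degree_N\<close>.\<close>

lemma isogeny:
  obtains N D where "lead_coeff N = 1" "0 < degree N" "degree N \<le> q" "degree D < degree N" "coprime N D"
    "\<And>z. z \<notin> L \<Longrightarrow> \<tau> * z \<notin> L \<Longrightarrow> poly N (x z) = x (\<tau> * z) * poly D (x z)"
proof -
  obtain N1 D1 where N1: "lead_coeff N1 = 1" "degree N1 = q" and D1: "degree D1 = q - 1" "D1 \<noteq> 0"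
    and eq: "\<And>z. z \<notin> Z q \<Longrightarrow> poly N1 (x z) = x (\<tau> * z) * poly D1 (x z)"
    using isogeny_polys by blast
  define G N D where "G = gcd N1 D1" and "N = N1 div G" and "D = D1 div G"
  have N10: "N1 \<noteq> 0" using N1 by auto
  have G0: "G \<noteq> 0" using D1(2) by (simp add: G_def)
  have ND: "N1 = N * G" "D1 = D * G" by (simp_all add: N_def D_def G_def)
  have "lead_coeff G = 1" using G0 unfolding G_def by (intro poly_gcd_monic) auto
  hence lN: "lead_coeff N = 1" using N1(1) ND(1) by (simp add: lead_coeff_mult)
  have nz: "N \<noteq> 0" "D \<noteq> 0" using N10 D1(2) ND by auto
  have deg: "degree N + degree G = q" "degree D + degree G = q - 1"
    using N1(2) D1(1) ND nz G0 by (simp_all add: degree_mult_eq)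
  have "coprime N D" unfolding N_def D_def G_def using D1(2) by (intro div_gcd_coprime) auto
  moreover have "poly N (x z) = x (\<tau> * z) * poly D (x z)" if z: "z \<notin> L" "\<tau> * z \<notin> L" for z
  proof -
    define k where "k z = poly N (x z) - x (\<tau> * z) * poly D (x z)" for z
    have "isCont x (\<tau> * z)" using z(2) by (rule isCont_x)
    hence "isCont (\<lambda>z. x (\<tau> * z)) z" by (intro isCont_o2[where g = x and f = "\<lambda>z. \<tau> * z"] continuous_intros)
    moreover have "isCont x z" using z by (intro isCont_x) auto
    ultimately have "k \<midarrow>z\<rightarrow> k z" unfolding k_def isCont_def by (intro tendsto_mult tendsto_poly tendsto_diff)
    moreover have "k \<midarrow>z\<rightarrow> 0"
    proof (rule tendsto_eventually)
      show "eventually (\<lambda>z. k z = 0) (at z)"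
        using eventually_not_Z[OF q_pos] eventually_poly_ne[OF G0]
      proof eventually_elim
        case (elim t)
        have "poly G (x t) * k t = 0" using eq[OF elim(1)] unfolding ND k_def by (simp add: algebra_simps)
        thus ?case using elim(2) by simp
      qed
    qed
    ultimately have "k z = 0" by (rule LIM_unique)
    thus ?thesis by (simp add: k_def)
  qed
  moreover have "degree D < degree N" "degree N \<le> q" using deg q_pos by simp_all
  ultimately show ?thesis using that[of N D] lN by simp
qed

text \<open>Near a kernel point z, multiply the identity at z + s by s^2 and let s tend to 0: the
  left side vanishes, and the right side tends to a nonzero multiple of D(x(z)).\<close>

lemma isogeny_kernel_root:
  assumes eq: "\<And>z. z \<notin> L \<Longrightarrow> \<tau> * z \<notin> L \<Longrightarrow> poly N (x z) = x (\<tau> * z) * poly D (x z)"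
    and z: "z \<notin> L" "\<tau> * z \<in> L"
  shows "poly D (x z) = 0"
proof -
  have "isCont (\<lambda>s. x (z + s)) 0" using z(1) by (intro isCont_o2[where g = x and f = "\<lambda>s. z + s"] isCont_x continuous_intros) auto
  hence cont: "(\<lambda>s. x (z + s)) \<midarrow>0\<rightarrow> x z" by (simp add: isCont_def)
  have "(\<lambda>s. s^2 * x (\<tau> * s) * poly D (x (z + s))) \<midarrow>0\<rightarrow> c / \<tau>^2 * poly D (x z)"
    by (intro tendsto_mult scaled_pole tau_nonzero tendsto_poly cont)
  moreover have "eventually (\<lambda>s. s^2 * x (\<tau> * s) * poly D (x (z + s)) = s^2 * poly N (x (z + s))) (at 0)"
  proof -
    have "eventually (\<lambda>s. z + s \<notin> Z q) (at 0)"
      using eventually_not_Z[OF q_pos, of z] by (subst (asm) at_to_0) (simp add: eventually_filtermap add.commute)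
    thus ?thesis
    proof eventually_elim
      case (elim s)
      have "x (\<tau> * (z + s)) = x (\<tau> * s)" using period_x[OF z(2), of "\<tau> * s"] by (simp add: distrib_left add.commute)
      moreover have "z + s \<notin> L" "\<tau> * (z + s) \<notin> L" using elim tau_mult_L_Z L_Z by blast+
      ultimately have "poly N (x (z + s)) = x (\<tau> * s) * poly D (x (z + s))" using eq by metis
      thus ?case by simp
    qed
  qed
  ultimately have "(\<lambda>s. s^2 * poly N (x (z + s))) \<midarrow>0\<rightarrow> c / \<tau>^2 * poly D (x z)" by (rule Lim_transform_eventually)
  moreover have "(\<lambda>s. s^2 * poly N (x (z + s))) \<midarrow>0\<rightarrow> 0^2 * poly N (x z)"
    by (intro tendsto_mult tendsto_power tendsto_ident_at tendsto_poly cont)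
  ultimately have "c / \<tau>^2 * poly D (x z) = 0^2 * poly N (x z)" by (rule LIM_unique)
  thus ?thesis using c tau_nonzero by simp
qed

text \<open>Differentiate N(x) = x(\<tau> z) D(x), multiply by D(x) and square.
  \<open>deriv_f\<close> at z and at \<tau> z replaces the squared derivatives, and \<tau>^2 = -q.
  An identity in x(z) is one of polynomials.\<close>

lemma isogeny_ode:
  assumes cop: "coprime N D" and eq: "\<And>z. z \<notin> L \<Longrightarrow> \<tau> * z \<notin> L \<Longrightarrow> poly N (x z) = x (\<tau> * z) * poly D (x z)"
  shows "f * (pderiv N * D - N * pderiv D)^2 = smult (- of_nat q) (D * N * (N - D) * (N - smult \<mu> D))"
proof (rule poly_eqI[OF q_pos])
  fix z assume z: "z \<notin> Z q"
  have nL: "t \<notin> L" "\<tau> * t \<notin> L" if "t \<notin> Z q" for t using that tau_mult_L_Z L_Z by auto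
  have "((\<lambda>z. x (\<tau> * z) * poly D (x z)) has_field_derivative
     deriv x (\<tau> * z) * \<tau> * poly D (x z) + poly (pderiv D) (x z) * deriv x z * x (\<tau> * z)) (at z)"
    by (rule DERIV_mult[OF scaled_deriv[OF nL(2)[OF z]] poly_deriv[OF deriv_x[OF nL(1)[OF z]]]])
  hence "((\<lambda>z. poly N (x z)) has_field_derivative
     deriv x (\<tau> * z) * \<tau> * poly D (x z) + poly (pderiv D) (x z) * deriv x z * x (\<tau> * z)) (at z)"
    by (rule has_field_derivative_transform_within_open[where S = "- Z q"])
      (use z open_Z[OF q_pos] eq nL in auto)
  moreover have "((\<lambda>z. poly N (x z)) has_field_derivative poly (pderiv N) (x z) * deriv x z) (at z)"
    by (intro poly_deriv deriv_x nL z)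
  ultimately have d: "poly (pderiv N) (x z) * deriv x z =
     deriv x (\<tau> * z) * \<tau> * poly D (x z) + poly (pderiv D) (x z) * deriv x z * x (\<tau> * z)"
    by (rule DERIV_unique[rotated])
  define n d' n' dd y where "n = poly N (x z)" and "d' = poly D (x z)" and "n' = poly (pderiv N) (x z)"
    and "dd = poly (pderiv D) (x z)" and "y = x (\<tau> * z)"
  have n: "n = y * d'" unfolding n_def d'_def y_def by (rule eq[OF nL[OF z]])
  define a b where "a = deriv x z" and "b = deriv x (\<tau> * z)"
  have a2: "a^2 = 4 / c * poly f (x z)" and b2: "b^2 = 4 / c * (y * (y - 1) * (y - \<mu>))"
    unfolding a_def b_def y_def using deriv_f nL[OF z] f_factor by simp_all
  have "n' * a = b * \<tau> * d' + dd * a * y" using d by (simp add: n'_def a_def b_def d'_def dd_def y_def)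
  hence "(n' * d' - n * dd) * a = b * \<tau> * d'^2" using n by Groebner_Basis.algebra
  hence "(n' * d' - n * dd)^2 * a^2 = b^2 * \<tau>^2 * d'^4" by Groebner_Basis.algebra
  hence "4 / c * (poly f (x z) * (n' * d' - n * dd)^2) = 4 / c * (- of_nat q * ((y * (y - 1) * (y - \<mu>)) * d'^4))"
    unfolding a2 b2 tau_squared by (simp add: mult_ac)
  moreover have "4 / c \<noteq> 0" using c by simp
  ultimately have "poly f (x z) * (n' * d' - n * dd)^2 = - of_nat q * ((y * (y - 1) * (y - \<mu>)) * d'^4)"
    by (metis mult_left_cancel)
  also have "(y * (y - 1) * (y - \<mu>)) * d'^4 = d' * n * (n - d') * (n - \<mu> * d')" using n by Groebner_Basis.algebra
  finally show "poly (f * (pderiv N * D - N * pderiv D)^2) (x z) = poly (smult (- of_nat q) (D * N * (N - D) * (N - smult \<mu> D))) (x z)"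
    by (simp add: n_def d'_def n'_def dd_def)
qed

lemma isogeny_special:
  assumes eq: "\<And>z. z \<notin> L \<Longrightarrow> \<tau> * z \<notin> L \<Longrightarrow> poly N (x z) = x (\<tau> * z) * poly D (x z)"
  shows "poly N 0 = 0" "poly N 1 = \<mu> * poly D 1" "poly N \<mu> = poly D \<mu>"
proof -
  have *: "poly N (x w) = x w' * poly D (x w)" if "\<tau> * w - w' \<in> L" "w \<notin> L" "w' \<notin> L" for w w'
  proof -
    have "\<tau> * w \<notin> L" using that(3) L_diff[OF _ that(1), of "\<tau> * w"] by auto
    thus ?thesis using eq[OF that(2)] period_x'[OF that(1)] by simp
  qed
  show "poly N 0 = 0" "poly N 1 = \<mu> * poly D 1" "poly N \<mu> = poly D \<mu>"
    using *[OF tau_w(3) half_0(2) half_0(2)] *[OF tau_w(1) half_1(2) half_2(2)] *[OF tau_w(2) half_2(2) half_1(2)]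
    by (simp_all add: x_w0 x_w1 x_w2)
qed

end


section \<open>Integrality of the isogeny at the place\<close>

context place
begin

lemma monic_root:
  fixes P :: "complex poly"
  assumes "lead_coeff P = 1" "degree P = Suc n"
  obtains a R where "P = [:- a, 1:] * R" "lead_coeff R = 1" "degree R = n"
proof -
  have "\<not> constant (poly P)" using assms(2) by (simp add: constant_degree)
  from Fundamental_Theorem_Algebra.fundamental_theorem_of_algebra[OF this] obtain a where "poly P a = 0" ..
  hence "[:- a, 1:] dvd P" by (simp add: poly_eq_0_iff_dvd)
  then obtain R where R: "P = [:- a, 1:] * R" by (elim dvdE)
  have R0: "R \<noteq> 0" using R assms by auto
  have "lead_coeff P = lead_coeff R" unfolding R lead_coeff_mult by simp
  moreover have "degree P = 1 + degree R" unfolding R using R0 by (subst degree_mult_eq) auto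
  ultimately have "lead_coeff R = 1" "degree R = n" using assms by simp_all
  with R show ?thesis by (rule that)
qed

lemma monic_roots_mem:
  assumes "lead_coeff P = 1" "\<And>w. poly P w = 0 \<Longrightarrow> w \<in> A"
  shows "P \<in> PA"
  using assms
proof (induction "degree P" arbitrary: P)
  case 0
  then obtain a where "P = [:a:]" by (metis degree_eq_zeroE)
  thus ?case using 0 by (simp add: PA_pCons)
next
  case (Suc n)
  obtain a R where R: "P = [:- a, 1:] * R" "lead_coeff R = 1" "degree R = n"
    using monic_root[OF Suc.prems(1)] Suc.hyps(2) by metis
  have "R \<in> PA" using Suc.prems(2) R by (intro Suc.hyps(1)) auto
  moreover have "a \<in> A" using Suc.prems(2)[of a] R(1) by simp
  ultimately show ?case unfolding R(1) by (intro PA_mult) (simp_all add: PA_pCons minus_mem)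
qed

text \<open>Splitting P into linear factors over the complex numbers, P(e) in the prime ideal
  \<open>M\<close> puts one of the differences e - w into \<open>M\<close>.\<close>

lemma monic_residue_root:
  assumes "lead_coeff P = 1" "\<And>w. poly P w = 0 \<Longrightarrow> w \<in> A" "e \<in> A" "poly P e \<in> M"
  shows "\<exists>w. poly P w = 0 \<and> w - e \<in> M"
  using assms
proof (induction "degree P" arbitrary: P)
  case 0
  then obtain a where "P = [:a:]" by (metis degree_eq_zeroE)
  thus ?case using 0 by simp
next
  case (Suc n)
  obtain a R where R: "P = [:- a, 1:] * R" "lead_coeff R = 1" "degree R = n"
    using monic_root[OF Suc.prems(1)] Suc.hyps(2) by metis
  have roots: "w \<in> A" if "poly R w = 0" for w using Suc.prems(2)[of w] that R(1) by simp
  have a: "a \<in> A" using Suc.prems(2)[of a] R(1) by simp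
  have "(e - a) * poly R e \<in> M" using Suc.prems(4) unfolding R(1) by (simp add: algebra_simps)
  hence "e - a \<in> M \<or> poly R e \<in> M"
    using prime_M[of "e - a" "poly R e"] diff_mem[OF Suc.prems(3) a] poly_mem[OF monic_roots_mem[OF R(2) roots] Suc.prems(3)] by auto
  thus ?case
  proof
    assume "e - a \<in> M"
    hence "a - e \<in> M" using minus_M[of "e - a"] by simp
    thus ?thesis using R(1) by (intro exI[of _ a]) simp
  next
    assume "poly R e \<in> M"
    then obtain w where "poly R w = 0" "w - e \<in> M" using Suc.hyps(1)[of R] R roots Suc.prems(3) by auto
    thus ?thesis using R(1) by auto
  qed
qed

lemma mult_not_mem: "a \<notin> A \<Longrightarrow> b \<notin> A \<Longrightarrow> a * b \<notin> A"
proof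
  assume a: "a \<notin> A" and b: "b \<notin> A" and ab: "a * b \<in> A"
  have "a \<noteq> 0" using a by auto
  have "inverse a \<in> A" using valuation[of a] a by auto
  hence "inverse a * (a * b) \<in> A" using ab by (rule mult_mem)
  moreover have "inverse a * (a * b) = b" using \<open>a \<noteq> 0\<close> by simp
  ultimately show False using b by simp
qed

lemma unit_mult_not_mem: "a \<in> A \<Longrightarrow> a \<notin> M \<Longrightarrow> b \<notin> A \<Longrightarrow> a * b \<notin> A"
proof
  assume a: "a \<in> A" "a \<notin> M" and b: "b \<notin> A" and ab: "a * b \<in> A"
  have "a \<noteq> 0" "inverse a \<in> A" using unit_iff[OF a(1)] a(2) by auto
  hence "inverse a * (a * b) \<in> A" using ab by (intro mult_mem[of "inverse a"])
  moreover have "inverse a * (a * b) = b" using \<open>a \<noteq> 0\<close> by simp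
  ultimately show False using b by simp
qed

lemma diff_not_mem: "a \<notin> A \<Longrightarrow> e \<in> A \<Longrightarrow> a - e \<notin> A"
  using add_mem[of "a - e" e] by auto

end

locale cm_place = cm_elliptic \<tau> c x L q \<mu> w1 w2 + place A q
  for \<tau> c :: complex and x :: "complex \<Rightarrow> complex" and L :: "complex set" and q :: nat and \<mu> w1 w2 :: complex
    and A :: "complex set" +
  assumes mu_mem: "\<mu> \<in> A"
begin

text \<open>Points with nonintegral abscissa play the role of the kernel of reduction. With v =
  1/x(z) in \<open>M\<close>, duplication reads 4 x(2z) (1 - v)(1 - \<mu> v) v = (1 - \<mu> v^2)^2.
  The right side is a unit, so x(2z) cannot be integral.\<close>

lemma double_not_mem:
  assumes z: "z \<notin> L" "x z \<notin> A"
  shows "2 * z \<notin> L \<and> x (2 * z) \<notin> A"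
proof
  show 2: "2 * z \<notin> L"
  proof
    assume "2 * z \<in> L"
    hence "poly f (x z) = 0" using z(1) by (rule f_roots_period)
    thus False using z(2) mu_mem by (auto simp: f_factor)
  qed
  show "x (2 * z) \<notin> A"
  proof
    assume y: "x (2 * z) \<in> A"
    define v where "v = inverse (x z)"
    have v: "v \<in> M" unfolding v_def using z(2) by (rule not_in_A)
    have "x z \<noteq> 0" using z(2) by auto
    hence wv: "x z * v = 1" by (simp add: v_def)
    have "4 * x (2 * z) * (x z * (x z - 1) * (x z - \<mu>)) = ((x z)^2 - \<mu>)^2"
      using duplication[OF 2] by (simp add: f_factor)
    hence eq: "4 * x (2 * z) * (1 - v) * (1 - \<mu> * v) * v = (1 - \<mu> * v^2)^2" using wv by Groebner_Basis.algebra
    have vA: "v \<in> A" using v by (rule M_subset)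
    have "4 * x (2 * z) * (1 - v) * (1 - \<mu> * v) * v \<in> M"
      using v by (rule mult_M) (intro mult_mem diff_mem y vA mu_mem numeral_mem one_mem)
    hence "(1 - \<mu> * v^2)^2 \<in> M" unfolding eq .
    hence "1 - \<mu> * v^2 \<in> M" by (rule power_M) (intro diff_mem mult_mem power_mem one_mem vA mu_mem)
    moreover have "\<mu> * v * v \<in> M" using v by (rule mult_M) (intro mult_mem vA mu_mem)
    ultimately have "(1 - \<mu> * v^2) + \<mu> * v * v \<in> M" by (rule add_M)
    thus False by (simp add: power2_eq_square)
  qed
qed

lemma double_iterate_not_mem: "z \<notin> L \<Longrightarrow> x z \<notin> A \<Longrightarrow> 2 ^ k * z \<notin> L \<and> x (2 ^ k * z) \<notin> A"
proof (induction k)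
  case (Suc k)
  thus ?case using double_not_mem[of "2 ^ k * z"] by (simp add: mult.assoc)
qed simp

text \<open>The hypotheses give q z = -s' modulo the lattice. By Fermat 2^(q-1) = 1 + q m with m
  odd, and 2 s' lies in the lattice, so 2^(q-1) z = z + s' modulo the lattice. Repeated doubling of
  2z therefore reaches z + s' without leaving the nonintegral points.\<close>

lemma translate_not_mem:
  assumes z: "2 * z \<notin> L" "x (2 * z) \<notin> A" and s: "\<tau> * z - s \<in> L" "\<tau> * s - s' \<in> L" "2 * s' \<in> L"
  shows "z + s' \<notin> L \<and> x (z + s') \<notin> A"
proof -
  have "\<not> q dvd 2" using odd_q prime_q by (metis primes_dvd_imp_eq two_is_prime_nat even_numeral)
  hence "[2 ^ (q - 1) = 1] (mod q)" using fermat_theorem[OF prime_q] by auto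
  hence "q dvd 2 ^ (q - 1) - 1" by (rule cong_to_1_nat)
  then obtain m where m: "2 ^ (q - 1) - 1 = q * m" by (elim dvdE)
  have q2: "q \<ge> 2" using prime_q by (rule prime_ge_2_nat)
  have m': "(2 ^ (q - 1) :: nat) = 1 + q * m" using m by (metis le_add_diff_inverse one_le_numeral one_le_power)
  have "even (1 + q * m)" unfolding m'[symmetric] using q2 by simp
  hence "odd m" using odd_q by simp
  then obtain k where k: "m = 2 * k + 1" by (elim oddE)
  have "\<tau> * (\<tau> * z - s) + (\<tau> * s - s') \<in> L" by (intro L_add tau_L s)
  hence "- (\<tau> * (\<tau> * z - s) + (\<tau> * s - s')) \<in> L" by (rule L_minus)
  also have "- (\<tau> * (\<tau> * z - s) + (\<tau> * s - s')) = of_nat q * z + s'" using tau_squared by Groebner_Basis.algebra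
  finally have qz: "of_nat q * z + s' \<in> L" .
  hence "of_nat m * (of_nat q * z + s') - of_nat (k + 1) * (2 * s') \<in> L" using s(3) by (intro L_diff L_of_nat_mult)
  moreover have "of_nat (2 ^ (q - 1)) * z = z + of_nat m * (of_nat q * z)" unfolding m' by (simp add: algebra_simps)
  hence "2 ^ (q - 1) * z - (z + s') = of_nat m * (of_nat q * z + s') - of_nat (k + 1) * (2 * s')"
    by (simp add: k algebra_simps)
  ultimately have T: "2 ^ (q - 1) * z - (z + s') \<in> L" by (simp only:)
  have "2 ^ (q - 2) * (2 * z) = 2 ^ Suc (q - 2) * z" by simp
  also have "Suc (q - 2) = q - 1" using q2 by simp
  finally have "2 ^ (q - 1) * z \<notin> L \<and> x (2 ^ (q - 1) * z) \<notin> A" using double_iterate_not_mem[OF z, of "q - 2"] by metis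
  thus ?thesis using period_x'[OF T] L_add[OF T, of "z + s'"] by auto
qed

lemma product_mem:
  assumes "s \<in> {w1 + w2, w1, w2}" "z \<notin> L" "z + s \<notin> L"
  shows "(x z - x s) * (x (z + s) - x s) \<in> A"
proof -
  have "\<mu> \<in> A" "1 - \<mu> \<in> A" "\<mu> * (\<mu> - 1) \<in> A" using mu_mem by (auto intro!: mult_mem diff_mem)
  thus ?thesis using assms product_0[of z] product_1[of z] product_2[of z] by (auto simp: x_w0 x_w1 x_w2)
qed

context
  fixes N D :: "complex poly"
  assumes monic_N: "lead_coeff N = 1" and degree_less: "degree D < degree N" and coprime_ND: "coprime N D"
    and isogeny_eq: "\<And>z. z \<notin> L \<Longrightarrow> \<tau> * z \<notin> L \<Longrightarrow> poly N (x z) = x (\<tau> * z) * poly D (x z)"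
begin

lemma fibre_monic: "lead_coeff (N - smult r D) = 1"
proof -
  have "degree (smult r D) < degree N" using degree_less by (auto intro: le_less_trans[OF degree_smult_le])
  hence "degree (N - smult r D) = degree N" "coeff (smult r D) (degree N) = 0"
    using degree_add_eq_left[of "- smult r D" N] by (simp_all add: coeff_eq_0 del: coeff_smult)
  thus ?thesis using monic_N by simp
qed

lemma fibre_point:
  assumes w: "poly (N - smult (x s) D) w = 0" and s: "2 * s \<in> L" "s \<notin> L"
  obtains z where "z \<notin> L" "x z = w" "\<tau> * z - s \<in> L"
proof -
  obtain z where z: "z \<notin> L" "x z = w" using surj by blast
  have w': "poly N w = x s * poly D w" using w by simp
  have D0: "poly D w \<noteq> 0"
  proof
    assume "poly D w = 0"
    thus False using w' coprime_no_common_root[OF coprime_ND, of w] by simp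
  qed
  have tz: "\<tau> * z \<notin> L" using isogeny_kernel_root[OF isogeny_eq z(1)] D0 z(2) by auto
  have "x (\<tau> * z) = x s" using isogeny_eq[OF z(1) tz] w' D0 z(2) by simp
  hence "\<tau> * z - s \<in> L" by (rule half_period_value[OF s tz])
  thus ?thesis using that z by blast
qed

lemma half_pairs:
  assumes "(s, s') \<in> {(w1 + w2, w1 + w2), (w1, w2), (w2, w1)}"
  shows "2 * s \<in> L" "s \<notin> L" "2 * s' \<in> L" "\<tau> * s - s' \<in> L" "s' \<in> {w1 + w2, w1, w2}" "x s' \<in> A"
  using assms half_0 half_1 half_2 tau_w mu_mem by (auto simp: x_w0 x_w1 x_w2)

text \<open>A nonintegral root w = x(z) would make x(z + s') nonintegral as well, against the
  integrality of (x(z) - x(s')) (x(z + s') - x(s')).\<close>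

lemma fibre_mem:
  assumes ss: "(s, s') \<in> {(w1 + w2, w1 + w2), (w1, w2), (w2, w1)}" and w: "poly (N - smult (x s) D) w = 0"
  shows "w \<in> A"
proof (rule ccontr)
  note p = half_pairs[OF ss]
  assume wA: "w \<notin> A"
  obtain z where z: "z \<notin> L" "x z = w" "\<tau> * z - s \<in> L" using fibre_point[OF w p(1,2)] by blast
  have "2 * z \<notin> L \<and> x (2 * z) \<notin> A" using double_not_mem[OF z(1)] z(2) wA by simp
  hence t: "z + s' \<notin> L" "x (z + s') \<notin> A" using translate_not_mem z(3) p by blast+
  have "x z \<notin> A" using wA z(2) by simp
  hence "(x z - x s') * (x (z + s') - x s') \<notin> A"
    by (rule mult_not_mem[OF diff_not_mem[OF _ p(6)] diff_not_mem[OF t(2) p(6)]])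
  thus False using product_mem[OF p(5) z(1) t(1)] by blast
qed

lemma fibre_PA:
  assumes ss: "(s, s') \<in> {(w1 + w2, w1 + w2), (w1, w2), (w2, w1)}"
  shows "N - smult (x s) D \<in> PA"
  using monic_roots_mem[OF fibre_monic fibre_mem[OF ss]] .

text \<open>The fibres over 0 and 1 are \<open>N\<close> and \<open>N - D\<close>; each is monic
  with integral roots.\<close>

lemma N_PA: "N \<in> PA" and D_PA: "D \<in> PA"
proof -
  show N: "N \<in> PA" using fibre_PA[of "w1 + w2" "w1 + w2"] by (simp add: x_w0)
  have "N - D \<in> PA" using fibre_PA[of w1 w2] by (simp add: x_w1)
  from PA_diff[OF N this] show "D \<in> PA" by simp
qed

text \<open>If a fibre polynomial vanishes at e modulo \<open>M\<close> but not exactly, it has a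
  root w = x(z) congruent to e and different from it. Then f(w) is small while w^2 - \<mu> is a
  unit, so by duplication x(2z) is nonintegral, and so is x(z + s'). As w - x(s') is a unit, the
  product formula fails.\<close>

lemma residue_contradiction:
  assumes ss: "(s, s') \<in> {(w1 + w2, w1 + w2), (w1, w2), (w2, w1)}" and e: "e \<in> A"
    and fe: "poly (N - smult (x s) D) e \<in> M" "poly (N - smult (x s) D) e \<noteq> 0"
    and simple: "\<And>w. w - e \<in> M \<Longrightarrow> w \<noteq> e \<Longrightarrow> poly f w \<noteq> 0 \<and> poly f w \<in> M"
    and units: "e^2 - \<mu> \<notin> M" "e - x s' \<notin> M"
  shows False
proof -
  note p = half_pairs[OF ss]
  obtain w where w: "poly (N - smult (x s) D) w = 0" "w - e \<in> M"
    using monic_residue_root[OF fibre_monic fibre_mem[OF ss] e fe(1)] by blast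
  have wA: "w \<in> A" using w(1) by (rule fibre_mem[OF ss])
  have we: "w \<noteq> e" using w(1) fe(2) by auto
  obtain z where z: "z \<notin> L" "x z = w" "\<tau> * z - s \<in> L" using fibre_point[OF w(1) p(1,2)] by blast
  have fw: "poly f w \<noteq> 0" "poly f w \<in> M" using simple[OF w(2) we] by auto
  have 2: "2 * z \<notin> L" using f_roots_period[of z] z fw(1) by auto
  have "x (2 * z) \<notin> A"
  proof
    assume "x (2 * z) \<in> A"
    hence "4 * x (2 * z) * poly f w \<in> M" using fw(2) by (intro mult_M mult_mem numeral_mem)
    hence "(w^2 - \<mu>)^2 \<in> M" using duplication[OF 2] z(2) by simp
    hence "w^2 - \<mu> \<in> M" by (rule power_M) (intro diff_mem power_mem wA mu_mem)
    moreover have "(w + e) * (w - e) \<in> M" using w(2) by (rule mult_M) (intro add_mem wA e)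
    ultimately have "(w^2 - \<mu>) - (w + e) * (w - e) \<in> M" by (rule diff_M)
    thus False using units(1) by (simp add: algebra_simps power2_eq_square)
  qed
  hence *: "z + s' \<notin> L \<and> x (z + s') \<notin> A" using translate_not_mem[OF 2] z(3) p by blast
  have "w - x s' \<notin> M"
  proof
    assume "w - x s' \<in> M"
    hence "(w - x s') - (w - e) \<in> M" using w(2) by (rule diff_M)
    thus False using units(2) by simp
  qed
  hence "(w - x s') * (x (z + s') - x s') \<notin> A"
    using * wA p(6) by (intro unit_mult_not_mem diff_not_mem diff_mem) auto
  thus False using product_mem[OF p(5) z(1)] * z(2) by blast
qed

text \<open>If D vanished modulo \<open>M\<close>, all fibre polynomials would reduce to N. For
  \<mu> in \<open>M\<close> the fibre over 0 is tested at e = 1, otherwise the fibre over \<mu> at e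
  = 0: its value there is \<mu> D(1) or -\<mu> D(0), in \<open>M\<close> but nonzero by
  coprimality.\<close>

lemma D_not_PM: 
  assumes special: "poly N 0 = 0" "poly N 1 = \<mu> * poly D 1"
  shows "D \<notin> PM"
proof
  assume PM: "D \<in> PM"
  have no_root: "poly D e \<noteq> 0" if "poly N e = r * poly D e" for e r
    using coprime_no_common_root[OF coprime_ND, of e] that by auto
  show False
  proof (cases "\<mu> \<in> M")
    case True
    have m1: "1 - \<mu> \<notin> M" using add_M[OF _ True, of "1 - \<mu>"] by auto
    show False
    proof (rule residue_contradiction[of "w1 + w2" "w1 + w2" 1])
      show "poly (N - smult (x (w1 + w2)) D) 1 \<in> M"
        using mult_M[OF poly_M[OF PM one_mem] mu_mem] by (simp add: x_w0 special)
      show "poly (N - smult (x (w1 + w2)) D) 1 \<noteq> 0"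
        using no_root[OF special(2)] mu by (simp add: x_w0 special)
      show "poly f w \<noteq> 0 \<and> poly f w \<in> M" if w: "w - 1 \<in> M" "w \<noteq> 1" for w
      proof
        have wA: "w \<in> A" using add_mem[OF M_subset[OF w(1)] one_mem] by simp
        have "w \<noteq> 0" using w(1) minus_M[of "- 1"] by auto
        moreover have "w \<noteq> \<mu>" using minus_M[OF w(1)] m1 by auto
        ultimately show "poly f w \<noteq> 0" using w(2) by (simp add: f_factor)
        have "w * (w - \<mu>) * (w - 1) \<in> M" using w(1) by (rule mult_M) (intro mult_mem diff_mem wA mu_mem)
        thus "poly f w \<in> M" by (simp add: f_factor mult_ac)
      qed
    qed (use m1 in \<open>simp_all add: x_w0\<close>)
  next
    case False
    hence mm: "- \<mu> \<notin> M" using minus_M[of "- \<mu>"] by auto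
    have e0: "poly N 0 = 0 * poly D 0" using special by simp
    show False
    proof (rule residue_contradiction[of w2 w1 0])
      show "poly (N - smult (x w2) D) 0 \<in> M"
        using minus_M[OF mult_M[OF poly_M[OF PM zero_mem] mu_mem]] by (simp add: x_w2 special)
      show "poly (N - smult (x w2) D) 0 \<noteq> 0"
        using no_root[OF e0] mu by (simp add: x_w2 special)
      show "poly f w \<noteq> 0 \<and> poly f w \<in> M" if w: "w - 0 \<in> M" "w \<noteq> 0" for w
      proof
        have wA: "w \<in> A" using M_subset[OF w(1)] by simp
        have "w \<noteq> 1" using w(1) by auto
        moreover have "w \<noteq> \<mu>" using w(1) False by auto
        ultimately show "poly f w \<noteq> 0" using w(2) by (simp add: f_factor)
        have "(w - 1) * (w - \<mu>) * (w - 0) \<in> M" using w(1) by (rule mult_M) (intro mult_mem diff_mem wA mu_mem one_mem)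
        thus "poly f w \<in> M" by (simp add: f_factor mult_ac)
      qed
      show "0 - x w1 \<notin> M" using minus_M[of "- 1"] by (auto simp: x_w1)
    qed (use mm in simp_all)
  qed
qed

end

lemma place_isogeny_ex:
  assumes "q mod 4 = 1"
  shows "\<exists>N D n. place_isogeny A q \<mu> N D n"
proof -
  obtain N D where ND: "lead_coeff N = 1" "0 < degree N" "degree N \<le> q" "degree D < degree N" "coprime N D"
    and eq: "\<And>z. z \<notin> L \<Longrightarrow> \<tau> * z \<notin> L \<Longrightarrow> poly N (x z) = x (\<tau> * z) * poly D (x z)"
    using isogeny by blast
  note special = isogeny_special[OF eq]
  have "place_isogeny A q \<mu> N D (degree N)"
  proof unfold_locales
    show "N \<in> PA" "D \<in> PA" by (rule N_PA[OF ND(1,4,5) eq] D_PA[OF ND(1,4,5) eq], assumption+)+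
    show "D \<notin> PM" by (rule D_not_PM[OF ND(1,4,5) eq _ _]) (use special in auto)
    show "[:0, \<mu>, - (1 + \<mu>), 1:] * (pderiv N * D - N * pderiv D)^2 = smult (- of_nat q) (D * N * (N - D) * (N - smult \<mu> D))"
      unfolding f_def[symmetric] by (rule isogeny_ode[OF ND(5)]) (rule eq)
  qed (use ND special assms mu_mem in auto)
  thus ?thesis by blast
qed

end


section \<open>Construction of the elliptic function by Tate's series, and the supersingular
  parameter\<close>

definition tate_term :: "complex \<Rightarrow> complex" where "tate_term t = t / (1 - t)^2"

definition tate_sum :: "complex \<Rightarrow> complex \<Rightarrow> complex" where
  "tate_sum Q u = (\<Sum>n. tate_term (Q ^ n * u))"

lemma norm_tate_term: "norm t \<le> 1 / 2 \<Longrightarrow> norm (tate_term t) \<le> 4 * norm t"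
proof -
  assume t: "norm t \<le> 1 / 2"
  have "1 / 2 \<le> norm (1 - t)" using norm_triangle_ineq2[of 1 t] t by simp
  hence "(1 / 2)^2 \<le> norm (1 - t) ^ 2" by (intro power_mono) auto
  hence h: "1 / 4 \<le> norm (1 - t) ^ 2" by (simp add: power2_eq_square)
  have "norm (tate_term t) = norm t / norm (1 - t) ^ 2" by (simp add: tate_term_def norm_divide norm_power)
  also have "\<dots> \<le> norm t / (1 / 4)" using h by (intro divide_left_mono) auto
  finally show ?thesis by simp
qed

lemma tate_term_inverse: "u \<noteq> 0 \<Longrightarrow> tate_term (inverse u) = tate_term u"
  by (cases "u = 1") (auto simp: tate_term_def field_simps power2_eq_square)

lemma tate_term_differentiable: "t \<noteq> 1 \<Longrightarrow> tate_term field_differentiable at t"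
proof -
  assume t: "t \<noteq> 1"
  have "(\<lambda>t. t / (1 - t)^2) field_differentiable at t"
    using t by (intro field_differentiable_divide field_differentiable_power field_differentiable_diff derivative_intros) auto
  thus ?thesis by (simp add: tate_term_def[abs_def])
qed

context
  fixes Q :: complex
  assumes Q: "norm Q < 1" "Q \<noteq> 0"
begin

lemma power_small: "\<exists>N. norm (Q ^ N * u) < 1 / 2"
proof -
  have "(\<lambda>n. Q ^ n * u) \<longlonglongrightarrow> 0" using LIMSEQ_power_zero[OF Q(1)] by (rule tendsto_mult_left_zero)
  hence "eventually (\<lambda>n. dist (Q ^ n * u) 0 < 1 / 2) sequentially" by (rule tendstoD) simp
  hence "\<exists>N. dist (Q ^ N * u) 0 < 1 / 2" using eventually_happens' sequentially_bot by blast
  thus ?thesis by (simp only: dist_0_norm dist_norm diff_zero)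
qed

lemma summable_tate: "summable (\<lambda>n. tate_term (Q ^ n * u))"
proof -
  obtain N where N: "norm (Q ^ N * u) < 1 / 2" using power_small by blast
  have "summable (\<lambda>n. tate_term (Q ^ (n + N) * u))"
  proof (rule summable_comparison_test')
    show "summable (\<lambda>n. 2 * norm Q ^ n)" using Q(1) by (intro summable_mult summable_geometric) simp
    fix n :: nat
    have eq: "norm (Q ^ (n + N) * u) = norm Q ^ n * norm (Q ^ N * u)"
      by (simp add: norm_mult norm_power Power.power_add mult_ac)
    have "norm Q ^ n \<le> 1" using Q(1) by (intro power_le_one) auto
    moreover have "norm Q ^ n * norm (Q ^ N * u) \<le> norm Q ^ n * (1 / 2)"
      using N by (intro mult_left_mono) simp_all
    ultimately show "norm (tate_term (Q ^ (n + N) * u)) \<le> 2 * norm Q ^ n"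
      using norm_tate_term[of "Q ^ (n + N) * u"] eq by simp
  qed
  thus ?thesis by (rule summable_iff_shift[THEN iffD1])
qed

lemma tate_sum_step: "tate_sum Q u = tate_term u + tate_sum Q (Q * u)"
  using suminf_split_head[OF summable_tate[of u]] by (simp add: tate_sum_def mult_ac)

lemma tate_sum_split: "tate_sum Q u = (\<Sum>n<N. tate_term (Q ^ n * u)) + tate_sum Q (Q ^ N * u)"
proof (induction N)
  case (Suc N)
  thus ?case using tate_sum_step[of "Q ^ N * u"] by (simp add: mult_ac)
qed simp

lemma tate_sum_differentiable_small: "norm u < 1 / 2 \<Longrightarrow> tate_sum Q field_differentiable at u"
proof -
  assume u: "norm u < 1 / 2"
  have small: "norm (Q ^ n * y) \<le> norm Q ^ n / 2" "norm (Q ^ n * y) \<le> 1 / 2" if "norm y < 1 / 2" for n y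
  proof -
    have "norm Q ^ n \<le> 1" using Q(1) by (intro power_le_one) auto
    moreover have "norm Q ^ n * norm y \<le> norm Q ^ n * (1 / 2)" using that by (intro mult_left_mono) simp_all
    ultimately show "norm (Q ^ n * y) \<le> norm Q ^ n / 2" "norm (Q ^ n * y) \<le> 1 / 2" by (simp_all add: norm_mult norm_power)
  qed
  have ne: "Q ^ n * y \<noteq> 1" if "norm y < 1 / 2" for n y using small(2)[OF that, of n] by auto
  have "\<exists>g. \<forall>u\<in>ball 0 (1 / 2). (\<lambda>n. tate_term (Q ^ n * u)) sums g u \<and> g field_differentiable at u"
  proof (rule series_differentiable_comparison_complex[of "ball 0 (1 / 2)" "\<lambda>n u. tate_term (Q ^ n * u)"])
    fix n y assume y: "y \<in> ball (0::complex) (1 / 2)"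
    have "(tate_term \<circ> (\<lambda>u. Q ^ n * u)) field_differentiable at y"
      using y ne by (intro field_differentiable_compose tate_term_differentiable derivative_intros) auto
    thus "(\<lambda>u. tate_term (Q ^ n * u)) field_differentiable at y" by (simp add: o_def)
  next
    fix y assume "y \<in> ball (0::complex) (1 / 2)"
    have "norm (tate_term (Q ^ n * v)) \<le> norm (complex_of_real (2 * norm Q ^ n))" if "norm v < 1 / 2" for n v
      using norm_tate_term[OF small(2)[OF that, of n]] small(1)[OF that, of n] by (simp add: norm_mult norm_power)
    moreover have "summable (\<lambda>n. complex_of_real (2 * norm Q ^ n))"
      using Q(1) by (intro summable_of_real summable_mult summable_geometric) simp
    ultimately show "\<exists>d h. 0 < d \<and> summable h \<and> range h \<subseteq> \<real>\<^sub>\<ge>\<^sub>0 \<and>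
        (\<forall>\<^sub>F n in sequentially. \<forall>v\<in>ball y d \<inter> ball 0 (1 / 2). norm (tate_term (Q ^ n * v)) \<le> norm (h n :: complex))"
      by (intro exI[of _ 1] exI[of _ "\<lambda>n. complex_of_real (2 * norm Q ^ n)"]) auto
  qed auto
  then obtain g where g: "\<And>u. u \<in> ball 0 (1 / 2) \<Longrightarrow> (\<lambda>n. tate_term (Q ^ n * u)) sums g u \<and> g field_differentiable at u" by blast
  have "g field_differentiable at u" using g u by simp
  moreover have "tate_sum Q v = g v" if "v \<in> ball 0 (1 / 2)" for v
    using g[OF that] unfolding tate_sum_def by (auto simp: sums_iff)
  ultimately obtain d where "(g has_field_derivative d) (at u)" and eq: "\<And>v. v \<in> ball 0 (1 / 2) \<Longrightarrow> g v = tate_sum Q v"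
    by (auto simp: field_differentiable_def)
  from this(1) have "(tate_sum Q has_field_derivative d) (at u)"
    by (rule has_field_derivative_transform_within_open[OF _ open_ball[of 0 "1 / 2"] _ eq]) (use u in simp_all)
  thus ?thesis unfolding field_differentiable_def ..
qed

lemma tate_sum_differentiable: "(\<And>n. Q ^ n * u \<noteq> 1) \<Longrightarrow> tate_sum Q field_differentiable at u"
proof -
  assume u: "\<And>n. Q ^ n * u \<noteq> 1"
  obtain N where N: "norm (Q ^ N * u) < 1 / 2" using power_small by blast
  have d: "(\<lambda>u. g (Q ^ n * u)) field_differentiable at u" if "g field_differentiable at (Q ^ n * u)" for g n
  proof -
    have "(g \<circ> (\<lambda>u. Q ^ n * u)) field_differentiable at u"
      using that by (intro field_differentiable_compose derivative_intros)
    thus ?thesis by (simp add: o_def)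
  qed
  have "(\<lambda>u. (\<Sum>n<N. tate_term (Q ^ n * u)) + tate_sum Q (Q ^ N * u)) field_differentiable at u"
    by (intro field_differentiable_add field_differentiable_sum d tate_term_differentiable u tate_sum_differentiable_small N)
  moreover have "tate_sum Q = (\<lambda>u. (\<Sum>n<N. tate_term (Q ^ n * u)) + tate_sum Q (Q ^ N * u))"
    by (rule ext) (rule tate_sum_split)
  ultimately show ?thesis by (rule ssubst[rotated])
qed

end

text \<open>With u = exp(2 pi i z) and Q = exp(2 pi i \<tau>) this is the sum over all integers n of
  Q^n u / (1 - Q^n u)^2. The negative n are folded into the second series by the symmetry of the
  term under inversion.\<close>

definition tate_function :: "complex \<Rightarrow> complex \<Rightarrow> complex" where
  "tate_function \<tau> z = tate_sum (exp (2 * pi * \<i> * \<tau>)) (exp (2 * pi * \<i> * z))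
     + tate_sum (exp (2 * pi * \<i> * \<tau>)) (exp (2 * pi * \<i> * \<tau>) * exp (- (2 * pi * \<i> * z)))"

lemma even_elliptic_tate_function:
  assumes tau: "Im \<tau> > 0"
  shows "even_elliptic \<tau> (1 / (2 * pi * \<i>)^2) (tate_function \<tau>)"
proof -
  define Q where "Q = exp (2 * pi * \<i> * \<tau>)"
  have Q: "norm Q < 1" "Q \<noteq> 0" using tau by (simp_all add: Q_def)
  define e where "e z = exp (2 * pi * \<i> * z)" for z :: complex
  have S: "tate_function \<tau> z = tate_sum Q (e z) + tate_sum Q (Q * e (- z))" for z
    by (simp add: tate_function_def Q_def e_def)
  have e0: "e z \<noteq> 0" for z by (simp add: e_def)
  have em: "e (- z) = inverse (e z)" for z by (simp add: e_def exp_minus)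
  have e1: "e (z + 1) = e z" for z
    using exp_plus_2pin[of "2 * pi * \<i> * z" 1] by (simp add: e_def distrib_left mult_ac)
  have et: "e (z + \<tau>) = Q * e z" for z by (simp add: e_def Q_def distrib_left exp_add)
  have eQ: "Q ^ n * e z = e (of_nat n * \<tau> + z)" for n z
    by (simp add: e_def Q_def distrib_left exp_add mult_ac flip: exp_of_nat_mult)
  have eq1: "e z = 1 \<Longrightarrow> \<exists>m. z = of_int m" for z
  proof -
    assume "e z = 1"
    then obtain m :: int where m: "2 * pi * \<i> * z = 0 + complex_of_real (real_of_int (2 * m) * pi) * \<i>"
      using exp_eq[of "2 * pi * \<i> * z" 0] by (auto simp: e_def)
    hence "(2 * pi * \<i>) * z = (2 * pi * \<i>) * of_int m" by simp
    hence "z = of_int m" by simp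
    thus ?thesis ..
  qed
  have step: "tate_sum Q u = tate_term u + tate_sum Q (Q * u)" for u by (rule tate_sum_step[OF Q])
  have S': "tate_function \<tau> z = tate_term (e z) + tate_sum Q (Q * e z) + tate_sum Q (Q * e (- z))" for z
    unfolding S using step[of "e z"] by simp
  let ?L = "{of_int a + of_int b * \<tau> | a b. True}"
  show ?thesis
  proof
    show "Im \<tau> > 0" by fact
    show "tate_function \<tau> (z + 1) = tate_function \<tau> z" for z
      unfolding S em e1 ..
    show "tate_function \<tau> (- z) = tate_function \<tau> z" for z
      unfolding S' by (simp add: em tate_term_inverse e0)
    show "tate_function \<tau> (z + \<tau>) = tate_function \<tau> z" for z
    proof -
      have "Q * e (- (z + \<tau>)) = e (- z)" unfolding em et using Q e0 by simp
      hence "tate_function \<tau> (z + \<tau>) = tate_sum Q (Q * e z) + tate_sum Q (e (- z))" by (simp add: S et)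
      also have "\<dots> = tate_function \<tau> z"
        unfolding S' step[of "e (- z)"] by (simp add: em tate_term_inverse e0)
      finally show ?thesis .
    qed
    show "1 / (2 * pi * \<i>)^2 \<noteq> 0" by simp
    have e_d: "e field_differentiable at z" for z
      unfolding e_def by (intro derivative_intros field_differentiable_within_exp field_differentiable_compose[unfolded o_def, of _ _ exp] )
    have comp: "(\<lambda>z. tate_sum Q (g z)) field_differentiable at z"
      if "g field_differentiable at z" "\<And>n. Q ^ n * g z \<noteq> 1" for g z
      using field_differentiable_compose[OF that(1) tate_sum_differentiable[OF Q that(2)]] by (simp add: o_def)
    have em_d: "(\<lambda>z. Q * e (- z)) field_differentiable at z" for z
      unfolding em using e_d e0 by (intro derivative_intros)
    have hol: "tate_function \<tau> field_differentiable at z" if z: "z \<notin> ?L" for z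
    proof -
      have 1: "Q ^ n * e z \<noteq> 1" for n
      proof
        assume "Q ^ n * e z = 1"
        then obtain m where "of_nat n * \<tau> + z = of_int m" using eq1 eQ by metis
        hence "z = of_int m + of_int (- int n) * \<tau>" by (simp add: algebra_simps)
        thus False using z by blast
      qed
      have 2: "Q ^ n * (Q * e (- z)) \<noteq> 1" for n
      proof
        assume "Q ^ n * (Q * e (- z)) = 1"
        hence "Q ^ Suc n * e (- z) = 1" by (simp add: mult_ac)
        then obtain m where "of_nat (Suc n) * \<tau> + - z = of_int m" using eq1 eQ by metis
        hence "z = of_int (- m) + of_int (int (Suc n)) * \<tau>" by (simp add: algebra_simps)
        thus False using z by blast
      qed
      show ?thesis unfolding S by (intro field_differentiable_add comp e_d em_d 1 2)
    qed
    thus "tate_function \<tau> holomorphic_on - ?L"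
      by (auto simp: holomorphic_on_def intro: field_differentiable_at_within)
    have Q1: "Q ^ n * (Q * e 0) \<noteq> 1" for n
    proof -
      have "norm (Q ^ Suc n) < 1" unfolding norm_power using Q by (intro power_Suc_less_one) simp_all
      thus ?thesis by (auto simp: e_def mult.commute)
    qed
    have "(\<lambda>z. tate_sum Q (Q * e z) + tate_sum Q (Q * e (- z))) field_differentiable at 0"
      using Q1 by (intro field_differentiable_add comp em_d derivative_intros e_d) auto
    hence c1: "(\<lambda>z. tate_sum Q (Q * e z) + tate_sum Q (Q * e (- z))) \<midarrow>0\<rightarrow> tate_sum Q (Q * e 0) + tate_sum Q (Q * e (- 0))"
      using field_differentiable_imp_continuous_at isCont_def by blast
    have "(e has_field_derivative 2 * pi * \<i>) (at 0)" unfolding e_def by (auto intro!: derivative_eq_intros)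
    hence d: "(\<lambda>h. (e h - 1) / h) \<midarrow>0\<rightarrow> 2 * pi * \<i>" by (simp add: DERIV_def e_def)
    have "e \<midarrow>0\<rightarrow> e 0" using e_d field_differentiable_imp_continuous_at isCont_def by blast
    hence "(\<lambda>z. e z / ((e z - 1) / z)^2 + z^2 * (tate_sum Q (Q * e z) + tate_sum Q (Q * e (- z)))) \<midarrow>0\<rightarrow>
       e 0 / (2 * pi * \<i>)^2 + 0^2 * (tate_sum Q (Q * e 0) + tate_sum Q (Q * e (- 0)))"
      by (intro tendsto_add tendsto_mult tendsto_divide tendsto_power d c1 tendsto_ident_at) simp_all
    moreover have "e z / ((e z - 1) / z)^2 + z^2 * (tate_sum Q (Q * e z) + tate_sum Q (Q * e (- z))) = z^2 * tate_function \<tau> z" for z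
      unfolding S' tate_term_def by (simp add: power_divide power2_commute[of "e z"] distrib_left)
    ultimately show "(\<lambda>z. z^2 * tate_function \<tau> z) \<midarrow>0\<rightarrow> 1 / (2 * pi * \<i>)^2" by (simp add: e_def)
  qed
qed

lemma (in even_elliptic) affine: 
  assumes "a \<noteq> 0"
  shows "even_elliptic \<tau> (c / a) (\<lambda>z. (x z - b) / a)"
proof
  show "Im \<tau> > 0" by (rule Im_pos)
  show "(\<lambda>z. (x z - b) / a) holomorphic_on - {of_int a + of_int b * \<tau> | a b. True}"
    using hol assms unfolding L_def by (intro holomorphic_intros)
  have "(\<lambda>z. (z^2 * x z - z^2 * b) / a) \<midarrow>0\<rightarrow> (c - 0^2 * b) / a"
    using assms by (intro tendsto_intros pole)
  thus "(\<lambda>z. z^2 * ((x z - b) / a)) \<midarrow>0\<rightarrow> c / a" by (simp add: algebra_simps)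
qed (use assms c in \<open>simp_all add: period_1 period_tau even\<close>)

text \<open>The Tate function for \<tau> = sqrt(-q) is normalised to 0 and 1 at two half periods.
  The third value and its inverse correspond to the two orders of 1/2 and \<tau>/2; a valuation ring
  contains one of them, which selects \<open>w1\<close>.\<close>

theorem trace_zero_parameter:
  assumes q: "prime q" "q mod 4 = 1"
  shows "\<exists>k::int. \<not> int q dvd k \<and> \<not> int q dvd k - 4 \<and>
    int q dvd coeff ([:k, k, 1:] ^ ((q - 1) div 2)) ((q - 1) div 2)"
proof -
  obtain A where "place A q" using place_ex[OF q(1)] by blast
  then interpret place A q .
  define \<tau> where "\<tau> = \<i> * sqrt q"
  have q0: "q > 0" using q(1) by (rule prime_gt_0_nat)
  have tau: "Im \<tau> > 0" using q0 by (simp add: \<tau>_def)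
  have tau2: "\<tau>^2 = - of_nat q"
    by (simp add: \<tau>_def power_mult_distrib flip: of_real_power)
  define c where "c = 1 / (2 * pi * \<i>)^2"
  interpret E: even_elliptic \<tau> c "tate_function \<tau>" "{of_int a + of_int b * \<tau> | a b. True}"
    unfolding c_def using even_elliptic_tate_function[OF tau] by simp
  let ?L = "{of_int a + of_int b * \<tau> | a b. True}"
  define s where "s w = tate_function \<tau> w - tate_function \<tau> (1 / 2 + \<tau> / 2)" for w
  have half: "2 * (1 / 2) \<in> ?L" "1 / 2 \<notin> ?L" "2 * (\<tau> / 2) \<in> ?L" "\<tau> / 2 \<notin> ?L" "1 / 2 + \<tau> / 2 \<notin> ?L"
    using E.half_in_L[of 1 0] E.half_in_L[of 0 1] E.half_in_L[of 1 1] E.L_1 E.L_tau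
    by (simp_all add: add_divide_distrib)
  have s1: "s (1 / 2) \<noteq> 0"
  proof
    assume "s (1 / 2) = 0"
    hence "1 / 2 + \<tau> / 2 - 1 / 2 \<in> ?L"
      using half by (intro E.half_period_value[of "1 / 2"]) (auto simp only: s_def right_minus_eq)
    thus False using half(4) by simp
  qed
  have s2: "s (\<tau> / 2) \<noteq> 0"
  proof
    assume "s (\<tau> / 2) = 0"
    hence "1 / 2 + \<tau> / 2 - \<tau> / 2 \<in> ?L"
      using half by (intro E.half_period_value[of "\<tau> / 2"]) (auto simp only: s_def right_minus_eq)
    thus False using half(2) by simp
  qed
  have main: ?thesis
    if w: "w1 = 1 / 2 \<and> w2 = \<tau> / 2 \<or> w1 = \<tau> / 2 \<and> w2 = 1 / 2" and mem: "s w2 / s w1 \<in> A" for w1 w2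
  proof -
    have s0: "s w1 \<noteq> 0" using w s1 s2 by metis
    define x where "x z = (tate_function \<tau> z - tate_function \<tau> (1 / 2 + \<tau> / 2)) / s w1" for z
    have sum: "w1 + w2 = 1 / 2 + \<tau> / 2" using w by (metis add.commute)
    have "cm_elliptic_axioms \<tau> x q (s w2 / s w1) w1 w2"
    proof
      show "odd q" using q(2) by presburger
      show "x (w1 + w2) = 0" unfolding x_def sum by simp
      show "x w1 = 1" "x w2 = s w2 / s w1" using s0 by (simp_all add: x_def s_def)
    qed fact+
    moreover have "even_elliptic \<tau> (c / s w1) x" unfolding x_def using s0 by (rule E.affine)
    ultimately have "cm_elliptic \<tau> (c / s w1) x q (s w2 / s w1) w1 w2" by (rule cm_elliptic.intro[rotated])
    moreover have "cm_place_axioms (s w2 / s w1) A" using mem by unfold_locales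
    ultimately have "cm_place \<tau> (c / s w1) x q (s w2 / s w1) w1 w2 A" 
      using place_axioms by (intro cm_place.intro)
    then obtain N D n where "place_isogeny A q (s w2 / s w1) N D n" using cm_place.place_isogeny_ex q(2) by blast
    thus ?thesis by (rule place_isogeny.integer_parameter)
  qed
  show ?thesis
  proof (cases "s (\<tau> / 2) / s (1 / 2) \<in> A")
    case True
    thus ?thesis by (intro main[of "1 / 2" "\<tau> / 2"]) auto
  next
    case False
    hence "s (1 / 2) / s (\<tau> / 2) \<in> A" using valuation[of "s (\<tau> / 2) / s (1 / 2)"] by simp
    thus ?thesis by (intro main[of "\<tau> / 2" "1 / 2"]) auto
  qed
qed


section \<open>Multiplicative orders and assembly of the cycles\<close>

lemma CHAR_Fbar: "CHAR('p::prime_card Fbar) = CARD('p)"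
  by simp

lemma prime_CARD: "prime CARD('p::prime_card)"
  by (rule prime_card)

lemma of_nat_power_CHAR: "prime CHAR('a::field) \<Longrightarrow> (of_nat m :: 'a) ^ CHAR('a) = of_nat m"
proof (induction m)
  case 0
  thus ?case using prime_gt_0_nat by simp
next
  case (Suc m)
  thus ?case using freshmans_dream[OF Suc.prems refl, of 1 "of_nat m"] by simp
qed

text \<open>All iterated Frobenius images of z are roots of one nonzero polynomial over the prime
  field, so two of them coincide; injectivity of Frobenius cancels the smaller exponent.\<close>

lemma Fbar_algebraic: "\<exists>k>0. (z :: 'p::prime_card Fbar) ^ (CHAR('p Fbar) ^ k) = z"
proof -
  let ?p = "CHAR('p Fbar)"
  have p: "prime ?p" unfolding CHAR_Fbar by (rule prime_CARD)
  obtain P :: "'p mod_ring poly" where P: "P \<noteq> 0" "poly (map_poly to_ac P) z = 0"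
    using alg_closure_algebraic by blast
  define R where "R = map_poly to_ac P"
  have R0: "R \<noteq> 0" using P(1) by (simp add: R_def map_poly_eq_0_iff)
  have fixed: "coeff R i ^ ?p = coeff R i" for i
  proof -
    obtain m where "coeff P i = of_nat m" using surj_of_nat_mod_ring by blast
    hence "coeff R i = of_nat m" by (simp add: R_def coeff_map_poly)
    thus ?thesis using of_nat_power_CHAR[OF p] by metis
  qed
  have root: "poly R (w ^ ?p) = 0" if "poly R w = 0" for w
  proof -
    have "poly R (w ^ ?p) = (\<Sum>i\<le>degree R. (coeff R i * w ^ i) ^ ?p)"
      by (simp only: poly_altdef power_mult_distrib fixed power_mult[symmetric] mult.commute)
    also have "\<dots> = (poly R w) ^ ?p"
      by (simp only: poly_altdef freshmans_dream_sum[OF p refl])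
    finally show ?thesis using that p by (simp add: prime_gt_0_nat)
  qed
  have roots: "poly R (z ^ (?p ^ k)) = 0" for k
  proof (induction k)
    case (Suc k)
    have "z ^ (?p ^ Suc k) = (z ^ (?p ^ k)) ^ ?p" by (simp add: mult.commute flip: power_mult)
    thus ?case using root[OF Suc.IH] by simp
  qed (use P(2) in \<open>simp add: R_def\<close>)
  have "finite (range (\<lambda>k. z ^ (?p ^ k)))"
    by (rule finite_subset[OF _ poly_roots_finite[OF R0]]) (use roots in auto)
  hence "\<not> inj (\<lambda>k::nat. z ^ (?p ^ k))" using finite_imageD infinite_UNIV_nat by blast
  then obtain i j where ij: "i < j" "z ^ (?p ^ i) = z ^ (?p ^ j)" 
    by (auto simp: inj_def) (metis linorder_neqE_nat)
  have inj: "y = w" if "y ^ (?p ^ k) = w ^ (?p ^ k)" for y w :: "'p Fbar" and k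
  proof -
    have "y ^ (?p ^ k) = (y - w) ^ (?p ^ k) + w ^ (?p ^ k)"
      using freshmans_dream'[OF p refl, of "y - w" w k] by simp
    hence "(y - w) ^ (?p ^ k) = 0" using that by simp
    thus ?thesis by (metis power_eq_0_iff right_minus_eq)
  qed
  have "z ^ (?p ^ j) = (z ^ (?p ^ (j - i))) ^ (?p ^ i)"
    using ij(1) by (simp flip: power_mult Power.power_add)
  hence "z ^ (?p ^ (j - i)) = z" using ij(2) inj by metis
  thus ?thesis using ij(1) by (intro exI[of _ "j - i"]) simp
qed

lemma supersingular_cycle_4_6I:
  fixes E :: "'p::prime_card Fbar weierstrass" and E' :: "'q::prime_card Fbar weierstrass"
  assumes ord: "u * ord CARD('q) (CARD('p) ^ u) = 4" "v * ord CARD('p) (CARD('q) ^ v) = 6"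
    and ne: "CARD('p) \<noteq> CARD('q)" and pos: "0 < u" "0 < v"
    and E: "supersingular E" "elliptic_curve (CARD('p) ^ u) E" "CARD('q) dvd card (points E (GF (CARD('p) ^ u)))"
    and E': "supersingular E'" "elliptic_curve (CARD('q) ^ v) E'" "CARD('p) dvd card (points E' (GF (CARD('q) ^ v)))"
  shows "supersingular_cycle_4_6 u E v E'"
proof -
  have "1 * ord CARD('q) (CARD('p) ^ u) \<le> u * ord CARD('q) (CARD('p) ^ u)"
    "1 * ord CARD('p) (CARD('q) ^ v) \<le> v * ord CARD('p) (CARD('q) ^ v)"
    using pos by (intro mult_le_mono1; simp)+
  hence "ord CARD('q) (CARD('p) ^ u) \<le> 50" "ord CARD('p) (CARD('q) ^ v) \<le> 50" using ord by simp_all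
  moreover have "(CARD('p) ^ u) ^ ord CARD('q) (CARD('p) ^ u) = CARD('p) ^ 4"
    "(CARD('q) ^ v) ^ ord CARD('p) (CARD('q) ^ v) = CARD('q) ^ 6"
    using ord by (simp_all flip: power_mult)
  ultimately show ?thesis
    using E E' ne prime_CARD[where 'p = 'p] prime_CARD[where 'p = 'q]
    by (simp add: supersingular_cycle_4_6_def pairing_friendly_2_cycle_def pairing_friendly_def
        target_group_def embedding_degree_def CHAR_Fbar Let_def)
qed

lemma ord_4:
  fixes r a :: nat
  assumes r: "prime r" "odd r" "r dvd a^2 + 1"
  shows "ord r a = 4"
proof -
  have r2: "\<not> r dvd 2" using r by (metis primes_dvd_imp_eq two_is_prime_nat)
  have a4: "[a ^ 4 = 1] (mod r)"
  proof -
    have "int r dvd (int a ^ 2 + 1) * (int a ^ 2 - 1)" using r(3) by (metis dvd_mult2 int_dvd_int_iff of_nat_1 of_nat_add of_nat_power)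
    also have "(int a ^ 2 + 1) * (int a ^ 2 - 1) = int (a ^ 4) - int 1" by (simp add: algebra_simps numeral_eq_Suc)
    finally show ?thesis by (simp only: cong_iff_dvd_diff flip: cong_int_iff)
  qed
  have a2: "\<not> [a ^ 2 = 1] (mod r)"
  proof
    assume "[a ^ 2 = 1] (mod r)"
    hence "[a^2 + 1 = 1 + 1] (mod r)" by (rule cong_add) simp
    hence "r dvd 1 + 1" using r(3) cong_dvd_iff by blast
    thus False using r2 by (simp add: numeral_2_eq_2)
  qed
  have "ord r a dvd 4" "\<not> ord r a dvd 2" using a4 a2 unfolding ord_divides .
  moreover have "k dvd (4::nat) \<Longrightarrow> \<not> k dvd 2 \<Longrightarrow> k = 4" for k
  proof -
    assume k: "k dvd (4::nat)" "\<not> k dvd 2"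
    have "k \<le> 4" using k(1) by (rule dvd_imp_le) simp
    hence "k = 0 \<or> k = 1 \<or> k = 2 \<or> k = 3 \<or> k = 4" by linarith
    thus "k = 4" using k by auto
  qed
  ultimately show ?thesis by blast
qed

text \<open>From r | a^2 - a + 1 follows a^3 = -1, hence a^6 = 1. If a^3 = 1, then r | 2. If a^2 =
  1, then a = 2 and r | 3.\<close>

lemma ord_6:
  fixes r a :: nat
  assumes r: "prime r" "r \<noteq> 2" "r \<noteq> 3" "[a^2 + 1 = a] (mod r)"
  shows "ord r a = 6" "r dvd a^3 + 1"
proof -
  have d: "int r dvd (int a)^2 + 1 - int a"
    using r(4) unfolding cong_int_iff[symmetric] cong_iff_dvd_diff by (simp add: add.commute)
  have r2: "\<not> int r dvd 2"
  proof
    assume "int r dvd 2"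
    hence "r dvd 2" by (metis int_dvd_int_iff of_nat_numeral)
    thus False using r by (metis primes_dvd_imp_eq two_is_prime_nat)
  qed
  have r3: "\<not> int r dvd 3"
  proof
    assume "int r dvd 3"
    hence "r dvd 3" by (metis int_dvd_int_iff of_nat_numeral)
    moreover have "prime (3::nat)" by simp
    ultimately show False using r(1,3) by (metis primes_dvd_imp_eq)
  qed
  have "int r dvd ((int a)^2 + 1 - int a) * (int a + 1)" using d by simp
  also have "((int a)^2 + 1 - int a) * (int a + 1) = int (a^3 + 1)" by (simp add: algebra_simps power2_eq_square power3_eq_cube)
  finally have a3': "int r dvd int (a ^ 3 + 1)" .
  thus a3: "r dvd a^3 + 1" by (simp only: int_dvd_int_iff)
  have iff: "[a ^ k = 1] (mod r) \<longleftrightarrow> int r dvd int a ^ k - 1" for k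
    unfolding cong_int_iff[symmetric] cong_iff_dvd_diff by simp
  have "int r dvd int (a^3 + 1) * (int a ^ 3 - 1)" using a3' by simp
  hence a6: "[a ^ 6 = 1] (mod r)" unfolding iff by (simp add: algebra_simps numeral_eq_Suc)
  have "\<not> [a ^ 3 = 1] (mod r)"
  proof
    assume "[a ^ 3 = 1] (mod r)"
    hence "int r dvd int (a^3 + 1) - (int a ^ 3 - 1)" unfolding iff by (rule dvd_diff[OF a3'])
    thus False using r2 by simp
  qed
  moreover have "\<not> [a ^ 2 = 1] (mod r)"
  proof
    assume a2: "[a ^ 2 = 1] (mod r)"
    have "int r dvd ((int a)^2 - 1) - ((int a)^2 + 1 - int a)" using a2 d unfolding iff by (rule dvd_diff)
    hence "int r dvd (int a - 2)" by (simp add: algebra_simps)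
    hence "int r dvd (int a - 2) * (int a + 2)" by simp
    with a2 have "int r dvd ((int a)^2 - 1) - (int a - 2) * (int a + 2)" unfolding iff by (rule dvd_diff)
    thus False using r3 by (simp add: algebra_simps power2_eq_square)
  qed
  ultimately have o: "ord r a dvd 6" "\<not> ord r a dvd 3" "\<not> ord r a dvd 2" using a6 unfolding ord_divides by blast+
  have "m dvd (6::nat) \<Longrightarrow> \<not> m dvd 3 \<Longrightarrow> \<not> m dvd 2 \<Longrightarrow> m = 6" for m
  proof -
    assume m: "m dvd (6::nat)" "\<not> m dvd 3" "\<not> m dvd 2"
    have "m \<le> 6" using m(1) by (rule dvd_imp_le) simp
    hence "m = 0 \<or> m = 1 \<or> m = 2 \<or> m = 3 \<or> m = 4 \<or> m = 5 \<or> m = 6" by linarith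
    thus "m = 6" using m by auto
  qed
  thus "ord r a = 6" using o by blast
qed


theorem theorem1:
  fixes x :: int
  assumes "x \<notin> {-1, 2}"
    and "prime (x^2 - x + 1)" and "prime (x^2 + 1)"
    and "int CARD('p::prime_card) = x^2 - x + 1"
    and "int CARD('q::prime_card) = x^2 + 1"
  shows
    "(\<exists>u\<in>{2, 4}. \<exists>v\<in>{2, 3}.
        \<exists>(E :: 'p Fbar weierstrass) (E' :: 'q Fbar weierstrass). supersingular_cycle_4_6 u E v E') \<and>
     ([x = 0] (mod 12) \<or> [x = 4] (mod 12) \<or> [x = 6] (mod 12) \<or> [x = 10] (mod 12)) \<and>
     ([x = 10] (mod 12) \<longrightarrow>
       (\<exists>(E :: 'p Fbar weierstrass) (E' :: 'q Fbar weierstrass). supersingular_cycle_4_6 2 E 2 E')) \<and>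
     ([x = 6] (mod 12) \<longrightarrow>
       (\<exists>(E :: 'p Fbar weierstrass) (E' :: 'q Fbar weierstrass). supersingular_cycle_4_6 2 E 3 E')) \<and>
     ([x = 4] (mod 12) \<longrightarrow>
       (\<exists>(E :: 'p Fbar weierstrass) (E' :: 'q Fbar weierstrass). supersingular_cycle_4_6 4 E 2 E')) \<and>
     ([x = 0] (mod 12) \<longrightarrow>
       (\<exists>(E :: 'p Fbar weierstrass) (E' :: 'q Fbar weierstrass). supersingular_cycle_4_6 4 E 3 E'))"
proof -
  define p q where "p = CARD('p)" and "q = CARD('q)"
  have pq: "prime p" "prime q" unfolding p_def q_def by (rule prime_CARD)+
  have px: "int p = x^2 - x + 1" and qx: "int q = x^2 + 1" using assms by (simp_all add: p_def q_def)
  have p1: "p > 1" and q1: "q > 1" using pq prime_gt_1_nat by auto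
  have x: "x \<noteq> - 1" "x \<noteq> 2" using assms(1) by auto
  have x0: "x \<noteq> 0" using qx q1 by auto
  have p3: "p \<noteq> 3"
  proof
    assume "p = 3"
    hence "(x - 2) * (x + 1) = 0" using px by (simp add: algebra_simps power2_eq_square)
    thus False using x by auto
  qed
  have ex: "even x"
  proof (rule ccontr)
    assume "odd x"
    hence "even (int q)" unfolding qx by simp
    hence "even q" by simp
    hence "q = 2" using pq(2) by (metis primes_dvd_imp_eq two_is_prime_nat)
    hence "(x - 1) * (x + 1) = 0" using qx by (simp add: algebra_simps power2_eq_square)
    hence "x = 1" using x by auto
    thus False using px p1 by simp
  qed
  have odd_p: "odd p"
  proof -
    have "odd (int p)" unfolding px using ex by simp
    thus ?thesis by simp
  qed
  have odd_q: "odd q"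
  proof -
    have "odd (int q)" unfolding qx using ex by simp
    thus ?thesis by simp
  qed
  \<comment> \<open>Otherwise 3 divides p, so p = 3, which happens only for the excluded values -1
    and 2 of x.\<close>
  have x3: "x mod 3 \<noteq> 2"
  proof
    assume "x mod 3 = 2"
    hence "x = 3 * (x div 3) + 2" by presburger
    then obtain m where m: "x = 3 * m + 2" by blast
    have "int p = 3 * (3 * m^2 + 3 * m + 1)" unfolding px m by (simp add: algebra_simps power2_eq_square)
    hence "int 3 dvd int p" by simp
    hence "3 dvd p" by (simp only: int_dvd_int_iff)
    moreover have "prime (3::nat)" by simp
    ultimately have "3 = p" using pq(1) by (metis primes_dvd_imp_eq)
    thus False using p3 by simp
  qed
  have ne: "p \<noteq> q" using px qx x0 by auto
  have q4: "q mod 4 = 1"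
  proof -
    obtain m where "x = 2 * m" using ex by (elim evenE)
    hence "int q = 4 * m^2 + 1" by (simp add: qx power2_eq_square)
    hence "int q mod 4 = 1" by presburger
    thus ?thesis by presburger
  qed
  have q3: "q > 3"
  proof -
    have "q \<noteq> 2" "q \<noteq> 3" using q4 by auto
    thus ?thesis using q1 by simp
  qed
  have qdvd: "q dvd p^2 + 1"
  proof -
    \<comment> \<open>Use p = q - x and x^2 + 1 = q.\<close>
    have "int p^2 + 1 = int q * (int q - 2 * x + 1)" unfolding px qx by (simp add: algebra_simps power2_eq_square)
    hence "int (p^2 + 1) = int q * (int q - 2 * x + 1)" by simp
    hence "int q dvd int (p^2 + 1)" by (metis dvd_triv_left)
    thus ?thesis by (simp only: int_dvd_int_iff)
  qed
  have pcong: "[q^2 + 1 = q] (mod p)"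
  proof -
    \<comment> \<open>Use q = p + x and x^2 - x + 1 = p.\<close>
    have "int (q^2 + 1) - int q = int p * (int p + 2 * x)"
      unfolding px of_nat_add of_nat_power qx by (simp add: algebra_simps power2_eq_square)
    thus ?thesis unfolding cong_int_iff[symmetric] cong_iff_dvd_diff by (metis dvd_triv_left)
  qed
  have p2: "p \<noteq> 2" using odd_p by auto
  have ord_q: "ord q p = 4" using pq(2) odd_q qdvd by (rule ord_4)
  have ord_p: "ord p q = 6" and pdvd: "p dvd q^3 + 1" by (rule ord_6[OF pq(1) p2 p3 pcong])+
  have cop: "coprime q p" "coprime p q" using pq ne primes_coprime by auto
  have ords: "2 * ord q (p^2) = 4" "4 * ord q (p^4) = 4" "2 * ord p (q^2) = 6" "3 * ord p (q^3) = 6"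
    using cop by (simp_all add: ord_power ord_q ord_p gcd_nat.absorb1 gcd_nat.absorb2)
  have Cp: "CHAR('p Fbar) = p" and Cq: "CHAR('q Fbar) = q" by (simp_all add: CHAR_Fbar p_def q_def)
  have nzq: "of_nat q \<noteq> (0 :: 'p Fbar)" and nzp: "of_nat p \<noteq> (0 :: 'q Fbar)"
    using pq ne unfolding of_nat_eq_0_iff_char_dvd Cp Cq by (metis primes_dvd_imp_eq)+
  note alg_p = Fbar_algebraic[where 'p = 'p] and alg_q = Fbar_algebraic[where 'p = 'q]
  let ?E = "\<lambda>u. \<exists>E :: 'p Fbar weierstrass. supersingular E \<and> elliptic_curve (p^u) E \<and> q dvd card (points E (GF (p^u)))"
  let ?E' = "\<lambda>v. \<exists>E :: 'q Fbar weierstrass. supersingular E \<and> elliptic_curve (q^v) E \<and> p dvd card (points E (GF (q^v)))"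
  have E2: "?E 2" if "x mod 4 = 2"
  proof -
    have "x = 4 * (x div 4) + 2" using that by presburger
    then obtain m where m: "x = 4 * m + 2" by blast
    have "int p = 4 * (4 * m^2 + 3 * m) + 3" unfolding px m by (simp add: algebra_simps power2_eq_square)
    hence "int p mod 4 = 3" by presburger
    hence "p mod 4 = 3" by presburger
    thus ?thesis using supersingular_curve_embedding_2[where 'a = "'p Fbar", unfolded Cp, OF pq(1) alg_p[unfolded Cp] _ pq(2) nzq qdvd] by blast
  qed
  have E4: "?E 4"
    using supersingular_curve_embedding_1[where 'a = "'p Fbar", unfolded Cp, OF pq(1) odd_p alg_p[unfolded Cp] pq(2) nzq qdvd] .
  have E2': "?E' 2" if "x mod 3 = 1"
  proof -
    have "x = 3 * (x div 3) + 1" using that by presburger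
    then obtain m where m: "x = 3 * m + 1" by blast
    have "int q = 3 * (3 * m^2 + 2 * m) + 2" unfolding qx m by (simp add: algebra_simps power2_eq_square)
    hence "int q mod 3 = 2" by presburger
    hence "q mod 3 = 2" by presburger
    thus ?thesis using supersingular_curve_embedding_3[where 'a = "'q Fbar", unfolded Cq, OF pq(2) odd_q alg_q[unfolded Cq] _ pq(1) nzp pcong] by blast
  qed
  obtain k :: int where k: "\<not> int q dvd k" "\<not> int q dvd k - 4"
      "int q dvd coeff ([:k, k, 1:] ^ ((q - 1) div 2)) ((q - 1) div 2)"
    using trace_zero_parameter[OF pq(2) q4] by blast
  have E3': "?E' 3"
    using supersingular_curve_embedding_trace_zero[where 'a = "'q Fbar", unfolded Cq, OF pq(2) odd_q q3 alg_q[unfolded Cq] k pq(1) nzp pdvd] .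
  let ?C = "\<lambda>u v. \<exists>(E :: 'p Fbar weierstrass) (E' :: 'q Fbar weierstrass). supersingular_cycle_4_6 u E v E'"
  have C: "?C u v" if uv: "u * ord q (p^u) = 4" "v * ord p (q^v) = 6" "0 < u" "0 < v" "?E u" "?E' v" for u v
  proof -
    obtain E E' where E: "supersingular (E :: 'p Fbar weierstrass)" "elliptic_curve (p^u) E" "q dvd card (points E (GF (p^u)))"
      and E': "supersingular (E' :: 'q Fbar weierstrass)" "elliptic_curve (q^v) E'" "p dvd card (points E' (GF (q^v)))"
      using uv(5,6) by blast
    have "supersingular_cycle_4_6 u E v E'"
      using uv(1-4) E E' ne unfolding p_def q_def by (intro supersingular_cycle_4_6I)
    thus ?thesis by blast
  qed
  \<comment> \<open>The curves over F_(p^4) and F_(q^3) exist for every admissible x. The smaller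
    fields need x = 2 modulo 4 for p and x = 1 modulo 3 for q, so the residue modulo 12 selects the
    pair.\<close>
  have C22: "?C 2 2" if "x mod 4 = 2" "x mod 3 = 1" using C[OF ords(1,3) _ _ E2 E2'] that by simp
  have C23: "?C 2 3" if "x mod 4 = 2" using C[OF ords(1,4) _ _ E2 E3'] that by simp
  have C42: "?C 4 2" if "x mod 3 = 1" using C[OF ords(2,3) _ _ E4 E2'] that by simp
  have C43: "?C 4 3" using C[OF ords(2,4) _ _ E4 E3'] by simp
  have classes: "[x = 0] (mod 12) \<or> [x = 4] (mod 12) \<or> [x = 6] (mod 12) \<or> [x = 10] (mod 12)"
  proof -
    define r where "r = x mod 12"
    have "r mod 2 = 0" "r mod 3 \<noteq> 2" unfolding r_def using ex x3 by (simp_all add: mod_mod_cancel even_iff_mod_2_eq_zero)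
    moreover have "r = 0 \<or> r = 1 \<or> r = 2 \<or> r = 3 \<or> r = 4 \<or> r = 5 \<or> r = 6 \<or> r = 7 \<or> r = 8 \<or> r = 9 \<or> r = 10 \<or> r = 11"
    proof -
      have "0 \<le> r" "r < 12" unfolding r_def by simp_all
      thus ?thesis by presburger
    qed
    ultimately have "r = 0 \<or> r = 4 \<or> r = 6 \<or> r = 10" by auto
    thus ?thesis by (simp add: Cong.cong_def r_def)
  qed
  have mm: "x mod 4 = (x mod 12) mod 4" "x mod 3 = (x mod 12) mod 3" by (simp_all add: mod_mod_cancel)
  have mods: "x mod 4 = 2 \<and> x mod 3 = 1" if "[x = 10] (mod 12)"
    using that unfolding mm Cong.cong_def by simp
  have mods': "x mod 4 = 2" if "[x = 6] (mod 12)" using that unfolding mm Cong.cong_def by simp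
  have mods'': "x mod 3 = 1" if "[x = 4] (mod 12)" using that unfolding mm Cong.cong_def by simp
  show ?thesis
    using classes mods mods' mods'' C22 C23 C42 C43 by blast
qed

end
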